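(* Suppose that, for Gaussian disorder, $$\mathcal{W}_2(\zeta_N^G,\zeta_* )\longrightarrow 0\qquad (N\to\infty)$$ for some $\zeta_*\in\mathcal{P}_2(\mathcal{P}_2(\mathbb{R}))$. Then, for every real $b\ge1$ and every symmetric probability law $\nu$ on $\mathbb{R}$ supported on $[-b,b]$ with $\int x^2\,\nu(dx)=1$, $$\mathcal{W}_2(\zeta_N^\nu,\zeta_* )\longrightarrow 0\qquad (N\to\infty).$$ In particular, conditional on the assertion of Du and Huang that for Gaussian disorder this convergence holds with limit the law of their random probability measure $\mathfrak P_{a(\chi)}$, the limit is $\zeta_*=\mathrm{Law}(\mathfrak P_{a(\chi)})$.
   Context: For an integer $N\ge 2$ let $\Sigma_N=\{-1,1\}^N$. Given real couplings $J=(J_{ij})_{1\le i<j\le N}$, define for $\sigma\in\Sigma_N$ $$H_N^J(\sigma)=\frac1{\sqrt N}\sum_{1\le i<j\le N}J_{ij}\sigma_i\sigma_j,\qquad G_N^J(\sigma)=\frac{e^{H_N^J(\sigma)}}{\sum_{\tau\in\Sigma_N}e^{H_N^J(\tau)}}$$ (the Sherrington–Kirkpatrick model at inverse temperature one and zero external field). Angle brackets $\langle\cdot\rangle$ denote expectation over independent replicas $\sigma^1,\sigma^2,\ldots$ sampled from $G_N^J$, conditional on $J$. The overlap is $R_{12}=N^{-1}\sum_{i=1}^N\sigma_i^1\sigma_i^2$. The random quenched overlap measure is the ($J$-dependent) probability measure on $\mathbb{R}$ $$\mu_N^J=\langle\delta_{N^{1/3}R_{12}}\rangle,$$ i.e.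 the conditional law of $N^{1/3}R_{12}$ given $J$. $\zeta_N^G$ denotes the law of the random measure $\mu_N^J$ when the $J_{ij}$, $i<j$, are independent standard Gaussians, and $\zeta_N^\nu$ denotes its law when the $J_{ij}$, $i<j$, are independent with common law $\nu$. $\mathcal{P}_2(\mathbb{R})$ is the set of probability measures on $\mathbb{R}$ with finite second moment, equipped with the usual Wasserstein-2 distance $W_2$. $\mathcal{P}_2(\mathcal{P}_2(\mathbb{R}))$ is the set of Borel probability measures $\zeta$ on $(\mathcal{P}_2(\mathbb{R}),W_2)$ with $\int W_2(\mu,\delta_0)^2\,\zeta(d\mu)<\infty$, equipped with the iterated Wasserstein-2 distance $$\mathcal{W}_2(\zeta,\zeta')^2=\inf_{\pi\in\Pi(\zeta,\zeta')}\int W_2(\mu,\mu')^2\,\pi(d\mu,d\mu'),$$ where $\Pi(\zeta,\zeta')$ is the set of couplings of $\zeta$ and $\zeta'$. $\mathfrak P_{a(\chi)}$ denotes the explicit random probability measure on $\mathbb{R}$ constructed by Du and Huang, in their work on the critical overlap of the Gaussian Sherrington–Kirkpatrick model, from the reflected Airy$_1$ point process and a pinned Gaussian construction. It is the limit they state for the quenched law of $N^{1/3}R_{12}$ under Gaussian couplings. That Gaussian convergence is assumed here, not proved, and $\mathfrak P_{a(\chi)}$ enters only through it. *)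

theory Defs
  imports "HOL-Probability.Probability"
begin

definition couplings :: "'a measure \<Rightarrow> 'a measure \<Rightarrow> ('a \<times> 'a) measure set" where
  "couplings M N =
     {\<pi>. sets \<pi> = sets (M \<Otimes>\<^sub>M N) \<and> distr \<pi> M fst = M \<and> distr \<pi> N snd = N}"

text \<open>
  The Wasserstein-2 distance for a distance function \<open>d\<close>. The conversion \<open>enn2real\<close> sends an
  infinite infimum to 0. This does not happen between two elements of the spaces
  \<open>P2_real\<close> and \<open>P2_P2_real\<close> below: there the product coupling has finite cost.
\<close>

definition wasserstein2 :: "('a \<Rightarrow> 'a \<Rightarrow> real) \<Rightarrow> 'a measure \<Rightarrow> 'a measure \<Rightarrow> real" where
  "wasserstein2 d M N =
     sqrt (enn2real (\<Sqinter>\<pi>\<in>couplings M N. \<integral>\<^sup>+ z. ennreal ((d (fst z) (snd z))\<^sup>2) \<partial>\<pi>))"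

abbreviation W2 :: "real measure \<Rightarrow> real measure \<Rightarrow> real" where
  "W2 \<equiv> wasserstein2 dist"

definition P2_real :: "real measure set" where
  "P2_real = {\<mu>. real_distribution \<mu> \<and> integrable \<mu> (\<lambda>x. x\<^sup>2)}"

text \<open>
  The Borel sigma-algebra of the metric space \<open>(P2_real, W2)\<close>. The predicate
  \<open>Metric_space.mopen\<close> is the library's openness predicate for a carrier and a distance
  function, used here outside its locale.
\<close>

definition P2_borel :: "real measure measure" where
  "P2_borel = sigma P2_real {U. Metric_space.mopen P2_real W2 U}"

definition P2_P2_real :: "real measure measure set" where
  "P2_P2_real =
     {\<zeta>. prob_space \<zeta> \<and> sets \<zeta> = sets P2_borel \<and>
         (\<integral>\<^sup>+ \<mu>. ennreal ((W2 \<mu> (return borel 0))\<^sup>2) \<partial>\<zeta>) < \<infinity>}"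

abbreviation iterated_W2 :: "real measure measure \<Rightarrow> real measure measure \<Rightarrow> real" where
  "iterated_W2 \<equiv> wasserstein2 W2"

definition spin_configs :: "nat \<Rightarrow> (nat \<Rightarrow> real) set" where
  "spin_configs N = {1..N} \<rightarrow>\<^sub>E {-1, 1}"

definition bonds :: "nat \<Rightarrow> (nat \<times> nat) set" where
  "bonds N = {(i, j). 1 \<le> i \<and> i < j \<and> j \<le> N}"

definition sk_hamiltonian :: "nat \<Rightarrow> (nat \<times> nat \<Rightarrow> real) \<Rightarrow> (nat \<Rightarrow> real) \<Rightarrow> real" where
  "sk_hamiltonian N J \<sigma> = 1 / sqrt (real N) * (\<Sum>(i, j)\<in>bonds N. J (i, j) * \<sigma> i * \<sigma> j)"

definition gibbs_weight :: "nat \<Rightarrow> (nat \<times> nat \<Rightarrow> real) \<Rightarrow> (nat \<Rightarrow> real) \<Rightarrow> real" where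
  "gibbs_weight N J \<sigma> =
     exp (sk_hamiltonian N J \<sigma>) / (\<Sum>\<tau>\<in>spin_configs N. exp (sk_hamiltonian N J \<tau>))"

definition gibbs_measure :: "nat \<Rightarrow> (nat \<times> nat \<Rightarrow> real) \<Rightarrow> (nat \<Rightarrow> real) measure" where
  "gibbs_measure N J = point_measure (spin_configs N) (\<lambda>\<sigma>. ennreal (gibbs_weight N J \<sigma>))"

definition overlap :: "nat \<Rightarrow> (nat \<Rightarrow> real) \<Rightarrow> (nat \<Rightarrow> real) \<Rightarrow> real" where
  "overlap N \<sigma> \<tau> = (\<Sum>i=1..N. \<sigma> i * \<tau> i) / real N"

definition quenched_overlap_measure :: "nat \<Rightarrow> (nat \<times> nat \<Rightarrow> real) \<Rightarrow> real measure" where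
  "quenched_overlap_measure N J =
     distr (gibbs_measure N J \<Otimes>\<^sub>M gibbs_measure N J) borel
       (\<lambda>(\<sigma>, \<tau>). real N powr (1/3) * overlap N \<sigma> \<tau>)"

text \<open>
  The law of the random measure \<open>quenched_overlap_measure N J\<close> when the couplings
  \<open>J (i, j)\<close>, \<open>i < j\<close>, are independent with common law \<open>\<nu>\<close>; the family of couplings is
  realised on its canonical product space.
\<close>

definition quenched_overlap_law :: "real measure \<Rightarrow> nat \<Rightarrow> real measure measure" where
  "quenched_overlap_law \<nu> N =
     distr (\<Pi>\<^sub>M e\<in>bonds N. \<nu>) P2_borel (quenched_overlap_measure N)"

definition symmetric_unit_variance_law :: "real \<Rightarrow> real measure \<Rightarrow> bool" where
  "symmetric_unit_variance_law b \<nu> \<longleftrightarrow>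
     real_distribution \<nu> \<and> distr \<nu> borel uminus = \<nu> \<and>
     measure \<nu> {-b..b} = 1 \<and> (\<integral>x. x\<^sup>2 \<partial>\<nu>) = 1"

end

theory Submission
  imports Defs "HOL-Real_Asymp.Real_Asymp"
begin

text \<open>
  Replace the couplings of a critical spin glass by other couplings with the same first three
  moments. Expanding in a single coupling, the leading effect on an average \<open>\<langle>f\<rangle>\<close> over replicas is
  of order \<open>N\<^sup>-\<^sup>2\<close>, and there are about \<open>N\<^sup>2 / 2\<close> couplings, so a naive replacement argument loses a
  constant. The gain comes from the form of the leading term. For one bond \<open>(i, j)\<close> the tilt
  \<open>exp (x \<sigma>\<^sub>i \<sigma>\<^sub>j)\<close> equals \<open>cosh x (1 + tanh x \<sigma>\<^sub>i \<sigma>\<^sub>j)\<close>; the factor \<open>cosh x\<close> cancels in the Gibbs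
  measure, and what remains is a series in \<open>tanh x\<close> whose coefficients are averages of \<open>f\<close> times
  products of \<open>\<sigma>\<^sub>i \<sigma>\<^sub>j\<close> over sets \<open>T\<close> of distinct replicas (\<open>iid_avg_tilt_expansion\<close>). Odd powers of
  \<open>tanh x\<close> average to zero by symmetry, the constant term does not see the disorder, and every other
  term has at least two replicas in \<open>T\<close>. Summed over the bonds, such a term becomes
  \<open>\<langle>f R\<^sub>T\<^sup>2\<rangle>\<close>, where \<open>R\<^sub>T\<close> is the overlap of the replicas in \<open>T\<close>, up to errors of order \<open>1 / N\<close>
  (\<open>sum_swap_gain_bound\<close>). At criticality overlaps are small, and this is the gain.

  To add up the replacements, all couplings are moved simultaneously from the Gaussian law to \<open>\<nu>\<close>
  along the mixtures \<open>(1 - p) G + p \<nu>\<close>. With \<open>f = R\<^sub>1\<^sub>2\<^sup>4\<close> the bound on the derivative is linear in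
  \<open>E \<langle>R\<^sub>1\<^sub>2\<^sup>4\<rangle>\<close> itself, because \<open>R\<^sub>T\<^sup>2 \<le> 1\<close>; Gronwall's inequality then carries the smallness of
  this moment from the Gaussian end to the whole path (\<open>overlap4_growth\<close>). Since \<open>\<langle>R\<^sub>T\<^sup>4\<rangle> \<le> \<langle>R\<^sub>1\<^sub>2\<^sup>4\<rangle>\<close>
  (\<open>multi_overlap_power4_le\<close>), the same moment controls the derivative for other \<open>f\<close>. At the Gaussian end it is
  small by the assumed convergence: convergence in the iterated distance makes \<open>N\<^sup>2\<^sup>/\<^sup>3 R\<^sub>1\<^sub>2\<^sup>2\<close> uniformly integrable,
  hence \<open>N\<^sup>2\<^sup>/\<^sup>3 E \<langle>R\<^sub>1\<^sub>2\<^sup>4\<rangle> \<rightarrow> 0\<close> (\<open>overlap4_A_tendsto\<close>). It follows that bounded replica averages have the same limits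
  for both disorders, and so do second moments of \<open>N\<^sup>1\<^sup>/\<^sup>3 R\<^sub>1\<^sub>2\<close> outside large intervals, since
  \<open>N\<^sup>2\<^sup>/\<^sup>3 \<langle>R\<^sub>1\<^sub>2\<^sup>2 R\<^sub>T\<^sup>2\<rangle>\<close> is controlled by the same fourth moment.

  It remains to see that these quantities control the iterated distance. Both levels use the same
  coupling (\<open>partition_coupling\<close>): given a partition of unity \<open>\<psi>\<^sub>i\<close> into functions concentrated near
  points, two laws with almost equal masses \<open>\<integral>\<psi>\<^sub>i\<close> are coupled by pairing independently within each
  \<open>\<psi>\<^sub>i\<close>. On the line the \<open>\<psi>\<^sub>i\<close> are Bernstein polynomials of a truncated coordinate. On the space of laws
  the index is a list \<open>i\<^sub>1 \<dots> i\<^sub>m\<close> and the weight of \<open>\<mu>\<close> is \<open>\<Prod>\<^sub>l \<integral>\<psi>\<^bsub>i\<^sub>l\<^esub> d\<mu>\<close>, the probability that \<open>m\<close>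
  independent samples from \<open>\<mu>\<close> fall into these cells; the empirical frequencies then recover the
  masses of \<open>\<mu>\<close>. Such a product is an average over \<open>2 m\<close> replicas of a bounded function, which is what
  the universality of replica averages covers.
\<close>

section \<open>Couplings from partitions of unity\<close>

text \<open>
  The integral of a non-measurable function is the supremum over the simple functions below it, so
  upper bounds survive. This permits the transport distance between laws as a cost on the space of laws
  without any statement on its measurability.
\<close>

lemma nn_integral_density_le:
  assumes w: "w \<in> borel_measurable M" and b: "b \<in> borel_measurable M"
    and le: "\<And>x. x \<in> space M \<Longrightarrow> w x * c x \<le> b x"
  shows "(\<integral>\<^sup>+x. c x \<partial>density M w) \<le> (\<integral>\<^sup>+x. b x \<partial>M)"
  unfolding nn_integral_def[of "density M w"]
proof (rule SUP_least)
  fix g assume "g \<in> {g. simple_function (density M w) g \<and> g \<le> (\<lambda>x. c x)}"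
  then have g: "simple_function (density M w) g" and gc: "\<And>x. g x \<le> c x"
    by (auto simp: le_fun_def)
  have gm: "g \<in> borel_measurable M"
    using borel_measurable_simple_function[OF g] by simp
  have "integral\<^sup>S (density M w) g = (\<integral>\<^sup>+x. g x \<partial>density M w)"
    using nn_integral_eq_simple_integral[OF g] by simp
  also have "\<dots> = (\<integral>\<^sup>+x. w x * g x \<partial>M)"
    using nn_integral_density[OF w gm] .
  also have "\<dots> \<le> (\<integral>\<^sup>+x. b x \<partial>M)"
    by (rule nn_integral_mono) (meson gc le mult_left_mono order_trans zero_le)
  finally show "integral\<^sup>S (density M w) g \<le> (\<integral>\<^sup>+x. b x \<partial>M)" .
qed

lemma nn_integral_pair_mult:
  assumes "sigma_finite_measure M'" "f \<in> borel_measurable M" "g \<in> borel_measurable M'"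
  shows "(\<integral>\<^sup>+z. f (fst z) * g (snd z) \<partial>(M \<Otimes>\<^sub>M M')) = (\<integral>\<^sup>+x. f x \<partial>M) * (\<integral>\<^sup>+y. g y \<partial>M')"
proof -
  interpret sigma_finite_measure M' by fact
  note [measurable] = assms(2,3)
  have "(\<integral>\<^sup>+z. f (fst z) * g (snd z) \<partial>(M \<Otimes>\<^sub>M M')) = (\<integral>\<^sup>+x. \<integral>\<^sup>+y. f x * g y \<partial>M' \<partial>M)"
    by (subst nn_integral_fst[symmetric]) auto
  also have "\<dots> = (\<integral>\<^sup>+x. f x * (\<integral>\<^sup>+y. g y \<partial>M') \<partial>M)"
    by (intro nn_integral_cong nn_integral_cmult) auto
  also have "\<dots> = (\<integral>\<^sup>+x. f x \<partial>M) * (\<integral>\<^sup>+y. g y \<partial>M')"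
    by (rule nn_integral_multc) auto
  finally show ?thesis .
qed

text \<open>
  Couplings that have a density with respect to the product measure can be glued to other couplings
  without conditional laws.
\<close>

definition coupling_density :: "'a measure \<Rightarrow> 'a measure \<Rightarrow> ('a \<times> 'a \<Rightarrow> ennreal) \<Rightarrow> bool" where
  "coupling_density M M' w \<longleftrightarrow> w \<in> borel_measurable (M \<Otimes>\<^sub>M M') \<and>
     (AE x in M. (\<integral>\<^sup>+y. w (x, y) \<partial>M') = 1) \<and> (AE y in M'. (\<integral>\<^sup>+x. w (x, y) \<partial>M) = 1)"

lemma coupling_densityD:
  assumes "sigma_finite_measure M" "sigma_finite_measure M'" "coupling_density M M' w"
  shows "density (M \<Otimes>\<^sub>M M') w \<in> couplings M M'"
proof -
  interpret A: sigma_finite_measure M by fact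
  interpret B: sigma_finite_measure M' by fact
  interpret pair_sigma_finite M M' ..
  have w[measurable]: "w \<in> borel_measurable (M \<Otimes>\<^sub>M M')"
    and w1: "AE x in M. (\<integral>\<^sup>+y. w (x, y) \<partial>M') = 1" and w2: "AE y in M'. (\<integral>\<^sup>+x. w (x, y) \<partial>M) = 1"
    using assms(3) by (auto simp: coupling_density_def)
  have "distr (density (M \<Otimes>\<^sub>M M') w) M fst = M"
  proof (rule measure_eqI)
    fix X assume "X \<in> sets (distr (density (M \<Otimes>\<^sub>M M') w) M fst)"
    then have X[measurable]: "X \<in> sets M" by simp
    have "emeasure (distr (density (M \<Otimes>\<^sub>M M') w) M fst) X
        = (\<integral>\<^sup>+x. indicator X x \<partial>distr (density (M \<Otimes>\<^sub>M M') w) M fst)"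
      by simp
    also have "\<dots> = (\<integral>\<^sup>+z. w z * indicator X (fst z) \<partial>(M \<Otimes>\<^sub>M M'))"
      by (subst nn_integral_distr, simp, simp, subst nn_integral_density) auto
    also have "\<dots> = (\<integral>\<^sup>+x. (\<integral>\<^sup>+y. w (x, y) * indicator X x \<partial>M') \<partial>M)"
      by (subst B.nn_integral_fst[symmetric]) auto
    also have "\<dots> = (\<integral>\<^sup>+x. (\<integral>\<^sup>+y. w (x, y) \<partial>M') * indicator X x \<partial>M)"
      by (intro nn_integral_cong nn_integral_multc) auto
    also have "\<dots> = (\<integral>\<^sup>+x. indicator X x \<partial>M)"
      by (intro nn_integral_cong_AE) (use w1 in auto)
    finally show "emeasure (distr (density (M \<Otimes>\<^sub>M M') w) M fst) X = emeasure M X" by simp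
  qed simp
  moreover have "distr (density (M \<Otimes>\<^sub>M M') w) M' snd = M'"
  proof (rule measure_eqI)
    fix X assume "X \<in> sets (distr (density (M \<Otimes>\<^sub>M M') w) M' snd)"
    then have X[measurable]: "X \<in> sets M'" by simp
    have "emeasure (distr (density (M \<Otimes>\<^sub>M M') w) M' snd) X
        = (\<integral>\<^sup>+x. indicator X x \<partial>distr (density (M \<Otimes>\<^sub>M M') w) M' snd)"
      by simp
    also have "\<dots> = (\<integral>\<^sup>+z. w z * indicator X (snd z) \<partial>(M \<Otimes>\<^sub>M M'))"
      by (subst nn_integral_distr, simp, simp, subst nn_integral_density) auto
    also have "\<dots> = (\<integral>\<^sup>+y. (\<integral>\<^sup>+x. w (x, y) * indicator X y \<partial>M) \<partial>M')"
      by (subst nn_integral_snd[symmetric]) auto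
    also have "\<dots> = (\<integral>\<^sup>+y. (\<integral>\<^sup>+x. w (x, y) \<partial>M) * indicator X y \<partial>M')"
      by (intro nn_integral_cong nn_integral_multc) auto
    also have "\<dots> = (\<integral>\<^sup>+x. indicator X x \<partial>M')"
      by (intro nn_integral_cong_AE) (use w2 in auto)
    finally show "emeasure (distr (density (M \<Otimes>\<^sub>M M') w) M' snd) X = emeasure M' X" by simp
  qed simp
  ultimately show ?thesis by (auto simp: couplings_def)
qed

text \<open>
  Let \<open>a\<^sub>i\<close> and \<open>a\<^sub>i'\<close> be the masses of \<open>\<psi>\<^sub>i\<close> under the two laws. The part \<open>min a\<^sub>i a\<^sub>i'\<close> of each is paired within
  cell \<open>i\<close>, at a cost of at most \<open>d\<^sub>i x + d\<^sub>i y\<close>; what is left over has total mass at most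
  \<open>\<Sum>\<^sub>i \<bar>a\<^sub>i - a\<^sub>i'\<bar>\<close> and is paired independently. The cells may overlap: only the average \<open>\<Sum>\<^sub>i \<psi>\<^sub>i d\<^sub>i\<close> has to be small,
  which allows polynomial partitions of unity.
\<close>

lemma partition_coupling:
  fixes M M' :: "'a measure" and \<psi> d :: "'i \<Rightarrow> 'a \<Rightarrow> real" and c :: "'a \<Rightarrow> 'a \<Rightarrow> real"
  assumes "prob_space M" "prob_space M'" and sets': "sets M' = sets M" and fin: "finite I"
    and \<psi>m: "\<And>i. i \<in> I \<Longrightarrow> \<psi> i \<in> borel_measurable M" and \<psi>0: "\<And>i x. i \<in> I \<Longrightarrow> x \<in> space M \<Longrightarrow> 0 \<le> \<psi> i x"
    and \<psi>1: "\<And>x. x \<in> space M \<Longrightarrow> (\<Sum>i\<in>I. \<psi> i x) = 1"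
    and dm: "\<And>i. i \<in> I \<Longrightarrow> d i \<in> borel_measurable M" and d0: "\<And>i x. i \<in> I \<Longrightarrow> x \<in> space M \<Longrightarrow> 0 \<le> d i x"
    and D: "integrable M D" "integrable M' D"
    and dD: "\<And>x. x \<in> space M \<Longrightarrow> (\<Sum>i\<in>I. \<psi> i x * d i x) \<le> D x"
    and cd: "\<And>i x y. i \<in> I \<Longrightarrow> x \<in> space M \<Longrightarrow> y \<in> space M \<Longrightarrow> c x y \<le> d i x + d i y"
    and cG: "\<And>x y. x \<in> space M \<Longrightarrow> y \<in> space M \<Longrightarrow> c x y \<le> G + D x + D y" and G: "0 \<le> G"
  shows "\<exists>w. coupling_density M M' w \<and>
    (\<integral>\<^sup>+z. ennreal (c (fst z) (snd z)) \<partial>density (M \<Otimes>\<^sub>M M') w)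
      \<le> ennreal (2 * (\<integral>x. D x \<partial>M) + 2 * (\<integral>x. D x \<partial>M') + G * (\<Sum>i\<in>I. \<bar>(\<integral>x. \<psi> i x \<partial>M) - (\<integral>x. \<psi> i x \<partial>M')\<bar>))"
proof -
  interpret A: prob_space M by fact
  interpret B: prob_space M' by fact
  have sp: "space M' = space M" using sets_eq_imp_space_eq[OF sets'] .
  have \<psi>m'[measurable]: "\<psi> i \<in> borel_measurable M'" "\<psi> i \<in> borel_measurable M" if "i \<in> I" for i
    using \<psi>m[OF that] measurable_cong_sets[OF sets' refl, of borel] by auto
  have dm'[measurable]: "d i \<in> borel_measurable M'" "d i \<in> borel_measurable M" if "i \<in> I" for i
    using dm[OF that] measurable_cong_sets[OF sets' refl, of borel] by auto
  have [measurable]: "D \<in> borel_measurable M" "D \<in> borel_measurable M'" using D by auto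
  have \<psi>le: "\<psi> i x \<le> 1" if "i \<in> I" "x \<in> space M" for i x
    using \<psi>1[OF that(2)] member_le_sum[OF that(1), of "\<lambda>i. \<psi> i x"] \<psi>0 that fin by auto
  have D0: "0 \<le> D x" if "x \<in> space M" for x
    using dD[OF that] sum_nonneg[of I "\<lambda>i. \<psi> i x * d i x"] \<psi>0 d0 that by fastforce
  have i\<psi>: "integrable M (\<psi> i)" "integrable M' (\<psi> i)" if "i \<in> I" for i
    using that \<psi>0 \<psi>le by (auto intro!: A.integrable_const_bound[where B=1] B.integrable_const_bound[where B=1] AE_I2 simp: sp)
  define a where "a i = (\<integral>x. \<psi> i x \<partial>M)" for i
  define a' where "a' i = (\<integral>x. \<psi> i x \<partial>M')" for i
  have a0: "0 \<le> a i" "0 \<le> a' i" if "i \<in> I" for i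
    using \<psi>0 that by (auto simp: a_def a'_def sp intro!: integral_nonneg_AE AE_I2)
  \<comment> \<open>\<open>r i * a i * a' i\<close> is the smaller of the two masses; for an empty cell division by zero gives weight zero\<close>
  define r where "r i = 1 / max (a i) (a' i)" for i
  have r0: "0 \<le> r i" if "i \<in> I" for i using a0[OF that] by (auto simp: r_def)
  have ra: "r i * a i \<le> 1" "r i * a' i \<le> 1" if "i \<in> I" for i
    using a0[OF that] by (auto simp: r_def max_def divide_le_eq)
  have raa: "r i * a i * a' i = min (a i) (a' i)" if "i \<in> I" for i
    using a0[OF that] by (auto simp: r_def max_def min_def)
  define s where "s = (\<Sum>i\<in>I. r i * a i * a' i)"
  have suma: "(\<Sum>i\<in>I. a i) = 1" "(\<Sum>i\<in>I. a' i) = 1"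
  proof -
    have "(\<Sum>i\<in>I. a i) = (\<integral>x. (\<Sum>i\<in>I. \<psi> i x) \<partial>M)"
      unfolding a_def using i\<psi> by (intro Bochner_Integration.integral_sum[symmetric]) auto
    also have "\<dots> = (\<integral>x. 1 \<partial>M)" using \<psi>1 by (intro Bochner_Integration.integral_cong) auto
    finally show "(\<Sum>i\<in>I. a i) = 1" by (simp add: A.prob_space)
    have "(\<Sum>i\<in>I. a' i) = (\<integral>x. (\<Sum>i\<in>I. \<psi> i x) \<partial>M')"
      unfolding a'_def using i\<psi> by (intro Bochner_Integration.integral_sum[symmetric]) auto
    also have "\<dots> = (\<integral>x. 1 \<partial>M')" using \<psi>1 by (intro Bochner_Integration.integral_cong) (auto simp: sp)
    finally show "(\<Sum>i\<in>I. a' i) = 1" by (simp add: B.prob_space)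
  qed
  have s1: "1 - s = (\<Sum>i\<in>I. a i - min (a i) (a' i))"
    using suma raa by (simp add: s_def sum_subtractf)
  have s_le: "1 - s \<le> (\<Sum>i\<in>I. \<bar>a i - a' i\<bar>)" unfolding s1 by (rule sum_mono) auto
  have s_le1: "0 \<le> 1 - s" unfolding s1 by (rule sum_nonneg) auto
  \<comment> \<open>densities of the mass that is left over; \<open>k\<close> below is zero when nothing is left over\<close>
  define v where "v x = 1 - (\<Sum>i\<in>I. r i * a' i * \<psi> i x)" for x
  define v' where "v' x = 1 - (\<Sum>i\<in>I. r i * a i * \<psi> i x)" for x
  have [measurable]: "v \<in> borel_measurable M" "v' \<in> borel_measurable M'" unfolding v_def v'_def by measurable
  have v0: "0 \<le> v x" "0 \<le> v' x" if x: "x \<in> space M" for x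
  proof -
    have "(\<Sum>i\<in>I. r i * a' i * \<psi> i x) \<le> (\<Sum>i\<in>I. \<psi> i x)" "(\<Sum>i\<in>I. r i * a i * \<psi> i x) \<le> (\<Sum>i\<in>I. \<psi> i x)"
      using ra \<psi>0 x by (auto intro!: sum_mono mult_left_le_one_le mult_nonneg_nonneg r0 a0)
    then show "0 \<le> v x" "0 \<le> v' x" using \<psi>1[OF x] by (auto simp: v_def v'_def)
  qed
  have v1: "v x \<le> 1" "v' x \<le> 1" if x: "x \<in> space M" for x
    using \<psi>0 x by (auto simp: v_def v'_def intro!: sum_nonneg mult_nonneg_nonneg r0 a0)
  have iv: "integrable M v" "integrable M' v'"
    using v0 v1 by (auto intro!: A.integrable_const_bound[where B=1] B.integrable_const_bound[where B=1] AE_I2 simp: sp)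
  have Iv: "(\<integral>x. v x \<partial>M) = 1 - s" "(\<integral>x. v' x \<partial>M') = 1 - s"
    using i\<psi> by (auto simp: v_def v'_def s_def a_def a'_def A.prob_space B.prob_space mult_ac intro!: sum.cong)
  define k where "k = 1 / (1 - s)"
  have k0: "0 \<le> k" using s_le1 by (simp add: k_def)
  have ks: "k * (1 - s) \<le> 1" by (simp add: k_def)
  define w where "w z = (\<Sum>i\<in>I. r i * \<psi> i (fst z) * \<psi> i (snd z)) + k * v (fst z) * v' (snd z)" for z
  have wm[measurable]: "w \<in> borel_measurable (M \<Otimes>\<^sub>M M')" unfolding w_def by measurable
  have w0: "0 \<le> w (x, y)" if "x \<in> space M" "y \<in> space M" for x y
    using that v0 k0 r0 \<psi>0 by (auto simp: w_def intro!: add_nonneg_nonneg sum_nonneg mult_nonneg_nonneg)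
  have marg_x: "(\<integral>\<^sup>+y. ennreal (w (x, y)) \<partial>M') = ennreal (1 - v x + k * v x * (1 - s))" if x: "x \<in> space M" for x
  proof -
    have int: "integrable M' (\<lambda>y. w (x, y))" unfolding w_def using i\<psi> iv by auto
    have "(\<integral>\<^sup>+y. ennreal (w (x, y)) \<partial>M') = ennreal (\<integral>y. w (x, y) \<partial>M')"
      using int w0 x by (intro nn_integral_eq_integral) (auto simp: sp intro!: AE_I2)
    also have "(\<integral>y. w (x, y) \<partial>M') = (\<Sum>i\<in>I. r i * \<psi> i x * a' i) + k * v x * (1 - s)"
      unfolding w_def using i\<psi> iv Iv by (simp add: a'_def)
    also have "(\<Sum>i\<in>I. r i * \<psi> i x * a' i) = 1 - v x" by (simp add: v_def mult_ac)
    finally show ?thesis .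
  qed
  have marg_y: "(\<integral>\<^sup>+x. ennreal (w (x, y)) \<partial>M) = ennreal (1 - v' y + k * v' y * (1 - s))" if y: "y \<in> space M" for y
  proof -
    have eqf: "(\<lambda>x. w (x, y)) = (\<lambda>x. (\<Sum>i\<in>I. r i * \<psi> i y * \<psi> i x) + k * v' y * v x)" by (auto simp: w_def mult_ac)
    have int: "integrable M (\<lambda>x. w (x, y))" unfolding eqf using i\<psi> iv by auto
    have "(\<integral>\<^sup>+x. ennreal (w (x, y)) \<partial>M) = ennreal (\<integral>x. w (x, y) \<partial>M)"
      using int w0 y by (intro nn_integral_eq_integral) (auto simp: sp intro!: AE_I2)
    also have "(\<integral>x. w (x, y) \<partial>M) = (\<Sum>i\<in>I. r i * \<psi> i y * a i) + k * v' y * (1 - s)"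
      unfolding eqf using i\<psi> iv Iv by (simp add: a_def)
    also have "(\<Sum>i\<in>I. r i * \<psi> i y * a i) = 1 - v' y" by (simp add: v'_def mult_ac)
    finally show ?thesis .
  qed
  have AEv: "AE x in M. 1 - v x + k * v x * (1 - s) = 1" "AE x in M'. 1 - v' x + k * v' x * (1 - s) = 1"
  proof -
    show "AE x in M. 1 - v x + k * v x * (1 - s) = 1"
    proof (cases "s = 1")
      case True
      then have "AE x in M. v x = 0"
        using integral_nonneg_eq_0_iff_AE[OF iv(1)] Iv v0 by (auto intro!: AE_I2)
      then show ?thesis by eventually_elim simp
    qed (simp add: k_def)
    show "AE x in M'. 1 - v' x + k * v' x * (1 - s) = 1"
    proof (cases "s = 1")
      case True
      then have "AE x in M'. v' x = 0"
        using integral_nonneg_eq_0_iff_AE[OF iv(2)] Iv v0 AE_I2[of M' "\<lambda>x. 0 \<le> v' x"] by (simp add: sp)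
      then show ?thesis by eventually_elim simp
    qed (simp add: k_def)
  qed
  have cdens: "coupling_density M M' (\<lambda>z. ennreal (w z))"
    unfolding coupling_density_def
  proof (intro conjI)
    show "AE x in M. (\<integral>\<^sup>+y. ennreal (w (x, y)) \<partial>M') = 1"
      using AEv(1) AE_space by eventually_elim (simp add: marg_x)
    show "AE y in M'. (\<integral>\<^sup>+x. ennreal (w (x, y)) \<partial>M) = 1"
      using AEv(2) AE_space by eventually_elim (simp add: marg_y sp)
  qed measurable
  define b where "b z = (\<Sum>i\<in>I. ennreal (r i * (\<psi> i (fst z) * d i (fst z))) * ennreal (\<psi> i (snd z))
        + ennreal (r i * \<psi> i (fst z)) * ennreal (\<psi> i (snd z) * d i (snd z)))
      + (ennreal (k * v (fst z) * (G + D (fst z))) * ennreal (v' (snd z))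
        + ennreal (k * v (fst z)) * ennreal (v' (snd z) * D (snd z)))" for z
  have bm[measurable]: "b \<in> borel_measurable (M \<Otimes>\<^sub>M M')" unfolding b_def by measurable
  have b_ge: "ennreal (w z) * ennreal (c (fst z) (snd z)) \<le> b z" if zs: "z \<in> space (M \<Otimes>\<^sub>M M')" for z
  proof -
    obtain x y where z: "z = (x, y)" "x \<in> space M" "y \<in> space M"
      using zs by (cases z) (auto simp: space_pair_measure sp)
    have bz: "b z = ennreal ((\<Sum>i\<in>I. r i * \<psi> i x * \<psi> i y * (d i x + d i y)) + k * v x * v' y * (G + D x + D y))"
      unfolding b_def z using z \<psi>0 r0 d0 v0 k0 D0 G
      by (simp add: ennreal_mult'[symmetric] ennreal_plus[symmetric] sum_ennreal sum_nonneg algebra_simps del: ennreal_plus)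
    have "w z * c x y = (\<Sum>i\<in>I. r i * \<psi> i x * \<psi> i y * c x y) + k * v x * v' y * c x y"
      by (simp add: w_def z distrib_right sum_distrib_right)
    also have "\<dots> \<le> (\<Sum>i\<in>I. r i * \<psi> i x * \<psi> i y * (d i x + d i y)) + k * v x * v' y * (G + D x + D y)"
      using z \<psi>0 r0 v0 k0 cd cG by (intro add_mono sum_mono mult_left_mono) auto
    finally have "ennreal (w z * c x y) \<le> b z" unfolding bz by (rule ennreal_leI)
    then show ?thesis using w0 z by (simp add: ennreal_mult')
  qed
  have i\<psi>d: "integrable M (\<lambda>x. \<psi> i x * d i x)" "integrable M' (\<lambda>x. \<psi> i x * d i x)" if i: "i \<in> I" for i
  proof -
    have "\<psi> i x * d i x \<le> D x" if "x \<in> space M" for x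
      using member_le_sum[OF i, of "\<lambda>i. \<psi> i x * d i x"] fin that \<psi>0 d0 dD by (auto intro: order_trans)
    then show "integrable M (\<lambda>x. \<psi> i x * d i x)" "integrable M' (\<lambda>x. \<psi> i x * d i x)"
      using i \<psi>0 d0 D0
      by (auto intro!: Bochner_Integration.integrable_bound[OF D(1)] Bochner_Integration.integrable_bound[OF D(2)] AE_I2 simp: sp abs_mult)
  qed
  have vD: "v x * D x \<le> D x" "v' x * D x \<le> D x" if "x \<in> space M" for x
    using v0[OF that] v1[OF that] D0[OF that] by (auto intro!: mult_left_le_one_le)
  have ivD: "integrable M (\<lambda>x. v x * D x)" "integrable M' (\<lambda>x. v' x * D x)"
    using vD v0 D0
    by (auto intro!: Bochner_Integration.integrable_bound[OF D(1)] Bochner_Integration.integrable_bound[OF D(2)] AE_I2 simp: sp abs_mult)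
  have ID: "(\<integral>x. v x * D x \<partial>M) \<le> (\<integral>x. D x \<partial>M)" "(\<integral>x. v' x * D x \<partial>M') \<le> (\<integral>x. D x \<partial>M')"
    using vD ivD D by (auto intro!: integral_mono simp: sp)
  have Isum: "(\<Sum>i\<in>I. \<integral>x. \<psi> i x * d i x \<partial>M) \<le> (\<integral>x. D x \<partial>M)" "(\<Sum>i\<in>I. \<integral>x. \<psi> i x * d i x \<partial>M') \<le> (\<integral>x. D x \<partial>M')"
  proof -
    have "(\<Sum>i\<in>I. \<integral>x. \<psi> i x * d i x \<partial>M) = (\<integral>x. (\<Sum>i\<in>I. \<psi> i x * d i x) \<partial>M)"
      using i\<psi>d by (intro Bochner_Integration.integral_sum[symmetric]) auto
    also have "\<dots> \<le> (\<integral>x. D x \<partial>M)"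
      using i\<psi>d D dD by (intro integral_mono) auto
    finally show "(\<Sum>i\<in>I. \<integral>x. \<psi> i x * d i x \<partial>M) \<le> (\<integral>x. D x \<partial>M)" .
    have "(\<Sum>i\<in>I. \<integral>x. \<psi> i x * d i x \<partial>M') = (\<integral>x. (\<Sum>i\<in>I. \<psi> i x * d i x) \<partial>M')"
      using i\<psi>d by (intro Bochner_Integration.integral_sum[symmetric]) auto
    also have "\<dots> \<le> (\<integral>x. D x \<partial>M')"
      using i\<psi>d D dD by (intro integral_mono) (auto simp: sp)
    finally show "(\<Sum>i\<in>I. \<integral>x. \<psi> i x * d i x \<partial>M') \<le> (\<integral>x. D x \<partial>M')" .
  qed
  define E where "E i = (\<integral>x. \<psi> i x * d i x \<partial>M)" for i
  define E' where "E' i = (\<integral>x. \<psi> i x * d i x \<partial>M')" for i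
  have E0: "0 \<le> E i" "0 \<le> E' i" if "i \<in> I" for i
    using that \<psi>0 d0 by (auto simp: E_def E'_def sp intro!: integral_nonneg_AE AE_I2)
  define F where "F = (\<integral>x. v x * D x \<partial>M)"
  define F' where "F' = (\<integral>x. v' x * D x \<partial>M')"
  have F0: "0 \<le> F" "0 \<le> F'" using v0 D0 by (auto simp: F_def F'_def sp intro!: integral_nonneg_AE AE_I2)
  have nn: "(\<integral>\<^sup>+x. ennreal (f x) \<partial>N) = ennreal (integral\<^sup>L N f)"
    if "integrable N f" "\<And>x. x \<in> space N \<Longrightarrow> 0 \<le> f x" for N :: "'a measure" and f
    using that by (intro nn_integral_eq_integral) (auto intro!: AE_I2)
  have nn\<psi>: "(\<integral>\<^sup>+x. ennreal (\<psi> i x) \<partial>M') = ennreal (a' i)" "(\<integral>\<^sup>+x. ennreal (r i * \<psi> i x) \<partial>M) = ennreal (r i * a i)"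
    "(\<integral>\<^sup>+x. ennreal (\<psi> i x * d i x) \<partial>M') = ennreal (E' i)"
    "(\<integral>\<^sup>+x. ennreal (r i * (\<psi> i x * d i x)) \<partial>M) = ennreal (r i * E i)" if i: "i \<in> I" for i
    using i \<psi>0 d0 r0 i\<psi> i\<psi>d by (subst nn; simp add: sp a_def a'_def E_def E'_def)+
  have nnv: "(\<integral>\<^sup>+x. ennreal (v' x) \<partial>M') = ennreal (1 - s)" "(\<integral>\<^sup>+x. ennreal (k * v x) \<partial>M) = ennreal (k * (1 - s))"
    "(\<integral>\<^sup>+x. ennreal (v' x * D x) \<partial>M') = ennreal F'"
    "(\<integral>\<^sup>+x. ennreal (k * (G * v x + v x * D x)) \<partial>M) = ennreal (k * (G * (1 - s) + F))"
    using v0 D0 k0 iv ivD Iv G by (subst nn; simp add: sp F_def F'_def)+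
  have "(\<integral>\<^sup>+z. b z \<partial>(M \<Otimes>\<^sub>M M')) =
      (\<Sum>i\<in>I. ennreal (r i * E i) * ennreal (a' i) + ennreal (r i * a i) * ennreal (E' i))
      + (ennreal (k * (G * (1 - s) + F)) * ennreal (1 - s) + ennreal (k * (1 - s)) * ennreal F')"
  proof -
    have t1: "(\<integral>\<^sup>+z. ennreal (r i * (\<psi> i (fst z) * d i (fst z))) * ennreal (\<psi> i (snd z)) \<partial>(M \<Otimes>\<^sub>M M'))
        = ennreal (r i * E i) * ennreal (a' i)" if i: "i \<in> I" for i
      using i
      by (subst nn_integral_pair_mult[where f="\<lambda>x. ennreal (r i * (\<psi> i x * d i x))" and g="\<lambda>x. ennreal (\<psi> i x)"])
        (auto simp: nn\<psi> intro: B.sigma_finite_measure_axioms)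
    have t2: "(\<integral>\<^sup>+z. ennreal (r i * \<psi> i (fst z)) * ennreal (\<psi> i (snd z) * d i (snd z)) \<partial>(M \<Otimes>\<^sub>M M'))
        = ennreal (r i * a i) * ennreal (E' i)" if i: "i \<in> I" for i
      using i
      by (subst nn_integral_pair_mult[where f="\<lambda>x. ennreal (r i * \<psi> i x)" and g="\<lambda>x. ennreal (\<psi> i x * d i x)"])
        (auto simp: nn\<psi> intro: B.sigma_finite_measure_axioms)
    have t3: "(\<integral>\<^sup>+z. ennreal (k * v (fst z) * (G + D (fst z))) * ennreal (v' (snd z)) \<partial>(M \<Otimes>\<^sub>M M'))
        = ennreal (k * (G * (1 - s) + F)) * ennreal (1 - s)"
    proof -
      have e: "k * v x * (G + D x) = k * (G * v x + v x * D x)" for x by (simp add: algebra_simps)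
      show ?thesis unfolding e
        by (subst nn_integral_pair_mult[where f="\<lambda>x. ennreal (k * (G * v x + v x * D x))" and g="\<lambda>x. ennreal (v' x)"])
          (auto simp: nnv intro: B.sigma_finite_measure_axioms)
    qed
    have t4: "(\<integral>\<^sup>+z. ennreal (k * v (fst z)) * ennreal (v' (snd z) * D (snd z)) \<partial>(M \<Otimes>\<^sub>M M'))
        = ennreal (k * (1 - s)) * ennreal F'"
      by (subst nn_integral_pair_mult[where f="\<lambda>x. ennreal (k * v x)" and g="\<lambda>x. ennreal (v' x * D x)"])
        (auto simp: nnv intro: B.sigma_finite_measure_axioms)
    show ?thesis unfolding b_def
      by (subst nn_integral_add, measurable, subst nn_integral_sum, measurable)
        (simp add: nn_integral_add t1 t2 t3 t4)
  qed
  also have "\<dots> = ennreal ((\<Sum>i\<in>I. r i * a' i * E i + r i * a i * E' i) + (k * (1 - s) * (G * (1 - s) + F) + k * (1 - s) * F'))"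
    using r0 a0 E0 F0 k0 s_le1 G
    by (simp add: ennreal_mult'[symmetric] ennreal_plus[symmetric] sum_ennreal sum_nonneg mult_ac del: ennreal_plus)
  also have "\<dots> \<le> ennreal (2 * (\<integral>x. D x \<partial>M) + 2 * (\<integral>x. D x \<partial>M') + G * (\<Sum>i\<in>I. \<bar>a i - a' i\<bar>))"
  proof (rule ennreal_leI)
    have "(\<Sum>i\<in>I. r i * a' i * E i + r i * a i * E' i) \<le> (\<Sum>i\<in>I. E i + E' i)"
      using ra E0 r0 a0 by (intro sum_mono add_mono mult_left_le_one_le) auto
    also have "\<dots> \<le> (\<integral>x. D x \<partial>M) + (\<integral>x. D x \<partial>M')"
      using Isum by (simp add: sum.distrib E_def E'_def)
    finally have 1: "(\<Sum>i\<in>I. r i * a' i * E i + r i * a i * E' i) \<le> (\<integral>x. D x \<partial>M) + (\<integral>x. D x \<partial>M')" .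
    have "k * (1 - s) * (G * (1 - s) + F) \<le> G * (1 - s) + F" "k * (1 - s) * F' \<le> F'"
      using ks k0 s_le1 F0 G by (auto intro!: mult_left_le_one_le)
    moreover have "G * (1 - s) \<le> G * (\<Sum>i\<in>I. \<bar>a i - a' i\<bar>)" using s_le G by (rule mult_left_mono)
    ultimately show "(\<Sum>i\<in>I. r i * a' i * E i + r i * a i * E' i) + (k * (1 - s) * (G * (1 - s) + F) + k * (1 - s) * F')
        \<le> 2 * (\<integral>x. D x \<partial>M) + 2 * (\<integral>x. D x \<partial>M') + G * (\<Sum>i\<in>I. \<bar>a i - a' i\<bar>)"
      using 1 ID by (simp add: F_def F'_def)
  qed
  finally have "(\<integral>\<^sup>+z. b z \<partial>(M \<Otimes>\<^sub>M M')) \<le> ennreal (2 * (\<integral>x. D x \<partial>M) + 2 * (\<integral>x. D x \<partial>M') + G * (\<Sum>i\<in>I. \<bar>a i - a' i\<bar>))" .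
  then have "(\<integral>\<^sup>+z. ennreal (c (fst z) (snd z)) \<partial>density (M \<Otimes>\<^sub>M M') (\<lambda>z. ennreal (w z)))
      \<le> ennreal (2 * (\<integral>x. D x \<partial>M) + 2 * (\<integral>x. D x \<partial>M') + G * (\<Sum>i\<in>I. \<bar>a i - a' i\<bar>))"
    by (intro order_trans[OF nn_integral_density_le[OF _ bm b_ge]]) auto
  then show ?thesis using cdens unfolding a_def a'_def by blast
qed

section \<open>Transport costs and functionals\<close>

lemma couplings_measurable:
  assumes "\<pi> \<in> couplings M N"
  shows "fst \<in> measurable \<pi> M" "snd \<in> measurable \<pi> N"
proof -
  have s: "sets \<pi> = sets (M \<Otimes>\<^sub>M N)" using assms by (simp add: couplings_def)
  show "fst \<in> measurable \<pi> M" "snd \<in> measurable \<pi> N"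
    unfolding measurable_cong_sets[OF s refl] by (rule measurable_fst measurable_snd)+
qed

lemma couplings_integral:
  fixes f g :: "'a \<Rightarrow> real"
  assumes \<pi>: "\<pi> \<in> couplings M N"
  shows "integrable M f \<Longrightarrow> integrable \<pi> (\<lambda>z. f (fst z))"
    and "integrable N g \<Longrightarrow> integrable \<pi> (\<lambda>z. g (snd z))"
    and "f \<in> borel_measurable M \<Longrightarrow> (\<integral>z. f (fst z) \<partial>\<pi>) = (\<integral>x. f x \<partial>M)"
    and "g \<in> borel_measurable N \<Longrightarrow> (\<integral>z. g (snd z) \<partial>\<pi>) = (\<integral>x. g x \<partial>N)"
proof -
  note m = couplings_measurable[OF \<pi>]
  have d: "distr \<pi> M fst = M" "distr \<pi> N snd = N" using \<pi> by (auto simp: couplings_def)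
  show "integrable M f \<Longrightarrow> integrable \<pi> (\<lambda>z. f (fst z))"
    using integrable_distr[OF m(1), of f] d by simp
  show "integrable N g \<Longrightarrow> integrable \<pi> (\<lambda>z. g (snd z))"
    using integrable_distr[OF m(2), of g] d by simp
  show "f \<in> borel_measurable M \<Longrightarrow> (\<integral>z. f (fst z) \<partial>\<pi>) = (\<integral>x. f x \<partial>M)"
    using integral_distr[OF m(1), of f] d by simp
  show "g \<in> borel_measurable N \<Longrightarrow> (\<integral>z. g (snd z) \<partial>\<pi>) = (\<integral>x. g x \<partial>N)"
    using integral_distr[OF m(2), of g] d by simp
qed

lemma couplings_prob_space:
  assumes "\<pi> \<in> couplings M N" "prob_space M" shows "prob_space \<pi>"
  using prob_space_distrD[OF couplings_measurable(1)[OF assms(1)]] assms by (simp add: couplings_def)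

lemma couplings_swap:
  assumes "\<pi> \<in> couplings M N"
  shows "distr \<pi> (N \<Otimes>\<^sub>M M) (\<lambda>(x, y). (y, x)) \<in> couplings N M"
proof -
  note [measurable] = couplings_measurable[OF assms]
  have [measurable]: "(\<lambda>(x, y). (y, x)) \<in> measurable \<pi> (N \<Otimes>\<^sub>M M)"
    unfolding case_prod_beta by measurable
  show ?thesis using assms
    by (auto simp: couplings_def distr_distr comp_def case_prod_beta)
qed

lemma wasserstein2_sq:
  "(wasserstein2 d M N)\<^sup>2 = enn2real (\<Sqinter>\<pi>\<in>couplings M N. \<integral>\<^sup>+ z. ennreal ((d (fst z) (snd z))\<^sup>2) \<partial>\<pi>)"
  by (simp add: wasserstein2_def)

lemma wasserstein2_nonneg: "0 \<le> wasserstein2 d M N"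
  by (simp add: wasserstein2_def)

lemma wasserstein2_le:
  assumes "\<pi> \<in> couplings M N" "(\<integral>\<^sup>+ z. ennreal ((d (fst z) (snd z))\<^sup>2) \<partial>\<pi>) \<le> ennreal r" "0 \<le> r"
  shows "(wasserstein2 d M N)\<^sup>2 \<le> r"
proof -
  have "(\<Sqinter>\<pi>\<in>couplings M N. \<integral>\<^sup>+ z. ennreal ((d (fst z) (snd z))\<^sup>2) \<partial>\<pi>) \<le> ennreal r"
    by (rule INF_lower2) (use assms in auto)
  then show ?thesis unfolding wasserstein2_sq using assms(3) by (rule enn2real_leI[rotated])
qed

text \<open>
  A coupling of finite cost must exist, for otherwise the infimum is infinite and
  \<open>enn2real\<close> turns it into zero.
\<close>

lemma wasserstein2_coupling:
  assumes "\<pi>0 \<in> couplings M N" "(\<integral>\<^sup>+ z. ennreal ((d (fst z) (snd z))\<^sup>2) \<partial>\<pi>0) < \<infinity>"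
    and "(wasserstein2 d M N)\<^sup>2 < r"
  shows "\<exists>\<pi>\<in>couplings M N. (\<integral>\<^sup>+ z. ennreal ((d (fst z) (snd z))\<^sup>2) \<partial>\<pi>) < ennreal r"
proof -
  let ?I = "\<Sqinter>\<pi>\<in>couplings M N. \<integral>\<^sup>+ z. ennreal ((d (fst z) (snd z))\<^sup>2) \<partial>\<pi>"
  have "?I \<le> (\<integral>\<^sup>+ z. ennreal ((d (fst z) (snd z))\<^sup>2) \<partial>\<pi>0)" by (rule INF_lower) fact
  then have "?I < \<infinity>" using assms(2) by (rule le_less_trans)
  then have "?I = ennreal ((wasserstein2 d M N)\<^sup>2)" by (simp add: wasserstein2_sq ennreal_enn2real)
  also have "\<dots> < ennreal r" using assms(3) by (intro ennreal_lessI) (auto intro: le_less_trans[OF zero_le_power2])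
  finally show ?thesis by (simp add: INF_less_iff)
qed

text \<open>
  The converse direction to constructing couplings: a pair of functions that differ by at most a
  multiple of the squared distance has integrals that differ by at most that multiple of the
  transport cost. All continuity statements on laws, and on laws of random laws, are instances.
\<close>

lemma wasserstein2_functional_bound:
  fixes f g :: "'a \<Rightarrow> real"
  assumes fin: "\<pi>0 \<in> couplings M N" "(\<integral>\<^sup>+ z. ennreal ((d (fst z) (snd z))\<^sup>2) \<partial>\<pi>0) < \<infinity>"
    and fg: "integrable M f" "integrable N g" and C: "0 < C"
    and le: "\<And>x y. x \<in> space M \<Longrightarrow> y \<in> space N \<Longrightarrow> f x \<le> g y + C * (d x y)\<^sup>2"
  shows "(\<integral>x. f x \<partial>M) \<le> (\<integral>x. g x \<partial>N) + C * (wasserstein2 d M N)\<^sup>2"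
proof (rule field_le_epsilon)
  fix e :: real assume e: "0 < e"
  obtain \<pi> where \<pi>: "\<pi> \<in> couplings M N"
    and c: "(\<integral>\<^sup>+ z. ennreal ((d (fst z) (snd z))\<^sup>2) \<partial>\<pi>) < ennreal ((wasserstein2 d M N)\<^sup>2 + e / C)"
    using wasserstein2_coupling[OF fin, of "(wasserstein2 d M N)\<^sup>2 + e / C"] e C by auto
  note m = couplings_measurable[OF \<pi>]
  have sp: "z \<in> space \<pi> \<Longrightarrow> fst z \<in> space M \<and> snd z \<in> space N" for z
    using measurable_space[OF m(1)] measurable_space[OF m(2)] by auto
  define h where "h z = max 0 ((f (fst z) - g (snd z)) / C)" for z
  have if': "integrable \<pi> (\<lambda>z. f (fst z))" "integrable \<pi> (\<lambda>z. g (snd z))"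
    using couplings_integral[OF \<pi>] fg by auto
  then have ih: "integrable \<pi> h"
    unfolding h_def by (intro Bochner_Integration.integrable_max Bochner_Integration.integrable_divide
      Bochner_Integration.integrable_diff) auto
  have h0: "0 \<le> h z" for z by (simp add: h_def)
  have "ennreal (\<integral>z. h z \<partial>\<pi>) = (\<integral>\<^sup>+z. ennreal (h z) \<partial>\<pi>)"
    using ih h0 by (intro nn_integral_eq_integral[symmetric]) auto
  also have "\<dots> \<le> (\<integral>\<^sup>+ z. ennreal ((d (fst z) (snd z))\<^sup>2) \<partial>\<pi>)"
  proof (intro nn_integral_mono ennreal_leI)
    fix z assume "z \<in> space \<pi>"
    then show "h z \<le> (d (fst z) (snd z))\<^sup>2"
      using le[of "fst z" "snd z"] sp[of z] C by (auto simp: h_def divide_le_eq mult_ac)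
  qed
  also note c
  finally have h: "(\<integral>z. h z \<partial>\<pi>) < (wasserstein2 d M N)\<^sup>2 + e / C"
    using ennreal_less_iff[of "\<integral>z. h z \<partial>\<pi>"] h0 by simp
  have "(\<integral>x. f x \<partial>M) - (\<integral>x. g x \<partial>N) = (\<integral>z. f (fst z) - g (snd z) \<partial>\<pi>)"
    using couplings_integral(3,4)[OF \<pi>] fg if' by simp
  also have "\<dots> \<le> (\<integral>z. C * h z \<partial>\<pi>)"
  proof (rule integral_mono)
    show "f (fst z) - g (snd z) \<le> C * h z" for z
      using C by (auto simp: h_def field_simps max_def)
  qed (use if' ih in auto)
  also have "\<dots> \<le> C * (wasserstein2 d M N)\<^sup>2 + e"
    using mult_left_mono[OF less_imp_le[OF h], of C] C by (simp add: distrib_left)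
  finally show "(\<integral>x. f x \<partial>M) \<le> (\<integral>x. g x \<partial>N) + C * (wasserstein2 d M N)\<^sup>2 + e" by simp
qed

section \<open>Transport on the real line\<close>

lemma P2_realD:
  assumes "\<mu> \<in> P2_real"
  shows "prob_space \<mu>" "sets \<mu> = sets borel" "space \<mu> = UNIV" "integrable \<mu> (\<lambda>x. x\<^sup>2)" "real_distribution \<mu>"
proof -
  have r: "real_distribution \<mu>" and i: "integrable \<mu> (\<lambda>x. x\<^sup>2)" using assms by (auto simp: P2_real_def)
  interpret real_distribution \<mu> by (rule r)
  show "prob_space \<mu>" "sets \<mu> = sets borel" "space \<mu> = UNIV" "integrable \<mu> (\<lambda>x. x\<^sup>2)" "real_distribution \<mu>"
    using r i prob_space_axioms by auto
qed

lemma P2_integrable: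
  assumes \<mu>: "\<mu> \<in> P2_real" and f: "f \<in> borel_measurable borel" and le: "\<And>x::real. \<bar>f x\<bar> \<le> a + b * x\<^sup>2"
  shows "integrable \<mu> f"
proof -
  interpret prob_space \<mu> by (rule P2_realD[OF \<mu>])
  have "f \<in> borel_measurable \<mu>" using f measurable_cong_sets[OF P2_realD(2)[OF \<mu>] refl] by blast
  moreover have "integrable \<mu> (\<lambda>x. a + b * x\<^sup>2)" using P2_realD(4)[OF \<mu>] by simp
  ultimately show ?thesis
  proof -
    assume "f \<in> borel_measurable \<mu>" "integrable \<mu> (\<lambda>x. a + b * x\<^sup>2)"
    moreover have "AE x in \<mu>. norm (f x) \<le> norm (a + b * x\<^sup>2)"
    proof (rule AE_I2)
      fix x show "norm (f x) \<le> norm (a + b * x\<^sup>2)" using le[of x] by simp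
    qed
    ultimately show ?thesis by (blast intro: Bochner_Integration.integrable_bound)
  qed
qed

lemma square_diff_le: "(x - y)\<^sup>2 \<le> 2 * x\<^sup>2 + 2 * y\<^sup>2" for x y :: real
  using zero_le_power2[of "x + y"] by (simp add: power2_eq_square algebra_simps)

lemma P2_product_coupling:
  assumes "\<mu> \<in> P2_real" "\<nu> \<in> P2_real"
  shows "\<exists>\<pi>\<in>couplings \<mu> \<nu>. (\<integral>\<^sup>+ z. ennreal ((dist (fst z) (snd z))\<^sup>2) \<partial>\<pi>) \<le> ennreal (4 * (\<integral>x. x\<^sup>2 \<partial>\<mu>) + 4 * (\<integral>x. x\<^sup>2 \<partial>\<nu>))"
proof -
  note m = P2_realD(1-4)[OF assms(1)] and n = P2_realD(1-4)[OF assms(2)]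
  have "\<exists>w. coupling_density \<mu> \<nu> w \<and>
    (\<integral>\<^sup>+z. ennreal ((dist (fst z) (snd z))\<^sup>2) \<partial>density (\<mu> \<Otimes>\<^sub>M \<nu>) w)
      \<le> ennreal (2 * (\<integral>x. 2 * x\<^sup>2 \<partial>\<mu>) + 2 * (\<integral>x. 2 * x\<^sup>2 \<partial>\<nu>)
         + 0 * (\<Sum>i\<in>{()}. \<bar>(\<integral>x. (\<lambda>_ _. 1) i x \<partial>\<mu>) - (\<integral>x. (\<lambda>_ _. 1) i x \<partial>\<nu>)\<bar>))"
  proof (rule partition_coupling[where d="\<lambda>_ x. 2 * x\<^sup>2" and c="\<lambda>x y. (dist x y)\<^sup>2" and I="{()}" and \<psi>="\<lambda>_ _. 1" and D="\<lambda>x. 2 * x\<^sup>2"])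
    show "(dist x y)\<^sup>2 \<le> 2 * x\<^sup>2 + 2 * y\<^sup>2" for x y :: real
      using square_diff_le[of x y] by (simp add: dist_real_def)
    show "(dist x y)\<^sup>2 \<le> 0 + 2 * x\<^sup>2 + 2 * y\<^sup>2" for x y :: real
      using square_diff_le[of x y] by (simp add: dist_real_def)
    have "(\<lambda>x::real. 2 * x\<^sup>2) \<in> borel_measurable borel" by simp
    then show "(\<lambda>x. 2 * x\<^sup>2) \<in> borel_measurable \<mu>" using m(2) by (simp cong: measurable_cong_sets)
  qed (use m n in simp_all)
  then obtain w where w: "coupling_density \<mu> \<nu> w"
    "(\<integral>\<^sup>+z. ennreal ((dist (fst z) (snd z))\<^sup>2) \<partial>density (\<mu> \<Otimes>\<^sub>M \<nu>) w) \<le> ennreal (4 * (\<integral>x. x\<^sup>2 \<partial>\<mu>) + 4 * (\<integral>x. x\<^sup>2 \<partial>\<nu>))"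
    by auto
  have "sigma_finite_measure \<mu>" "sigma_finite_measure \<nu>"
    using m(1) n(1) prob_space_imp_sigma_finite by auto
  from coupling_densityD[OF this w(1)] w(2) show ?thesis by blast
qed

lemma W2_sq_le_moments:
  assumes "\<mu> \<in> P2_real" "\<nu> \<in> P2_real"
  shows "(W2 \<mu> \<nu>)\<^sup>2 \<le> 4 * (\<integral>x. x\<^sup>2 \<partial>\<mu>) + 4 * (\<integral>x. x\<^sup>2 \<partial>\<nu>)"
proof -
  obtain \<pi> where "\<pi> \<in> couplings \<mu> \<nu>"
    "(\<integral>\<^sup>+ z. ennreal ((dist (fst z) (snd z))\<^sup>2) \<partial>\<pi>) \<le> ennreal (4 * (\<integral>x. x\<^sup>2 \<partial>\<mu>) + 4 * (\<integral>x. x\<^sup>2 \<partial>\<nu>))"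
    using P2_product_coupling[OF assms] by blast
  then show ?thesis by (rule wasserstein2_le) simp
qed

lemma P2_finite_cost:
  assumes "\<mu> \<in> P2_real" "\<nu> \<in> P2_real"
  obtains \<pi> where "\<pi> \<in> couplings \<mu> \<nu>" "(\<integral>\<^sup>+ z. ennreal ((dist (fst z) (snd z))\<^sup>2) \<partial>\<pi>) < \<infinity>"
proof -
  obtain \<pi> where \<pi>: "\<pi> \<in> couplings \<mu> \<nu>"
    "(\<integral>\<^sup>+ z. ennreal ((dist (fst z) (snd z))\<^sup>2) \<partial>\<pi>) \<le> ennreal (4 * (\<integral>x. x\<^sup>2 \<partial>\<mu>) + 4 * (\<integral>x. x\<^sup>2 \<partial>\<nu>))"
    using P2_product_coupling[OF assms] by blast
  show thesis by (rule that[OF \<pi>(1)]) (rule le_less_trans[OF \<pi>(2)], simp)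
qed

text \<open>
  With \<open>f\<close> and \<open>g\<close> indicators of nested half-lines this compares distribution functions; with quadratic
  \<open>f\<close> and \<open>g\<close> it compares moments and tails.
\<close>

lemma W2_functional_bound:
  assumes "\<mu> \<in> P2_real" "\<nu> \<in> P2_real" "integrable \<mu> f" "integrable \<nu> g" "0 < C"
    and le: "\<And>x y. f x \<le> g y + C * (x - y)\<^sup>2"
  shows "(\<integral>x. f x \<partial>\<mu>) \<le> (\<integral>x. g x \<partial>\<nu>) + C * (W2 \<mu> \<nu>)\<^sup>2"
proof -
  obtain \<pi> where "\<pi> \<in> couplings \<mu> \<nu>" "(\<integral>\<^sup>+ z. ennreal ((dist (fst z) (snd z))\<^sup>2) \<partial>\<pi>) < \<infinity>"
    using P2_finite_cost[OF assms(1,2)] .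
  then show ?thesis
    by (rule wasserstein2_functional_bound) (use assms in \<open>auto simp: dist_real_def\<close>)
qed

definition clip :: "real \<Rightarrow> real \<Rightarrow> real" where
  "clip K x = max (- K) (min K x)"

text \<open>
  Its integral measures how far \<open>\<mu>\<close> is from being supported in \<open>[-K, K]\<close>, in the transport sense.
\<close>

definition excess :: "real \<Rightarrow> real \<Rightarrow> real" where
  "excess K x = (x - clip K x)\<^sup>2"

text \<open>
  Bernstein polynomials of the clipped coordinate, rescaled to the unit interval. The \<open>i\<close>-th one is
  concentrated near \<open>K (2 i / n - 1)\<close>, and the first and the last absorb the two tails.
\<close>

definition bump :: "real \<Rightarrow> nat \<Rightarrow> nat \<Rightarrow> real \<Rightarrow> real" where
  "bump K n i x = Bernstein n i ((clip K x + K) / (2 * K))"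

lemma clip_borel[measurable]: "clip K \<in> borel_measurable borel"
  unfolding clip_def[abs_def] by measurable

lemma excess_borel[measurable]: "excess K \<in> borel_measurable borel"
  unfolding excess_def[abs_def] by measurable

lemma bump_borel[measurable]: "bump K n i \<in> borel_measurable borel"
  unfolding bump_def[abs_def] Bernstein_def by measurable

lemma clip_bounds: "0 \<le> K \<Longrightarrow> \<bar>clip K x\<bar> \<le> K" by (auto simp: clip_def)

lemma clip_lipschitz: "\<bar>clip K x - clip K y\<bar> \<le> \<bar>x - y\<bar>" by (auto simp: clip_def max_def min_def)

lemma excess_le: "0 \<le> K \<Longrightarrow> excess K x \<le> x\<^sup>2"
  unfolding excess_def by (subst abs_le_square_iff[symmetric]) (auto simp: clip_def max_def min_def)

lemma excess_nonneg: "0 \<le> excess K x" by (simp add: excess_def)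

lemma square_le_excess: "0 \<le> K \<Longrightarrow> x\<^sup>2 \<le> 2 * excess K x + 2 * K\<^sup>2"
proof -
  assume K: "0 \<le> K"
  have "x\<^sup>2 = ((x - clip K x) - (- clip K x))\<^sup>2" by simp
  also have "\<dots> \<le> 2 * (x - clip K x)\<^sup>2 + 2 * (- clip K x)\<^sup>2" by (rule square_diff_le)
  also have "\<dots> \<le> 2 * excess K x + 2 * K\<^sup>2"
    using clip_bounds[OF K, of x] power_mono[of "\<bar>clip K x\<bar>" K 2] by (simp add: excess_def)
  finally show ?thesis .
qed

lemma bump_arg: "0 < K \<Longrightarrow> 0 \<le> (clip K x + K) / (2 * K) \<and> (clip K x + K) / (2 * K) \<le> 1"
  using clip_bounds[of K x] by (auto simp: field_simps)

lemma bump_nonneg: "0 < K \<Longrightarrow> 0 \<le> bump K n i x"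
  unfolding bump_def using bump_arg by (intro Bernstein_nonneg) auto

lemma bump_sum: "(\<Sum>i\<le>n. bump K n i x) = 1"
  unfolding bump_def by (rule sum_Bernstein)

lemma bump_le1: "0 < K \<Longrightarrow> i \<le> n \<Longrightarrow> bump K n i x \<le> 1"
  using bump_sum[of K n x] member_le_sum[of i "{..n}" "\<lambda>i. bump K n i x"] bump_nonneg by auto

text \<open>
  The variance of \<open>i / n\<close> for a binomial variable \<open>i\<close> with success probability \<open>u\<close>.
\<close>

lemma Bernstein_variance:
  assumes n: "0 < n"
  shows "(\<Sum>i\<le>n. Bernstein n i u * (u - real i / real n)\<^sup>2) = u * (1 - u) / n"
proof -
  have "real n ^ 2 * (Bernstein n i u * (u - real i / real n)\<^sup>2)
      = (real n * u)\<^sup>2 * Bernstein n i u - 2 * real n * u * (real i * Bernstein n i u)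
        + (real i * (real i - 1) * Bernstein n i u + real i * Bernstein n i u)" for i
    using n by (simp add: power2_eq_square field_simps)
  then have "(real n)^2 * (\<Sum>i\<le>n. Bernstein n i u * (u - real i / real n)\<^sup>2)
      = (real n * u)\<^sup>2 * (\<Sum>i\<le>n. Bernstein n i u) - 2 * real n * u * (\<Sum>i\<le>n. real i * Bernstein n i u)
        + ((\<Sum>i\<le>n. real i * (real i - 1) * Bernstein n i u) + (\<Sum>i\<le>n. real i * Bernstein n i u))"
    by (simp only: sum_distrib_left sum.distrib sum_subtractf)
  also have "\<dots> = (real n)^2 * (u * (1 - u) / n)"
  proof -
    have "(real n)^2 * (u * (1 - u) / n) = real n * (u * (1 - u))" using n by (simp add: power2_eq_square)
    then show ?thesis
      unfolding sum_Bernstein sum_k_Bernstein sum_kk_Bernstein by (simp add: power2_eq_square algebra_simps)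
  qed
  finally have e: "(real n)^2 * (\<Sum>i\<le>n. Bernstein n i u * (u - real i / real n)\<^sup>2) = (real n)^2 * (u * (1 - u) / n)" .
  show ?thesis by (rule mult_left_cancel[THEN iffD1, OF _ e]) (use n in simp)
qed

text \<open>
  The cost of cell \<open>i\<close> is the squared distance to its centre, and by the binomial variance its average is
  \<open>O (K\<^sup>2 / n)\<close>; leaving \<open>[-K, K]\<close> costs the excess.
\<close>

lemma bump_coupling:
  assumes \<mu>: "\<mu> \<in> P2_real" "\<nu> \<in> P2_real" and K: "0 < K" and n: "0 < n"
  shows "\<exists>w. coupling_density \<mu> \<nu> w \<and>
    (\<integral>\<^sup>+z. ennreal ((dist (fst z) (snd z))\<^sup>2) \<partial>density (\<mu> \<Otimes>\<^sub>M \<nu>) w)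
    \<le> ennreal (16 * K\<^sup>2 / n + 8 * (\<integral>x. excess K x \<partial>\<mu>) + 8 * (\<integral>x. excess K x \<partial>\<nu>)
        + 12 * K\<^sup>2 * (\<Sum>i\<le>n. \<bar>(\<integral>x. bump K n i x \<partial>\<mu>) - (\<integral>x. bump K n i x \<partial>\<nu>)\<bar>))"
proof -
  note m = P2_realD(1-4)[OF \<mu>(1)] and n' = P2_realD(1-4)[OF \<mu>(2)]
  interpret A: prob_space \<mu> by (rule m)
  interpret B: prob_space \<nu> by (rule n')
  have ie: "integrable \<mu> (excess K)" "integrable \<nu> (excess K)"
    by (rule P2_integrable[OF \<mu>(1), where a=0 and b=1] P2_integrable[OF \<mu>(2), where a=0 and b=1];
        use excess_le[of K] excess_nonneg K in auto)+
  define c where "c i = - K + 2 * K * (real i / n)" for i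
  define d where "d i x = 4 * (clip K x - c i)\<^sup>2 + 4 * excess K x" for i x
  define D where "D x = 4 * K\<^sup>2 / n + 4 * excess K x" for x
  have mb: "f \<in> borel_measurable borel \<Longrightarrow> f \<in> borel_measurable \<mu>" for f :: "real \<Rightarrow> real"
    using m(2) by (simp cong: measurable_cong_sets)
  have four: "(p - q + r - s)\<^sup>2 \<le> 4 * p\<^sup>2 + 4 * q\<^sup>2 + 4 * r\<^sup>2 + 4 * s\<^sup>2" for p q r s :: real
    using zero_le_power2[of "p + q"] zero_le_power2[of "p - r"] zero_le_power2[of "p + s"]
      zero_le_power2[of "q + r"] zero_le_power2[of "q - s"] zero_le_power2[of "r + s"]
    by (simp add: power2_eq_square algebra_simps)
  have three: "(p + q - r)\<^sup>2 \<le> 3 * p\<^sup>2 + 3 * q\<^sup>2 + 3 * r\<^sup>2" for p q r :: real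
    using zero_le_power2[of "p - q"] zero_le_power2[of "p + r"] zero_le_power2[of "q + r"]
    by (simp add: power2_eq_square algebra_simps)
  have "\<exists>w. coupling_density \<mu> \<nu> w \<and>
    (\<integral>\<^sup>+z. ennreal ((\<lambda>x y. (dist x y)\<^sup>2) (fst z) (snd z)) \<partial>density (\<mu> \<Otimes>\<^sub>M \<nu>) w)
    \<le> ennreal (2 * (\<integral>x. D x \<partial>\<mu>) + 2 * (\<integral>x. D x \<partial>\<nu>)
        + 12 * K\<^sup>2 * (\<Sum>i\<in>{..n}. \<bar>(\<integral>x. bump K n i x \<partial>\<mu>) - (\<integral>x. bump K n i x \<partial>\<nu>)\<bar>))"
  proof (rule partition_coupling[where d=d and I="{..n}" and c="\<lambda>x y. (dist x y)\<^sup>2" and \<psi>="bump K n" and D=D])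
    fix i :: nat and x y :: real
    have "(dist x y)\<^sup>2 = ((clip K x - c i) - (clip K y - c i) + (x - clip K x) - (y - clip K y))\<^sup>2"
      by (simp add: dist_real_def)
    also have "\<dots> \<le> d i x + d i y"
      by (rule order_trans[OF four]) (simp add: d_def excess_def)
    finally show "(dist x y)\<^sup>2 \<le> d i x + d i y" .
  next
    fix x y :: real
    have "(dist x y)\<^sup>2 = ((clip K x - clip K y) + (x - clip K x) - (y - clip K y))\<^sup>2"
      by (simp add: dist_real_def)
    also have "\<dots> \<le> 3 * (clip K x - clip K y)\<^sup>2 + 3 * excess K x + 3 * excess K y"
      by (rule order_trans[OF three]) (simp add: excess_def)
    also have "(clip K x - clip K y)\<^sup>2 \<le> (2 * K)\<^sup>2"
      unfolding abs_le_square_iff[symmetric] using clip_bounds[of K x] clip_bounds[of K y] K by auto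
    also have "3 * (2 * K)\<^sup>2 + 3 * excess K x + 3 * excess K y \<le> 12 * K\<^sup>2 + D x + D y"
      using excess_nonneg[of K x] excess_nonneg[of K y]
      by (simp add: D_def power_mult_distrib)
    finally show "(dist x y)\<^sup>2 \<le> 12 * K\<^sup>2 + D x + D y" by simp
  next
    fix x :: real
    let ?u = "(clip K x + K) / (2 * K)"
    have cc: "clip K x - c i = 2 * K * (?u - real i / n)" for i using K by (simp add: c_def field_simps)
    have "(\<Sum>i\<le>n. bump K n i x * d i x) = (\<Sum>i\<le>n. 16 * K\<^sup>2 * (Bernstein n i ?u * (?u - real i / n)\<^sup>2) + 4 * excess K x * bump K n i x)"
      unfolding d_def cc bump_def by (intro sum.cong refl) (simp only: power_mult_distrib, simp add: distrib_left mult_ac)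
    also have "\<dots> = 16 * K\<^sup>2 * (?u * (1 - ?u) / n) + 4 * excess K x"
      unfolding sum.distrib sum_distrib_left[symmetric] Bernstein_variance[OF n] bump_sum by simp
    also have "\<dots> \<le> 16 * K\<^sup>2 * ((1/4) / n) + 4 * excess K x"
    proof -
      have q: "u * (1 - u) \<le> 1/4" for u :: real using zero_le_power2[of "u - 1/2"] by (simp add: power2_eq_square algebra_simps)
      show ?thesis by (intro add_right_mono mult_left_mono divide_right_mono q) auto
    qed
    finally show "(\<Sum>i\<in>{..n}. bump K n i x * d i x) \<le> D x" by (simp add: D_def)
  next
    show "bump K n i \<in> borel_measurable \<mu>" for i by (rule mb) simp
    show "d i \<in> borel_measurable \<mu>" for i unfolding d_def[abs_def] by (rule mb) simp
    show "integrable \<mu> D" "integrable \<nu> D" using ie by (auto simp: D_def[abs_def])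
    show "0 \<le> d i x" for i x using excess_nonneg by (simp add: d_def)
  qed (use m n' K bump_nonneg bump_sum in simp_all)
  moreover have "2 * (\<integral>x. D x \<partial>\<mu>) + 2 * (\<integral>x. D x \<partial>\<nu>) = 16 * K\<^sup>2 / n + 8 * (\<integral>x. excess K x \<partial>\<mu>) + 8 * (\<integral>x. excess K x \<partial>\<nu>)"
    unfolding D_def using ie by (simp add: A.prob_space B.prob_space)
  ultimately show ?thesis by simp
qed

lemma W2_sq_le_bumps:
  assumes \<mu>: "\<mu> \<in> P2_real" "\<nu> \<in> P2_real" and K: "0 < K" and n: "0 < n"
  shows "(W2 \<mu> \<nu>)\<^sup>2 \<le> 16 * K\<^sup>2 / n + 8 * (\<integral>x. excess K x \<partial>\<mu>) + 8 * (\<integral>x. excess K x \<partial>\<nu>)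
        + 12 * K\<^sup>2 * (\<Sum>i\<le>n. \<bar>(\<integral>x. bump K n i x \<partial>\<mu>) - (\<integral>x. bump K n i x \<partial>\<nu>)\<bar>)"
proof -
  obtain w where w: "coupling_density \<mu> \<nu> w"
    "(\<integral>\<^sup>+z. ennreal ((dist (fst z) (snd z))\<^sup>2) \<partial>density (\<mu> \<Otimes>\<^sub>M \<nu>) w)
    \<le> ennreal (16 * K\<^sup>2 / n + 8 * (\<integral>x. excess K x \<partial>\<mu>) + 8 * (\<integral>x. excess K x \<partial>\<nu>)
        + 12 * K\<^sup>2 * (\<Sum>i\<le>n. \<bar>(\<integral>x. bump K n i x \<partial>\<mu>) - (\<integral>x. bump K n i x \<partial>\<nu>)\<bar>))"
    using bump_coupling[OF assms] by blast
  have "sigma_finite_measure \<mu>" "sigma_finite_measure \<nu>"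
    using P2_realD(1) \<mu> prob_space_imp_sigma_finite by auto
  from coupling_densityD[OF this w(1)] w(2) show ?thesis
    by (rule wasserstein2_le) (auto intro!: add_nonneg_nonneg mult_nonneg_nonneg sum_nonneg integral_nonneg_AE AE_I2 excess_nonneg)
qed

lemma excess_tendsto:
  assumes "\<mu> \<in> P2_real"
  shows "(\<lambda>k. \<integral>x. excess (real k) x \<partial>\<mu>) \<longlonglongrightarrow> 0"
proof -
  have "(\<lambda>k. \<integral>x. excess (real k) x \<partial>\<mu>) \<longlonglongrightarrow> (\<integral>x. 0 \<partial>\<mu>)"
  proof (rule integral_dominated_convergence[where w="\<lambda>x. x\<^sup>2"])
    show "AE x in \<mu>. (\<lambda>k. excess (real k) x) \<longlonglongrightarrow> 0"
    proof (rule AE_I2)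
      fix x :: real
      have "eventually (\<lambda>k. excess (real k) x = 0) sequentially"
      proof (rule eventually_mono[OF eventually_ge_at_top[of "nat \<lceil>\<bar>x\<bar>\<rceil>"]])
        fix k assume "nat \<lceil>\<bar>x\<bar>\<rceil> \<le> k"
        then have "\<bar>x\<bar> \<le> real k" by linarith
        then show "excess (real k) x = 0" by (auto simp: excess_def clip_def)
      qed
      then show "(\<lambda>k. excess (real k) x) \<longlonglongrightarrow> 0" by (rule tendsto_eventually)
    qed
  qed (use P2_realD[OF assms] excess_le excess_nonneg in \<open>auto cong: measurable_cong_sets\<close>)
  then show ?thesis by simp
qed

section \<open>The metric on square-integrable laws\<close>

text \<open>
  Two couplings that share the marginal \<open>\<mu>2\<close> are normally glued along it by disintegration. Here they are
  joined through a coupling of \<open>\<mu>2\<close> with itself of small cost that has a density \<open>w\<close>: the measure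
  \<open>w (y, y') \<pi>(dx, dy) \<rho>(dy', dz)\<close> needs no conditional laws, and the extra cost is arbitrarily small.
\<close>

lemma W2_glue:
  assumes \<mu>: "\<mu>1 \<in> P2_real" "\<mu>2 \<in> P2_real" "\<mu>3 \<in> P2_real"
    and \<pi>: "\<pi> \<in> couplings \<mu>1 \<mu>2" "\<rho> \<in> couplings \<mu>2 \<mu>3"
    and c\<pi>: "(\<integral>\<^sup>+ z. ennreal ((dist (fst z) (snd z))\<^sup>2) \<partial>\<pi>) < ennreal (A\<^sup>2)"
    and c\<rho>: "(\<integral>\<^sup>+ z. ennreal ((dist (fst z) (snd z))\<^sup>2) \<partial>\<rho>) < ennreal (B\<^sup>2)"
    and w: "coupling_density \<mu>2 \<mu>2 w"
    and cw: "(\<integral>\<^sup>+ z. ennreal ((dist (fst z) (snd z))\<^sup>2) \<partial>density (\<mu>2 \<Otimes>\<^sub>M \<mu>2) w) \<le> ennreal (e\<^sup>2)"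
    and pos: "0 < A" "0 < B" "0 < e"
  shows "W2 \<mu>1 \<mu>3 \<le> A + e + B"
proof -
  have sb: "sets \<mu>1 = sets borel" "sets \<mu>2 = sets borel" "sets \<mu>3 = sets borel"
    using \<mu> P2_realD by auto
  have ps: "prob_space \<mu>1" "prob_space \<mu>2" "prob_space \<mu>3" using \<mu> P2_realD by auto
  interpret m1: prob_space \<mu>1 by fact
  interpret m2: prob_space \<mu>2 by fact
  interpret m3: prob_space \<mu>3 by fact
  have pp: "prob_space \<pi>" "prob_space \<rho>" using \<pi> ps couplings_prob_space by auto
  interpret p: prob_space \<pi> by fact
  interpret r: prob_space \<rho> by fact
  interpret pr: pair_sigma_finite \<pi> \<rho> ..
  have [measurable_cong]: "sets \<pi> = sets (borel \<Otimes>\<^sub>M borel)" "sets \<rho> = sets (borel \<Otimes>\<^sub>M borel)"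
    using \<pi> sb by (auto simp: couplings_def cong: sets_pair_measure_cong)
  note [measurable_cong] = sb
  have wm: "w \<in> borel_measurable (\<mu>2 \<Otimes>\<^sub>M \<mu>2)" and w1: "AE x in \<mu>2. (\<integral>\<^sup>+y. w (x, y) \<partial>\<mu>2) = 1"
    and w2: "AE y in \<mu>2. (\<integral>\<^sup>+x. w (x, y) \<partial>\<mu>2) = 1"
    using w by (auto simp: coupling_density_def)
  have [measurable]: "w \<in> borel_measurable (borel \<Otimes>\<^sub>M borel)"
    using wm by (simp add: sb cong: measurable_cong_sets sets_pair_measure_cong)
  have d: "distr \<pi> \<mu>1 fst = \<mu>1" "distr \<pi> \<mu>2 snd = \<mu>2" "distr \<rho> \<mu>2 fst = \<mu>2" "distr \<rho> \<mu>3 snd = \<mu>3"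
    using \<pi> by (auto simp: couplings_def)
  define \<Gamma> where "\<Gamma> = density (\<pi> \<Otimes>\<^sub>M \<rho>) (\<lambda>(p, q). w (snd p, fst q))"
  have \<Gamma>: "(\<integral>\<^sup>+t. F t \<partial>\<Gamma>) = (\<integral>\<^sup>+p. \<integral>\<^sup>+q. w (snd p, fst q) * F (p, q) \<partial>\<rho> \<partial>\<pi>)"
    if [measurable]: "F \<in> borel_measurable (\<pi> \<Otimes>\<^sub>M \<rho>)" for F
    unfolding \<Gamma>_def
    by (subst nn_integral_density, measurable, subst r.nn_integral_fst[symmetric], auto)
  have \<Gamma>': "(\<integral>\<^sup>+t. F t \<partial>\<Gamma>) = (\<integral>\<^sup>+q. \<integral>\<^sup>+p. w (snd p, fst q) * F (p, q) \<partial>\<pi> \<partial>\<rho>)"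
    if [measurable]: "F \<in> borel_measurable (\<pi> \<Otimes>\<^sub>M \<rho>)" for F
    unfolding \<Gamma>_def
    by (subst nn_integral_density, measurable, subst pr.nn_integral_snd[symmetric], auto)
  have dR: "(\<integral>\<^sup>+q. f (fst q) \<partial>\<rho>) = (\<integral>\<^sup>+y. f y \<partial>\<mu>2)" if [measurable]: "f \<in> borel_measurable borel" for f
  proof -
    have "(\<integral>\<^sup>+y. f y \<partial>distr \<rho> \<mu>2 fst) = (\<integral>\<^sup>+q. f (fst q) \<partial>\<rho>)" by (rule nn_integral_distr) auto
    then show ?thesis unfolding d by simp
  qed
  have dL: "(\<integral>\<^sup>+p. f (snd p) \<partial>\<pi>) = (\<integral>\<^sup>+y. f y \<partial>\<mu>2)" if [measurable]: "f \<in> borel_measurable borel" for f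
  proof -
    have "(\<integral>\<^sup>+y. f y \<partial>distr \<pi> \<mu>2 snd) = (\<integral>\<^sup>+p. f (snd p) \<partial>\<pi>)" by (rule nn_integral_distr) auto
    then show ?thesis unfolding d by simp
  qed
  have i1: "(\<integral>\<^sup>+q. w (y, fst q) \<partial>\<rho>) = (\<integral>\<^sup>+y'. w (y, y') \<partial>\<mu>2)" for y
    by (rule dR) measurable
  have i2: "(\<integral>\<^sup>+p. w (snd p, y) \<partial>\<pi>) = (\<integral>\<^sup>+x. w (x, y) \<partial>\<mu>2)" for y
    by (rule dL) measurable
  have AE1: "AE p in \<pi>. (\<integral>\<^sup>+q. w (snd p, fst q) \<partial>\<rho>) = 1"
  proof -
    have "AE x in distr \<pi> \<mu>2 snd. (\<integral>\<^sup>+y. w (x, y) \<partial>\<mu>2) = 1" unfolding d by (rule w1)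
    then have "AE p in \<pi>. (\<integral>\<^sup>+y. w (snd p, y) \<partial>\<mu>2) = 1" by (subst (asm) AE_distr_iff) auto
    then show ?thesis unfolding i1 .
  qed
  have AE2: "AE q in \<rho>. (\<integral>\<^sup>+p. w (snd p, fst q) \<partial>\<pi>) = 1"
  proof -
    have "AE y in distr \<rho> \<mu>2 fst. (\<integral>\<^sup>+x. w (x, y) \<partial>\<mu>2) = 1" unfolding d by (rule w2)
    then have "AE q in \<rho>. (\<integral>\<^sup>+x. w (x, fst q) \<partial>\<mu>2) = 1" by (subst (asm) AE_distr_iff) auto
    then show ?thesis unfolding i2 .
  qed
  have F1: "(\<integral>\<^sup>+t. F (fst t) \<partial>\<Gamma>) = (\<integral>\<^sup>+p. F p \<partial>\<pi>)" if [measurable]: "F \<in> borel_measurable \<pi>" for F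
  proof -
    have "(\<integral>\<^sup>+t. F (fst t) \<partial>\<Gamma>) = (\<integral>\<^sup>+p. \<integral>\<^sup>+q. w (snd p, fst q) * F p \<partial>\<rho> \<partial>\<pi>)" by (subst \<Gamma>) auto
    also have "\<dots> = (\<integral>\<^sup>+p. (\<integral>\<^sup>+q. w (snd p, fst q) \<partial>\<rho>) * F p \<partial>\<pi>)"
      by (intro nn_integral_cong nn_integral_multc) measurable
    also have "\<dots> = (\<integral>\<^sup>+p. F p \<partial>\<pi>)" by (intro nn_integral_cong_AE) (use AE1 in auto)
    finally show ?thesis .
  qed
  have F2: "(\<integral>\<^sup>+t. F (snd t) \<partial>\<Gamma>) = (\<integral>\<^sup>+q. F q \<partial>\<rho>)" if [measurable]: "F \<in> borel_measurable \<rho>" for F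
  proof -
    have "(\<integral>\<^sup>+t. F (snd t) \<partial>\<Gamma>) = (\<integral>\<^sup>+q. \<integral>\<^sup>+p. w (snd p, fst q) * F q \<partial>\<pi> \<partial>\<rho>)" by (subst \<Gamma>') auto
    also have "\<dots> = (\<integral>\<^sup>+q. (\<integral>\<^sup>+p. w (snd p, fst q) \<partial>\<pi>) * F q \<partial>\<rho>)"
      by (intro nn_integral_cong nn_integral_multc) measurable
    also have "\<dots> = (\<integral>\<^sup>+q. F q \<partial>\<rho>)" by (intro nn_integral_cong_AE) (use AE2 in auto)
    finally show ?thesis .
  qed
  have F3: "(\<integral>\<^sup>+t. F (snd (fst t), fst (snd t)) \<partial>\<Gamma>) = (\<integral>\<^sup>+z. F z \<partial>density (\<mu>2 \<Otimes>\<^sub>M \<mu>2) w)"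
    if F[measurable]: "F \<in> borel_measurable (borel \<Otimes>\<^sub>M borel)" for F
  proof -
    have "(\<integral>\<^sup>+t. F (snd (fst t), fst (snd t)) \<partial>\<Gamma>)
        = (\<integral>\<^sup>+p. \<integral>\<^sup>+q. w (snd p, fst q) * F (snd p, fst q) \<partial>\<rho> \<partial>\<pi>)" by (subst \<Gamma>) auto
    also have "\<dots> = (\<integral>\<^sup>+p. \<integral>\<^sup>+y. w (snd p, y) * F (snd p, y) \<partial>\<mu>2 \<partial>\<pi>)"
      by (intro nn_integral_cong dR) measurable
    also have "\<dots> = (\<integral>\<^sup>+x. \<integral>\<^sup>+y. w (x, y) * F (x, y) \<partial>\<mu>2 \<partial>\<mu>2)"
      by (rule dL) measurable
    also have "\<dots> = (\<integral>\<^sup>+z. w z * F z \<partial>(\<mu>2 \<Otimes>\<^sub>M \<mu>2))"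
      by (subst m2.nn_integral_fst[symmetric]) auto
    also have "\<dots> = (\<integral>\<^sup>+z. F z \<partial>density (\<mu>2 \<Otimes>\<^sub>M \<mu>2) w)"
      by (subst nn_integral_density) auto
    finally show ?thesis .
  qed
  have [measurable_cong]: "sets \<Gamma> = sets (\<pi> \<Otimes>\<^sub>M \<rho>)" by (simp add: \<Gamma>_def)
  define \<kappa> where "\<kappa> = distr \<Gamma> (\<mu>1 \<Otimes>\<^sub>M \<mu>3) (\<lambda>t. (fst (fst t), snd (snd t)))"
  have "\<kappa> \<in> couplings \<mu>1 \<mu>3"
  proof -
    have "distr \<kappa> \<mu>1 fst = \<mu>1"
    proof (rule measure_eqI)
      fix X assume "X \<in> sets (distr \<kappa> \<mu>1 fst)"
      then have [measurable]: "X \<in> sets \<mu>1" by simp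
      have "emeasure (distr \<kappa> \<mu>1 fst) X = (\<integral>\<^sup>+x. indicator X x \<partial>distr \<kappa> \<mu>1 fst)" by simp
      also have "\<dots> = (\<integral>\<^sup>+z. indicator X (fst z) \<partial>\<kappa>)"
        by (rule nn_integral_distr) (auto simp: \<kappa>_def)
      also have "\<dots> = (\<integral>\<^sup>+t. indicator X (fst (fst t)) \<partial>\<Gamma>)"
        unfolding \<kappa>_def by (subst nn_integral_distr) auto
      also have "\<dots> = (\<integral>\<^sup>+p. indicator X (fst p) \<partial>\<pi>)" by (rule F1) measurable
      also have "\<dots> = (\<integral>\<^sup>+x. indicator X x \<partial>distr \<pi> \<mu>1 fst)" by (subst nn_integral_distr) auto
      finally show "emeasure (distr \<kappa> \<mu>1 fst) X = emeasure \<mu>1 X" unfolding d by simp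
    qed simp
    moreover have "distr \<kappa> \<mu>3 snd = \<mu>3"
    proof (rule measure_eqI)
      fix X assume "X \<in> sets (distr \<kappa> \<mu>3 snd)"
      then have [measurable]: "X \<in> sets \<mu>3" by simp
      have "emeasure (distr \<kappa> \<mu>3 snd) X = (\<integral>\<^sup>+x. indicator X x \<partial>distr \<kappa> \<mu>3 snd)" by simp
      also have "\<dots> = (\<integral>\<^sup>+z. indicator X (snd z) \<partial>\<kappa>)"
        by (rule nn_integral_distr) (auto simp: \<kappa>_def)
      also have "\<dots> = (\<integral>\<^sup>+t. indicator X (snd (snd t)) \<partial>\<Gamma>)"
        unfolding \<kappa>_def by (subst nn_integral_distr) auto
      also have "\<dots> = (\<integral>\<^sup>+q. indicator X (snd q) \<partial>\<rho>)" by (rule F2) measurable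
      also have "\<dots> = (\<integral>\<^sup>+x. indicator X x \<partial>distr \<rho> \<mu>3 snd)" by (subst nn_integral_distr) auto
      finally show "emeasure (distr \<kappa> \<mu>3 snd) X = emeasure \<mu>3 X" unfolding d by simp
    qed simp
    ultimately show ?thesis by (simp add: couplings_def \<kappa>_def)
  qed
  moreover have "(\<integral>\<^sup>+ z. ennreal ((dist (fst z) (snd z))\<^sup>2) \<partial>\<kappa>) \<le> ennreal ((A + e + B)\<^sup>2)"
  proof -
    let ?S = "A + e + B"
    let ?D = "\<lambda>z::real \<times> real. (dist (fst z) (snd z))\<^sup>2"
    have S: "0 < ?S" using pos by simp
    \<comment> \<open>the weights \<open>S/A\<close>, \<open>S/e\<close>, \<open>S/B\<close> have reciprocals of sum one\<close>
    have conv: "(a + b + c)\<^sup>2 \<le> ?S / A * a\<^sup>2 + ?S / e * b\<^sup>2 + ?S / B * c\<^sup>2" for a b c :: real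
    proof -
      have "?S / A * a\<^sup>2 + ?S / e * b\<^sup>2 + ?S / B * c\<^sup>2 - (a + b + c)\<^sup>2
          = (a * e - b * A)\<^sup>2 / (A * e) + (a * B - c * A)\<^sup>2 / (A * B) + (b * B - c * e)\<^sup>2 / (e * B)"
        using pos by (simp add: field_simps power2_eq_square)
      also have "\<dots> \<ge> 0" using pos by auto
      finally show ?thesis by simp
    qed
    have em: "ennreal (p * a\<^sup>2 + q * b\<^sup>2 + r * c\<^sup>2) = ennreal p * ennreal (a\<^sup>2) + ennreal q * ennreal (b\<^sup>2) + ennreal r * ennreal (c\<^sup>2)"
      if "0 \<le> p" "0 \<le> q" "0 \<le> r" for p q r a b c :: real
      using that by (simp add: ennreal_mult)
    have SA: "0 \<le> ?S / A" "0 \<le> ?S / e" "0 \<le> ?S / B" using pos by auto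
    have "(\<integral>\<^sup>+ z. ennreal (?D z) \<partial>\<kappa>) = (\<integral>\<^sup>+ t. ennreal (?D (fst (fst t), snd (snd t))) \<partial>\<Gamma>)"
      unfolding \<kappa>_def by (subst nn_integral_distr) auto
    also have "\<dots> \<le> (\<integral>\<^sup>+ t. ennreal (?S / A) * ennreal (?D (fst t))
        + ennreal (?S / e) * ennreal (?D (snd (fst t), fst (snd t))) + ennreal (?S / B) * ennreal (?D (snd t)) \<partial>\<Gamma>)"
    proof (rule nn_integral_mono)
      fix t :: "(real \<times> real) \<times> (real \<times> real)"
      obtain x y y' z where t: "t = ((x, y), (y', z))" by (cases t) auto
      have "?D (x, z) = ((x - y) + (y - y') + (y' - z))\<^sup>2" by (simp add: dist_real_def)
      also have "\<dots> \<le> ?S / A * ?D (x, y) + ?S / e * ?D (y, y') + ?S / B * ?D (y', z)"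
        by (rule order_trans[OF conv]) (simp add: dist_real_def)
      finally have "ennreal (?D (x, z)) \<le> ennreal (?S / A * ?D (x, y) + ?S / e * ?D (y, y') + ?S / B * ?D (y', z))"
        by (rule ennreal_leI)
      also have "\<dots> = ennreal (?S / A) * ennreal (?D (x, y)) + ennreal (?S / e) * ennreal (?D (y, y')) + ennreal (?S / B) * ennreal (?D (y', z))"
        by (rule em[OF SA])
      finally show "ennreal (?D (fst (fst t), snd (snd t))) \<le> ennreal (?S / A) * ennreal (?D (fst t))
        + ennreal (?S / e) * ennreal (?D (snd (fst t), fst (snd t))) + ennreal (?S / B) * ennreal (?D (snd t))"
        by (simp add: t)
    qed
    also have "\<dots> = ennreal (?S / A) * (\<integral>\<^sup>+t. ennreal (?D (fst t)) \<partial>\<Gamma>)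
        + ennreal (?S / e) * (\<integral>\<^sup>+t. ennreal (?D (snd (fst t), fst (snd t))) \<partial>\<Gamma>)
        + ennreal (?S / B) * (\<integral>\<^sup>+t. ennreal (?D (snd t)) \<partial>\<Gamma>)"
      by (simp add: nn_integral_add nn_integral_cmult)
    also have "\<dots> = ennreal (?S / A) * (\<integral>\<^sup>+p. ennreal (?D p) \<partial>\<pi>)
        + ennreal (?S / e) * (\<integral>\<^sup>+z. ennreal (?D z) \<partial>density (\<mu>2 \<Otimes>\<^sub>M \<mu>2) w)
        + ennreal (?S / B) * (\<integral>\<^sup>+q. ennreal (?D q) \<partial>\<rho>)"
      using F1[of "\<lambda>z. ennreal (?D z)"] F2[of "\<lambda>z. ennreal (?D z)"] F3[of "\<lambda>z. ennreal (?D z)"] by simp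
    also have "\<dots> \<le> ennreal (?S / A) * ennreal (A\<^sup>2) + ennreal (?S / e) * ennreal (e\<^sup>2) + ennreal (?S / B) * ennreal (B\<^sup>2)"
      using c\<pi> c\<rho> cw by (intro add_mono mult_left_mono) auto
    also have "\<dots> = ennreal (?S / A * A\<^sup>2 + ?S / e * e\<^sup>2 + ?S / B * B\<^sup>2)"
      by (rule em[OF SA, symmetric])
    also have "?S / A * A\<^sup>2 + ?S / e * e\<^sup>2 + ?S / B * B\<^sup>2 = ?S\<^sup>2"
    proof -
      have "s / a * a\<^sup>2 = s * a" if "0 < a" for s a :: real using that by (simp add: power2_eq_square)
      then show ?thesis using pos by (simp add: power2_eq_square distrib_left)
    qed
    finally show ?thesis .
  qed
  ultimately have "(W2 \<mu>1 \<mu>3)\<^sup>2 \<le> (A + e + B)\<^sup>2" by (rule wasserstein2_le) simp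
  then show ?thesis by (rule power2_le_imp_le) (use pos in simp)
qed

lemma W2_triangle:
  assumes \<mu>: "\<mu>1 \<in> P2_real" "\<mu>2 \<in> P2_real" "\<mu>3 \<in> P2_real"
  shows "W2 \<mu>1 \<mu>3 \<le> W2 \<mu>1 \<mu>2 + W2 \<mu>2 \<mu>3"
proof (rule field_le_epsilon)
  fix h :: real assume h: "0 < h"
  define e where "e = h / 3"
  have e: "0 < e" using h by (simp add: e_def)
  note nn = wasserstein2_nonneg[of dist]
  obtain \<pi>0 where "\<pi>0 \<in> couplings \<mu>1 \<mu>2" "(\<integral>\<^sup>+ z. ennreal ((dist (fst z) (snd z))\<^sup>2) \<partial>\<pi>0) < \<infinity>"
    using P2_finite_cost[OF \<mu>(1,2)] .
  moreover have "(W2 \<mu>1 \<mu>2)\<^sup>2 < (W2 \<mu>1 \<mu>2 + e)\<^sup>2" using nn e by (intro power_strict_mono) auto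
  ultimately obtain \<pi> where \<pi>: "\<pi> \<in> couplings \<mu>1 \<mu>2"
    "(\<integral>\<^sup>+ z. ennreal ((dist (fst z) (snd z))\<^sup>2) \<partial>\<pi>) < ennreal ((W2 \<mu>1 \<mu>2 + e)\<^sup>2)"
    using wasserstein2_coupling[of _ \<mu>1 \<mu>2 dist] by blast
  obtain \<rho>0 where "\<rho>0 \<in> couplings \<mu>2 \<mu>3" "(\<integral>\<^sup>+ z. ennreal ((dist (fst z) (snd z))\<^sup>2) \<partial>\<rho>0) < \<infinity>"
    using P2_finite_cost[OF \<mu>(2,3)] .
  moreover have "(W2 \<mu>2 \<mu>3)\<^sup>2 < (W2 \<mu>2 \<mu>3 + e)\<^sup>2" using nn e by (intro power_strict_mono) auto
  ultimately obtain \<rho> where \<rho>: "\<rho> \<in> couplings \<mu>2 \<mu>3"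
    "(\<integral>\<^sup>+ z. ennreal ((dist (fst z) (snd z))\<^sup>2) \<partial>\<rho>) < ennreal ((W2 \<mu>2 \<mu>3 + e)\<^sup>2)"
    using wasserstein2_coupling[of _ \<mu>2 \<mu>3 dist] by blast
  have "\<exists>w. coupling_density \<mu>2 \<mu>2 w \<and>
    (\<integral>\<^sup>+ z. ennreal ((dist (fst z) (snd z))\<^sup>2) \<partial>density (\<mu>2 \<Otimes>\<^sub>M \<mu>2) w) \<le> ennreal (e\<^sup>2)"
  proof -
    have "\<forall>\<^sub>F k in sequentially. (\<integral>x. excess (real k) x \<partial>\<mu>2) < e\<^sup>2 / 32"
      by (rule order_tendstoD(2)[OF excess_tendsto[OF \<mu>(2)]]) (use e in simp)
    then have "\<forall>\<^sub>F k in sequentially. (\<integral>x. excess (real k) x \<partial>\<mu>2) < e\<^sup>2 / 32 \<and> 0 < k"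
      using eventually_gt_at_top[of 0] by eventually_elim simp
    then obtain k where k: "(\<integral>x. excess (real k) x \<partial>\<mu>2) < e\<^sup>2 / 32" "0 < k"
      by (auto simp: eventually_sequentially)
    obtain n :: nat where n: "32 * (real k)\<^sup>2 / e\<^sup>2 < real n" using reals_Archimedean2 by blast
    then have n0: "0 < real n" by (rule le_less_trans[rotated]) simp
    have nk: "16 * (real k)\<^sup>2 / n \<le> e\<^sup>2 / 2" using n n0 e by (simp add: field_simps)
    from bump_coupling[OF \<mu>(2) \<mu>(2), of "real k" n] n0 k obtain w where w: "coupling_density \<mu>2 \<mu>2 w"
      "(\<integral>\<^sup>+z. ennreal ((dist (fst z) (snd z))\<^sup>2) \<partial>density (\<mu>2 \<Otimes>\<^sub>M \<mu>2) w)
        \<le> ennreal (16 * (real k)\<^sup>2 / n + 8 * (\<integral>x. excess k x \<partial>\<mu>2) + 8 * (\<integral>x. excess k x \<partial>\<mu>2))" by auto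
    have "16 * (real k)\<^sup>2 / n + 8 * (\<integral>x. excess k x \<partial>\<mu>2) + 8 * (\<integral>x. excess k x \<partial>\<mu>2) \<le> e\<^sup>2"
      using nk k by simp
    with w show ?thesis by (meson ennreal_leI order_trans)
  qed
  then obtain w where "coupling_density \<mu>2 \<mu>2 w"
    "(\<integral>\<^sup>+ z. ennreal ((dist (fst z) (snd z))\<^sup>2) \<partial>density (\<mu>2 \<Otimes>\<^sub>M \<mu>2) w) \<le> ennreal (e\<^sup>2)" by blast
  from W2_glue[OF \<mu> \<pi>(1) \<rho>(1) \<pi>(2) \<rho>(2) this] e nn[of \<mu>1 \<mu>2] nn[of \<mu>2 \<mu>3]
  show "W2 \<mu>1 \<mu>3 \<le> W2 \<mu>1 \<mu>2 + W2 \<mu>2 \<mu>3 + h" by (simp add: e_def)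
qed

lemma W2_commute: "W2 \<mu> \<nu> = W2 \<nu> \<mu>"
proof -
  have le: "(\<Sqinter>\<pi>\<in>couplings \<nu> \<mu>. \<integral>\<^sup>+ z. ennreal ((dist (fst z) (snd z))\<^sup>2) \<partial>\<pi>)
      \<le> (\<Sqinter>\<pi>\<in>couplings \<mu> \<nu>. \<integral>\<^sup>+ z. ennreal ((dist (fst z) (snd z))\<^sup>2) \<partial>\<pi>)" for \<mu> \<nu> :: "real measure"
  proof (rule INF_greatest)
    fix \<pi> assume \<pi>: "\<pi> \<in> couplings \<mu> \<nu>"
    note [measurable] = couplings_measurable[OF \<pi>]
    have m: "(\<lambda>(x, y). (y, x)) \<in> measurable \<pi> (\<nu> \<Otimes>\<^sub>M \<mu>)" unfolding case_prod_beta by measurable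
    have "(\<integral>\<^sup>+ z. ennreal ((dist (fst z) (snd z))\<^sup>2) \<partial>distr \<pi> (\<nu> \<Otimes>\<^sub>M \<mu>) (\<lambda>(x, y). (y, x)))
      \<le> (\<integral>\<^sup>+ z. ennreal ((dist (fst z) (snd z))\<^sup>2) \<partial>\<pi>)"
      unfolding nn_integral_def[of "distr \<pi> (\<nu> \<Otimes>\<^sub>M \<mu>) (\<lambda>(x, y). (y, x))"]
    proof (rule SUP_least)
      fix g assume "g \<in> {g. simple_function (distr \<pi> (\<nu> \<Otimes>\<^sub>M \<mu>) (\<lambda>(x, y). (y, x))) g \<and> g \<le> (\<lambda>z. ennreal ((dist (fst z) (snd z))\<^sup>2))}"
      then have g: "simple_function (distr \<pi> (\<nu> \<Otimes>\<^sub>M \<mu>) (\<lambda>(x, y). (y, x))) g" "\<And>z. g z \<le> ennreal ((dist (fst z) (snd z))\<^sup>2)"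
        by (auto simp: le_fun_def)
      have gm: "g \<in> borel_measurable (\<nu> \<Otimes>\<^sub>M \<mu>)" using borel_measurable_simple_function[OF g(1)] by simp
      have "integral\<^sup>S (distr \<pi> (\<nu> \<Otimes>\<^sub>M \<mu>) (\<lambda>(x, y). (y, x))) g = (\<integral>\<^sup>+z. g z \<partial>distr \<pi> (\<nu> \<Otimes>\<^sub>M \<mu>) (\<lambda>(x, y). (y, x)))"
        using nn_integral_eq_simple_integral[OF g(1)] by simp
      also have "\<dots> = (\<integral>\<^sup>+z. g (case z of (x, y) \<Rightarrow> (y, x)) \<partial>\<pi>)" by (rule nn_integral_distr[OF m]) (simp add: gm)
      also have "\<dots> \<le> (\<integral>\<^sup>+ z. ennreal ((dist (fst z) (snd z))\<^sup>2) \<partial>\<pi>)"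
        by (rule nn_integral_mono) (auto split: prod.split simp: dist_commute intro!: order_trans[OF g(2)])
      finally show "integral\<^sup>S (distr \<pi> (\<nu> \<Otimes>\<^sub>M \<mu>) (\<lambda>(x, y). (y, x))) g \<le> (\<integral>\<^sup>+ z. ennreal ((dist (fst z) (snd z))\<^sup>2) \<partial>\<pi>)" .
    qed
    then show "(\<Sqinter>\<pi>\<in>couplings \<nu> \<mu>. \<integral>\<^sup>+ z. ennreal ((dist (fst z) (snd z))\<^sup>2) \<partial>\<pi>)
      \<le> (\<integral>\<^sup>+ z. ennreal ((dist (fst z) (snd z))\<^sup>2) \<partial>\<pi>)"
      by (rule INF_lower2[OF couplings_swap[OF \<pi>]])
  qed
  show ?thesis unfolding wasserstein2_def using antisym[OF le le] by simp
qed

lemma W2_self: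
  assumes "\<mu> \<in> P2_real" shows "W2 \<mu> \<mu> = 0"
proof -
  note [measurable_cong] = P2_realD(2)[OF assms]
  let ?\<pi> = "distr \<mu> (\<mu> \<Otimes>\<^sub>M \<mu>) (\<lambda>x. (x, x))"
  have "?\<pi> \<in> couplings \<mu> \<mu>" by (auto simp: couplings_def distr_distr comp_def distr_id2)
  moreover have "(\<integral>\<^sup>+ z. ennreal ((dist (fst z) (snd z))\<^sup>2) \<partial>?\<pi>) \<le> ennreal 0"
    by (subst nn_integral_distr) auto
  ultimately have "(W2 \<mu> \<mu>)\<^sup>2 \<le> 0" by (rule wasserstein2_le) simp
  then show ?thesis by simp
qed

text \<open>
  If \<open>x \<le> a\<close> and \<open>y > b > a\<close> then \<open>(x - y)\<^sup>2 > (b - a)\<^sup>2\<close>, so at distance zero the distribution function of \<open>\<mu>\<close>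
  at \<open>a\<close> is at most that of \<open>\<nu>\<close> at every \<open>b > a\<close>, and right-continuity finishes.
\<close>

lemma W2_eq_0_imp_eq:
  assumes \<mu>: "\<mu> \<in> P2_real" "\<nu> \<in> P2_real" and 0: "W2 \<mu> \<nu> = 0"
  shows "\<mu> = \<nu>"
proof -
  have le: "cdf \<mu> a \<le> cdf \<nu> a" if \<mu>: "\<mu> \<in> P2_real" "\<nu> \<in> P2_real" and 0: "W2 \<mu> \<nu> = 0" for \<mu> \<nu> a
  proof -
    interpret A: real_distribution \<mu> using P2_realD \<mu> by blast
    interpret B: real_distribution \<nu> using P2_realD \<mu> by blast
    have *: "cdf \<mu> a \<le> cdf \<nu> b" if "a < b" for b
    proof -
      have "(\<integral>x. indicator {..a} x \<partial>\<mu>) \<le> (\<integral>x. indicator {..b} x \<partial>\<nu>) + (1 / (b - a)\<^sup>2) * (W2 \<mu> \<nu>)\<^sup>2"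
      proof (rule W2_functional_bound[OF \<mu>])
        fix x y :: real
        show "indicator {..a} x \<le> indicator {..b} y + 1 / (b - a)\<^sup>2 * (x - y)\<^sup>2"
        proof (cases "x \<le> a \<and> b < y")
          case True
          then have "(b - a)\<^sup>2 \<le> (x - y)\<^sup>2" using that by (subst abs_le_square_iff[symmetric]) auto
          then show ?thesis using True that by (simp add: field_simps)
        qed (auto simp: indicator_def)
      qed (use that in \<open>auto intro!: A.integrable_const_bound[where B=1] B.integrable_const_bound[where B=1]\<close>)
      then show ?thesis using 0 by (simp add: cdf_def)
    qed
    have "((\<lambda>b. cdf \<nu> b) \<longlongrightarrow> cdf \<nu> a) (at_right a)"
      using B.cdf_is_right_cont[of a] by (simp add: continuous_within)
    moreover have "\<forall>\<^sub>F b in at_right a. cdf \<mu> a \<le> cdf \<nu> b"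
      using * by (auto simp: eventually_at_right[OF lt_ex[of a, THEN exE, OF _]] intro: eventually_at_rightI[of a "a+1"])
    ultimately show ?thesis by (intro tendsto_lowerbound) auto
  qed
  have "cdf \<mu> = cdf \<nu>" using le[OF \<mu> 0] le[OF \<mu>(2,1)] 0 W2_commute[of \<mu> \<nu>] by (intro ext antisym) auto
  then show ?thesis using cdf_unique P2_realD(5) \<mu> by blast
qed

text \<open>
  Open sets are described through balls in a metric space only, so this fact comes before any statement on the
  Borel structure of the space of laws.
\<close>

lemma Metric_space_W2: "Metric_space P2_real W2"
proof
  show "0 \<le> W2 x y" for x y by (rule wasserstein2_nonneg)
  show "W2 x y = W2 y x" for x y by (rule W2_commute)
  show "(W2 x y = 0) = (x = y)" if "x \<in> P2_real" "y \<in> P2_real" for x y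
    using W2_self W2_eq_0_imp_eq that by blast
  show "W2 x z \<le> W2 x y + W2 y z" if "x \<in> P2_real" "y \<in> P2_real" "z \<in> P2_real" for x y z
    using that by (rule W2_triangle)
qed

section \<open>Averages over independent samples\<close>

text \<open>
  The expectation of \<open>f\<close> over a list of \<open>n\<close> independent samples with weights \<open>w\<close>. It serves both for
  replicas drawn from a Gibbs measure and for the cells hit by samples of a law on the line. Lists make the number
  of samples a parameter on which one can induct.
\<close>

definition iid_avg :: "'a set \<Rightarrow> ('a \<Rightarrow> real) \<Rightarrow> nat \<Rightarrow> ('a list \<Rightarrow> real) \<Rightarrow> real" where
  "iid_avg X w n f = (\<Sum>l | set l \<subseteq> X \<and> length l = n. prod_list (map w l) * f l)"

lemma iid_avg_0 [simp]: "iid_avg X w 0 f = f []"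
proof -
  have "{l. set l \<subseteq> X \<and> length l = 0} = {[]}" by auto
  then show ?thesis by (simp add: iid_avg_def)
qed

lemma iid_avg_Suc:
  assumes "finite X"
  shows "iid_avg X w (Suc n) f = (\<Sum>x\<in>X. w x * iid_avg X w n (\<lambda>l. f (x # l)))"
proof -
  let ?L = "{l. set l \<subseteq> X \<and> length l = n}"
  have "iid_avg X w (Suc n) f = (\<Sum>(l, x)\<in>?L \<times> X. prod_list (map w (x # l)) * f (x # l))"
    unfolding iid_avg_def lists_length_Suc_eq
    by (subst sum.reindex) (auto simp: inj_on_def case_prod_beta comp_def)
  also have "\<dots> = (\<Sum>l\<in>?L. \<Sum>x\<in>X. prod_list (map w (x # l)) * f (x # l))"
    by (rule sum.cartesian_product[symmetric])
  also have "\<dots> = (\<Sum>x\<in>X. \<Sum>l\<in>?L. prod_list (map w (x # l)) * f (x # l))"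
    by (rule sum.swap)
  finally show ?thesis by (simp add: iid_avg_def sum_distrib_left mult.assoc)
qed

lemma iid_avg_cong:
  assumes "\<And>l. set l \<subseteq> X \<Longrightarrow> length l = n \<Longrightarrow> f l = g l"
  shows "iid_avg X w n f = iid_avg X w n g"
  unfolding iid_avg_def using assms by (intro sum.cong) auto

lemma iid_avg_cong_weight:
  assumes "\<And>x. x \<in> X \<Longrightarrow> w x = w' x"
  shows "iid_avg X w n f = iid_avg X w' n f"
  unfolding iid_avg_def
proof (intro sum.cong refl)
  fix l assume "l \<in> {l. set l \<subseteq> X \<and> length l = n}"
  then have "map w l = map w' l" using assms by auto
  then show "prod_list (map w l) * f l = prod_list (map w' l) * f l" by (simp only:)
qed

lemma iid_avg_cmult: "iid_avg X w n (\<lambda>l. c * f l) = c * iid_avg X w n f"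
  by (simp add: iid_avg_def sum_distrib_left mult_ac)

lemma iid_avg_add: "iid_avg X w n (\<lambda>l. f l + g l) = iid_avg X w n f + iid_avg X w n g"
  by (simp add: iid_avg_def sum.distrib distrib_left)

lemma iid_avg_sum: "iid_avg X w n (\<lambda>l. \<Sum>i\<in>I. f i l) = (\<Sum>i\<in>I. iid_avg X w n (f i))"
  unfolding iid_avg_def sum_distrib_left by (rule sum.swap)

lemma prod_list_map_nonneg:
  assumes "\<And>x. x \<in> X \<Longrightarrow> 0 \<le> (w x :: real)" "set l \<subseteq> X"
  shows "0 \<le> prod_list (map w l)"
  using assms(2) by (induction l) (auto simp: assms(1))

lemma iid_avg_mono:
  assumes "\<And>x. x \<in> X \<Longrightarrow> 0 \<le> w x" "\<And>l. set l \<subseteq> X \<Longrightarrow> length l = n \<Longrightarrow> f l \<le> g l"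
  shows "iid_avg X w n f \<le> iid_avg X w n g"
  unfolding iid_avg_def
  by (intro sum_mono mult_left_mono) (use assms in \<open>auto intro: prod_list_map_nonneg\<close>)

lemma iid_avg_const:
  assumes "finite X" "(\<Sum>x\<in>X. w x) = 1"
  shows "iid_avg X w n (\<lambda>_. c) = c"
  by (induction n) (auto simp: iid_avg_Suc[OF assms(1)] sum_distrib_right[symmetric] assms(2))

lemma iid_avg_abs_le:
  assumes "\<And>x. x \<in> X \<Longrightarrow> 0 \<le> w x"
  shows "\<bar>iid_avg X w n f\<bar> \<le> iid_avg X w n (\<lambda>l. \<bar>f l\<bar>)"
  unfolding iid_avg_def
  by (rule order_trans[OF sum_abs], rule sum_mono)
    (auto simp: abs_mult intro!: mult_right_mono abs_of_nonneg[THEN eq_refl] prod_list_map_nonneg[of X w] assms)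

lemma iid_avg_abs_bound:
  assumes "finite X" "\<And>x. x \<in> X \<Longrightarrow> 0 \<le> w x" "(\<Sum>x\<in>X. w x) = 1"
    and "\<And>l. set l \<subseteq> X \<Longrightarrow> length l = n \<Longrightarrow> \<bar>f l\<bar> \<le> c"
  shows "\<bar>iid_avg X w n f\<bar> \<le> c"
proof -
  have "\<bar>iid_avg X w n f\<bar> \<le> iid_avg X w n (\<lambda>l. \<bar>f l\<bar>)" by (rule iid_avg_abs_le) fact
  also have "\<dots> \<le> iid_avg X w n (\<lambda>_. c)" by (rule iid_avg_mono) fact+
  also have "\<dots> = c" by (rule iid_avg_const) fact+
  finally show ?thesis .
qed

lemma iid_avg_append:
  assumes "finite X"
  shows "iid_avg X w (n + j) f = iid_avg X w n (\<lambda>l. iid_avg X w j (\<lambda>r. f (l @ r)))"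
  by (induction n arbitrary: f) (auto simp: iid_avg_Suc[OF assms])

lemma iid_avg_prod:
  assumes "finite X"
  shows "iid_avg X w n (\<lambda>l. \<Prod>a<n. g a (l ! a)) = (\<Prod>a<n. \<Sum>x\<in>X. w x * g a x)"
proof (induction n arbitrary: g)
  case (Suc n)
  have split: "(\<Prod>a<Suc n. g a ((x # l) ! a)) = g 0 x * (\<Prod>a<n. g (Suc a) (l ! a))" for x l
    by (simp only: prod.lessThan_Suc_shift) simp
  have "iid_avg X w (Suc n) (\<lambda>l. \<Prod>a<Suc n. g a (l ! a))
      = (\<Sum>x\<in>X. w x * g 0 x * (\<Prod>a<n. \<Sum>x\<in>X. w x * g (Suc a) x))"
    by (simp only: iid_avg_Suc[OF assms] split iid_avg_cmult Suc.IH[of "\<lambda>a. g (Suc a)"] mult.assoc)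
  then show ?case by (simp only: prod.lessThan_Suc_shift) (simp add: sum_distrib_right)
qed simp

text \<open>
  A change of measure in each sample is a product weight on the whole list.
\<close>

lemma iid_avg_tilt:
  "iid_avg X (\<lambda>x. c * w x * u x) n f = c ^ n * iid_avg X w n (\<lambda>l. prod_list (map u l) * f l)"
proof -
  have "prod_list (map (\<lambda>x. c * w x * u x) l) = c ^ length l * prod_list (map w l) * prod_list (map u l)" for l
    by (induction l) auto
  then show ?thesis unfolding iid_avg_def by (simp add: sum_distrib_left mult_ac)
qed

lemma iid_avg_sum_list:
  assumes "finite X" "(\<Sum>x\<in>X. w x) = 1" "(\<Sum>x\<in>X. w x * v x) = 0"
  shows "iid_avg X w m (\<lambda>l. sum_list (map v l)) = 0"
proof (induction m)
  case (Suc m)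
  have "iid_avg X w (Suc m) (\<lambda>l. sum_list (map v l)) = (\<Sum>x\<in>X. w x * (v x + 0))"
    by (simp add: iid_avg_Suc assms iid_avg_add iid_avg_const Suc.IH)
  then show ?case using assms by simp
qed simp

lemma iid_avg_variance:
  assumes "finite X" "(\<Sum>x\<in>X. w x) = 1" "(\<Sum>x\<in>X. w x * v x) = 0"
  shows "iid_avg X w m (\<lambda>l. (sum_list (map v l))\<^sup>2) = real m * (\<Sum>x\<in>X. w x * (v x)\<^sup>2)"
proof (induction m)
  case (Suc m)
  have "(sum_list (map v (x # l)))\<^sup>2 = (v x)\<^sup>2 + (2 * v x * sum_list (map v l) + (sum_list (map v l))\<^sup>2)" for x l
    by (simp add: power2_eq_square algebra_simps)
  then have "iid_avg X w (Suc m) (\<lambda>l. (sum_list (map v l))\<^sup>2)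
      = (\<Sum>x\<in>X. w x * ((v x)\<^sup>2 + real m * (\<Sum>x\<in>X. w x * (v x)\<^sup>2)))"
    by (simp only: iid_avg_Suc[OF assms(1)] iid_avg_add iid_avg_cmult iid_avg_const[OF assms(1,2)]
        iid_avg_sum_list[OF assms] Suc.IH) simp
  then show ?case using assms
    by (simp add: distrib_left sum.distrib sum_distrib_right[symmetric] distrib_right)
qed simp

section \<open>Measurable functionals of a random law\<close>

lemma P2_mopen_iff:
  "Metric_space.mopen P2_real W2 U \<longleftrightarrow> U \<subseteq> P2_real \<and> (\<forall>\<mu>\<in>U. \<exists>r>0. \<forall>\<nu>\<in>P2_real. W2 \<mu> \<nu> < r \<longrightarrow> \<nu> \<in> U)"
  unfolding Metric_space.mopen_def[OF Metric_space_W2] Metric_space.mball_def[OF Metric_space_W2] by blast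

lemma space_P2_borel: "space P2_borel = P2_real"
  unfolding P2_borel_def by (rule space_measure_of) (auto simp: P2_mopen_iff)

lemma sets_P2_borel: "sets P2_borel = sigma_sets P2_real {U. Metric_space.mopen P2_real W2 U}"
  unfolding P2_borel_def by (rule sets_measure_of) (auto simp: P2_mopen_iff)

lemma P2_borel_measurableI:
  assumes "\<And>\<mu> e. \<mu> \<in> P2_real \<Longrightarrow> 0 < e \<Longrightarrow> \<exists>r>0. \<forall>\<nu>\<in>P2_real. W2 \<mu> \<nu> < r \<longrightarrow> \<bar>F \<nu> - F \<mu>\<bar> < (e::real)"
  shows "F \<in> borel_measurable P2_borel"
  unfolding borel_measurable_iff_greater
proof
  fix a
  have "Metric_space.mopen P2_real W2 {\<mu> \<in> P2_real. a < F \<mu>}"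
    unfolding P2_mopen_iff
  proof safe
    fix \<mu> assume \<mu>: "\<mu> \<in> P2_real" "a < F \<mu>"
    obtain r where r: "r > 0" "\<forall>\<nu>\<in>P2_real. W2 \<mu> \<nu> < r \<longrightarrow> \<bar>F \<nu> - F \<mu>\<bar> < F \<mu> - a"
      using assms[OF \<mu>(1), of "F \<mu> - a"] \<mu>(2) by auto
    then have "\<forall>\<nu>\<in>P2_real. W2 \<mu> \<nu> < r \<longrightarrow> a < F \<nu>" by fastforce
    then show "\<exists>r>0. \<forall>\<nu>\<in>P2_real. W2 \<mu> \<nu> < r \<longrightarrow> \<nu> \<in> {\<mu> \<in> P2_real. a < F \<mu>}"
      using r(1) by auto
  qed
  then show "{\<mu> \<in> space P2_borel. a < F \<mu>} \<in> sets P2_borel"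
    unfolding space_P2_borel sets_P2_borel by (intro sigma_sets.Basic) simp
qed

text \<open>
  The oscillation condition makes \<open>\<mu> \<mapsto> \<integral>f d\<mu>\<close> continuous for the transport distance. It holds for Lipschitz
  functions and for functions of quadratic growth such as the excess.
\<close>

lemma P2_integral_measurable:
  assumes f[measurable]: "f \<in> borel_measurable borel"
    and osc: "\<And>e. 0 < e \<Longrightarrow> \<exists>C>0. \<forall>x y. \<bar>f x - f y\<bar> \<le> e * (1 + y\<^sup>2) + C * (x - y)\<^sup>2"
  shows "(\<lambda>\<mu>. \<integral>x. f x \<partial>\<mu>) \<in> borel_measurable P2_borel"
    and "\<mu> \<in> P2_real \<Longrightarrow> integrable \<mu> f"
proof -
  show int: "integrable \<mu> f" if \<mu>: "\<mu> \<in> P2_real" for \<mu>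
  proof -
    obtain C where C: "C > 0" "\<And>x y. \<bar>f x - f y\<bar> \<le> 1 * (1 + y\<^sup>2) + C * (x - y)\<^sup>2"
      using osc[of 1] by auto
    have "\<bar>f x\<bar> \<le> (\<bar>f 0\<bar> + 1) + C * x\<^sup>2" for x using C(2)[of x 0] by simp
    then show ?thesis by (rule P2_integrable[OF \<mu> f])
  qed
  show "(\<lambda>\<mu>. \<integral>x. f x \<partial>\<mu>) \<in> borel_measurable P2_borel"
  proof (rule P2_borel_measurableI)
    fix \<mu> and e :: real assume \<mu>: "\<mu> \<in> P2_real" and e: "0 < e"
    interpret prob_space \<mu> by (rule P2_realD[OF \<mu>])
    note i2 = P2_realD(4)[OF \<mu>]
    define S where "S = 1 + (\<integral>x. x\<^sup>2 \<partial>\<mu>)"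
    have S: "1 \<le> S" by (simp add: S_def)
    define h where "h = e / (2 * S)"
    have h: "0 < h" "h * S = e / 2" using e S by (auto simp: h_def)
    obtain C where C: "C > 0" "\<And>x y. \<bar>f x - f y\<bar> \<le> h * (1 + y\<^sup>2) + C * (x - y)\<^sup>2"
      using osc[OF h(1)] by auto
    define r where "r = sqrt (e / (2 * C))"
    have r: "0 < r" "C * r\<^sup>2 = e / 2" using e C(1) by (auto simp: r_def)
    have ih: "(\<integral>x. h * (1 + x\<^sup>2) \<partial>\<mu>) = e / 2" "integrable \<mu> (\<lambda>x. h * (1 + x\<^sup>2))"
      using h i2 by (auto simp: S_def prob_space)
    have ifh: "integrable \<mu> (\<lambda>x. f x + h * (1 + x\<^sup>2))" "integrable \<mu> (\<lambda>x. f x - h * (1 + x\<^sup>2))"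
      by (rule Bochner_Integration.integrable_add[OF int[OF \<mu>] ih(2)] Bochner_Integration.integrable_diff[OF int[OF \<mu>] ih(2)])+
    have Ifh: "(\<integral>x. f x + h * (1 + x\<^sup>2) \<partial>\<mu>) = (\<integral>x. f x \<partial>\<mu>) + e / 2"
      "(\<integral>x. f x - h * (1 + x\<^sup>2) \<partial>\<mu>) = (\<integral>x. f x \<partial>\<mu>) - e / 2"
      using Bochner_Integration.integral_add[OF int[OF \<mu>] ih(2)] Bochner_Integration.integral_diff[OF int[OF \<mu>] ih(2)]
      unfolding ih(1) by auto
    show "\<exists>r>0. \<forall>\<nu>\<in>P2_real. W2 \<mu> \<nu> < r \<longrightarrow> \<bar>(\<integral>x. f x \<partial>\<nu>) - (\<integral>x. f x \<partial>\<mu>)\<bar> < e"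
    proof (intro exI conjI ballI impI)
      fix \<nu> assume \<nu>: "\<nu> \<in> P2_real" and W: "W2 \<mu> \<nu> < r"
      have W': "C * (W2 \<mu> \<nu>)\<^sup>2 < e / 2"
        using r(2) mult_strict_left_mono[OF power_strict_mono[OF W wasserstein2_nonneg, of 2] C(1)] by simp
      have "(\<integral>x. f x \<partial>\<nu>) \<le> (\<integral>x. f x + h * (1 + x\<^sup>2) \<partial>\<mu>) + C * (W2 \<nu> \<mu>)\<^sup>2"
      proof (rule W2_functional_bound[OF \<nu> \<mu> int[OF \<nu>] ifh(1) C(1)])
        show "f x \<le> f y + h * (1 + y\<^sup>2) + C * (x - y)\<^sup>2" for x y
          using C(2)[of x y] by linarith
      qed
      moreover have "(\<integral>x. f x - h * (1 + x\<^sup>2) \<partial>\<mu>) \<le> (\<integral>x. f x \<partial>\<nu>) + C * (W2 \<mu> \<nu>)\<^sup>2"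
      proof (rule W2_functional_bound[OF \<mu> \<nu> ifh(2) int[OF \<nu>] C(1)])
        show "f x - h * (1 + x\<^sup>2) \<le> f y + C * (x - y)\<^sup>2" for x y
          using C(2)[of y x] by (simp add: power2_commute[of x y])
      qed
      ultimately show "\<bar>(\<integral>x. f x \<partial>\<nu>) - (\<integral>x. f x \<partial>\<mu>)\<bar> < e"
        using W' unfolding Ifh W2_commute[of \<nu> \<mu>] by linarith
    qed (rule r)
  qed
qed

lemma abs_le_am_gm: "0 < e \<Longrightarrow> L * \<bar>t\<bar> \<le> e + L\<^sup>2 / e * t\<^sup>2" for e L t :: real
proof -
  assume e: "0 < e"
  have "e * (L * \<bar>t\<bar>) \<le> e\<^sup>2 + (L * \<bar>t\<bar>)\<^sup>2"
    using zero_le_power2[of "e - L * \<bar>t\<bar>"] zero_le_power2[of e] zero_le_power2[of "L * \<bar>t\<bar>"]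
    unfolding power2_diff by linarith
  then have "L * \<bar>t\<bar> \<le> (e\<^sup>2 + (L * \<bar>t\<bar>)\<^sup>2) / e" using e by (simp add: field_simps)
  also have "\<dots> = e + L\<^sup>2 / e * t\<^sup>2" using e by (simp add: add_divide_distrib power_mult_distrib power2_eq_square)
  finally show ?thesis .
qed

lemma lipschitz_osc:
  assumes "\<And>x y. \<bar>f x - f y\<bar> \<le> L * \<bar>x - y\<bar>" "0 < e"
  shows "\<exists>C>0. \<forall>x y::real. \<bar>f x - f y\<bar> \<le> (e::real) * (1 + y\<^sup>2) + C * (x - y)\<^sup>2"
proof (intro exI conjI allI)
  show "0 < L\<^sup>2 / e + 1" using assms(2) by (simp add: add_nonneg_pos)
  fix x y
  have "\<bar>f x - f y\<bar> \<le> e + L\<^sup>2 / e * (x - y)\<^sup>2"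
    using assms(1)[of x y] abs_le_am_gm[OF assms(2), of L "x - y"] by linarith
  also have "\<dots> \<le> e * (1 + y\<^sup>2) + (L\<^sup>2 / e + 1) * (x - y)\<^sup>2"
    using assms(2) by (simp add: distrib_left distrib_right)
  finally show "\<bar>f x - f y\<bar> \<le> e * (1 + y\<^sup>2) + (L\<^sup>2 / e + 1) * (x - y)\<^sup>2" .
qed

lemma excess_osc:
  assumes K: "0 \<le> K" and e: "0 < e"
  shows "\<exists>C>0. \<forall>x y::real. \<bar>excess K x - excess K y\<bar> \<le> (e::real) * (1 + y\<^sup>2) + C * (x - y)\<^sup>2"
proof (intro exI conjI allI)
  show "0 < 1 + 4 / e" using e by (simp add: add_pos_pos)
  fix x y :: real
  let ?p = "x - clip K x" and ?q = "y - clip K y"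
  have pq: "\<bar>?p - ?q\<bar> \<le> \<bar>x - y\<bar>" by (auto simp: clip_def max_def min_def)
  have q: "\<bar>?q\<bar> \<le> \<bar>y\<bar>" using K by (auto simp: clip_def max_def min_def)
  have "\<bar>excess K x - excess K y\<bar> = \<bar>(?p - ?q) * (?p - ?q) + 2 * ?q * (?p - ?q)\<bar>"
    by (simp add: excess_def power2_eq_square algebra_simps)
  also have "\<dots> \<le> \<bar>?p - ?q\<bar> * \<bar>?p - ?q\<bar> + 2 * \<bar>?q\<bar> * \<bar>?p - ?q\<bar>"
    using abs_triangle_ineq[of "(?p - ?q) * (?p - ?q)" "2 * ?q * (?p - ?q)"] by (simp only: abs_mult) simp
  also have "\<dots> \<le> \<bar>x - y\<bar> * \<bar>x - y\<bar> + 2 * \<bar>y\<bar> * \<bar>x - y\<bar>"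
    using pq q by (intro add_mono mult_mono) auto
  also have "2 * \<bar>y\<bar> * \<bar>x - y\<bar> \<le> e * y\<^sup>2 + 4 / e * (x - y)\<^sup>2"
  proof -
    have "2 * \<bar>y\<bar> * \<bar>x - y\<bar> = (2 * \<bar>x - y\<bar>) * \<bar>y\<bar>" by simp
    also have "\<dots> \<le> (e * \<bar>y\<bar>) * \<bar>y\<bar> + 4 / e * (x - y)\<^sup>2"
    proof (cases "e * \<bar>y\<bar> \<ge> 2 * \<bar>x - y\<bar>")
      case True
      then have "(2 * \<bar>x - y\<bar>) * \<bar>y\<bar> \<le> (e * \<bar>y\<bar>) * \<bar>y\<bar>" by (rule mult_right_mono) simp
      then show ?thesis using e by (simp add: add_increasing2)
    next
      case False
      then have "\<bar>y\<bar> \<le> 2 * \<bar>x - y\<bar> / e" using e by (simp add: field_simps)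
      then have "(2 * \<bar>x - y\<bar>) * \<bar>y\<bar> \<le> (2 * \<bar>x - y\<bar>) * (2 * \<bar>x - y\<bar> / e)" by (rule mult_left_mono) simp
      also have "\<dots> = 4 / e * (x - y)\<^sup>2" by (simp add: power2_eq_square)
      finally show ?thesis using e by (simp add: add_increasing)
    qed
    finally show ?thesis by (simp add: power2_eq_square)
  qed
  finally show "\<bar>excess K x - excess K y\<bar> \<le> e * (1 + y\<^sup>2) + (1 + 4 / e) * (x - y)\<^sup>2"
    using e by (simp add: distrib_left distrib_right power2_eq_square)
qed

lemma excess_0: "excess 0 = (\<lambda>x. x\<^sup>2)" by (auto simp: excess_def clip_def)

lemma P2_excess_measurable: "0 \<le> K \<Longrightarrow> (\<lambda>\<mu>. \<integral>x. excess K x \<partial>\<mu>) \<in> borel_measurable P2_borel"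
  by (rule P2_integral_measurable) (auto intro: excess_osc)

lemma P2_second_moment_measurable: "(\<lambda>\<mu>. \<integral>x. x\<^sup>2 \<partial>\<mu>) \<in> borel_measurable P2_borel"
  using P2_excess_measurable[of 0] by (simp add: excess_0)

lemma P2_excess_integrable: "\<mu> \<in> P2_real \<Longrightarrow> 0 \<le> K \<Longrightarrow> integrable \<mu> (excess K)"
  by (rule P2_integral_measurable(2)) (auto intro: excess_osc)

lemma Bernstein_lipschitz:
  assumes "0 \<le> u" "u \<le> 1" "0 \<le> v" "v \<le> 1" "i \<le> n"
  shows "\<bar>Bernstein n i u - Bernstein n i v\<bar> \<le> real (n choose i) * real n * \<bar>u - v\<bar>"
proof -
  have pw: "\<bar>x ^ k - y ^ k\<bar> \<le> real k * \<bar>x - y\<bar>" if "0 \<le> x" "x \<le> 1" "0 \<le> y" "y \<le> 1" for x y :: real and k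
    using norm_power_diff[of x y k] that by simp
  have "\<bar>u ^ i * (1 - u) ^ (n - i) - v ^ i * (1 - v) ^ (n - i)\<bar>
      = \<bar>(u ^ i - v ^ i) * (1 - u) ^ (n - i) + v ^ i * ((1 - u) ^ (n - i) - (1 - v) ^ (n - i))\<bar>"
    by (simp add: algebra_simps)
  also have "\<dots> \<le> \<bar>u ^ i - v ^ i\<bar> * 1 + 1 * \<bar>(1 - u) ^ (n - i) - (1 - v) ^ (n - i)\<bar>"
    using assms by (intro order_trans[OF abs_triangle_ineq] add_mono)
      (auto simp: abs_mult intro!: mult_mono mult_left_le mult_left_le_one_le power_le_one)
  also have "\<dots> \<le> real i * \<bar>u - v\<bar> + real (n - i) * \<bar>(1 - u) - (1 - v)\<bar>"
    using pw[of u v i] pw[of "1 - u" "1 - v" "n - i"] assms by simp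
  also have "\<dots> = real n * \<bar>u - v\<bar>"
  proof -
    have "\<bar>(1 - u) - (1 - v)\<bar> = \<bar>u - v\<bar>" by simp
    then show ?thesis using assms(5) by (simp only: distrib_right[symmetric] of_nat_add[symmetric] le_add_diff_inverse)
  qed
  finally have "real (n choose i) * \<bar>u ^ i * (1 - u) ^ (n - i) - v ^ i * (1 - v) ^ (n - i)\<bar> \<le> real (n choose i) * (real n * \<bar>u - v\<bar>)"
    by (rule mult_left_mono) simp
  moreover have "Bernstein n i u - Bernstein n i v = real (n choose i) * (u ^ i * (1 - u) ^ (n - i) - v ^ i * (1 - v) ^ (n - i))"
    by (simp add: Bernstein_def right_diff_distrib mult.assoc)
  ultimately show ?thesis by (simp only: abs_mult abs_of_nat mult.assoc)
qed

lemma bump_lipschitz: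
  assumes K: "0 < K" and "i \<le> n"
  shows "\<exists>L. \<forall>x y. \<bar>bump K n i x - bump K n i y\<bar> \<le> L * \<bar>x - y\<bar>"
proof (intro exI allI)
  fix x y
  have "\<bar>bump K n i x - bump K n i y\<bar> \<le> real (n choose i) * real n * \<bar>(clip K x + K) / (2 * K) - (clip K y + K) / (2 * K)\<bar>"
    unfolding bump_def using bump_arg[OF K] assms(2) by (intro Bernstein_lipschitz) auto
  also have "\<bar>(clip K x + K) / (2 * K) - (clip K y + K) / (2 * K)\<bar> \<le> \<bar>x - y\<bar> / (2 * K)"
    using K clip_lipschitz[of K x y] by (simp add: diff_divide_distrib[symmetric] divide_right_mono)
  finally show "\<bar>bump K n i x - bump K n i y\<bar> \<le> real (n choose i) * real n / (2 * K) * \<bar>x - y\<bar>"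
    by (simp add: mult_left_mono)
qed

section \<open>An upper bound for the iterated distance\<close>

text \<open>
  Compared with membership in \<open>P2_P2_real\<close>, the second moment is expressed by a measurable functional, so that
  ordinary integrals apply.
\<close>

definition P2_law :: "real measure measure \<Rightarrow> bool" where
  "P2_law \<zeta> \<longleftrightarrow> prob_space \<zeta> \<and> sets \<zeta> = sets P2_borel \<and> integrable \<zeta> (\<lambda>\<mu>. \<integral>x. x\<^sup>2 \<partial>\<mu>)"

lemma P2_lawD:
  assumes "P2_law \<zeta>"
  shows "prob_space \<zeta>" "sets \<zeta> = sets P2_borel" "space \<zeta> = P2_real" "integrable \<zeta> (\<lambda>\<mu>. \<integral>x. x\<^sup>2 \<partial>\<mu>)"
    "borel_measurable \<zeta> = (borel_measurable P2_borel :: (real measure \<Rightarrow> real) set)"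
  using assms sets_eq_imp_space_eq[of \<zeta> P2_borel] measurable_cong_sets[of \<zeta> P2_borel borel borel]
  by (auto simp: P2_law_def space_P2_borel)

lemma excess_integral_nonneg: "0 \<le> (\<integral>x. excess K x \<partial>\<mu>)"
  using excess_nonneg by (simp add: integral_nonneg_AE)

lemma P2_law_integrable_excess:
  assumes \<zeta>: "P2_law \<zeta>" and K: "0 \<le> K"
  shows "integrable \<zeta> (\<lambda>\<mu>. \<integral>x. excess K x \<partial>\<mu>)"
proof (rule Bochner_Integration.integrable_bound[OF P2_lawD(4)[OF \<zeta>]])
  show "(\<lambda>\<mu>. \<integral>x. excess K x \<partial>\<mu>) \<in> borel_measurable \<zeta>"
    unfolding P2_lawD(5)[OF \<zeta>] by (rule P2_excess_measurable[OF K])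
  show "AE \<mu> in \<zeta>. norm (\<integral>x. excess K x \<partial>\<mu>) \<le> norm (\<integral>x. x\<^sup>2 \<partial>\<mu>)"
  proof (rule AE_I2)
    fix \<mu> assume "\<mu> \<in> space \<zeta>"
    then have \<mu>: "\<mu> \<in> P2_real" using P2_lawD[OF \<zeta>] by simp
    have "(\<integral>x. excess K x \<partial>\<mu>) \<le> (\<integral>x. x\<^sup>2 \<partial>\<mu>)"
      by (rule integral_mono[OF P2_excess_integrable[OF \<mu> K] P2_realD(4)[OF \<mu>] excess_le[OF K]])
    then show "norm (\<integral>x. excess K x \<partial>\<mu>) \<le> norm (\<integral>x. x\<^sup>2 \<partial>\<mu>)"
      using excess_integral_nonneg[of \<mu> K] by simp
  qed
qed

lemma P2_bump:
  assumes "0 < K" "i \<le> n"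
  shows "(\<lambda>\<mu>. \<integral>x. bump K n i x \<partial>\<mu>) \<in> borel_measurable P2_borel"
    and "\<mu> \<in> P2_real \<Longrightarrow> integrable \<mu> (bump K n i)"
    and "\<mu> \<in> P2_real \<Longrightarrow> 0 \<le> (\<integral>x. bump K n i x \<partial>\<mu>)"
    and "\<mu> \<in> P2_real \<Longrightarrow> (\<integral>x. bump K n i x \<partial>\<mu>) \<le> 1"
proof -
  obtain L where L: "\<And>x y. \<bar>bump K n i x - bump K n i y\<bar> \<le> L * \<bar>x - y\<bar>" using bump_lipschitz[OF assms] by auto
  show "(\<lambda>\<mu>. \<integral>x. bump K n i x \<partial>\<mu>) \<in> borel_measurable P2_borel"
    by (rule P2_integral_measurable(1)) (auto intro: lipschitz_osc[OF L])
  show int: "integrable \<mu> (bump K n i)" if "\<mu> \<in> P2_real"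
    using that by (rule P2_integral_measurable(2)[rotated 2]) (auto intro: lipschitz_osc[OF L])
  show "0 \<le> (\<integral>x. bump K n i x \<partial>\<mu>)" using bump_nonneg[OF assms(1)] by (simp add: integral_nonneg_AE)
  show "(\<integral>x. bump K n i x \<partial>\<mu>) \<le> 1" if \<mu>: "\<mu> \<in> P2_real"
  proof -
    interpret prob_space \<mu> by (rule P2_realD[OF \<mu>])
    show ?thesis using integral_mono[OF int[OF \<mu>], of "\<lambda>_. 1"] bump_le1[OF assms] by (simp add: prob_space)
  qed
qed

lemma P2_bump_sum:
  assumes \<mu>: "\<mu> \<in> P2_real" and "0 < K"
  shows "(\<Sum>i\<le>n. \<integral>x. bump K n i x \<partial>\<mu>) = 1"
proof -
  interpret prob_space \<mu> by (rule P2_realD[OF \<mu>])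
  have "(\<Sum>i\<le>n. \<integral>x. bump K n i x \<partial>\<mu>) = (\<integral>x. (\<Sum>i\<le>n. bump K n i x) \<partial>\<mu>)"
    using P2_bump(2)[OF assms(2)] \<mu> by (intro Bochner_Integration.integral_sum[symmetric]) auto
  then show ?thesis by (simp add: bump_sum prob_space)
qed

lemma P2_law_finite_cost:
  assumes \<zeta>: "P2_law \<zeta>" "P2_law \<zeta>'"
  shows "\<exists>\<pi>\<in>couplings \<zeta> \<zeta>'. (\<integral>\<^sup>+ z. ennreal ((W2 (fst z) (snd z))\<^sup>2) \<partial>\<pi>) < \<infinity>"
proof -
  note z = P2_lawD[OF \<zeta>(1)] and z' = P2_lawD[OF \<zeta>(2)]
  let ?D = "\<lambda>\<mu>. 4 * (\<integral>x. x\<^sup>2 \<partial>\<mu>)"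
  have c: "(W2 \<mu> \<nu>)\<^sup>2 \<le> ?D \<mu> + ?D \<nu>" if "\<mu> \<in> space \<zeta>" "\<nu> \<in> space \<zeta>" for \<mu> \<nu>
    using W2_sq_le_moments that z by simp
  have [measurable]: "(\<lambda>\<mu>. \<integral>x. x\<^sup>2 \<partial>\<mu>) \<in> borel_measurable \<zeta>" using z(4) by simp
  have "\<exists>w. coupling_density \<zeta> \<zeta>' w \<and>
    (\<integral>\<^sup>+z. ennreal ((W2 (fst z) (snd z))\<^sup>2) \<partial>density (\<zeta> \<Otimes>\<^sub>M \<zeta>') w)
      \<le> ennreal (2 * (\<integral>x. ?D x \<partial>\<zeta>) + 2 * (\<integral>x. ?D x \<partial>\<zeta>') + 0 * (\<Sum>i\<in>{()}. \<bar>(\<integral>x. 1 \<partial>\<zeta>) - (\<integral>x. 1 \<partial>\<zeta>')\<bar>))"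
    by (rule partition_coupling[where d="\<lambda>_. ?D" and c="\<lambda>x y. (W2 x y)\<^sup>2" and I="{()}" and \<psi>="\<lambda>_ _. 1" and D="?D"])
      (use z z' c in simp_all)
  then obtain w where w: "coupling_density \<zeta> \<zeta>' w"
    "(\<integral>\<^sup>+z. ennreal ((W2 (fst z) (snd z))\<^sup>2) \<partial>density (\<zeta> \<Otimes>\<^sub>M \<zeta>') w)
      \<le> ennreal (2 * (\<integral>x. ?D x \<partial>\<zeta>) + 2 * (\<integral>x. ?D x \<partial>\<zeta>') + 0 * (\<Sum>i\<in>{()}. \<bar>(\<integral>x. 1 \<partial>\<zeta>) - (\<integral>x. 1 \<partial>\<zeta>')\<bar>))" by blast
  have "sigma_finite_measure \<zeta>" "sigma_finite_measure \<zeta>'"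
    using z(1) z'(1) prob_space_imp_sigma_finite by auto
  from coupling_densityD[OF this w(1)] w(2) show ?thesis
    using le_less_trans[OF w(2) ennreal_less_top] by auto
qed

lemma iterated_W2_functional_bound:
  assumes \<zeta>: "P2_law \<zeta>" "P2_law \<zeta>'" "integrable \<zeta> F" "integrable \<zeta>' G" "0 < C"
    and le: "\<And>\<mu> \<nu>. \<mu> \<in> P2_real \<Longrightarrow> \<nu> \<in> P2_real \<Longrightarrow> F \<mu> \<le> G \<nu> + C * (W2 \<mu> \<nu>)\<^sup>2"
  shows "(\<integral>\<mu>. F \<mu> \<partial>\<zeta>) \<le> (\<integral>\<mu>. G \<mu> \<partial>\<zeta>') + C * (iterated_W2 \<zeta> \<zeta>')\<^sup>2"
proof -
  obtain \<pi> where "\<pi> \<in> couplings \<zeta> \<zeta>'" "(\<integral>\<^sup>+ z. ennreal ((W2 (fst z) (snd z))\<^sup>2) \<partial>\<pi>) < \<infinity>"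
    using P2_law_finite_cost[OF \<zeta>(1,2)] by blast
  then show ?thesis
    by (rule wasserstein2_functional_bound) (use assms P2_lawD(3) in auto)
qed

lemma return_in_P2: "return borel (0::real) \<in> P2_real"
proof -
  interpret prob_space "return borel (0::real)" by (rule prob_space_return) simp
  have "integrable (return borel 0) (\<lambda>x::real. x\<^sup>2)"
    by (rule integrableI_bounded) (simp_all add: nn_integral_return)
  then show ?thesis by (simp add: P2_real_def real_distribution_def real_distribution_axioms_def prob_space_axioms)
qed

text \<open>
  Transport to the point mass at zero moves every \<open>x\<close> by \<open>\<bar>x\<bar>\<close>, since the second marginal sits at zero; the
  factor two is the price of using the functional bound.
\<close>

lemma second_moment_le_W2:
  assumes "\<mu> \<in> P2_real"
  shows "(\<integral>x. x\<^sup>2 \<partial>\<mu>) \<le> 2 * (W2 \<mu> (return borel 0))\<^sup>2"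
proof -
  have "(\<integral>x. x\<^sup>2 \<partial>\<mu>) \<le> (\<integral>x. 2 * x\<^sup>2 \<partial>return borel 0) + 2 * (W2 \<mu> (return borel 0))\<^sup>2"
  proof (rule W2_functional_bound[OF assms return_in_P2])
    show "x\<^sup>2 \<le> 2 * y\<^sup>2 + 2 * (x - y)\<^sup>2" for x y :: real
      using square_diff_le[of "x - y" "- y"] by simp
  qed (use P2_realD(4)[OF assms] P2_realD(4)[OF return_in_P2] in auto)
  moreover have "(\<integral>x. 2 * x\<^sup>2 \<partial>return borel (0::real)) = 0" by (subst integral_return) auto
  ultimately show ?thesis by simp
qed

lemma P2_P2_law:
  assumes "\<zeta> \<in> P2_P2_real" shows "P2_law \<zeta>"
proof -
  have z: "prob_space \<zeta>" "sets \<zeta> = sets P2_borel" "(\<integral>\<^sup>+ \<mu>. ennreal ((W2 \<mu> (return borel 0))\<^sup>2) \<partial>\<zeta>) < \<infinity>"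
    using assms by (auto simp: P2_P2_real_def)
  have sp: "space \<zeta> = P2_real" using sets_eq_imp_space_eq[OF z(2)] by (simp add: space_P2_borel)
  have m: "(\<lambda>\<mu>. \<integral>x. x\<^sup>2 \<partial>\<mu>) \<in> borel_measurable \<zeta>"
    using P2_second_moment_measurable measurable_cong_sets[OF z(2) refl] by blast
  have "(\<integral>\<^sup>+ \<mu>. ennreal (norm ((\<integral>x. x\<^sup>2 \<partial>\<mu>) / 2)) \<partial>\<zeta>) \<le> (\<integral>\<^sup>+ \<mu>. ennreal ((W2 \<mu> (return borel 0))\<^sup>2) \<partial>\<zeta>)"
    using second_moment_le_W2 sp by (intro nn_integral_mono ennreal_leI) (auto simp: abs_of_nonneg mult.commute)
  then have "integrable \<zeta> (\<lambda>\<mu>. (\<integral>x. x\<^sup>2 \<partial>\<mu>) / 2)"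
    using m z(3) by (intro integrableI_bounded) (auto intro: le_less_trans)
  then have "integrable \<zeta> (\<lambda>\<mu>. 2 * ((\<integral>x. x\<^sup>2 \<partial>\<mu>) / 2))" by (rule integrable_mult_right)
  then show ?thesis using z by (simp add: P2_law_def)
qed

lemma P2_law_excess_tendsto:
  assumes \<zeta>: "P2_law \<zeta>"
  shows "(\<lambda>k. \<integral>\<mu>. (\<integral>x. excess (real k) x \<partial>\<mu>) \<partial>\<zeta>) \<longlonglongrightarrow> 0"
proof -
  note z = P2_lawD[OF \<zeta>]
  have "(\<lambda>k. \<integral>\<mu>. (\<integral>x. excess (real k) x \<partial>\<mu>) \<partial>\<zeta>) \<longlonglongrightarrow> (\<integral>\<mu>. 0 \<partial>\<zeta>)"
  proof (rule integral_dominated_convergence[where w="\<lambda>\<mu>. \<integral>x. x\<^sup>2 \<partial>\<mu>"])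
    show "(\<lambda>\<mu>. \<integral>x. excess (real k) x \<partial>\<mu>) \<in> borel_measurable \<zeta>" for k
      unfolding z(5) by (rule P2_excess_measurable) simp
    show "AE \<mu> in \<zeta>. (\<lambda>k. \<integral>x. excess (real k) x \<partial>\<mu>) \<longlonglongrightarrow> 0"
      using excess_tendsto z(3) by (auto intro: AE_I2)
    show "AE \<mu> in \<zeta>. norm (\<integral>x. excess (real k) x \<partial>\<mu>) \<le> (\<integral>x. x\<^sup>2 \<partial>\<mu>)" for k
    proof (rule AE_I2)
      fix \<mu> assume "\<mu> \<in> space \<zeta>"
      then have \<mu>: "\<mu> \<in> P2_real" using z by simp
      have "(\<integral>x. excess k x \<partial>\<mu>) \<le> (\<integral>x. x\<^sup>2 \<partial>\<mu>)"
        by (rule integral_mono[OF P2_excess_integrable[OF \<mu>] P2_realD(4)[OF \<mu>] excess_le]) auto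
      then show "norm (\<integral>x. excess k x \<partial>\<mu>) \<le> (\<integral>x. x\<^sup>2 \<partial>\<mu>)"
        using excess_integral_nonneg[of \<mu> "real k"] by simp
    qed
  qed (use z in auto)
  then show ?thesis by simp
qed

text \<open>
  For \<open>m\<close> samples that hit cell \<open>j\<close> with probability \<open>\<integral>\<psi>\<^sub>j d\<mu>\<close>, the frequency of cell \<open>i\<close> has variance at most
  \<open>1 / m\<close>.
\<close>

lemma bump_frequency_deviation:
  assumes \<mu>: "\<mu> \<in> P2_real" and K: "0 < K" and i: "i \<le> n" and m: "0 < m"
  shows "iid_avg {..n} (\<lambda>i. \<integral>x. bump K n i x \<partial>\<mu>) m (\<lambda>is. \<bar>(\<integral>x. bump K n i x \<partial>\<mu>) - real (count_list is i) / m\<bar>) \<le> 1 / sqrt m"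
proof -
  define a where "a i = (\<integral>x. bump K n i x \<partial>\<mu>)" for i
  have a0: "0 \<le> a j" "a j \<le> 1" if "j \<le> n" for j using P2_bump[OF K that] \<mu> by (auto simp: a_def)
  have a1: "(\<Sum>i\<le>n. a i) = 1" unfolding a_def by (rule P2_bump_sum[OF \<mu> K])
  define v where "v j = a i - (if j = i then 1 else 0)" for j
  have v: "(\<Sum>j\<le>n. a j * v j) = 0"
    using i a1 by (simp add: v_def right_diff_distrib sum_subtractf sum_distrib_right[symmetric] if_distrib[of "\<lambda>x. _ * x"] cong: if_cong)
  have v1: "(v j)\<^sup>2 \<le> 1" for j using a0[OF i] by (auto simp: v_def abs_square_le_1)
  have cnt: "(a i - real (count_list is i) / m)\<^sup>2 = (1 / m\<^sup>2) * (sum_list (map v is))\<^sup>2" if "length is = m" for "is"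
  proof -
    have "sum_list (map v is) = real (length is) * a i - real (count_list is i)"
      by (induction "is") (auto simp: v_def algebra_simps)
    then have "a i - real (count_list is i) / m = sum_list (map v is) / m" using that m by (simp add: field_simps)
    then show ?thesis by (simp add: power_divide)
  qed
  have "iid_avg {..n} a m (\<lambda>is. (a i - real (count_list is i) / m)\<^sup>2) = iid_avg {..n} a m (\<lambda>is. (1 / m\<^sup>2) * (sum_list (map v is))\<^sup>2)"
    by (rule iid_avg_cong) (rule cnt)
  also have "\<dots> = (1 / m\<^sup>2) * (real m * (\<Sum>j\<le>n. a j * (v j)\<^sup>2))"
    using iid_avg_variance[OF _ a1 v, of m] by (simp only: iid_avg_cmult finite_atMost)
  also have "\<dots> \<le> (1 / m\<^sup>2) * (real m * (\<Sum>j\<le>n. a j * 1))"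
    using v1 a0 by (intro mult_left_mono sum_mono) auto
  also have "\<dots> = 1 / m" using a1 m by (simp add: power2_eq_square)
  finally have var: "iid_avg {..n} a m (\<lambda>is. (a i - real (count_list is i) / m)\<^sup>2) \<le> 1 / m" .
  have am: "\<bar>t\<bar> \<le> (1 / 2) * (1 / c) + (c / 2) * t\<^sup>2" if c: "0 < c" for t c :: real
  proof -
    have "2 * c * \<bar>t\<bar> \<le> 1 + c\<^sup>2 * t\<^sup>2"
      using zero_le_power2[of "1 - c * \<bar>t\<bar>"] unfolding power2_diff by (simp add: power_mult_distrib)
    then have "2 * c * \<bar>t\<bar> / (2 * c) \<le> (1 + c\<^sup>2 * t\<^sup>2) / (2 * c)"
      using c by (intro divide_right_mono) auto
    then show ?thesis using c by (simp add: add_divide_distrib power2_eq_square)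
  qed
  have "iid_avg {..n} a m (\<lambda>is. \<bar>a i - real (count_list is i) / m\<bar>)
      \<le> iid_avg {..n} a m (\<lambda>is. (1 / 2) * (1 / sqrt m) + (sqrt m / 2) * (a i - real (count_list is i) / m)\<^sup>2)"
    by (rule iid_avg_mono) (use a0 am[of "sqrt m"] m in auto)
  also have "\<dots> = (1 / 2) * (1 / sqrt m) + (sqrt m / 2) * iid_avg {..n} a m (\<lambda>is. (a i - real (count_list is i) / m)\<^sup>2)"
    by (simp only: iid_avg_add iid_avg_cmult iid_avg_const[OF finite_atMost a1])
  also have "\<dots> \<le> (1 / 2) * (1 / sqrt m) + (sqrt m / 2) * (1 / m)"
    using var by (intro add_left_mono mult_left_mono) auto
  also have "(sqrt m / 2) * (1 / m) = (1 / 2) * (1 / sqrt m)"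
  proof -
    have "c / 2 * (1 / (c * c)) = 1 / 2 * (1 / c)" if "0 < c" for c :: real using that by simp
    from this[of "sqrt m"] show ?thesis using m by simp
  qed
  finally show ?thesis by (simp add: a_def)
qed

text \<open>
  The partition coupling on the space of laws, with lists of \<open>m\<close> cells as indices. By the bound on the line the distance
  between two laws is controlled by the differences of their cell masses, and both are close to the frequencies
  in the list on average. Thus finitely many integrals of products of cell masses, together with the mean
  excess, control the iterated distance.
\<close>

lemma iterated_W2_sq_le:
  assumes \<zeta>: "P2_law \<zeta>" "P2_law \<zeta>'" and K: "0 < K" and n: "0 < n" and m: "0 < m"
  shows "(iterated_W2 \<zeta> \<zeta>')\<^sup>2 \<le> 32 * K\<^sup>2 / n + 48 * K\<^sup>2 * (real n + 1) / sqrt m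
    + 16 * (\<integral>\<mu>. (\<integral>x. excess K x \<partial>\<mu>) \<partial>\<zeta>) + 16 * (\<integral>\<mu>. (\<integral>x. excess K x \<partial>\<mu>) \<partial>\<zeta>')
    + 24 * K\<^sup>2 * (\<Sum>is | set is \<subseteq> {..n} \<and> length is = m.
        \<bar>(\<integral>\<mu>. prod_list (map (\<lambda>i. \<integral>x. bump K n i x \<partial>\<mu>) is) \<partial>\<zeta>) - (\<integral>\<mu>. prod_list (map (\<lambda>i. \<integral>x. bump K n i x \<partial>\<mu>) is) \<partial>\<zeta>')\<bar>)"
proof -
  note z = P2_lawD[OF \<zeta>(1)] and z' = P2_lawD[OF \<zeta>(2)]
  interpret A: prob_space \<zeta> by (rule z)
  interpret B: prob_space \<zeta>' by (rule z')
  define a where "a i \<mu> = (\<integral>x. bump K n i x \<partial>\<mu>)" for i \<mu>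
  define E where "E \<mu> = (\<integral>x. excess K x \<partial>\<mu>)" for \<mu>
  define L where "L = {is. set is \<subseteq> {..n} \<and> length is = m}"
  have finL: "finite L" unfolding L_def by (rule finite_lists_length_eq) simp
  define \<psi> where "\<psi> is \<mu> = prod_list (map (\<lambda>i. a i \<mu>) is)" for "is" \<mu>
  define d where "d is \<mu> = 8 * K\<^sup>2 / n + 8 * E \<mu> + 12 * K\<^sup>2 * (\<Sum>i\<le>n. \<bar>a i \<mu> - real (count_list is i) / m\<bar>)" for "is" \<mu>
  define D where "D \<mu> = 8 * K\<^sup>2 / n + 8 * E \<mu> + 12 * K\<^sup>2 * ((real n + 1) / sqrt m)" for \<mu>
  have E0: "0 \<le> E \<mu>" for \<mu> unfolding E_def using excess_nonneg by (simp add: integral_nonneg_AE)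
  have a0: "0 \<le> a i \<mu>" "a i \<mu> \<le> 1" if "i \<le> n" "\<mu> \<in> P2_real" for i \<mu>
    using P2_bump[OF K that(1)] that(2) by (auto simp: a_def)
  have a1: "(\<Sum>i\<le>n. a i \<mu>) = 1" if "\<mu> \<in> P2_real" for \<mu> unfolding a_def by (rule P2_bump_sum[OF that K])
  have am: "a i \<in> borel_measurable P2_borel" if "i \<le> n" for i
    unfolding a_def[abs_def] by (rule P2_bump(1)[OF K that])
  have Em: "E \<in> borel_measurable P2_borel" unfolding E_def[abs_def] by (rule P2_excess_measurable) (use K in simp)
  have \<psi>m: "\<psi> is \<in> borel_measurable P2_borel" if "set is \<subseteq> {..n}" for "is"
    using that unfolding \<psi>_def[abs_def] by (induction "is") (auto intro!: borel_measurable_times am)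
  have iE: "integrable \<zeta> E" "integrable \<zeta>' E"
    unfolding E_def[abs_def] using P2_law_integrable_excess \<zeta> K by auto
  have \<psi>_iid: "(\<Sum>is\<in>L. \<psi> is \<mu> * f is) = iid_avg {..n} (\<lambda>i. a i \<mu>) m f" for \<mu> f
    by (simp add: iid_avg_def L_def \<psi>_def)
  have "\<exists>w. coupling_density \<zeta> \<zeta>' w \<and>
    (\<integral>\<^sup>+z. ennreal ((W2 (fst z) (snd z))\<^sup>2) \<partial>density (\<zeta> \<Otimes>\<^sub>M \<zeta>') w)
      \<le> ennreal (2 * (\<integral>x. D x \<partial>\<zeta>) + 2 * (\<integral>x. D x \<partial>\<zeta>') + 24 * K\<^sup>2 * (\<Sum>is\<in>L. \<bar>(\<integral>x. \<psi> is x \<partial>\<zeta>) - (\<integral>x. \<psi> is x \<partial>\<zeta>')\<bar>))"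
  proof (rule partition_coupling[where d=d and c="\<lambda>x y. (W2 x y)\<^sup>2" and I=L and \<psi>=\<psi> and D=D])
    show "\<psi> is \<in> borel_measurable \<zeta>" if "is \<in> L" for "is"
      unfolding z(5) by (rule \<psi>m) (use that in \<open>simp add: L_def\<close>)
    show "0 \<le> \<psi> is \<mu>" if "is \<in> L" "\<mu> \<in> space \<zeta>" for "is" \<mu>
      unfolding \<psi>_def by (rule prod_list_map_nonneg[of "{..n}"]) (use that a0 z in \<open>auto simp: L_def\<close>)
    show "(\<Sum>is\<in>L. \<psi> is \<mu>) = 1" if "\<mu> \<in> space \<zeta>" for \<mu>
      using \<psi>_iid[of \<mu> "\<lambda>_. 1"] iid_avg_const[of "{..n}" "\<lambda>i. a i \<mu>" m 1] a1 that z by simp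
    show "d is \<in> borel_measurable \<zeta>" for "is"
      unfolding z(5) d_def[abs_def] by (intro borel_measurable_add borel_measurable_times borel_measurable_sum borel_measurable_abs borel_measurable_diff Em am) auto
    show "0 \<le> d is \<mu>" for "is" \<mu>
      using E0 by (auto simp: d_def intro!: add_nonneg_nonneg mult_nonneg_nonneg sum_nonneg)
    show "integrable \<zeta> D" "integrable \<zeta>' D" unfolding D_def[abs_def] using iE by auto
    show "(\<Sum>is\<in>L. \<psi> is \<mu> * d is \<mu>) \<le> D \<mu>" if "\<mu> \<in> space \<zeta>" for \<mu>
    proof -
      have \<mu>: "\<mu> \<in> P2_real" using that z by simp
      have "(\<Sum>is\<in>L. \<psi> is \<mu> * d is \<mu>) = 8 * K\<^sup>2 / n + 8 * E \<mu>
          + 12 * K\<^sup>2 * (\<Sum>i\<le>n. iid_avg {..n} (\<lambda>i. a i \<mu>) m (\<lambda>is. \<bar>a i \<mu> - real (count_list is i) / m\<bar>))"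
        unfolding \<psi>_iid d_def
        by (simp only: iid_avg_add iid_avg_cmult iid_avg_sum iid_avg_const[OF finite_atMost a1[OF \<mu>]])
      also have "\<dots> \<le> 8 * K\<^sup>2 / n + 8 * E \<mu> + 12 * K\<^sup>2 * (\<Sum>i\<le>n. 1 / sqrt m)"
        unfolding a_def using bump_frequency_deviation[OF \<mu> K _ m]
        by (intro add_left_mono mult_left_mono sum_mono) auto
      finally show ?thesis by (simp add: D_def add.commute)
    qed
    fix \<mu> \<nu> assume "\<mu> \<in> space \<zeta>" "\<nu> \<in> space \<zeta>"
    then have \<mu>: "\<mu> \<in> P2_real" "\<nu> \<in> P2_real" using z by auto
    note W = W2_sq_le_bumps[OF \<mu> K n, folded a_def E_def]
    show "(W2 \<mu> \<nu>)\<^sup>2 \<le> d is \<mu> + d is \<nu>" for "is"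
    proof -
      have "(\<Sum>i\<le>n. \<bar>a i \<mu> - a i \<nu>\<bar>) \<le> (\<Sum>i\<le>n. \<bar>a i \<mu> - real (count_list is i) / m\<bar> + \<bar>a i \<nu> - real (count_list is i) / m\<bar>)"
        by (rule sum_mono) linarith
      then have "12 * K\<^sup>2 * (\<Sum>i\<le>n. \<bar>a i \<mu> - a i \<nu>\<bar>) \<le> 12 * K\<^sup>2 * (\<Sum>i\<le>n. \<bar>a i \<mu> - real (count_list is i) / m\<bar> + \<bar>a i \<nu> - real (count_list is i) / m\<bar>)"
        by (rule mult_left_mono) simp
      with W show ?thesis by (simp add: d_def sum.distrib distrib_left)
    qed
    show "(W2 \<mu> \<nu>)\<^sup>2 \<le> 24 * K\<^sup>2 + D \<mu> + D \<nu>"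
    proof -
      have "(\<Sum>i\<le>n. \<bar>a i \<mu> - a i \<nu>\<bar>) \<le> (\<Sum>i\<le>n. a i \<mu> + a i \<nu>)"
        using a0 \<mu> by (intro sum_mono) (auto simp: abs_le_iff add_increasing)
      also have "\<dots> = 2" using a1 \<mu> by (simp add: sum.distrib)
      finally have "12 * K\<^sup>2 * (\<Sum>i\<le>n. \<bar>a i \<mu> - a i \<nu>\<bar>) \<le> 12 * K\<^sup>2 * 2" by (rule mult_left_mono) simp
      moreover have "0 \<le> 12 * K\<^sup>2 * ((real n + 1) / sqrt m)" by simp
      ultimately show ?thesis using W unfolding D_def by linarith
    qed
  qed (use z z' finL in auto)
  then obtain w where w: "coupling_density \<zeta> \<zeta>' w"
    "(\<integral>\<^sup>+z. ennreal ((W2 (fst z) (snd z))\<^sup>2) \<partial>density (\<zeta> \<Otimes>\<^sub>M \<zeta>') w)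
      \<le> ennreal (2 * (\<integral>x. D x \<partial>\<zeta>) + 2 * (\<integral>x. D x \<partial>\<zeta>') + 24 * K\<^sup>2 * (\<Sum>is\<in>L. \<bar>(\<integral>x. \<psi> is x \<partial>\<zeta>) - (\<integral>x. \<psi> is x \<partial>\<zeta>')\<bar>))" by blast
  have sf: "sigma_finite_measure \<zeta>" "sigma_finite_measure \<zeta>'"
    using z(1) z'(1) prob_space_imp_sigma_finite by auto
  have D0: "0 \<le> D \<mu>" for \<mu> using E0 by (auto simp: D_def intro!: add_nonneg_nonneg)
  have "(iterated_W2 \<zeta> \<zeta>')\<^sup>2 \<le> 2 * (\<integral>x. D x \<partial>\<zeta>) + 2 * (\<integral>x. D x \<partial>\<zeta>') + 24 * K\<^sup>2 * (\<Sum>is\<in>L. \<bar>(\<integral>x. \<psi> is x \<partial>\<zeta>) - (\<integral>x. \<psi> is x \<partial>\<zeta>')\<bar>)"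
    by (rule wasserstein2_le[OF coupling_densityD[OF sf w(1)] w(2)])
      (auto intro!: add_nonneg_nonneg mult_nonneg_nonneg sum_nonneg integral_nonneg_AE AE_I2 D0)
  also have "(\<integral>x. D x \<partial>\<zeta>) = 8 * K\<^sup>2 / n + 8 * (\<integral>x. E x \<partial>\<zeta>) + 12 * K\<^sup>2 * ((real n + 1) / sqrt m)"
    unfolding D_def using iE by (simp add: A.prob_space)
  also have "(\<integral>x. D x \<partial>\<zeta>') = 8 * K\<^sup>2 / n + 8 * (\<integral>x. E x \<partial>\<zeta>') + 12 * K\<^sup>2 * ((real n + 1) / sqrt m)"
    unfolding D_def using iE by (simp add: B.prob_space)
  finally show ?thesis by (simp add: E_def \<psi>_def a_def L_def algebra_simps)
qed

section \<open>Tilting a product measure\<close>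

text \<open>
  The truncated series of \<open>1 / (1 + y)\<close>. Its \<open>n\<close>-th power approximates \<open>(1 + y)\<^sup>-\<^sup>n\<close>, the normalisation of \<open>n\<close>
  tilted replicas, to sixth order, and having it as a polynomial keeps the coefficients explicit.
\<close>

definition recip_poly :: "real poly" where "recip_poly = [:1, -1, 1, -1, 1, -1:]"

definition tilt_coeff :: "nat \<Rightarrow> nat \<Rightarrow> real" where "tilt_coeff n j = coeff (recip_poly ^ n) j"

definition tilt_degree :: "nat \<Rightarrow> nat" where "tilt_degree n = degree (recip_poly ^ n)"

lemma poly_recip: "poly recip_poly y = 1 - y + y^2 - y^3 + y^4 - y^5"
  by (simp add: recip_poly_def algebra_simps eval_nat_numeral)

lemma poly_recip_power: "poly recip_poly y ^ n = (\<Sum>j\<le>tilt_degree n. tilt_coeff n j * y ^ j)"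
  unfolding poly_power[symmetric] poly_altdef[of "recip_poly ^ n"] tilt_coeff_def tilt_degree_def ..

lemma recip_poly_error:
  assumes "\<bar>y\<bar> \<le> 1/2"
  shows "\<bar>(1 / (1 + y)) ^ n - poly recip_poly y ^ n\<bar> \<le> 2 ^ n * real n * y ^ 6"
proof -
  have y: "1/2 \<le> 1 + y" using assms by linarith
  have a: "\<bar>1 / (1 + y)\<bar> \<le> 2" using y by (simp add: field_simps)
  have pw: "\<bar>y ^ k\<bar> \<le> (1/2) ^ k" for k unfolding power_abs using assms by (intro power_mono) auto
  have b: "\<bar>poly recip_poly y\<bar> \<le> 2"
  proof -
    have "(1/2) ^ 2 = (1/4::real)" "(1/2) ^ 3 = (1/8::real)" "(1/2) ^ 4 = (1/16::real)" "(1/2) ^ 5 = (1/32::real)"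
      by (simp_all add: power_divide)
    then show ?thesis
      using assms pw[of 2] pw[of 3] pw[of 4] pw[of 5] unfolding poly_recip by linarith
  qed
  have geo: "(1 + y) * poly recip_poly y = 1 - y ^ 6"
    unfolding poly_recip by (simp add: algebra_simps eval_nat_numeral)
  have "1 / (1 + y) - poly recip_poly y = (1 - (1 + y) * poly recip_poly y) / (1 + y)"
    using y by (simp add: diff_divide_distrib)
  also have "\<dots> = y ^ 6 * (1 / (1 + y))" unfolding geo by simp
  finally have "\<bar>1 / (1 + y) - poly recip_poly y\<bar> = y ^ 6 * \<bar>1 / (1 + y)\<bar>"
    by (simp add: abs_mult)
  also have "\<dots> \<le> y ^ 6 * 2" using a by (intro mult_left_mono) auto
  finally have d: "\<bar>1 / (1 + y) - poly recip_poly y\<bar> \<le> 2 * y ^ 6" by simp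
  have scaled: "\<bar>(u / 2) ^ n - (v / 2) ^ n\<bar> \<le> real n * \<bar>u / 2 - v / 2\<bar>" if "\<bar>u\<bar> \<le> 2" "\<bar>v\<bar> \<le> 2" for u v :: real
    using norm_power_diff[of "u / 2" "v / 2" n] that by simp
  have "\<bar>(1 / (1 + y) / 2) ^ n - (poly recip_poly y / 2) ^ n\<bar> \<le> real n * \<bar>1 / (1 + y) / 2 - poly recip_poly y / 2\<bar>"
    using a b by (rule scaled)
  also have "\<dots> \<le> real n * y ^ 6"
  proof (rule mult_left_mono)
    have "1 / (1 + y) / 2 - poly recip_poly y / 2 = (1 / (1 + y) - poly recip_poly y) / 2"
      by (rule diff_divide_distrib[symmetric])
    with d show "\<bar>1 / (1 + y) / 2 - poly recip_poly y / 2\<bar> \<le> y ^ 6" by (simp only: abs_divide) simp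
  qed simp
  finally have "2 ^ n * \<bar>(1 / (1 + y) / 2) ^ n - (poly recip_poly y / 2) ^ n\<bar> \<le> 2 ^ n * (real n * y ^ 6)"
    by (rule mult_left_mono) simp
  moreover have "2 ^ n * \<bar>(1 / (1 + y) / 2) ^ n - (poly recip_poly y / 2) ^ n\<bar> = \<bar>(1 / (1 + y)) ^ n - poly recip_poly y ^ n\<bar>"
  proof -
    have "(1 / (1 + y)) ^ n - poly recip_poly y ^ n = 2 ^ n * ((1 / (1 + y) / 2) ^ n - (poly recip_poly y / 2) ^ n)"
      by (simp only: power_divide right_diff_distrib) simp
    then show ?thesis by (simp only: abs_mult) simp
  qed
  ultimately show ?thesis by (simp only: mult.assoc)
qed

lemma prod_one_plus_expansion:
  fixes s :: "'a \<Rightarrow> real"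
  shows "prod_list (map (\<lambda>x. 1 + t * s x) l) = (\<Sum>S\<in>Pow {..<length l}. t ^ card S * (\<Prod>a\<in>S. s (l ! a)))"
proof -
  have "prod_list (map (\<lambda>x. 1 + t * s x) l) = (\<Prod>a<length l. t * s (l ! a) + 1)"
    by (simp add: prod.list_conv_set_nth atLeast0LessThan add.commute)
  also have "\<dots> = (\<Sum>S\<in>Pow {..<length l}. (\<Prod>a\<in>S. t * s (l ! a)) * (\<Prod>a\<in>{..<length l} - S. 1))"
    by (rule prod_add) simp
  also have "\<dots> = (\<Sum>S\<in>Pow {..<length l}. t ^ card S * (\<Prod>a\<in>S. s (l ! a)))"
    by (simp add: prod.distrib)
  finally show ?thesis .
qed

lemma iid_avg_prod_subset:
  assumes "finite X" "(\<Sum>x\<in>X. w x) = 1" "T \<subseteq> {..<n}"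
  shows "iid_avg X w n (\<lambda>l. \<Prod>a\<in>T. g (l ! a)) = (\<Sum>x\<in>X. w x * g x) ^ card T"
proof -
  have fin: "finite T" using assms(3) finite_subset by blast
  have "(\<Prod>a\<in>T. g (l ! a)) = (\<Prod>a<n. if a \<in> T then g (l ! a) else 1)" for l
    using assms(3) by (subst prod.inter_restrict[symmetric]) (auto simp: Int_absorb1)
  then have "iid_avg X w n (\<lambda>l. \<Prod>a\<in>T. g (l ! a)) = (\<Prod>a<n. \<Sum>x\<in>X. w x * (if a \<in> T then g x else 1))"
    using iid_avg_prod[OF assms(1), of w n "\<lambda>a x. if a \<in> T then g x else 1"] by simp
  also have "\<dots> = (\<Prod>a<n. if a \<in> T then (\<Sum>x\<in>X. w x * g x) else 1)"
    using assms(2) by (intro prod.cong) auto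
  also have "\<dots> = (\<Prod>a\<in>T. \<Sum>x\<in>X. w x * g x)"
    using assms(3) by (subst prod.inter_restrict[symmetric]) (auto simp: Int_absorb1)
  finally show ?thesis by simp
qed

text \<open>
  Independent new samples turn the power \<open>\<langle>s\<rangle>\<^sup>j\<close> into a product of \<open>s\<close> over \<open>j\<close> further replicas.
\<close>

lemma iid_avg_extend:
  assumes "finite X" "(\<Sum>x\<in>X. w x) = 1" "S \<subseteq> {..<n}"
  shows "iid_avg X w (n + j) (\<lambda>l. f (take n l) * (\<Prod>a\<in>S \<union> {n..<n + j}. s (l ! a)))
    = iid_avg X w n (\<lambda>l. f l * (\<Prod>a\<in>S. s (l ! a))) * (\<Sum>x\<in>X. w x * s x) ^ j"
proof -
  have fin: "finite S" using assms(3) finite_subset by blast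
  have e: "f (take n (l @ r)) * (\<Prod>a\<in>S \<union> {n..<n + j}. s ((l @ r) ! a)) = (f l * (\<Prod>a\<in>S. s (l ! a))) * (\<Prod>a\<in>{..<j}. s (r ! a))"
    if "length l = n" for l r
  proof -
    have "(\<Prod>a\<in>S \<union> {n..<n + j}. s ((l @ r) ! a)) = (\<Prod>a\<in>S. s ((l @ r) ! a)) * (\<Prod>a\<in>{n..<n + j}. s ((l @ r) ! a))"
      using fin assms(3) by (intro prod.union_disjoint) auto
    also have "(\<Prod>a\<in>S. s ((l @ r) ! a)) = (\<Prod>a\<in>S. s (l ! a))"
      using assms(3) that by (intro prod.cong) (auto simp: nth_append)
    also have "(\<Prod>a\<in>{n..<n + j}. s ((l @ r) ! a)) = (\<Prod>a\<in>{..<j}. s (r ! a))"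
      using that by (intro prod.reindex_bij_witness[where j="\<lambda>a. a - n" and i="\<lambda>a. a + n"]) (auto simp: nth_append)
    finally show ?thesis using that by (simp add: mult_ac)
  qed
  have "iid_avg X w (n + j) (\<lambda>l. f (take n l) * (\<Prod>a\<in>S \<union> {n..<n + j}. s (l ! a)))
      = iid_avg X w n (\<lambda>l. iid_avg X w j (\<lambda>r. f (take n (l @ r)) * (\<Prod>a\<in>S \<union> {n..<n + j}. s ((l @ r) ! a))))"
    by (rule iid_avg_append[OF assms(1)])
  also have "\<dots> = iid_avg X w n (\<lambda>l. iid_avg X w j (\<lambda>r. (f l * (\<Prod>a\<in>S. s (l ! a))) * (\<Prod>a\<in>{..<j}. s (r ! a))))"
    by (rule iid_avg_cong) (simp only: e)
  also have "\<dots> = iid_avg X w n (\<lambda>l. (\<Sum>x\<in>X. w x * s x) ^ j * (f l * (\<Prod>a\<in>S. s (l ! a))))"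
    using iid_avg_prod_subset[OF assms(1,2), of "{..<j}" j s] by (simp add: iid_avg_cmult mult_ac)
  finally show ?thesis unfolding iid_avg_cmult by (simp only: mult.commute)
qed

text \<open>
  The first summand is the error for \<open>\<bar>t\<bar> \<le> 1 / 2\<close>. For larger \<open>\<bar>t\<bar>\<close> all quantities are merely bounded, and
  \<open>64 t\<^sup>6 \<ge> 1\<close>.
\<close>

definition tilt_const :: "nat \<Rightarrow> real" where
  "tilt_const n = 2 ^ n * (2 ^ n * real n) + 64 * (1 + 2 ^ n * 6 ^ n)"

lemma tilt_const_nonneg: "0 \<le> tilt_const n" by (simp add: tilt_const_def)

text \<open>
  The numerator of the tilted average expands over sets \<open>S\<close> of replicas, the normalisation
  \<open>(1 + t \<langle>s\<rangle>)\<^sup>-\<^sup>n\<close> in powers of \<open>t \<langle>s\<rangle>\<close>, and each power \<open>\<langle>s\<rangle>\<^sup>j\<close> is an average over \<open>j\<close> new replicas. The exponent of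
  \<open>t\<close> is therefore the number of distinct replicas that carry a factor \<open>s\<close>.
\<close>

lemma iid_avg_tilt_expansion:
  fixes f :: "'a list \<Rightarrow> real"
  assumes X: "finite X" and w0: "\<And>x. x \<in> X \<Longrightarrow> 0 \<le> w x" and w1: "(\<Sum>x\<in>X. w x) = 1"
    and s: "\<And>x. x \<in> X \<Longrightarrow> \<bar>s x\<bar> \<le> 1" and t: "\<bar>t\<bar> < 1"
    and f: "\<And>l. set l \<subseteq> X \<Longrightarrow> length l = n \<Longrightarrow> \<bar>f l\<bar> \<le> 1"
  shows "\<bar>iid_avg X (\<lambda>x. w x * (1 + t * s x) / (1 + t * (\<Sum>x\<in>X. w x * s x))) n f
    - (\<Sum>(S, j)\<in>Pow {..<n} \<times> {..tilt_degree n}. tilt_coeff n j * t ^ (card S + j) *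
        iid_avg X w (n + j) (\<lambda>l. f (take n l) * (\<Prod>a\<in>S \<union> {n..<n + j}. s (l ! a))))\<bar> \<le> tilt_const n * t ^ 6"
proof -
  define m where "m = (\<Sum>x\<in>X. w x * s x)"
  have "\<bar>m\<bar> \<le> (\<Sum>x\<in>X. w x * 1)"
    unfolding m_def by (rule order_trans[OF sum_abs], rule sum_mono) (use w0 s in \<open>auto simp: abs_mult intro!: mult_left_le\<close>)
  then have m: "\<bar>m\<bar> \<le> 1" using w1 by simp
  have tm: "\<bar>t * m\<bar> \<le> \<bar>t\<bar>" using m by (simp add: abs_mult mult_left_le)
  have pos: "0 < 1 + t * m" using tm t by linarith
  define B where "B S = iid_avg X w n (\<lambda>l. f l * (\<Prod>a\<in>S. s (l ! a)))" for S
  define A where "A = (\<Sum>S\<in>Pow {..<n}. t ^ card S * B S)"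
  let ?h = "iid_avg X (\<lambda>x. w x * (1 + t * s x) / (1 + t * m)) n f"
  have h: "?h = (1 / (1 + t * m)) ^ n * A"
  proof -
    have "?h = iid_avg X (\<lambda>x. 1 / (1 + t * m) * w x * (1 + t * s x)) n f" by simp
    also have "\<dots> = (1 / (1 + t * m)) ^ n * iid_avg X w n (\<lambda>l. prod_list (map (\<lambda>x. 1 + t * s x) l) * f l)"
      by (rule iid_avg_tilt)
    also have "iid_avg X w n (\<lambda>l. prod_list (map (\<lambda>x. 1 + t * s x) l) * f l)
        = iid_avg X w n (\<lambda>l. \<Sum>S\<in>Pow {..<n}. t ^ card S * (f l * (\<Prod>a\<in>S. s (l ! a))))"
      by (rule iid_avg_cong) (simp add: prod_one_plus_expansion sum_distrib_left mult_ac)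
    finally show ?thesis by (simp add: A_def B_def iid_avg_sum iid_avg_cmult)
  qed
  have sumP: "(\<Sum>(S, j)\<in>Pow {..<n} \<times> {..tilt_degree n}. tilt_coeff n j * t ^ (card S + j) *
        iid_avg X w (n + j) (\<lambda>l. f (take n l) * (\<Prod>a\<in>S \<union> {n..<n + j}. s (l ! a)))) = poly recip_poly (t * m) ^ n * A"
  proof -
    have "(\<Sum>(S, j)\<in>Pow {..<n} \<times> {..tilt_degree n}. tilt_coeff n j * t ^ (card S + j) *
        iid_avg X w (n + j) (\<lambda>l. f (take n l) * (\<Prod>a\<in>S \<union> {n..<n + j}. s (l ! a))))
      = (\<Sum>(S, j)\<in>Pow {..<n} \<times> {..tilt_degree n}. (t ^ card S * B S) * (tilt_coeff n j * (t * m) ^ j))"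
      using iid_avg_extend[OF X w1] by (intro sum.cong) (auto simp: B_def m_def power_add power_mult_distrib)
    also have "\<dots> = A * (\<Sum>j\<le>tilt_degree n. tilt_coeff n j * (t * m) ^ j)"
      unfolding A_def sum_product by (rule sum.cartesian_product[symmetric])
    finally show ?thesis by (simp add: poly_recip_power mult.commute)
  qed
  have Sb: "\<bar>\<Prod>a\<in>S. s (l ! a)\<bar> \<le> 1" if "S \<subseteq> {..<n}" "set l \<subseteq> X" "length l = n" for S l
    unfolding abs_prod by (rule prod_le_1) (use that s in \<open>auto simp: subset_iff\<close>)
  have B: "\<bar>B S\<bar> \<le> 1" if "S \<subseteq> {..<n}" for S
    unfolding B_def by (rule iid_avg_abs_bound[OF X w0 w1]) (auto simp: abs_mult intro!: mult_le_one f Sb that)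
  have A: "\<bar>A\<bar> \<le> 2 ^ n"
  proof -
    have "\<bar>A\<bar> \<le> (\<Sum>S\<in>Pow {..<n}. \<bar>t ^ card S * B S\<bar>)" unfolding A_def by (rule sum_abs)
    also have "\<dots> \<le> (\<Sum>S\<in>Pow {..<n}. 1)"
      using t B by (intro sum_mono) (auto simp: abs_mult power_abs intro!: mult_le_one power_le_one)
    finally show ?thesis by (simp add: card_Pow)
  qed
  have "\<bar>?h - poly recip_poly (t * m) ^ n * A\<bar> \<le> tilt_const n * t ^ 6"
  proof (cases "\<bar>t\<bar> \<le> 1/2")
    case True
    have "\<bar>?h - poly recip_poly (t * m) ^ n * A\<bar> = \<bar>(1 / (1 + t * m)) ^ n - poly recip_poly (t * m) ^ n\<bar> * \<bar>A\<bar>"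
      by (simp add: h left_diff_distrib abs_mult[symmetric])
    also have "\<dots> \<le> (2 ^ n * real n * (t * m) ^ 6) * 2 ^ n"
      using tm True A by (intro mult_mono recip_poly_error) auto
    also have "\<dots> \<le> (2 ^ n * real n * t ^ 6) * 2 ^ n"
    proof -
      have "(t * m) ^ 6 \<le> t ^ 6" using power_mono[OF tm, of 6] by (simp add: power_even_abs)
      then show ?thesis by (intro mult_left_mono mult_right_mono) auto
    qed
    also have "\<dots> = (2 ^ n * (2 ^ n * real n)) * t ^ 6" by (simp add: mult_ac)
    also have "\<dots> \<le> tilt_const n * t ^ 6" by (intro mult_right_mono) (auto simp: tilt_const_def)
    finally show ?thesis .
  next
    case False
    have h1: "\<bar>?h\<bar> \<le> 1"
    proof (rule iid_avg_abs_bound[OF X])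
      show "0 \<le> w x * (1 + t * s x) / (1 + t * m)" if "x \<in> X" for x
      proof -
        have "\<bar>t * s x\<bar> \<le> 1" using s[OF that] t by (simp add: abs_mult mult_le_one)
        then show ?thesis using w0[OF that] pos by (intro divide_nonneg_pos mult_nonneg_nonneg) auto
      qed
      have "(\<Sum>x\<in>X. w x * (1 + t * s x) / (1 + t * m)) = (\<Sum>x\<in>X. w x + t * (w x * s x)) / (1 + t * m)"
        by (simp add: sum_divide_distrib[symmetric] algebra_simps)
      also have "\<dots> = 1" using pos by (simp add: sum.distrib sum_distrib_left[symmetric] w1 m_def[symmetric])
      finally show "(\<Sum>x\<in>X. w x * (1 + t * s x) / (1 + t * m)) = 1" .
    qed (rule f)
    have tm1: "\<bar>t * m\<bar> \<le> 1" using tm t by linarith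
    have "\<bar>(t * m) ^ k\<bar> \<le> 1" for k using tm1 by (simp add: power_abs power_le_one)
    from this[of 2] this[of 3] this[of 4] this[of 5] tm1
    have P: "\<bar>poly recip_poly (t * m)\<bar> \<le> 6" unfolding poly_recip by linarith
    have "\<bar>poly recip_poly (t * m) ^ n * A\<bar> \<le> 6 ^ n * 2 ^ n"
      unfolding abs_mult power_abs using P A by (intro mult_mono power_mono) auto
    then have "\<bar>?h - poly recip_poly (t * m) ^ n * A\<bar> \<le> 1 + 2 ^ n * 6 ^ n" using h1 by (simp add: mult.commute)
    also have "\<dots> \<le> (1 + 2 ^ n * 6 ^ n) * (64 * t ^ 6)"
    proof -
      have "(1/2) ^ 6 \<le> \<bar>t\<bar> ^ 6" using False by (intro power_mono) auto
      then have "1 \<le> 64 * t ^ 6" by (simp add: power_even_abs power_divide)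
      then show ?thesis using mult_left_mono[of 1 "64 * t ^ 6" "1 + 2 ^ n * 6 ^ n"] by simp
    qed
    also have "\<dots> = (64 * (1 + 2 ^ n * 6 ^ n)) * t ^ 6" by simp
    also have "\<dots> \<le> tilt_const n * t ^ 6" by (intro mult_right_mono) (auto simp: tilt_const_def)
    finally show ?thesis .
  qed
  then show ?thesis unfolding sumP m_def[symmetric] .
qed

section \<open>The Gibbs measure as a function of one coupling\<close>

definition bond_spin :: "nat \<times> nat \<Rightarrow> (nat \<Rightarrow> real) \<Rightarrow> real" where
  "bond_spin e \<sigma> = \<sigma> (fst e) * \<sigma> (snd e)"

definition replica_avg :: "nat \<Rightarrow> (nat \<times> nat \<Rightarrow> real) \<Rightarrow> nat \<Rightarrow> ((nat \<Rightarrow> real) list \<Rightarrow> real) \<Rightarrow> real" where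
  "replica_avg N J n f = iid_avg (spin_configs N) (gibbs_weight N J) n f"

lemma finite_spin_configs: "finite (spin_configs N)"
  unfolding spin_configs_def by (intro finite_PiE) auto

lemma spin_configs_nonempty: "spin_configs N \<noteq> {}"
  unfolding spin_configs_def by (simp add: PiE_eq_empty_iff)

lemma spin_values: "\<sigma> \<in> spin_configs N \<Longrightarrow> 1 \<le> i \<Longrightarrow> i \<le> N \<Longrightarrow> \<sigma> i = 1 \<or> \<sigma> i = -1"
  unfolding spin_configs_def by (auto simp: PiE_def Pi_def)

lemma finite_bonds: "finite (bonds N)"
  by (rule finite_subset[of _ "{1..N} \<times> {1..N}"]) (auto simp: bonds_def)

lemma card_bonds_le: "card (bonds N) \<le> N\<^sup>2"
proof -
  have "bonds N \<subseteq> {1..N} \<times> {1..N}" by (auto simp: bonds_def)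
  from card_mono[OF _ this] show ?thesis by (simp add: power2_eq_square)
qed

lemma bond_spin_values: "\<sigma> \<in> spin_configs N \<Longrightarrow> e \<in> bonds N \<Longrightarrow> bond_spin e \<sigma> = 1 \<or> bond_spin e \<sigma> = -1"
  using spin_values[of \<sigma> N "fst e"] spin_values[of \<sigma> N "snd e"] by (auto simp: bonds_def bond_spin_def)

lemma partition_pos: "0 < (\<Sum>\<tau>\<in>spin_configs N. exp (sk_hamiltonian N J \<tau>))"
  using finite_spin_configs spin_configs_nonempty by (intro sum_pos) auto

lemma gibbs_weight_nonneg: "0 \<le> gibbs_weight N J \<sigma>"
  unfolding gibbs_weight_def using less_imp_le[OF partition_pos] by simp

lemma gibbs_weight_sum: "(\<Sum>\<sigma>\<in>spin_configs N. gibbs_weight N J \<sigma>) = 1"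
  unfolding gibbs_weight_def sum_divide_distrib[symmetric] using partition_pos[of N J] by simp

lemma exp_spin: "s = 1 \<or> s = -1 \<Longrightarrow> exp (z * s) = cosh z * (1 + tanh z * s)" for z s :: real
  by (auto simp: distrib_left tanh_def cosh_plus_sinh cosh_minus_sinh)

text \<open>
  For a spin product \<open>s = \<plusminus>1\<close> one has \<open>exp (z s) = cosh z (1 + tanh z s)\<close>, and \<open>cosh z\<close> cancels.
\<close>

lemma gibbs_weight_bond:
  fixes J :: "nat \<times> nat \<Rightarrow> real" and y :: real
  assumes e: "e \<in> bonds N" and \<sigma>: "\<sigma> \<in> spin_configs N"
  defines "w \<equiv> gibbs_weight N (J(e := 0))" and "t \<equiv> tanh (y / sqrt N)"
  shows "gibbs_weight N (J(e := y)) \<sigma>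
    = w \<sigma> * (1 + t * bond_spin e \<sigma>) / (1 + t * (\<Sum>\<tau>\<in>spin_configs N. w \<tau> * bond_spin e \<tau>))"
proof -
  let ?X = "spin_configs N"
  have H: "sk_hamiltonian N (J(e := y)) \<tau> = sk_hamiltonian N (J(e := 0)) \<tau> + y / sqrt N * bond_spin e \<tau>" for \<tau>
  proof -
    have *: "(\<Sum>(i, j)\<in>bonds N. (J(e := y)) (i, j) * \<tau> i * \<tau> j)
        = y * bond_spin e \<tau> + (\<Sum>(i, j)\<in>bonds N - {e}. J (i, j) * \<tau> i * \<tau> j)" for y
    proof -
      have "(\<Sum>(i, j)\<in>bonds N. (J(e := y)) (i, j) * \<tau> i * \<tau> j)
          = (case e of (i, j) \<Rightarrow> (J(e := y)) (i, j) * \<tau> i * \<tau> j) + (\<Sum>(i, j)\<in>bonds N - {e}. (J(e := y)) (i, j) * \<tau> i * \<tau> j)"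
        by (rule sum.remove[OF finite_bonds e])
      moreover have "(\<Sum>(i, j)\<in>bonds N - {e}. (J(e := y)) (i, j) * \<tau> i * \<tau> j) = (\<Sum>(i, j)\<in>bonds N - {e}. J (i, j) * \<tau> i * \<tau> j)"
        by (intro sum.cong) auto
      ultimately show ?thesis by (simp add: bond_spin_def case_prod_beta mult.assoc)
    qed
    show ?thesis unfolding sk_hamiltonian_def * by (simp add: distrib_left)
  qed
  let ?E = "\<lambda>\<tau>. exp (sk_hamiltonian N (J(e := 0)) \<tau>)"
  let ?Z = "\<Sum>\<tau>\<in>?X. ?E \<tau>"
  have Z: "0 < ?Z" by (rule partition_pos)
  have E: "exp (sk_hamiltonian N (J(e := y)) \<tau>) = cosh (y / sqrt N) * (?E \<tau> * (1 + t * bond_spin e \<tau>))" if "\<tau> \<in> ?X" for \<tau>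
    unfolding H exp_add t_def using exp_spin[OF bond_spin_values[OF that e], of "y / sqrt N"] by simp
  have c: "0 < cosh (y / sqrt N)" by simp
  have den: "(\<Sum>\<tau>\<in>?X. ?E \<tau> * (1 + t * bond_spin e \<tau>)) = ?Z * (1 + t * (\<Sum>\<tau>\<in>?X. w \<tau> * bond_spin e \<tau>))"
  proof -
    have "?Z * (\<Sum>\<tau>\<in>?X. w \<tau> * bond_spin e \<tau>) = (\<Sum>\<tau>\<in>?X. ?E \<tau> * bond_spin e \<tau>)"
      unfolding w_def gibbs_weight_def sum_distrib_left using Z by (intro sum.cong) auto
    moreover have "(\<Sum>\<tau>\<in>?X. ?E \<tau> * (1 + t * bond_spin e \<tau>)) = ?Z + t * (\<Sum>\<tau>\<in>?X. ?E \<tau> * bond_spin e \<tau>)"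
      by (simp add: distrib_left sum.distrib sum_distrib_left mult.left_commute)
    ultimately show ?thesis by (simp only: distrib_left mult_1_right mult.left_commute)
  qed
  have "gibbs_weight N (J(e := y)) \<sigma> = cosh (y / sqrt N) * (?E \<sigma> * (1 + t * bond_spin e \<sigma>)) / (\<Sum>\<tau>\<in>?X. cosh (y / sqrt N) * (?E \<tau> * (1 + t * bond_spin e \<tau>)))"
    unfolding gibbs_weight_def using E \<sigma> by simp
  also have "\<dots> = ?E \<sigma> * (1 + t * bond_spin e \<sigma>) / (?Z * (1 + t * (\<Sum>\<tau>\<in>?X. w \<tau> * bond_spin e \<tau>)))"
    using c unfolding sum_distrib_left[symmetric] den by simp
  also have "\<dots> = w \<sigma> * (1 + t * bond_spin e \<sigma>) / (1 + t * (\<Sum>\<tau>\<in>?X. w \<tau> * bond_spin e \<tau>))"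
    by (simp add: w_def gibbs_weight_def)
  finally show ?thesis .
qed

lemma replica_avg_bond_expansion:
  assumes e: "e \<in> bonds N"
    and f: "\<And>l. set l \<subseteq> spin_configs N \<Longrightarrow> length l = n \<Longrightarrow> \<bar>f l\<bar> \<le> 1"
  shows "\<bar>replica_avg N (J(e := y)) n f - (\<Sum>(S, j)\<in>Pow {..<n} \<times> {..tilt_degree n}.
      tilt_coeff n j * tanh (y / sqrt N) ^ (card S + j) *
      replica_avg N (J(e := 0)) (n + j) (\<lambda>l. f (take n l) * (\<Prod>a\<in>S \<union> {n..<n + j}. bond_spin e (l ! a))))\<bar>
    \<le> tilt_const n * tanh (y / sqrt N) ^ 6"
proof -
  have t: "\<bar>tanh (y / sqrt N)\<bar> < 1" using tanh_real_bounds[of "y / sqrt N"] by (simp add: abs_less_iff)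
  have s: "\<bar>bond_spin e \<sigma>\<bar> \<le> 1" if "\<sigma> \<in> spin_configs N" for \<sigma> using bond_spin_values[OF that e] by auto
  have "replica_avg N (J(e := y)) n f = iid_avg (spin_configs N) (\<lambda>\<sigma>. gibbs_weight N (J(e := 0)) \<sigma> * (1 + tanh (y / sqrt N) * bond_spin e \<sigma>)
      / (1 + tanh (y / sqrt N) * (\<Sum>\<tau>\<in>spin_configs N. gibbs_weight N (J(e := 0)) \<tau> * bond_spin e \<tau>))) n f"
    unfolding replica_avg_def by (rule iid_avg_cong_weight) (rule gibbs_weight_bond[OF e])
  then show ?thesis unfolding replica_avg_def
    using iid_avg_tilt_expansion[OF finite_spin_configs gibbs_weight_nonneg gibbs_weight_sum s t f] by simp
qed

section \<open>Overlaps of several replicas\<close>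

definition multi_overlap :: "nat \<Rightarrow> nat set \<Rightarrow> (nat \<Rightarrow> real) list \<Rightarrow> real" where
  "multi_overlap N T l = (\<Sum>i=1..N. \<Prod>a\<in>T. (l ! a) i) / real N"

lemma bonds_Suc: "bonds (Suc N) = bonds N \<union> (\<lambda>i. (i, Suc N)) ` {1..N}"
  by (auto simp: bonds_def image_iff)

lemma sum_bonds_square:
  fixes \<tau> :: "nat \<Rightarrow> real"
  shows "2 * (\<Sum>(i, j)\<in>bonds N. \<tau> i * \<tau> j) = (\<Sum>i=1..N. \<tau> i)\<^sup>2 - (\<Sum>i=1..N. (\<tau> i)\<^sup>2)"
proof (induction N)
  case 0
  have "bonds 0 = {}" by (auto simp: bonds_def)
  then show ?case by simp
next
  case (Suc N)
  have "(\<Sum>(i, j)\<in>bonds (Suc N). \<tau> i * \<tau> j)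
      = (\<Sum>(i, j)\<in>bonds N. \<tau> i * \<tau> j) + (\<Sum>(i, j)\<in>(\<lambda>i. (i, Suc N)) ` {1..N}. \<tau> i * \<tau> j)"
    unfolding bonds_Suc by (rule sum.union_disjoint[OF finite_bonds]) (auto simp: bonds_def)
  also have "(\<Sum>(i, j)\<in>(\<lambda>i. (i, Suc N)) ` {1..N}. \<tau> i * \<tau> j) = (\<Sum>i=1..N. \<tau> i) * \<tau> (Suc N)"
    by (subst sum.reindex) (auto simp: inj_on_def sum_distrib_right)
  finally show ?case using Suc.IH by (simp add: power2_sum distrib_left)
qed

text \<open>
  With \<open>\<tau>\<^sub>i\<close> the product of the spins at site \<open>i\<close> over the replicas in \<open>T\<close>, the sum over bonds is
  \<open>((\<Sum>\<^sub>i \<tau>\<^sub>i)\<^sup>2 - N) / 2\<close>.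
\<close>

lemma sum_bond_spins:
  assumes l: "set l \<subseteq> spin_configs N" and T: "T \<subseteq> {..<length l}" and N: "0 < N"
  shows "(\<Sum>e\<in>bonds N. \<Prod>a\<in>T. bond_spin e (l ! a)) = ((real N)\<^sup>2 * (multi_overlap N T l)\<^sup>2 - real N) / 2"
proof -
  define \<tau> where "\<tau> i = (\<Prod>a\<in>T. (l ! a) i)" for i
  have "(\<tau> i)\<^sup>2 = 1" if "1 \<le> i" "i \<le> N" for i
  proof -
    have "((l ! a) i)\<^sup>2 = 1" if "a \<in> T" for a
    proof -
      have "l ! a \<in> spin_configs N" using l T that by (auto simp: subset_iff)
      then show ?thesis using spin_values[of "l ! a" N i] \<open>1 \<le> i\<close> \<open>i \<le> N\<close> by auto
    qed
    then show ?thesis unfolding \<tau>_def prod_power_distrib by simp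
  qed
  then have "(\<Sum>i=1..N. (\<tau> i)\<^sup>2) = real N" by simp
  moreover have "(\<Sum>e\<in>bonds N. \<Prod>a\<in>T. bond_spin e (l ! a)) = (\<Sum>(i, j)\<in>bonds N. \<tau> i * \<tau> j)"
    by (intro sum.cong) (auto simp: bond_spin_def \<tau>_def prod.distrib)
  moreover have "(real N)\<^sup>2 * (multi_overlap N T l)\<^sup>2 = (\<Sum>i=1..N. \<tau> i)\<^sup>2"
    using N by (simp add: multi_overlap_def \<tau>_def power_divide)
  ultimately show ?thesis using sum_bonds_square[of \<tau> N] by simp
qed

definition overlap4 :: "nat \<Rightarrow> (nat \<times> nat \<Rightarrow> real) \<Rightarrow> real" where
  "overlap4 N J = replica_avg N J 2 (\<lambda>l. (overlap N (l ! 0) (l ! 1)) ^ 4)"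

lemma multi_overlap_pair: "multi_overlap N {0, 1} l = overlap N (l ! 0) (l ! 1)"
  by (simp add: multi_overlap_def overlap_def)

lemma sum_power4:
  fixes \<tau> :: "'a \<Rightarrow> real"
  shows "(\<Sum>i\<in>I. \<tau> i) ^ 4 = (\<Sum>i\<in>I. \<Sum>j\<in>I. \<Sum>k\<in>I. \<Sum>m\<in>I. \<tau> i * \<tau> j * \<tau> k * \<tau> m)"
  by (simp only: sum_distrib_left[symmetric] sum_distrib_right[symmetric]) (simp add: eval_nat_numeral)

lemma multi_overlap_power4_avg:
  assumes T: "T \<subseteq> {..<n}"
  shows "replica_avg N J n (\<lambda>l. multi_overlap N T l ^ 4)
    = (1 / real N ^ 4) * (\<Sum>i=1..N. \<Sum>j=1..N. \<Sum>k=1..N. \<Sum>m=1..N.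
        (\<Sum>\<sigma>\<in>spin_configs N. gibbs_weight N J \<sigma> * (\<sigma> i * \<sigma> j * \<sigma> k * \<sigma> m)) ^ card T)"
proof -
  have "replica_avg N J n (\<lambda>l. multi_overlap N T l ^ 4)
    = replica_avg N J n (\<lambda>l. (1 / real N ^ 4) * (\<Sum>i=1..N. \<Sum>j=1..N. \<Sum>k=1..N. \<Sum>m=1..N.
        \<Prod>a\<in>T. (l ! a) i * (l ! a) j * (l ! a) k * (l ! a) m))"
    by (simp add: multi_overlap_def power_divide sum_power4 prod.distrib)
  also have "\<dots> = (1 / real N ^ 4) * (\<Sum>i=1..N. \<Sum>j=1..N. \<Sum>k=1..N. \<Sum>m=1..N.
        replica_avg N J n (\<lambda>l. \<Prod>a\<in>T. (\<lambda>\<sigma>. \<sigma> i * \<sigma> j * \<sigma> k * \<sigma> m) (l ! a)))"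
    unfolding replica_avg_def by (simp only: iid_avg_cmult iid_avg_sum)
  also have "\<dots> = (1 / real N ^ 4) * (\<Sum>i=1..N. \<Sum>j=1..N. \<Sum>k=1..N. \<Sum>m=1..N.
        (\<Sum>\<sigma>\<in>spin_configs N. gibbs_weight N J \<sigma> * (\<sigma> i * \<sigma> j * \<sigma> k * \<sigma> m)) ^ card T)"
  proof -
    have "replica_avg N J n (\<lambda>l. \<Prod>a\<in>T. (\<lambda>\<sigma>. \<sigma> i * \<sigma> j * \<sigma> k * \<sigma> m) (l ! a))
        = (\<Sum>\<sigma>\<in>spin_configs N. gibbs_weight N J \<sigma> * (\<sigma> i * \<sigma> j * \<sigma> k * \<sigma> m)) ^ card T" for i j k m
      unfolding replica_avg_def by (rule iid_avg_prod_subset[OF finite_spin_configs gibbs_weight_sum T])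
    then show ?thesis by (simp only:)
  qed
  finally show ?thesis .
qed

text \<open>
  Expanding the power, \<open>\<langle>R\<^sub>T\<^sup>4\<rangle>\<close> is the average over four sites of \<open>\<langle>\<sigma>\<^sub>i \<sigma>\<^sub>j \<sigma>\<^sub>k \<sigma>\<^sub>m\<rangle>\<close> raised to the number of
  replicas in \<open>T\<close>. The correlations are at most one in absolute value, so two replicas give the
  largest value.
\<close>

lemma multi_overlap_power4_le:
  assumes T: "T \<subseteq> {..<n}" "2 \<le> card T"
  shows "replica_avg N J n (\<lambda>l. multi_overlap N T l ^ 4) \<le> overlap4 N J"
proof -
  have "overlap4 N J = replica_avg N J 2 (\<lambda>l. multi_overlap N {0, 1} l ^ 4)"
    unfolding overlap4_def multi_overlap_pair ..
  also have "\<dots> = (1 / real N ^ 4) * (\<Sum>i=1..N. \<Sum>j=1..N. \<Sum>k=1..N. \<Sum>m=1..N.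
        (\<Sum>\<sigma>\<in>spin_configs N. gibbs_weight N J \<sigma> * (\<sigma> i * \<sigma> j * \<sigma> k * \<sigma> m)) ^ card {0, 1::nat})"
    by (rule multi_overlap_power4_avg) auto
  finally have o: "overlap4 N J = \<dots>" .
  show ?thesis unfolding o multi_overlap_power4_avg[OF T(1)]
  proof (intro mult_left_mono sum_mono)
    fix i j k m assume ijkm: "i \<in> {1..N}" "j \<in> {1..N}" "k \<in> {1..N}" "m \<in> {1..N}"
    let ?q = "\<Sum>\<sigma>\<in>spin_configs N. gibbs_weight N J \<sigma> * (\<sigma> i * \<sigma> j * \<sigma> k * \<sigma> m)"
    have "\<bar>\<sigma> i * \<sigma> j * \<sigma> k * \<sigma> m\<bar> = 1" if "\<sigma> \<in> spin_configs N" for \<sigma>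
    proof -
      have "\<bar>\<sigma> i\<bar> = 1" if "i \<in> {1..N}" for i using spin_values[OF \<open>\<sigma> \<in> spin_configs N\<close>, of i] that by auto
      then show ?thesis using ijkm by (simp add: abs_mult)
    qed
    then have "\<bar>?q\<bar> \<le> (\<Sum>\<sigma>\<in>spin_configs N. gibbs_weight N J \<sigma> * 1)"
      using gibbs_weight_nonneg[of N J] by (intro order_trans[OF sum_abs] sum_mono) (auto simp: abs_mult simp del: mult_1_right)
    then have q: "\<bar>?q\<bar> \<le> 1" using gibbs_weight_sum[of N J] by simp
    have "?q ^ card T \<le> \<bar>?q\<bar> ^ card T" by (simp add: power_abs[symmetric])
    also have "\<dots> \<le> \<bar>?q\<bar> ^ 2" by (rule power_decreasing[OF T(2)]) (use q in auto)
    finally show "?q ^ card T \<le> ?q ^ card {0, 1::nat}" by (simp add: numeral_2_eq_2)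
  qed simp
qed

lemma multi_overlap_abs_le:
  assumes l: "set l \<subseteq> spin_configs N" and T: "T \<subseteq> {..<length l}"
  shows "\<bar>multi_overlap N T l\<bar> \<le> 1"
proof -
  have "\<bar>\<Prod>a\<in>T. (l ! a) i\<bar> = 1" if "i \<in> {1..N}" for i
  proof -
    have "\<bar>(l ! a) i\<bar> = 1" if "a \<in> T" for a
    proof -
      have "l ! a \<in> spin_configs N" using l T that by (auto simp: subset_iff)
      then show ?thesis using spin_values[of "l ! a" N i] \<open>i \<in> {1..N}\<close> by auto
    qed
    then show ?thesis by (simp add: abs_prod)
  qed
  then have "\<bar>\<Sum>i=1..N. \<Prod>a\<in>T. (l ! a) i\<bar> \<le> (\<Sum>i=1..N. 1)"
    by (intro order_trans[OF sum_abs] sum_mono) auto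
  then show ?thesis by (cases "N = 0") (auto simp: multi_overlap_def)
qed

section \<open>Interpolation between two product laws\<close>

lemma measurable_update:
  fixes F :: "('i \<Rightarrow> real) \<Rightarrow> real"
  assumes "F \<in> borel_measurable (\<Pi>\<^sub>M i\<in>insert e I. borel)"
  shows "(\<lambda>(x, y). F (x(e := y))) \<in> borel_measurable ((\<Pi>\<^sub>M i\<in>I. borel) \<Otimes>\<^sub>M (borel :: real measure))"
  using measurable_compose[OF measurable_add_dim assms] by (simp add: case_prod_beta)

lemma integral_update_measurable:
  fixes F :: "('i \<Rightarrow> real) \<Rightarrow> real"
  assumes "F \<in> borel_measurable (\<Pi>\<^sub>M i\<in>insert e I. borel)" "prob_space M" "sets M = sets (borel :: real measure)"
  shows "(\<lambda>x. \<integral>y. F (x(e := y)) \<partial>M) \<in> borel_measurable (\<Pi>\<^sub>M i\<in>I. borel)"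
proof -
  interpret prob_space M by fact
  have s: "sets ((\<Pi>\<^sub>M i\<in>I. borel) \<Otimes>\<^sub>M M) = sets ((\<Pi>\<^sub>M i\<in>I. borel) \<Otimes>\<^sub>M (borel :: real measure))"
    using assms(3) by (intro sets_pair_measure_cong) auto
  have "(\<lambda>(x, y). F (x(e := y))) \<in> borel_measurable ((\<Pi>\<^sub>M i\<in>I. borel) \<Otimes>\<^sub>M M)"
    using measurable_update[OF assms(1)] measurable_cong_sets[OF s refl] by blast
  then show ?thesis by (rule borel_measurable_lebesgue_integral)
qed

lemma update_section_measurable:
  fixes F :: "('i \<Rightarrow> real) \<Rightarrow> real"
  assumes "F \<in> borel_measurable (\<Pi>\<^sub>M i\<in>insert e I. borel)" "x \<in> space (\<Pi>\<^sub>M i\<in>I. borel)"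
  shows "(\<lambda>y. F (x(e := y))) \<in> borel_measurable (borel :: real measure)"
  using measurable_compose[OF measurable_Pair1'[OF assms(2)] measurable_update[OF assms(1)]] by simp

lemma integral_abs_le_const:
  fixes f :: "'b \<Rightarrow> real"
  assumes "prob_space M" "f \<in> borel_measurable M" "\<And>x. \<bar>f x\<bar> \<le> (c::real)"
  shows "\<bar>\<integral>x. f x \<partial>M\<bar> \<le> c" "integrable M f"
proof -
  interpret prob_space M by fact
  show i: "integrable M f" by (rule integrable_const_bound[where B=c]) (use assms in auto)
  have "\<bar>\<integral>x. f x \<partial>M\<bar> \<le> (\<integral>x. \<bar>f x\<bar> \<partial>M)" by (rule integral_abs_bound)
  also have "\<dots> \<le> (\<integral>x. c \<partial>M)" using i assms(3) by (intro integral_mono) auto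
  finally show "\<bar>\<integral>x. f x \<partial>M\<bar> \<le> c" by (simp add: prob_space)
qed

lemma integral_update_abs_le:
  fixes F :: "('i \<Rightarrow> real) \<Rightarrow> real"
  assumes M: "prob_space M" and c: "\<And>x. \<bar>F x\<bar> \<le> c"
  shows "\<bar>\<integral>y. F (x(e := y)) \<partial>M\<bar> \<le> c"
proof (cases "integrable M (\<lambda>y. F (x(e := y)))")
  case True
  then show ?thesis using integral_abs_le_const(1)[OF M _ c] by auto
next
  case False
  have "0 \<le> c" using c[of undefined] by linarith
  with False show ?thesis by (simp add: not_integrable_integral_eq)
qed

text \<open>
  The law \<open>(1 - p) A + p B\<close>.
\<close>

definition mix :: "real \<Rightarrow> real measure \<Rightarrow> real measure \<Rightarrow> real measure" where
  "mix p A B = measure_pmf (bernoulli_pmf p) \<bind> (\<lambda>b. if b then B else A)"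

definition mix_expect :: "real measure \<Rightarrow> real measure \<Rightarrow> 'i set \<Rightarrow> (('i \<Rightarrow> real) \<Rightarrow> real) \<Rightarrow> real \<Rightarrow> real" where
  "mix_expect A B I F p = (\<integral>x. F x \<partial>(\<Pi>\<^sub>M i\<in>I. mix p A B))"

text \<open>
  The contribution of coordinate \<open>e\<close> to the derivative along the mixture.
\<close>

definition swap_gain :: "real measure \<Rightarrow> real measure \<Rightarrow> 'i \<Rightarrow> (('i \<Rightarrow> real) \<Rightarrow> real) \<Rightarrow> ('i \<Rightarrow> real) \<Rightarrow> real" where
  "swap_gain A B e F x = (\<integral>y. F (x(e := y)) \<partial>B) - (\<integral>y. F (x(e := y)) \<partial>A)"

context
  fixes A B :: "real measure"
  assumes A: "prob_space A" "sets A = sets borel" and B: "prob_space B" "sets B = sets borel"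
begin

lemma mix_kernel: "(\<lambda>b. if b then B else A) \<in> measure_pmf (bernoulli_pmf p) \<rightarrow>\<^sub>M subprob_algebra borel"
  unfolding measurable_pmf_measure1 using A B by (auto simp: space_subprob_algebra prob_space_imp_subprob_space)

lemma sets_mix: "sets (mix p A B) = sets borel"
  unfolding mix_def by (rule sets_bind[OF _ ]) (use A B in auto)

lemma mix_prob_space: "prob_space (mix p A B)"
  unfolding mix_def
  by (rule prob_space.prob_space_bind[OF measure_pmf.prob_space_axioms _ mix_kernel]) (use A B in auto)

lemma mix_integral:
  fixes f :: "real \<Rightarrow> real"
  assumes f: "f \<in> borel_measurable borel" and c: "\<And>x. \<bar>f x\<bar> \<le> c" and p: "0 \<le> p" "p \<le> 1"
  shows "(\<integral>x. f x \<partial>mix p A B) = p * (\<integral>x. f x \<partial>B) + (1 - p) * (\<integral>x. f x \<partial>A)"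
proof -
  have "(\<integral>x. f x \<partial>mix p A B) = (\<integral>b. (\<integral>x. f x \<partial>(if b then B else A)) \<partial>measure_pmf (bernoulli_pmf p))"
    unfolding mix_def
    by (rule integral_bind[OF f, where B'=1 and B=c])
      (use c A B mix_kernel in \<open>auto simp: prob_space.emeasure_space_1 intro: measure_pmf.finite_measure_axioms\<close>)
  also have "\<dots> = p * (\<integral>x. f x \<partial>B) + (1 - p) * (\<integral>x. f x \<partial>A)"
    by (subst integral_bernoulli_pmf[OF p]) (simp add: mult.commute)
  finally show ?thesis .
qed

lemma mix_ends: "mix 0 A B = A" "mix 1 A B = B"
proof -
  interpret A: prob_space A by fact
  interpret B: prob_space B by fact
  interpret M0: prob_space "mix 0 A B" by (rule mix_prob_space)
  interpret M1: prob_space "mix 1 A B" by (rule mix_prob_space)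
  show "mix 0 A B = A"
  proof (rule measure_eqI)
    fix X assume "X \<in> sets (mix 0 A B)"
    then have X: "X \<in> sets borel" by (simp add: sets_mix)
    have "measure (mix 0 A B) X = (\<integral>x. indicator X x \<partial>mix 0 A B)" using X by (simp add: sets_mix sets_eq_imp_space_eq[OF sets_mix])
    also have "\<dots> = (\<integral>x. indicator X x \<partial>A)" by (subst mix_integral[where c=1]) (use X in \<open>auto simp: indicator_def\<close>)
    also have "\<dots> = measure A X" using X A by (simp add: sets_eq_imp_space_eq[OF A(2)])
    finally show "emeasure (mix 0 A B) X = emeasure A X" by (simp add: M0.emeasure_eq_measure A.emeasure_eq_measure)
  qed (simp add: sets_mix A)
  show "mix 1 A B = B"
  proof (rule measure_eqI)
    fix X assume "X \<in> sets (mix 1 A B)"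
    then have X: "X \<in> sets borel" by (simp add: sets_mix)
    have "measure (mix 1 A B) X = (\<integral>x. indicator X x \<partial>mix 1 A B)" using X by (simp add: sets_mix sets_eq_imp_space_eq[OF sets_mix])
    also have "\<dots> = (\<integral>x. indicator X x \<partial>B)" by (subst mix_integral[where c=1]) (use X in \<open>auto simp: indicator_def\<close>)
    also have "\<dots> = measure B X" using X B by (simp add: sets_eq_imp_space_eq[OF B(2)])
    finally show "emeasure (mix 1 A B) X = emeasure B X" by (simp add: M1.emeasure_eq_measure B.emeasure_eq_measure)
  qed (simp add: sets_mix B)
qed

lemma sets_PiM_mix: "sets (\<Pi>\<^sub>M i\<in>I. mix p A B) = sets (\<Pi>\<^sub>M i\<in>I. borel)"
  by (rule sets_PiM_cong) (auto simp: sets_mix)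

lemma PiM_mix_prob_space: "prob_space (\<Pi>\<^sub>M i\<in>I. mix p A B)"
  by (rule prob_space_PiM) (rule mix_prob_space)

lemma PiM_mix_integrable:
  fixes F :: "('i \<Rightarrow> real) \<Rightarrow> real"
  assumes "F \<in> borel_measurable (\<Pi>\<^sub>M i\<in>I. borel)" "\<And>x. \<bar>F x\<bar> \<le> c"
  shows "integrable (\<Pi>\<^sub>M i\<in>I. mix p A B) F"
proof -
  interpret prob_space "\<Pi>\<^sub>M i\<in>I. mix p A B" by (rule PiM_mix_prob_space)
  have "F \<in> borel_measurable (\<Pi>\<^sub>M i\<in>I. mix p A B)"
    using assms(1) measurable_cong_sets[OF sets_PiM_mix refl] by blast
  then show ?thesis by (intro integrable_const_bound[where B=c]) (use assms(2) in auto)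
qed

lemma mix_expect_insert:
  fixes F :: "('i \<Rightarrow> real) \<Rightarrow> real"
  assumes I: "finite I" "e \<notin> I" and F: "F \<in> borel_measurable (\<Pi>\<^sub>M i\<in>insert e I. borel)" and c: "\<And>x. \<bar>F x\<bar> \<le> c"
  shows "mix_expect A B (insert e I) F p = mix_expect A B I (\<lambda>x. \<integral>y. F (x(e := y)) \<partial>mix p A B) p"
proof -
  interpret product_sigma_finite "\<lambda>_. mix p A B"
    by (rule product_sigma_finite.intro) (rule prob_space_imp_sigma_finite[OF mix_prob_space])
  show ?thesis unfolding mix_expect_def
    by (rule product_integral_insert[OF I PiM_mix_integrable[OF F c]])
qed

lemma mix_expect_cong:
  assumes "\<And>x. x \<in> space (\<Pi>\<^sub>M i\<in>I. (borel :: real measure)) \<Longrightarrow> F x = G x"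
  shows "mix_expect A B I F p = mix_expect A B I G p"
  unfolding mix_expect_def using assms sets_eq_imp_space_eq[OF sets_PiM_mix]
  by (intro Bochner_Integration.integral_cong) auto

lemma mix_expect_add:
  fixes F G :: "('i \<Rightarrow> real) \<Rightarrow> real"
  assumes "F \<in> borel_measurable (\<Pi>\<^sub>M i\<in>I. borel)" "\<And>x. \<bar>F x\<bar> \<le> c"
    and "G \<in> borel_measurable (\<Pi>\<^sub>M i\<in>I. borel)" "\<And>x. \<bar>G x\<bar> \<le> c'"
  shows "mix_expect A B I (\<lambda>x. a * F x + b * G x) p = a * mix_expect A B I F p + b * mix_expect A B I G p"
  unfolding mix_expect_def using PiM_mix_integrable[OF assms(1,2)] PiM_mix_integrable[OF assms(3,4)] by simp

lemma mix_expect_insert_split: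
  fixes F :: "('i \<Rightarrow> real) \<Rightarrow> real"
  assumes I: "finite I" "e \<notin> I" and F: "F \<in> borel_measurable (\<Pi>\<^sub>M i\<in>insert e I. borel)" and c: "\<And>x. \<bar>F x\<bar> \<le> c"
    and p: "0 \<le> p" "p \<le> 1"
  shows "mix_expect A B (insert e I) F p
    = p * mix_expect A B I (\<lambda>x. \<integral>y. F (x(e := y)) \<partial>B) p + (1 - p) * mix_expect A B I (\<lambda>x. \<integral>y. F (x(e := y)) \<partial>A) p"
proof -
  have "mix_expect A B (insert e I) F p = mix_expect A B I (\<lambda>x. \<integral>y. F (x(e := y)) \<partial>mix p A B) p"
    by (rule mix_expect_insert[OF I F c])
  also have "\<dots> = mix_expect A B I (\<lambda>x. p * (\<integral>y. F (x(e := y)) \<partial>B) + (1 - p) * (\<integral>y. F (x(e := y)) \<partial>A)) p"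
    by (rule mix_expect_cong) (rule mix_integral[OF update_section_measurable[OF F] c p])
  also have "\<dots> = p * mix_expect A B I (\<lambda>x. \<integral>y. F (x(e := y)) \<partial>B) p + (1 - p) * mix_expect A B I (\<lambda>x. \<integral>y. F (x(e := y)) \<partial>A) p"
    by (rule mix_expect_add[OF integral_update_measurable[OF F B] integral_update_abs_le[OF B(1) c]
          integral_update_measurable[OF F A] integral_update_abs_le[OF A(1) c]])
  finally show ?thesis .
qed

lemma swap_gain_measurable:
  fixes F :: "('i \<Rightarrow> real) \<Rightarrow> real"
  assumes "e \<in> I" "F \<in> borel_measurable (\<Pi>\<^sub>M i\<in>I. borel)"
  shows "swap_gain A B e F \<in> borel_measurable (\<Pi>\<^sub>M i\<in>I. borel)"
proof -
  have F: "F \<in> borel_measurable (\<Pi>\<^sub>M i\<in>insert e I. borel)" using assms by (simp add: insert_absorb)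
  show ?thesis unfolding swap_gain_def[abs_def]
    by (intro borel_measurable_diff integral_update_measurable[OF F A] integral_update_measurable[OF F B])
qed

lemma swap_gain_abs_le:
  fixes F :: "('i \<Rightarrow> real) \<Rightarrow> real"
  assumes c: "\<And>x. \<bar>F x\<bar> \<le> c"
  shows "\<bar>swap_gain A B e F x\<bar> \<le> 2 * c"
  using integral_update_abs_le[OF A(1), of F c x e] integral_update_abs_le[OF B(1), of F c x e] c
  unfolding swap_gain_def by fastforce

text \<open>
  Integrating out one coordinate commutes with resampling another one, by Fubini.
\<close>

lemma swap_gain_integral_update:
  fixes F :: "('i \<Rightarrow> real) \<Rightarrow> real"
  assumes M: "prob_space M" "sets M = sets borel" and e: "e \<in> I" "i \<notin> I"
    and F: "F \<in> borel_measurable (\<Pi>\<^sub>M i\<in>insert i I. borel)" and c: "\<And>x. \<bar>F x\<bar> \<le> c"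
    and x: "x \<in> space (\<Pi>\<^sub>M i\<in>I. (borel :: real measure))"
  shows "(\<integral>y. swap_gain A B e F (x(i := y)) \<partial>M) = swap_gain A B e (\<lambda>x. \<integral>y. F (x(i := y)) \<partial>M) x"
proof -
  have ie: "i \<noteq> e" using e by auto
  have two: "(\<lambda>(y, z). F ((x(i := y))(e := z))) \<in> borel_measurable (borel \<Otimes>\<^sub>M (borel :: real measure))"
  proof -
    have "(\<lambda>q. ((x(i := fst q))(e := snd q))) \<in> measurable (borel \<Otimes>\<^sub>M borel) (\<Pi>\<^sub>M i\<in>insert i I. (borel :: real measure))"
    proof (rule measurable_fun_upd[where J="insert i I"])
      show "insert i I = insert i I \<union> {e}" using e by auto
      show "(\<lambda>q. x(i := fst q)) \<in> measurable (borel \<Otimes>\<^sub>M borel) (\<Pi>\<^sub>M i\<in>insert i I. (borel :: real measure))"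
        by (rule measurable_fun_upd[where J=I]) (use x in auto)
    qed auto
    from measurable_compose[OF this F] show ?thesis by (simp add: case_prod_beta)
  qed
  have swap: "(\<integral>y. (\<integral>z. F ((x(i := y))(e := z)) \<partial>C) \<partial>M) = (\<integral>z. (\<integral>y. F ((x(e := z))(i := y)) \<partial>M) \<partial>C)"
    "integrable M (\<lambda>y. \<integral>z. F ((x(i := y))(e := z)) \<partial>C)"
    if C: "prob_space C" "sets C = sets borel" for C :: "real measure"
  proof -
    interpret M: prob_space M by fact
    interpret C: prob_space C by fact
    interpret MC: pair_prob_space M C ..
    have s: "sets (M \<Otimes>\<^sub>M C) = sets (borel \<Otimes>\<^sub>M (borel :: real measure))"
      using M C by (intro sets_pair_measure_cong) auto
    have m: "(\<lambda>(y, z). F ((x(i := y))(e := z))) \<in> borel_measurable (M \<Otimes>\<^sub>M C)"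
      using two measurable_cong_sets[OF s refl] by blast
    have int: "integrable (M \<Otimes>\<^sub>M C) (\<lambda>(y, z). F ((x(i := y))(e := z)))"
      by (rule MC.P.integrable_const_bound[where B=c]) (use m c in \<open>auto simp: case_prod_beta\<close>)
    from MC.Fubini_integral[OF int]
    show "(\<integral>y. (\<integral>z. F ((x(i := y))(e := z)) \<partial>C) \<partial>M) = (\<integral>z. (\<integral>y. F ((x(e := z))(i := y)) \<partial>M) \<partial>C)"
      by (simp add: fun_upd_twist[OF ie])
    show "integrable M (\<lambda>y. \<integral>z. F ((x(i := y))(e := z)) \<partial>C)"
      using MC.integrable_fst'[OF int] by simp
  qed
  show ?thesis unfolding swap_gain_def using swap[OF A] swap[OF B] by simp
qed

text \<open>
  The expectation is a polynomial in \<open>p\<close>, affine in the law of each coordinate. Induction on the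
  number of coordinates splits off one factor at a time; the derivative is one-sided at the ends of the unit
  interval, where the mixture stops being a probability law.
\<close>

lemma mix_expect_deriv:
  fixes F :: "('i \<Rightarrow> real) \<Rightarrow> real"
  assumes "finite I" "F \<in> borel_measurable (\<Pi>\<^sub>M i\<in>I. borel)" "\<And>x. \<bar>F x\<bar> \<le> c" "0 \<le> p" "p \<le> 1"
  shows "(mix_expect A B I F has_real_derivative (\<Sum>e\<in>I. mix_expect A B I (swap_gain A B e F) p)) (at p within {0..1})"
  using assms(1,2,3)
proof (induction I arbitrary: F c rule: finite_induct)
  case empty
  have "mix_expect A B {} F = (\<lambda>_. F (\<lambda>_. undefined))"
    by (rule ext) (simp add: mix_expect_def PiM_empty lebesgue_integral_count_space_finite)
  then show ?case by simp
next
  case (insert i I)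
  note F = insert.prems(1) and c = insert.prems(2)
  let ?FB = "\<lambda>x. \<integral>y. F (x(i := y)) \<partial>B" and ?FA = "\<lambda>x. \<integral>y. F (x(i := y)) \<partial>A"
  have m: "?FB \<in> borel_measurable (\<Pi>\<^sub>M i\<in>I. borel)" "?FA \<in> borel_measurable (\<Pi>\<^sub>M i\<in>I. borel)"
    by (rule integral_update_measurable[OF F B] integral_update_measurable[OF F A])+
  have b: "\<bar>?FB x\<bar> \<le> c" "\<bar>?FA x\<bar> \<le> c" for x
    by (rule integral_update_abs_le[OF B(1), of F, OF c] integral_update_abs_le[OF A(1), of F, OF c])+
  let ?dB = "\<Sum>e\<in>I. mix_expect A B I (swap_gain A B e ?FB) p" and ?dA = "\<Sum>e\<in>I. mix_expect A B I (swap_gain A B e ?FA) p"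
  have dB: "(mix_expect A B I ?FB has_real_derivative ?dB) (at p within {0..1})" by (rule insert.IH[OF m(1) b(1)])
  have dA: "(mix_expect A B I ?FA has_real_derivative ?dA) (at p within {0..1})" by (rule insert.IH[OF m(2) b(2)])
  have split: "mix_expect A B (insert i I) F q = q * mix_expect A B I ?FB q + (1 - q) * mix_expect A B I ?FA q"
    if "q \<in> {0..1}" for q
    by (rule mix_expect_insert_split[OF insert.hyps F c]) (use that in auto)
  have "((\<lambda>q. q * mix_expect A B I ?FB q + (1 - q) * mix_expect A B I ?FA q) has_real_derivative
      (mix_expect A B I ?FB p + p * ?dB + (- mix_expect A B I ?FA p + (1 - p) * ?dA))) (at p within {0..1})"
    by (rule derivative_eq_intros dB dA refl | simp)+
  then have deriv: "(mix_expect A B (insert i I) F has_real_derivative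
      (mix_expect A B I ?FB p + p * ?dB + (- mix_expect A B I ?FA p + (1 - p) * ?dA))) (at p within {0..1})"
    by (rule has_field_derivative_transform_within[where d=1]) (use split assms(4,5) in auto)
  have gi: "mix_expect A B (insert i I) (swap_gain A B i F) p = mix_expect A B I ?FB p - mix_expect A B I ?FA p"
  proof -
    have "swap_gain A B i F \<in> borel_measurable (\<Pi>\<^sub>M i\<in>insert i I. borel)" by (rule swap_gain_measurable[OF _ F]) simp
    then have "mix_expect A B (insert i I) (swap_gain A B i F) p
        = mix_expect A B I (\<lambda>x. \<integral>y. swap_gain A B i F (x(i := y)) \<partial>mix p A B) p"
      by (rule mix_expect_insert[OF insert.hyps _ swap_gain_abs_le[OF c]])
    also have "\<dots> = mix_expect A B I (\<lambda>x. 1 * ?FB x + (-1) * ?FA x) p"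
      using prob_space.prob_space[OF mix_prob_space] by (intro mix_expect_cong) (simp add: swap_gain_def)
    also have "\<dots> = 1 * mix_expect A B I ?FB p + (-1) * mix_expect A B I ?FA p"
      by (rule mix_expect_add[OF m(1) b(1) m(2) b(2)])
    finally show ?thesis by simp
  qed
  have ge: "mix_expect A B (insert i I) (swap_gain A B e F) p
      = p * mix_expect A B I (swap_gain A B e ?FB) p + (1 - p) * mix_expect A B I (swap_gain A B e ?FA) p" if e: "e \<in> I" for e
  proof -
    have me: "swap_gain A B e F \<in> borel_measurable (\<Pi>\<^sub>M i\<in>insert i I. borel)"
      by (rule swap_gain_measurable[OF _ F]) (use e in simp)
    have "mix_expect A B (insert i I) (swap_gain A B e F) p
      = p * mix_expect A B I (\<lambda>x. \<integral>y. swap_gain A B e F (x(i := y)) \<partial>B) p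
        + (1 - p) * mix_expect A B I (\<lambda>x. \<integral>y. swap_gain A B e F (x(i := y)) \<partial>A) p"
      by (rule mix_expect_insert_split[OF insert.hyps me swap_gain_abs_le[OF c] assms(4,5)])
    also have "mix_expect A B I (\<lambda>x. \<integral>y. swap_gain A B e F (x(i := y)) \<partial>B) p = mix_expect A B I (swap_gain A B e ?FB) p"
      by (rule mix_expect_cong) (rule swap_gain_integral_update[OF B e insert.hyps(2) F c])
    also have "mix_expect A B I (\<lambda>x. \<integral>y. swap_gain A B e F (x(i := y)) \<partial>A) p = mix_expect A B I (swap_gain A B e ?FA) p"
      by (rule mix_expect_cong) (rule swap_gain_integral_update[OF A e insert.hyps(2) F c])
    finally show ?thesis .
  qed
  have "(\<Sum>e\<in>insert i I. mix_expect A B (insert i I) (swap_gain A B e F) p)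
      = mix_expect A B I ?FB p + p * ?dB + (- mix_expect A B I ?FA p + (1 - p) * ?dA)"
    using insert.hyps by (simp add: gi ge sum.distrib sum_distrib_left)
  then show ?case using deriv by simp
qed

text \<open>
  A coordinate may be resampled from its own law. This relates averages with a coupling removed to averages with
  that coupling present.
\<close>

lemma mix_expect_resample:
  fixes F :: "('i \<Rightarrow> real) \<Rightarrow> real"
  assumes I: "finite I" "e \<in> I" and F: "F \<in> borel_measurable (\<Pi>\<^sub>M i\<in>I. borel)" and c: "\<And>x. \<bar>F x\<bar> \<le> c"
  shows "mix_expect A B I F p = mix_expect A B I (\<lambda>x. \<integral>y. F (x(e := y)) \<partial>mix p A B) p"
proof -
  let ?I = "I - {e}"
  have II: "insert e ?I = I" using I by auto
  have F': "F \<in> borel_measurable (\<Pi>\<^sub>M i\<in>insert e ?I. borel)" "F \<in> borel_measurable (\<Pi>\<^sub>M i\<in>insert e I. borel)"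
    using F I by (auto simp: II insert_absorb)
  let ?G = "\<lambda>x. \<integral>y. F (x(e := y)) \<partial>mix p A B"
  have G: "?G \<in> borel_measurable (\<Pi>\<^sub>M i\<in>insert e ?I. borel)"
    unfolding II by (rule integral_update_measurable[OF F'(2) mix_prob_space sets_mix])
  have "mix_expect A B (insert e ?I) F p = mix_expect A B ?I ?G p"
    by (rule mix_expect_insert[OF _ _ F'(1) c]) (use I in auto)
  moreover have "mix_expect A B (insert e ?I) ?G p = mix_expect A B ?I (\<lambda>x. \<integral>y. ?G (x(e := y)) \<partial>mix p A B) p"
    by (rule mix_expect_insert[OF _ _ G integral_update_abs_le[OF mix_prob_space c]]) (use I in auto)
  moreover have "(\<lambda>x. \<integral>y. ?G (x(e := y)) \<partial>mix p A B) = ?G"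
    using prob_space.prob_space[OF mix_prob_space] by simp
  ultimately show ?thesis unfolding II by simp
qed

end

section \<open>Moments of the disorder\<close>

text \<open>
  The properties of the disorder on which the comparison rests; \<open>\<kappa>\<close> bounds the moments uniformly over
  the two laws that are compared.
\<close>

definition disorder :: "real \<Rightarrow> real measure \<Rightarrow> bool" where
  "disorder \<kappa> \<nu> \<longleftrightarrow> prob_space \<nu> \<and> sets \<nu> = sets borel \<and> distr \<nu> borel uminus = \<nu> \<and>
     integrable \<nu> (\<lambda>y. y ^ 2) \<and> integrable \<nu> (\<lambda>y. y ^ 4) \<and> integrable \<nu> (\<lambda>y. y ^ 6) \<and>
     (\<integral>y. y ^ 2 \<partial>\<nu>) = 1 \<and> (\<integral>y. y ^ 4 \<partial>\<nu>) \<le> \<kappa> \<and> (\<integral>y. y ^ 6 \<partial>\<nu>) \<le> \<kappa>"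

lemma tanh_cubic_bounds:
  fixes z :: real
  assumes "0 \<le> z"
  shows "tanh z \<le> z" "z - z ^ 3 / 3 \<le> tanh z"
proof -
  have "tanh 0 - 0 \<ge> tanh z - z"
  proof (rule DERIV_nonpos_imp_nonincreasing[OF assms])
    fix x :: real
    show "\<exists>y. ((\<lambda>z. tanh z - z) has_real_derivative y) (at x) \<and> y \<le> 0"
      by (rule exI[of _ "- (tanh x)\<^sup>2"]) (auto intro!: derivative_eq_intros)
  qed
  then show le: "tanh z \<le> z" by simp
  have "tanh z - (z - z ^ 3 / 3) \<ge> tanh 0 - (0 - 0 ^ 3 / 3)"
  proof (rule DERIV_nonneg_imp_nondecreasing[OF assms])
    fix x :: real assume x: "0 \<le> x"
    have "tanh 0 - 0 \<ge> tanh x - x"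
    proof (rule DERIV_nonpos_imp_nonincreasing[OF x])
      fix x :: real
      show "\<exists>y. ((\<lambda>z. tanh z - z) has_real_derivative y) (at x) \<and> y \<le> 0"
        by (rule exI[of _ "- (tanh x)\<^sup>2"]) (auto intro!: derivative_eq_intros)
    qed
    then have "(tanh x)\<^sup>2 \<le> x\<^sup>2" using x by (intro power_mono) auto
    then show "\<exists>y. ((\<lambda>z. tanh z - (z - z ^ 3 / 3)) has_real_derivative y) (at x) \<and> 0 \<le> y"
      by (intro exI[of _ "x\<^sup>2 - (tanh x)\<^sup>2"] conjI) (auto intro!: derivative_eq_intros)
  qed
  then show "z - z ^ 3 / 3 \<le> tanh z" by simp
qed

lemma abs_tanh_le: "\<bar>tanh z\<bar> \<le> \<bar>z::real\<bar>"
  using tanh_cubic_bounds(1)[of "\<bar>z\<bar>"] by (simp add: tanh_real_abs)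

text \<open>
  Equality of the variances of the couplings survives the passage to \<open>tanh\<close> up to fourth order.
\<close>

lemma tanh_square_bounds: "(tanh z)\<^sup>2 \<le> z\<^sup>2" "z\<^sup>2 - (tanh z)\<^sup>2 \<le> (z::real) ^ 4"
proof -
  show "(tanh z)\<^sup>2 \<le> z\<^sup>2" using abs_tanh_le by (simp add: abs_le_square_iff)
  let ?a = "\<bar>z\<bar>" and ?t = "tanh \<bar>z\<bar>"
  have t: "0 \<le> ?t" "?t \<le> ?a" "?a - ?t \<le> ?a ^ 3 / 3" using tanh_cubic_bounds[of ?a] by auto
  have "?a\<^sup>2 - ?t\<^sup>2 = (?a - ?t) * (?a + ?t)" by (simp add: power2_eq_square algebra_simps)
  also have "\<dots> \<le> (?a ^ 3 / 3) * (?a + ?a)" using t by (intro mult_mono) auto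
  also have "\<dots> = (2 / 3) * ?a ^ 4" by (simp add: eval_nat_numeral)
  also have "\<dots> \<le> ?a ^ 4" by simp
  finally show "z\<^sup>2 - (tanh z)\<^sup>2 \<le> z ^ 4" by (simp add: tanh_real_abs power_even_abs)
qed

lemma tanh_borel[measurable]: "tanh \<in> borel_measurable (borel :: real measure)"
  by (intro borel_measurable_continuous_onI continuous_on_tanh continuous_intros) simp

lemma abs_tanh_power_le_1: "\<bar>tanh (z::real) ^ k\<bar> \<le> 1"
  using tanh_real_bounds[of z] unfolding power_abs by (intro power_le_one) auto

lemma tanh_even_power_le: "even k \<Longrightarrow> tanh (z::real) ^ k \<le> z ^ k"
  using power_mono[OF abs_tanh_le, of z k] by (simp add: power_even_abs)

definition tanh_moment :: "nat \<Rightarrow> nat \<Rightarrow> real measure \<Rightarrow> real" where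
  "tanh_moment N k \<nu> = (\<integral>y. tanh (y / sqrt N) ^ k \<partial>\<nu>)"

lemma tanh_power_integrable:
  assumes "prob_space \<nu>" "sets \<nu> = sets borel"
  shows "integrable \<nu> (\<lambda>y. tanh (y / sqrt N) ^ k)"
proof -
  interpret prob_space \<nu> by fact
  have "(\<lambda>y. tanh (y / sqrt N) ^ k) \<in> borel_measurable borel" by measurable
  then have "(\<lambda>y. tanh (y / sqrt N) ^ k) \<in> borel_measurable \<nu>" using measurable_cong_sets[OF assms(2) refl] by blast
  then show ?thesis by (intro integrable_const_bound[where B=1]) (auto intro: abs_tanh_power_le_1)
qed

lemma tanh_power_antimono: "i \<le> k \<Longrightarrow> even i \<Longrightarrow> \<bar>tanh (z::real) ^ k\<bar> \<le> tanh z ^ i"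
proof -
  assume "i \<le> k" "even i"
  have "\<bar>tanh z\<bar> ^ k \<le> \<bar>tanh z\<bar> ^ i"
    by (rule power_decreasing[OF \<open>i \<le> k\<close>]) (use tanh_real_bounds[of z] in auto)
  then show ?thesis using \<open>even i\<close> by (simp add: power_abs power_even_abs)
qed

lemma abs_tanh_moment_le:
  assumes "prob_space \<nu>" "sets \<nu> = sets borel" "i \<le> k" "even i"
  shows "\<bar>tanh_moment N k \<nu>\<bar> \<le> tanh_moment N i \<nu>"
proof -
  have "\<bar>tanh_moment N k \<nu>\<bar> \<le> (\<integral>y. \<bar>tanh (y / sqrt N) ^ k\<bar> \<partial>\<nu>)"
    unfolding tanh_moment_def by (rule integral_abs_bound)
  also have "\<dots> \<le> tanh_moment N i \<nu>"
    unfolding tanh_moment_def using tanh_power_integrable[OF assms(1,2)] tanh_power_antimono[OF assms(3,4)]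
    by (intro integral_mono) auto
  finally show ?thesis .
qed

lemma disorderD:
  assumes "disorder \<kappa> \<nu>"
  shows "prob_space \<nu>" "sets \<nu> = sets borel" "distr \<nu> borel uminus = \<nu>"
    "integrable \<nu> (\<lambda>y. y ^ 2)" "integrable \<nu> (\<lambda>y. y ^ 4)" "integrable \<nu> (\<lambda>y. y ^ 6)"
    "(\<integral>y. y ^ 2 \<partial>\<nu>) = 1" "(\<integral>y. y ^ 4 \<partial>\<nu>) \<le> \<kappa>" "(\<integral>y. y ^ 6 \<partial>\<nu>) \<le> \<kappa>"
  using assms by (auto simp: disorder_def)

context
  fixes \<kappa> :: real and \<nu> :: "real measure" and N :: nat
  assumes \<nu>: "disorder \<kappa> \<nu>" and N: "0 < N"
begin

lemma tanh_moment_odd: "odd k \<Longrightarrow> tanh_moment N k \<nu> = 0"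
proof -
  assume k: "odd k"
  have [measurable_cong]: "sets \<nu> = sets borel" by (rule disorderD[OF \<nu>])
  have "tanh_moment N k \<nu> = (\<integral>y. tanh (y / sqrt N) ^ k \<partial>distr \<nu> borel uminus)"
    by (simp add: tanh_moment_def disorderD(3)[OF \<nu>])
  also have "\<dots> = (\<integral>y. tanh (- y / sqrt N) ^ k \<partial>\<nu>)" by (subst integral_distr) auto
  also have "\<dots> = - tanh_moment N k \<nu>" using k by (simp add: tanh_moment_def tanh_minus power_minus_odd)
  finally show ?thesis by simp
qed

lemma tanh_moment_2: "tanh_moment N 2 \<nu> \<le> 1 / N" "1 / N - tanh_moment N 2 \<nu> \<le> \<kappa> / (real N)\<^sup>2"
proof -
  have i: "integrable \<nu> (\<lambda>y. (y / sqrt N) ^ 2)" "integrable \<nu> (\<lambda>y. (y / sqrt N) ^ 4)"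
    unfolding power_divide using disorderD[OF \<nu>] by auto
  have e: "(\<integral>y. (y / sqrt N) ^ 2 \<partial>\<nu>) = 1 / N" unfolding power_divide using disorderD[OF \<nu>] by simp
  have "tanh_moment N 2 \<nu> \<le> (\<integral>y. (y / sqrt N) ^ 2 \<partial>\<nu>)"
    unfolding tanh_moment_def using i tanh_power_integrable[OF disorderD(1,2)[OF \<nu>]] tanh_square_bounds(1)
    by (intro integral_mono) auto
  then show "tanh_moment N 2 \<nu> \<le> 1 / N" unfolding e .
  have "(\<integral>y. (y / sqrt N) ^ 2 - tanh (y / sqrt N) ^ 2 \<partial>\<nu>) \<le> (\<integral>y. (y / sqrt N) ^ 4 \<partial>\<nu>)"
    using i tanh_power_integrable[OF disorderD(1,2)[OF \<nu>]] tanh_square_bounds(2)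
    by (intro integral_mono Bochner_Integration.integrable_diff) auto
  also have "(\<integral>y. (y / sqrt N) ^ 4 \<partial>\<nu>) = (\<integral>y. y ^ 4 \<partial>\<nu>) / (real N)\<^sup>2"
  proof -
    have "sqrt N ^ 4 = (real N)\<^sup>2"
      using power_mult[of "sqrt N" 2 2] by simp
    then show ?thesis by (simp add: power_divide)
  qed
  also have "\<dots> \<le> \<kappa> / (real N)\<^sup>2" using disorderD[OF \<nu>] by (intro divide_right_mono) auto
  finally show "1 / N - tanh_moment N 2 \<nu> \<le> \<kappa> / (real N)\<^sup>2"
    using i tanh_power_integrable[OF disorderD(1,2)[OF \<nu>]] e by (simp add: tanh_moment_def)
qed

lemma tanh_moment_4: "tanh_moment N 4 \<nu> \<le> \<kappa> / (real N)\<^sup>2"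
proof -
  have "tanh_moment N 4 \<nu> \<le> (\<integral>y. (y / sqrt N) ^ 4 \<partial>\<nu>)"
    unfolding tanh_moment_def
  proof (rule integral_mono)
    show "tanh (y / sqrt N) ^ 4 \<le> (y / sqrt N) ^ 4" for y
      by (rule tanh_even_power_le) simp
  qed (use disorderD[OF \<nu>] tanh_power_integrable in \<open>auto simp: power_divide\<close>)
  also have "\<dots> = (\<integral>y. y ^ 4 \<partial>\<nu>) / (real N)\<^sup>2"
  proof -
    have "sqrt N ^ 4 = (real N)\<^sup>2" using power_mult[of "sqrt N" 2 2] by simp
    then show ?thesis by (simp add: power_divide)
  qed
  also have "\<dots> \<le> \<kappa> / (real N)\<^sup>2" using disorderD[OF \<nu>] by (intro divide_right_mono) auto
  finally show ?thesis .
qed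

lemma tanh_moment_6: "tanh_moment N 6 \<nu> \<le> \<kappa> / (real N) ^ 3"
proof -
  have "tanh_moment N 6 \<nu> \<le> (\<integral>y. (y / sqrt N) ^ 6 \<partial>\<nu>)"
    unfolding tanh_moment_def
  proof (rule integral_mono)
    show "tanh (y / sqrt N) ^ 6 \<le> (y / sqrt N) ^ 6" for y
      by (rule tanh_even_power_le) simp
  qed (use disorderD[OF \<nu>] tanh_power_integrable in \<open>auto simp: power_divide\<close>)
  also have "\<dots> = (\<integral>y. y ^ 6 \<partial>\<nu>) / (real N) ^ 3"
  proof -
    have "sqrt N ^ 6 = (real N) ^ 3" using power_mult[of "sqrt N" 2 3] by simp
    then show ?thesis by (simp add: power_divide)
  qed
  also have "\<dots> \<le> \<kappa> / (real N) ^ 3" using disorderD[OF \<nu>] by (intro divide_right_mono) auto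
  finally show ?thesis .
qed

end

lemma tanh_moment_0: "prob_space \<nu> \<Longrightarrow> tanh_moment N 0 \<nu> = 1"
  by (simp add: tanh_moment_def prob_space.prob_space)

text \<open>
  Odd moments vanish by symmetry, the second moments both equal \<open>1 / N\<close> up to \<open>O (N\<^sup>-\<^sup>2)\<close>, and higher even
  moments are themselves \<open>O (N\<^sup>-\<^sup>2)\<close>.
\<close>

lemma tanh_moment_diff:
  assumes A: "disorder \<kappa> A" and B: "disorder \<kappa> B" and N: "0 < N"
  shows "\<bar>tanh_moment N k B - tanh_moment N k A\<bar> \<le> 2 * \<kappa> / (real N)\<^sup>2"
    and "k < 2 \<Longrightarrow> tanh_moment N k B - tanh_moment N k A = 0"
proof -
  note a = disorderD[OF A] and b = disorderD[OF B]
  have \<kappa>0: "0 \<le> \<kappa> / (real N)\<^sup>2"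
  proof -
    have "0 \<le> (\<integral>y. y ^ 4 \<partial>A)" by (rule integral_nonneg_AE) simp
    from order_trans[OF this a(8)] show ?thesis by simp
  qed
  show z: "tanh_moment N k B - tanh_moment N k A = 0" if "k < 2"
  proof -
    from that consider "k = 0" | "k = 1" by linarith
    then show ?thesis
      by cases (use a b tanh_moment_0 tanh_moment_odd[OF A N, of 1] tanh_moment_odd[OF B N, of 1] in auto)
  qed
  consider "k < 2" | "k = 2" | "k = 3" | "4 \<le> k" by linarith
  then show "\<bar>tanh_moment N k B - tanh_moment N k A\<bar> \<le> 2 * \<kappa> / (real N)\<^sup>2"
  proof cases
    case 1
    then show ?thesis using z \<kappa>0 by simp
  next
    case 2
    then show ?thesis using tanh_moment_2[OF A N] tanh_moment_2[OF B N] \<kappa>0 by (simp add: abs_le_iff)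
  next
    case 3
    then show ?thesis using tanh_moment_odd[OF A N, of k] tanh_moment_odd[OF B N, of k] \<kappa>0 by simp
  next
    case 4
    have "\<bar>tanh_moment N k A\<bar> \<le> \<kappa> / (real N)\<^sup>2" "\<bar>tanh_moment N k B\<bar> \<le> \<kappa> / (real N)\<^sup>2"
      using abs_tanh_moment_le[OF a(1,2) 4, of N] abs_tanh_moment_le[OF b(1,2) 4, of N] tanh_moment_4[OF A N] tanh_moment_4[OF B N]
      by auto
    then show ?thesis by (simp add: abs_le_iff)
  qed
qed

lemma mix_tanh_moment:
  assumes A: "disorder \<kappa> A" and B: "disorder \<kappa> B" and p: "0 \<le> p" "p \<le> 1"
  shows "tanh_moment N k (mix p A B) = p * tanh_moment N k B + (1 - p) * tanh_moment N k A"
  unfolding tanh_moment_def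
  by (rule mix_integral[OF disorderD(1,2)[OF A] disorderD(1,2)[OF B] _ abs_tanh_power_le_1 p]) measurable

lemma gibbs_weight_measurable: "(\<lambda>J. gibbs_weight N J \<sigma>) \<in> borel_measurable (\<Pi>\<^sub>M e\<in>bonds N. borel)"
proof -
  have [measurable]: "(\<lambda>J. sk_hamiltonian N J \<tau>) \<in> borel_measurable (\<Pi>\<^sub>M e\<in>bonds N. borel)" for \<tau>
    unfolding sk_hamiltonian_def case_prod_beta
    by (intro borel_measurable_times borel_measurable_const borel_measurable_sum measurable_component_singleton) auto
  show ?thesis unfolding gibbs_weight_def by measurable
qed

lemma replica_avg_measurable: "(\<lambda>J. replica_avg N J n f) \<in> borel_measurable (\<Pi>\<^sub>M e\<in>bonds N. borel)"
proof -
  have "(\<lambda>J. prod_list (map (gibbs_weight N J) l)) \<in> borel_measurable (\<Pi>\<^sub>M e\<in>bonds N. borel)" for l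
    by (induction l) (auto intro!: borel_measurable_times gibbs_weight_measurable)
  then show ?thesis unfolding replica_avg_def iid_avg_def
    by (intro borel_measurable_sum borel_measurable_times borel_measurable_const)
qed

lemma replica_avg_update_measurable:
  assumes "e \<in> bonds N"
  shows "(\<lambda>J. replica_avg N (J(e := c)) n f) \<in> borel_measurable (\<Pi>\<^sub>M e\<in>bonds N. borel)"
proof -
  have "(\<lambda>J. J(e := c)) \<in> measurable (\<Pi>\<^sub>M e\<in>bonds N. borel) (\<Pi>\<^sub>M e\<in>bonds N. (borel :: real measure))"
    by (rule measurable_fun_upd[where J="bonds N"]) (use assms in auto)
  from measurable_compose[OF this replica_avg_measurable] show ?thesis .
qed

lemma replica_avg_bound:
  assumes "\<And>l. set l \<subseteq> spin_configs N \<Longrightarrow> length l = n \<Longrightarrow> \<bar>f l\<bar> \<le> c"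
  shows "\<bar>replica_avg N J n f\<bar> \<le> c"
  unfolding replica_avg_def by (rule iid_avg_abs_bound[OF finite_spin_configs gibbs_weight_nonneg gibbs_weight_sum assms])

lemma replica_avg_mono:
  assumes "\<And>l. set l \<subseteq> spin_configs N \<Longrightarrow> length l = n \<Longrightarrow> f l \<le> g l"
  shows "replica_avg N J n f \<le> replica_avg N J n g"
  unfolding replica_avg_def by (rule iid_avg_mono[OF gibbs_weight_nonneg assms])

text \<open>
  The observable of \<open>n + j\<close> replicas that appears as the coefficient of \<open>t\<^bsup>card S + j\<^esup>\<close> when bond \<open>e\<close> is tilted.
\<close>

definition bond_term :: "nat \<Rightarrow> (nat \<times> nat) \<Rightarrow> nat \<Rightarrow> ((nat \<Rightarrow> real) list \<Rightarrow> real) \<Rightarrow> nat set \<Rightarrow> nat \<Rightarrow> (nat \<Rightarrow> real) list \<Rightarrow> real" where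
  "bond_term N e n f S j l = f (take n l) * (\<Prod>a\<in>S \<union> {n..<n + j}. bond_spin e (l ! a))"

lemma bond_term_bound:
  assumes e: "e \<in> bonds N" and S: "S \<subseteq> {..<n}"
    and f: "\<And>l. set l \<subseteq> spin_configs N \<Longrightarrow> length l = n \<Longrightarrow> \<bar>f l\<bar> \<le> 1"
    and l: "set l \<subseteq> spin_configs N" "length l = n + j"
  shows "\<bar>bond_term N e n f S j l\<bar> \<le> 1"
proof -
  have "\<bar>f (take n l)\<bar> \<le> 1" using l set_take_subset[of n l] by (intro f) auto
  moreover have "\<bar>\<Prod>a\<in>S \<union> {n..<n + j}. bond_spin e (l ! a)\<bar> \<le> 1"
    unfolding abs_prod
  proof (rule prod_le_1)
    fix a assume "a \<in> S \<union> {n..<n + j}"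
    then have "a < length l" using S l by auto
    then have "l ! a \<in> spin_configs N" using l nth_mem[of a l] by auto
    then show "0 \<le> \<bar>bond_spin e (l ! a)\<bar> \<and> \<bar>bond_spin e (l ! a)\<bar> \<le> 1"
      using bond_spin_values[OF _ e] by fastforce
  qed
  ultimately show ?thesis unfolding bond_term_def abs_mult by (intro mult_le_one) auto
qed

lemma bond_average_expansion:
  assumes e: "e \<in> bonds N" and M: "prob_space M" "sets M = sets borel"
    and f: "\<And>l. set l \<subseteq> spin_configs N \<Longrightarrow> length l = n \<Longrightarrow> \<bar>f l\<bar> \<le> 1"
    and J: "J \<in> space (\<Pi>\<^sub>M e\<in>bonds N. (borel :: real measure))"
  shows "\<bar>(\<integral>y. replica_avg N (J(e := y)) n f \<partial>M) - (\<Sum>(S, j)\<in>Pow {..<n} \<times> {..tilt_degree n}.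
      tilt_coeff n j * tanh_moment N (card S + j) M * replica_avg N (J(e := 0)) (n + j) (bond_term N e n f S j))\<bar>
    \<le> tilt_const n * tanh_moment N 6 M"
proof -
  interpret prob_space M by fact
  let ?L = "Pow {..<n} \<times> {..tilt_degree n}"
  let ?q = "\<lambda>S j. replica_avg N (J(e := 0)) (n + j) (bond_term N e n f S j)"
  note it = tanh_power_integrable[OF M]
  have "insert e (bonds N) = bonds N" using e by auto
  then have "(\<lambda>y. replica_avg N (J(e := y)) n f) \<in> borel_measurable borel"
    using update_section_measurable[of "\<lambda>J. replica_avg N J n f" e "bonds N" J] replica_avg_measurable J by simp
  then have "(\<lambda>y. replica_avg N (J(e := y)) n f) \<in> borel_measurable M"
    using measurable_cong_sets[OF M(2) refl] by blast
  then have i1: "integrable M (\<lambda>y. replica_avg N (J(e := y)) n f)"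
    by (intro integrable_const_bound[where B=1] AE_I2) (simp_all add: replica_avg_bound[OF f])
  have i2: "integrable M (\<lambda>y. \<Sum>(S, j)\<in>?L. tilt_coeff n j * tanh (y / sqrt N) ^ (card S + j) * ?q S j)"
    unfolding case_prod_beta using it by auto
  have I2: "(\<integral>y. (\<Sum>(S, j)\<in>?L. tilt_coeff n j * tanh (y / sqrt N) ^ (card S + j) * ?q S j) \<partial>M)
      = (\<Sum>(S, j)\<in>?L. tilt_coeff n j * tanh_moment N (card S + j) M * ?q S j)"
    unfolding case_prod_beta tanh_moment_def using it by (simp add: Bochner_Integration.integral_sum)
  have "\<bar>\<integral>y. replica_avg N (J(e := y)) n f - (\<Sum>(S, j)\<in>?L. tilt_coeff n j * tanh (y / sqrt N) ^ (card S + j) * ?q S j) \<partial>M\<bar>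
      \<le> (\<integral>y. \<bar>replica_avg N (J(e := y)) n f - (\<Sum>(S, j)\<in>?L. tilt_coeff n j * tanh (y / sqrt N) ^ (card S + j) * ?q S j)\<bar> \<partial>M)"
    by (rule integral_abs_bound)
  also have "\<dots> \<le> (\<integral>y. tilt_const n * tanh (y / sqrt N) ^ 6 \<partial>M)"
  proof (rule integral_mono)
    show "\<bar>replica_avg N (J(e := y)) n f - (\<Sum>(S, j)\<in>?L. tilt_coeff n j * tanh (y / sqrt N) ^ (card S + j) * ?q S j)\<bar>
        \<le> tilt_const n * tanh (y / sqrt N) ^ 6" for y
      using replica_avg_bond_expansion[OF e f, where J=J and y=y] unfolding bond_term_def[abs_def] .
  qed (use i1 i2 it in auto)
  finally show ?thesis using i1 i2 I2 by (simp add: tanh_moment_def)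
qed

section \<open>The derivative along the interpolation\<close>

text \<open>
  Divided by \<open>N\<close>, this bounds the change of a bounded average over \<open>n\<close> replicas when one coupling is removed.
\<close>

definition expansion_const :: "nat \<Rightarrow> real" where
  "expansion_const n = (\<Sum>(S, j)\<in>Pow {..<n} \<times> {..tilt_degree n}. \<bar>tilt_coeff n j\<bar>) + tilt_const n"

text \<open>
  Independent of \<open>N\<close> and of the observable.
\<close>

definition gain_const :: "real \<Rightarrow> nat \<Rightarrow> real" where
  "gain_const \<kappa> n = 2 * \<kappa> * ((\<Sum>(S, j)\<in>Pow {..<n} \<times> {..tilt_degree n}. \<bar>tilt_coeff n j\<bar> * (1 + expansion_const (n + j))) + tilt_const n)"

lemma expansion_const_nonneg: "0 \<le> expansion_const n"
  by (auto simp: expansion_const_def tilt_const_nonneg intro!: add_nonneg_nonneg sum_nonneg)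

lemma disorder_const_nonneg: "disorder \<kappa> \<nu> \<Longrightarrow> 0 \<le> \<kappa>"
proof -
  assume d: "disorder \<kappa> \<nu>"
  have "0 \<le> (\<integral>y. y ^ 4 \<partial>\<nu>)" by (rule integral_nonneg_AE) simp
  from order_trans[OF this disorderD(8)[OF d]] show ?thesis .
qed

context
  fixes \<kappa> :: real and A B :: "real measure" and N :: nat
  assumes A: "disorder \<kappa> A" and B: "disorder \<kappa> B" and N: "0 < N"
begin

lemma disorder_pair: "prob_space A" "sets A = sets borel" "prob_space B" "sets B = sets borel"
  using disorderD[OF A] disorderD[OF B] by auto

abbreviation "EE F p \<equiv> mix_expect A B (bonds N) F p"

text \<open>
  The first order in \<open>tanh\<close> averages to zero, so removing one coupling changes an average only by \<open>O (1 / N)\<close>. This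
  order matters: an error of order \<open>N\<^bsup>-1/2\<^esup>\<close> would not be negligible against \<open>N\<^bsup>-2/3\<^esup>\<close>.
\<close>

lemma mix_single_bond:
  assumes e: "e \<in> bonds N" and p: "0 \<le> p" "p \<le> 1"
    and f: "\<And>l. set l \<subseteq> spin_configs N \<Longrightarrow> length l = n \<Longrightarrow> \<bar>f l\<bar> \<le> 1"
    and J: "J \<in> space (\<Pi>\<^sub>M e\<in>bonds N. (borel :: real measure))"
  shows "\<bar>(\<integral>y. replica_avg N (J(e := y)) n f \<partial>mix p A B) - replica_avg N (J(e := 0)) n f\<bar> \<le> expansion_const n / N"
proof -
  let ?L = "Pow {..<n} \<times> {..tilt_degree n}"
  let ?q = "\<lambda>S j. replica_avg N (J(e := 0)) (n + j) (bond_term N e n f S j)"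
  let ?M = "mix p A B"
  note pM = mix_prob_space[OF disorder_pair] and sM = sets_mix[OF disorder_pair]
  have t2: "tanh_moment N 2 ?M \<le> 1 / N"
  proof -
    have "p * tanh_moment N 2 B + (1 - p) * tanh_moment N 2 A \<le> p * (1 / N) + (1 - p) * (1 / N)"
      using p tanh_moment_2(1)[OF A N] tanh_moment_2(1)[OF B N] by (intro add_mono mult_left_mono) auto
    then show ?thesis unfolding mix_tanh_moment[OF A B p] distrib_right[symmetric] by simp
  qed
  have t: "\<bar>tanh_moment N k ?M - 0 ^ k\<bar> \<le> 1 / N" for k
  proof -
    consider "k = 0" | "k = 1" | "2 \<le> k" by linarith
    then show ?thesis
    proof cases
      case 1 then show ?thesis using tanh_moment_0[OF pM] by simp
    next
      case 2 then show ?thesis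
        using mix_tanh_moment[OF A B p, of N 1] tanh_moment_odd[OF A N, of 1] tanh_moment_odd[OF B N, of 1] by simp
    next
      case 3
      then have z: "(0::real) ^ k = 0" by simp
      show ?thesis unfolding z diff_zero by (rule order_trans[OF abs_tanh_moment_le[OF pM sM 3] t2]) simp
    qed
  qed
  have q: "\<bar>?q S j\<bar> \<le> 1" if "S \<subseteq> {..<n}" for S j
    by (rule replica_avg_bound) (rule bond_term_bound[OF e that f])
  have "replica_avg N (J(e := 0)) n f = (\<Sum>(S, j)\<in>?L. tilt_coeff n j * 0 ^ (card S + j) * ?q S j)"
    using replica_avg_bond_expansion[OF e f, where J=J and y=0] unfolding bond_term_def[abs_def] by simp
  then have eq: "(\<integral>y. replica_avg N (J(e := y)) n f \<partial>?M) - replica_avg N (J(e := 0)) n f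
      = ((\<integral>y. replica_avg N (J(e := y)) n f \<partial>?M) - (\<Sum>(S, j)\<in>?L. tilt_coeff n j * tanh_moment N (card S + j) ?M * ?q S j))
        + (\<Sum>(S, j)\<in>?L. tilt_coeff n j * (tanh_moment N (card S + j) ?M - 0 ^ (card S + j)) * ?q S j)"
    by (simp add: case_prod_beta right_diff_distrib left_diff_distrib sum_subtractf)
  have "\<bar>(\<integral>y. replica_avg N (J(e := y)) n f \<partial>?M) - replica_avg N (J(e := 0)) n f\<bar>
      \<le> tilt_const n * (1 / N) + (\<Sum>(S, j)\<in>?L. \<bar>tilt_coeff n j\<bar> * (1 / N) * 1)"
    unfolding eq
  proof (rule order_trans[OF abs_triangle_ineq], rule add_mono)
    have "tanh_moment N 6 ?M \<le> 1 / N" using t[of 6] by (simp add: abs_le_iff)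
    then show "\<bar>(\<integral>y. replica_avg N (J(e := y)) n f \<partial>?M) - (\<Sum>(S, j)\<in>?L. tilt_coeff n j * tanh_moment N (card S + j) ?M * ?q S j)\<bar> \<le> tilt_const n * (1 / N)"
      by (intro order_trans[OF bond_average_expansion[OF e pM sM f J]] mult_left_mono tilt_const_nonneg)
    show "\<bar>\<Sum>(S, j)\<in>?L. tilt_coeff n j * (tanh_moment N (card S + j) ?M - 0 ^ (card S + j)) * ?q S j\<bar> \<le> (\<Sum>(S, j)\<in>?L. \<bar>tilt_coeff n j\<bar> * (1 / N) * 1)"
      unfolding case_prod_beta
    proof (rule order_trans[OF sum_abs], rule sum_mono)
      fix x assume "x \<in> ?L"
      then have "fst x \<subseteq> {..<n}" by auto
      from q[OF this] show "\<bar>tilt_coeff n (snd x) * (tanh_moment N (card (fst x) + snd x) ?M - 0 ^ (card (fst x) + snd x)) * ?q (fst x) (snd x)\<bar>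
        \<le> \<bar>tilt_coeff n (snd x)\<bar> * (1 / N) * 1"
        unfolding abs_mult by (intro mult_mono t) auto
    qed
  qed
  also have "\<dots> = expansion_const n / N"
    by (simp add: expansion_const_def case_prod_beta sum_divide_distrib[symmetric] add_divide_distrib)
  finally show ?thesis .
qed

text \<open>
  The tilt expansion averaged over both laws: their difference only sees differences of moments of \<open>tanh\<close>.
\<close>

lemma swap_gain_expansion:
  assumes e: "e \<in> bonds N"
    and f: "\<And>l. set l \<subseteq> spin_configs N \<Longrightarrow> length l = n \<Longrightarrow> \<bar>f l\<bar> \<le> 1"
    and J: "J \<in> space (\<Pi>\<^sub>M e\<in>bonds N. (borel :: real measure))"
  shows "\<bar>swap_gain A B e (\<lambda>J. replica_avg N J n f) J - (\<Sum>(S, j)\<in>Pow {..<n} \<times> {..tilt_degree n}.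
      tilt_coeff n j * (tanh_moment N (card S + j) B - tanh_moment N (card S + j) A) * replica_avg N (J(e := 0)) (n + j) (bond_term N e n f S j))\<bar>
    \<le> 2 * tilt_const n * (\<kappa> / real N ^ 3)"
proof -
  let ?L = "Pow {..<n} \<times> {..tilt_degree n}"
  let ?q = "\<lambda>S j. replica_avg N (J(e := 0)) (n + j) (bond_term N e n f S j)"
  let ?s = "\<lambda>M. \<Sum>(S, j)\<in>?L. tilt_coeff n j * tanh_moment N (card S + j) M * ?q S j"
  have "(\<Sum>(S, j)\<in>?L. tilt_coeff n j * (tanh_moment N (card S + j) B - tanh_moment N (card S + j) A) * ?q S j) = ?s B - ?s A"
    by (simp add: case_prod_beta right_diff_distrib left_diff_distrib sum_subtractf)
  moreover have "\<bar>(\<integral>y. replica_avg N (J(e := y)) n f \<partial>A) - ?s A\<bar> \<le> tilt_const n * (\<kappa> / real N ^ 3)"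
    by (rule order_trans[OF bond_average_expansion[OF e disorder_pair(1,2) f J] mult_left_mono[OF tanh_moment_6[OF A N] tilt_const_nonneg]])
  moreover have "\<bar>(\<integral>y. replica_avg N (J(e := y)) n f \<partial>B) - ?s B\<bar> \<le> tilt_const n * (\<kappa> / real N ^ 3)"
    by (rule order_trans[OF bond_average_expansion[OF e disorder_pair(3,4) f J] mult_left_mono[OF tanh_moment_6[OF B N] tilt_const_nonneg]])
  ultimately show ?thesis unfolding swap_gain_def by linarith
qed

lemma bonds_mix_integrable:
  assumes "F \<in> borel_measurable (\<Pi>\<^sub>M i\<in>bonds N. borel)" "\<And>x. \<bar>F x\<bar> \<le> (c::real)"
  shows "integrable (\<Pi>\<^sub>M i\<in>bonds N. mix p A B) F"
  by (rule PiM_mix_integrable[OF disorder_pair assms])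

lemma space_mix_bonds: "space (\<Pi>\<^sub>M i\<in>bonds N. mix p A B) = space (\<Pi>\<^sub>M e\<in>bonds N. (borel :: real measure))"
  by (rule sets_eq_imp_space_eq[OF sets_PiM_mix[OF disorder_pair]])

lemma mix_expect_bond_term:
  assumes e: "e \<in> bonds N" and S: "S \<subseteq> {..<n}" and p: "0 \<le> p" "p \<le> 1"
    and f: "\<And>l. set l \<subseteq> spin_configs N \<Longrightarrow> length l = n \<Longrightarrow> \<bar>f l\<bar> \<le> 1"
  shows "\<bar>EE (\<lambda>J. replica_avg N (J(e := 0)) (n + j) (bond_term N e n f S j)) p
      - EE (\<lambda>J. replica_avg N J (n + j) (bond_term N e n f S j)) p\<bar> \<le> expansion_const (n + j) / N"
proof -
  let ?Q = "\<lambda>J. replica_avg N J (n + j) (bond_term N e n f S j)"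
  interpret P: prob_space "\<Pi>\<^sub>M i\<in>bonds N. mix p A B" by (rule PiM_mix_prob_space[OF disorder_pair])
  have tb: "\<bar>bond_term N e n f S j l\<bar> \<le> 1" if "set l \<subseteq> spin_configs N" "length l = n + j" for l
    by (rule bond_term_bound[OF e S f that])
  have b: "\<bar>?Q J\<bar> \<le> 1" for J by (rule replica_avg_bound[OF tb])
  have ins: "insert e (bonds N) = bonds N" using e by auto
  have m: "(\<lambda>J. \<integral>y. ?Q (J(e := y)) \<partial>mix p A B) \<in> borel_measurable (\<Pi>\<^sub>M e\<in>bonds N. borel)"
    by (rule integral_update_measurable[OF _ mix_prob_space[OF disorder_pair] sets_mix[OF disorder_pair]])
      (simp add: ins replica_avg_measurable)
  have i: "integrable (\<Pi>\<^sub>M i\<in>bonds N. mix p A B) (\<lambda>J. ?Q (J(e := 0)))"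
    "integrable (\<Pi>\<^sub>M i\<in>bonds N. mix p A B) (\<lambda>J. \<integral>y. ?Q (J(e := y)) \<partial>mix p A B)"
    by (rule bonds_mix_integrable[OF replica_avg_update_measurable[OF e] b])
      (rule bonds_mix_integrable[OF m integral_update_abs_le[OF mix_prob_space[OF disorder_pair], of ?Q, OF b]])
  have "EE ?Q p = EE (\<lambda>J. \<integral>y. ?Q (J(e := y)) \<partial>mix p A B) p"
    by (rule mix_expect_resample[OF disorder_pair finite_bonds e replica_avg_measurable b])
  then have eq: "EE (\<lambda>J. ?Q (J(e := 0))) p - EE ?Q p
      = (\<integral>J. ?Q (J(e := 0)) - (\<integral>y. ?Q (J(e := y)) \<partial>mix p A B) \<partial>(\<Pi>\<^sub>M i\<in>bonds N. mix p A B))"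
    using i by (simp add: mix_expect_def)
  have "\<bar>EE (\<lambda>J. ?Q (J(e := 0))) p - EE ?Q p\<bar> \<le> (\<integral>J. \<bar>?Q (J(e := 0)) - (\<integral>y. ?Q (J(e := y)) \<partial>mix p A B)\<bar> \<partial>(\<Pi>\<^sub>M i\<in>bonds N. mix p A B))"
    unfolding eq by (rule integral_abs_bound)
  also have "\<dots> \<le> (\<integral>J. expansion_const (n + j) / N \<partial>(\<Pi>\<^sub>M i\<in>bonds N. mix p A B))"
  proof (rule integral_mono)
    fix J assume "J \<in> space (\<Pi>\<^sub>M i\<in>bonds N. mix p A B)"
    then have J: "J \<in> space (\<Pi>\<^sub>M e\<in>bonds N. (borel :: real measure))" unfolding space_mix_bonds .
    show "\<bar>?Q (J(e := 0)) - (\<integral>y. ?Q (J(e := y)) \<partial>mix p A B)\<bar> \<le> expansion_const (n + j) / N"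
      using mix_single_bond[OF e p tb J] by (simp only: abs_minus_commute)
  qed (use i in auto)
  finally show ?thesis by (simp add: P.prob_space)
qed

text \<open>
  Each bond contributes with a sign, so the sum has to be taken inside the Gibbs average, where it becomes
  a squared overlap.
\<close>

lemma sum_mix_expect_bond_terms:
  assumes S: "S \<subseteq> {..<n}"
    and f: "\<And>l. set l \<subseteq> spin_configs N \<Longrightarrow> length l = n \<Longrightarrow> \<bar>f l\<bar> \<le> 1"
    and \<beta>: "EE (\<lambda>J. replica_avg N J (n + j) (\<lambda>l. \<bar>f (take n l)\<bar> * (multi_overlap N (S \<union> {n..<n + j}) l)\<^sup>2)) p \<le> \<beta>"
  shows "\<bar>\<Sum>e\<in>bonds N. EE (\<lambda>J. replica_avg N J (n + j) (bond_term N e n f S j)) p\<bar> \<le> (real N)\<^sup>2 * (\<beta> + 1 / N)"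
proof -
  let ?T = "S \<union> {n..<n + j}"
  let ?P = "\<Pi>\<^sub>M i\<in>bonds N. mix p A B"
  interpret P: prob_space ?P by (rule PiM_mix_prob_space[OF disorder_pair])
  have T: "?T \<subseteq> {..<n + j}" using S by auto
  let ?g = "\<lambda>l. f (take n l) * (((real N)\<^sup>2 * (multi_overlap N ?T l)\<^sup>2 - real N) / 2)"
  let ?h = "\<lambda>l. \<bar>f (take n l)\<bar> * (multi_overlap N ?T l)\<^sup>2"
  have ft: "\<bar>f (take n l)\<bar> \<le> 1" if "set l \<subseteq> spin_configs N" "length l = n + j" for l
    using that set_take_subset[of n l] by (intro f) auto
  have R: "(multi_overlap N ?T l)\<^sup>2 \<le> 1" if "set l \<subseteq> spin_configs N" "length l = n + j" for l
    using multi_overlap_abs_le[OF that(1), of ?T] T that(2) by (simp add: abs_square_le_1)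
  have h1: "\<bar>?h l\<bar> \<le> 1" if "set l \<subseteq> spin_configs N" "length l = n + j" for l
    using ft[OF that] R[OF that] by (simp add: abs_mult mult_le_one)
  have ih: "integrable ?P (\<lambda>J. replica_avg N J (n + j) ?h)"
    by (rule bonds_mix_integrable[OF replica_avg_measurable replica_avg_bound[OF h1]])
  have ib: "integrable ?P (\<lambda>J. replica_avg N J (n + j) (bond_term N e n f S j))" if "e \<in> bonds N" for e
    by (rule bonds_mix_integrable[OF replica_avg_measurable replica_avg_bound[OF bond_term_bound[OF that S f]]])
  have "(\<Sum>e\<in>bonds N. replica_avg N J (n + j) (bond_term N e n f S j)) = replica_avg N J (n + j) ?g" for J
  proof -
    have "(\<Sum>e\<in>bonds N. replica_avg N J (n + j) (bond_term N e n f S j)) = replica_avg N J (n + j) (\<lambda>l. \<Sum>e\<in>bonds N. bond_term N e n f S j l)"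
      unfolding replica_avg_def by (rule iid_avg_sum[symmetric])
    also have "\<dots> = replica_avg N J (n + j) ?g"
      unfolding replica_avg_def
    proof (rule iid_avg_cong)
      fix l assume l: "set l \<subseteq> spin_configs N" "length l = n + j"
      show "(\<Sum>e\<in>bonds N. bond_term N e n f S j l) = ?g l"
        unfolding bond_term_def sum_distrib_left[symmetric] using sum_bond_spins[OF l(1), of ?T] T l(2) N by simp
    qed
    finally show ?thesis .
  qed
  then have eq: "(\<Sum>e\<in>bonds N. EE (\<lambda>J. replica_avg N J (n + j) (bond_term N e n f S j)) p) = EE (\<lambda>J. replica_avg N J (n + j) ?g) p"
    unfolding mix_expect_def using ib by (subst Bochner_Integration.integral_sum[symmetric]) auto
  have "\<bar>\<Sum>e\<in>bonds N. EE (\<lambda>J. replica_avg N J (n + j) (bond_term N e n f S j)) p\<bar> \<le> (\<integral>J. \<bar>replica_avg N J (n + j) ?g\<bar> \<partial>?P)"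
    unfolding eq unfolding mix_expect_def by (rule integral_abs_bound)
  also have "\<dots> \<le> (\<integral>J. (real N)\<^sup>2 / 2 * replica_avg N J (n + j) ?h + real N / 2 \<partial>?P)"
  proof (rule integral_mono)
    fix J
    have gb: "\<bar>?g l\<bar> \<le> (real N)\<^sup>2 / 2 * ?h l + real N / 2" if "set l \<subseteq> spin_configs N" "length l = n + j" for l
    proof -
      have "\<bar>?g l\<bar> = \<bar>f (take n l)\<bar> * \<bar>(real N)\<^sup>2 * (multi_overlap N ?T l)\<^sup>2 - real N\<bar> / 2" by (simp add: abs_mult)
      also have "\<dots> \<le> \<bar>f (take n l)\<bar> * ((real N)\<^sup>2 * (multi_overlap N ?T l)\<^sup>2 + real N) / 2"
      proof (intro divide_right_mono mult_left_mono)
        have "0 \<le> (real N)\<^sup>2 * (multi_overlap N ?T l)\<^sup>2" by simp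
        then show "\<bar>(real N)\<^sup>2 * (multi_overlap N ?T l)\<^sup>2 - real N\<bar> \<le> (real N)\<^sup>2 * (multi_overlap N ?T l)\<^sup>2 + real N" by linarith
      qed auto
      also have "\<dots> = (real N)\<^sup>2 / 2 * ?h l + \<bar>f (take n l)\<bar> * real N / 2" by (simp add: algebra_simps add_divide_distrib)
      also have "\<dots> \<le> (real N)\<^sup>2 / 2 * ?h l + 1 * real N / 2"
        using ft[OF that] by (intro add_left_mono divide_right_mono mult_right_mono) auto
      finally show ?thesis by simp
    qed
    have "\<bar>replica_avg N J (n + j) ?g\<bar> \<le> replica_avg N J (n + j) (\<lambda>l. \<bar>?g l\<bar>)"
      unfolding replica_avg_def by (rule iid_avg_abs_le[OF gibbs_weight_nonneg])
    also have "\<dots> \<le> replica_avg N J (n + j) (\<lambda>l. (real N)\<^sup>2 / 2 * ?h l + real N / 2)"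
      by (rule replica_avg_mono[OF gb])
    also have "\<dots> = (real N)\<^sup>2 / 2 * replica_avg N J (n + j) ?h + real N / 2"
      unfolding replica_avg_def by (simp only: iid_avg_add iid_avg_cmult iid_avg_const[OF finite_spin_configs gibbs_weight_sum])
    finally show "\<bar>replica_avg N J (n + j) ?g\<bar> \<le> (real N)\<^sup>2 / 2 * replica_avg N J (n + j) ?h + real N / 2" .
  next
    have "\<bar>?g l\<bar> \<le> (real N)\<^sup>2 / 2 + real N / 2" if "set l \<subseteq> spin_configs N" "length l = n + j" for l
    proof -
      have "\<bar>?g l\<bar> = \<bar>f (take n l)\<bar> * (\<bar>(real N)\<^sup>2 * (multi_overlap N ?T l)\<^sup>2 - real N\<bar> / 2)" by (simp add: abs_mult)
      also have "\<dots> \<le> 1 * (((real N)\<^sup>2 * 1 + real N) / 2)"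
      proof (intro mult_mono divide_right_mono ft[OF that])
        have "(real N)\<^sup>2 * (multi_overlap N ?T l)\<^sup>2 \<le> (real N)\<^sup>2 * 1" using R[OF that] by (rule mult_left_mono) simp
        moreover have "0 \<le> (real N)\<^sup>2 * (multi_overlap N ?T l)\<^sup>2" by simp
        ultimately show "\<bar>(real N)\<^sup>2 * (multi_overlap N ?T l)\<^sup>2 - real N\<bar> \<le> (real N)\<^sup>2 * 1 + real N" by linarith
      qed auto
      finally show ?thesis by (simp add: add_divide_distrib)
    qed
    from Bochner_Integration.integrable_abs[OF bonds_mix_integrable[OF replica_avg_measurable replica_avg_bound[OF this]]]
    show "integrable ?P (\<lambda>J. \<bar>replica_avg N J (n + j) ?g\<bar>)" .
  next
    show "integrable ?P (\<lambda>J. (real N)\<^sup>2 / 2 * replica_avg N J (n + j) ?h + real N / 2)"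
      by (intro Bochner_Integration.integrable_add Bochner_Integration.integrable_mult_right ih P.integrable_const)
  qed
  also have "\<dots> = (real N)\<^sup>2 / 2 * EE (\<lambda>J. replica_avg N J (n + j) ?h) p + real N / 2"
    unfolding mix_expect_def using ih by (simp add: P.prob_space)
  also have "\<dots> \<le> (real N)\<^sup>2 / 2 * \<beta> + real N / 2" using \<beta> by (intro add_right_mono mult_left_mono) auto
  also have "\<dots> \<le> (real N)\<^sup>2 * (\<beta> + 1 / N)"
  proof -
    have "0 \<le> EE (\<lambda>J. replica_avg N J (n + j) ?h) p"
      unfolding mix_expect_def
    proof (intro integral_nonneg_AE AE_I2)
      fix J
      have "replica_avg N J (n + j) (\<lambda>_. 0) \<le> replica_avg N J (n + j) ?h" by (rule replica_avg_mono) simp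
      then show "0 \<le> replica_avg N J (n + j) ?h"
        unfolding replica_avg_def iid_avg_const[OF finite_spin_configs gibbs_weight_sum] .
    qed
    then have "0 \<le> \<beta>" using \<beta> by linarith
    then have "0 \<le> (real N)\<^sup>2 * \<beta>" by simp
    moreover have "(real N)\<^sup>2 * (\<beta> + 1 / N) = (real N)\<^sup>2 * \<beta> + real N" using N by (simp add: distrib_left power2_eq_square)
    ultimately show ?thesis by simp
  qed
  finally show ?thesis .
qed

text \<open>
  The bound on the derivative along the interpolation. Removing the coupling at \<open>e\<close> makes the Gibbs measure
  depend on \<open>e\<close>; it is put back at a cost of \<open>O (1 / N)\<close> per bond before the terms are summed over \<open>e\<close>.
\<close>

lemma sum_swap_gain_bound:
  assumes p: "0 \<le> p" "p \<le> 1"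
    and f: "\<And>l. set l \<subseteq> spin_configs N \<Longrightarrow> length l = n \<Longrightarrow> \<bar>f l\<bar> \<le> 1"
    and \<beta>: "\<And>j T. T \<subseteq> {..<n + j} \<Longrightarrow> 2 \<le> card T \<Longrightarrow>
      EE (\<lambda>J. replica_avg N J (n + j) (\<lambda>l. \<bar>f (take n l)\<bar> * (multi_overlap N T l)\<^sup>2)) p \<le> \<beta>"
    and \<beta>0: "0 \<le> \<beta>"
  shows "\<bar>\<Sum>e\<in>bonds N. EE (swap_gain A B e (\<lambda>J. replica_avg N J n f)) p\<bar> \<le> gain_const \<kappa> n * (\<beta> + 1 / N)"
proof -
  let ?L = "Pow {..<n} \<times> {..tilt_degree n}"
  let ?P = "\<Pi>\<^sub>M i\<in>bonds N. mix p A B"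
  let ?F = "\<lambda>J. replica_avg N J n f"
  define \<delta> where "\<delta> k = tanh_moment N k B - tanh_moment N k A" for k
  define q where "q e S j J = replica_avg N (J(e := 0)) (n + j) (bond_term N e n f S j)" for e S j J
  define Q where "Q e S j J = replica_avg N J (n + j) (bond_term N e n f S j)" for e S j J
  interpret P: prob_space ?P by (rule PiM_mix_prob_space[OF disorder_pair])
  have \<delta>: "\<bar>\<delta> k\<bar> \<le> 2 * \<kappa> / (real N)\<^sup>2" "k < 2 \<Longrightarrow> \<delta> k = 0" for k
    using tanh_moment_diff[OF A B N] by (auto simp: \<delta>_def)
  have \<kappa>: "0 \<le> \<kappa>" by (rule disorder_const_nonneg[OF A])
  have qb: "\<bar>q e S j J\<bar> \<le> 1" if "e \<in> bonds N" "S \<subseteq> {..<n}" for e S j J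
    unfolding q_def by (rule replica_avg_bound) (rule bond_term_bound[OF that f])
  have iq: "integrable ?P (q e S j)" if "e \<in> bonds N" "S \<subseteq> {..<n}" for e S j
    unfolding q_def[abs_def] by (rule bonds_mix_integrable[OF replica_avg_update_measurable[OF that(1)]]) (rule qb[OF that, unfolded q_def])
  have ig: "integrable ?P (swap_gain A B e ?F)" if e: "e \<in> bonds N" for e
    by (rule bonds_mix_integrable[OF swap_gain_measurable[OF disorder_pair e replica_avg_measurable] swap_gain_abs_le[OF disorder_pair replica_avg_bound[OF f]]])
  have step1: "\<bar>EE (swap_gain A B e ?F) p - (\<Sum>(S, j)\<in>?L. tilt_coeff n j * \<delta> (card S + j) * EE (q e S j) p)\<bar> \<le> 2 * tilt_const n * (\<kappa> / real N ^ 3)"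
    if e: "e \<in> bonds N" for e
  proof -
    have is': "integrable ?P (\<lambda>J. \<Sum>(S, j)\<in>?L. tilt_coeff n j * \<delta> (card S + j) * q e S j J)"
      unfolding case_prod_beta using iq[OF e] by auto
    have "(\<Sum>(S, j)\<in>?L. tilt_coeff n j * \<delta> (card S + j) * EE (q e S j) p) = (\<integral>J. (\<Sum>(S, j)\<in>?L. tilt_coeff n j * \<delta> (card S + j) * q e S j J) \<partial>?P)"
      unfolding case_prod_beta mix_expect_def using iq[OF e] by (subst Bochner_Integration.integral_sum) auto
    then have eq: "EE (swap_gain A B e ?F) p - (\<Sum>(S, j)\<in>?L. tilt_coeff n j * \<delta> (card S + j) * EE (q e S j) p)
        = (\<integral>J. swap_gain A B e ?F J - (\<Sum>(S, j)\<in>?L. tilt_coeff n j * \<delta> (card S + j) * q e S j J) \<partial>?P)"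
      using ig[OF e] is' by (simp add: mix_expect_def)
    have "\<bar>EE (swap_gain A B e ?F) p - (\<Sum>(S, j)\<in>?L. tilt_coeff n j * \<delta> (card S + j) * EE (q e S j) p)\<bar> \<le> (\<integral>J. \<bar>swap_gain A B e ?F J - (\<Sum>(S, j)\<in>?L. tilt_coeff n j * \<delta> (card S + j) * q e S j J)\<bar> \<partial>?P)"
      unfolding eq by (rule integral_abs_bound)
    also have "\<dots> \<le> (\<integral>J. 2 * tilt_const n * (\<kappa> / real N ^ 3) \<partial>?P)"
    proof (rule integral_mono)
      fix J assume "J \<in> space ?P"
      then have J: "J \<in> space (\<Pi>\<^sub>M e\<in>bonds N. (borel :: real measure))" unfolding space_mix_bonds .
      show "\<bar>swap_gain A B e ?F J - (\<Sum>(S, j)\<in>?L. tilt_coeff n j * \<delta> (card S + j) * q e S j J)\<bar> \<le> 2 * tilt_const n * (\<kappa> / real N ^ 3)"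
        unfolding \<delta>_def q_def by (rule swap_gain_expansion[OF e f J])
    qed (use ig[OF e] is' in auto)
    finally show ?thesis by (simp add: P.prob_space)
  qed
  have step2: "\<bar>\<delta> (card S + j) * (\<Sum>e\<in>bonds N. EE (q e S j) p)\<bar> \<le> 2 * \<kappa> * (1 + expansion_const (n + j)) * (\<beta> + 1 / N)"
    if S: "S \<subseteq> {..<n}" for S j
  proof (cases "card S + j < 2")
    case True
    then show ?thesis using \<delta>(2) \<kappa> \<beta>0 expansion_const_nonneg[of "n + j"] by simp
  next
    case False
    have finS: "finite S" using S finite_subset by blast
    have cT: "card (S \<union> {n..<n + j}) = card S + j"
      using S finS by (subst card_Un_disjoint) auto
    have "\<bar>\<Sum>e\<in>bonds N. EE (Q e S j) p\<bar> \<le> (real N)\<^sup>2 * (\<beta> + 1 / N)"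
      unfolding Q_def by (rule sum_mix_expect_bond_terms[OF S f \<beta>]) (use S cT False in auto)
    moreover have "\<bar>(\<Sum>e\<in>bonds N. EE (q e S j) p) - (\<Sum>e\<in>bonds N. EE (Q e S j) p)\<bar> \<le> (real N)\<^sup>2 * (expansion_const (n + j) * (1 / N))"
    proof -
      have "\<bar>(\<Sum>e\<in>bonds N. EE (q e S j) p) - (\<Sum>e\<in>bonds N. EE (Q e S j) p)\<bar> \<le> (\<Sum>e\<in>bonds N. \<bar>EE (q e S j) p - EE (Q e S j) p\<bar>)"
        unfolding sum_subtractf[symmetric] by (rule sum_abs)
      also have "\<dots> \<le> (\<Sum>e\<in>bonds N. expansion_const (n + j) / N)"
        unfolding q_def Q_def by (intro sum_mono mix_expect_bond_term[OF _ S p f])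
      also have "\<dots> = real (card (bonds N)) * (expansion_const (n + j) * (1 / N))" by simp
      also have "\<dots> \<le> (real N)\<^sup>2 * (expansion_const (n + j) * (1 / N))"
        using card_bonds_le[of N] expansion_const_nonneg[of "n + j"]
        by (intro mult_right_mono) (auto simp flip: of_nat_power)
      finally show ?thesis .
    qed
    moreover have "(real N)\<^sup>2 * (expansion_const (n + j) * (1 / N)) \<le> (real N)\<^sup>2 * (expansion_const (n + j) * (\<beta> + 1 / N))"
      using expansion_const_nonneg \<beta>0 by (intro mult_left_mono) auto
    ultimately have "\<bar>\<Sum>e\<in>bonds N. EE (q e S j) p\<bar> \<le> (real N)\<^sup>2 * (\<beta> + 1 / N) + (real N)\<^sup>2 * (expansion_const (n + j) * (\<beta> + 1 / N))"
      by linarith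
    also have "\<dots> = (real N)\<^sup>2 * ((1 + expansion_const (n + j)) * (\<beta> + 1 / N))" by (simp add: algebra_simps)
    finally have s: "\<bar>\<Sum>e\<in>bonds N. EE (q e S j) p\<bar> \<le> (real N)\<^sup>2 * ((1 + expansion_const (n + j)) * (\<beta> + 1 / N))" .
    have "\<bar>\<delta> (card S + j) * (\<Sum>e\<in>bonds N. EE (q e S j) p)\<bar> \<le> (2 * \<kappa> / (real N)\<^sup>2) * ((real N)\<^sup>2 * ((1 + expansion_const (n + j)) * (\<beta> + 1 / N)))"
      unfolding abs_mult using \<delta>(1) s \<kappa> by (intro mult_mono) auto
    also have "\<dots> = 2 * \<kappa> * (1 + expansion_const (n + j)) * (\<beta> + 1 / N)" using N by simp
    finally show ?thesis .
  qed
  have err: "\<bar>(\<Sum>e\<in>bonds N. EE (swap_gain A B e ?F) p) - (\<Sum>e\<in>bonds N. \<Sum>(S, j)\<in>?L. tilt_coeff n j * \<delta> (card S + j) * EE (q e S j) p)\<bar>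
      \<le> 2 * \<kappa> * tilt_const n * (\<beta> + 1 / N)"
  proof -
    have "\<bar>(\<Sum>e\<in>bonds N. EE (swap_gain A B e ?F) p) - (\<Sum>e\<in>bonds N. \<Sum>(S, j)\<in>?L. tilt_coeff n j * \<delta> (card S + j) * EE (q e S j) p)\<bar>
        \<le> (\<Sum>e\<in>bonds N. 2 * tilt_const n * (\<kappa> / real N ^ 3))"
      unfolding sum_subtractf[symmetric] by (rule order_trans[OF sum_abs sum_mono[OF step1]])
    also have "\<dots> = real (card (bonds N)) * (2 * tilt_const n * (\<kappa> / real N ^ 3))" by simp
    also have "\<dots> \<le> (real N)\<^sup>2 * (2 * tilt_const n * (\<kappa> / real N ^ 3))"
      using card_bonds_le[of N] tilt_const_nonneg[of n] \<kappa>
      by (intro mult_right_mono) (auto simp flip: of_nat_power)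
    also have "\<dots> = 2 * \<kappa> * tilt_const n * (1 / N)" using N by (simp add: power2_eq_square power3_eq_cube)
    also have "\<dots> \<le> 2 * \<kappa> * tilt_const n * (\<beta> + 1 / N)" using \<kappa> tilt_const_nonneg[of n] \<beta>0 by (intro mult_left_mono) auto
    finally show ?thesis .
  qed
  have eq: "(\<Sum>e\<in>bonds N. \<Sum>(S, j)\<in>?L. tilt_coeff n j * \<delta> (card S + j) * EE (q e S j) p)
      = (\<Sum>(S, j)\<in>?L. tilt_coeff n j * (\<delta> (card S + j) * (\<Sum>e\<in>bonds N. EE (q e S j) p)))"
    unfolding case_prod_beta by (subst sum.swap) (simp add: sum_distrib_left mult.assoc)
  have "\<bar>\<Sum>e\<in>bonds N. \<Sum>(S, j)\<in>?L. tilt_coeff n j * \<delta> (card S + j) * EE (q e S j) p\<bar>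
      \<le> (\<Sum>(S, j)\<in>?L. \<bar>tilt_coeff n j\<bar> * (2 * \<kappa> * (1 + expansion_const (n + j)) * (\<beta> + 1 / N)))"
    unfolding eq case_prod_beta
  proof (rule order_trans[OF sum_abs], rule sum_mono)
    fix x assume "x \<in> ?L"
    then have "fst x \<subseteq> {..<n}" by auto
    from mult_left_mono[OF step2[OF this, of "snd x"], of "\<bar>tilt_coeff n (snd x)\<bar>"]
    show "\<bar>tilt_coeff n (snd x) * (\<delta> (card (fst x) + snd x) * (\<Sum>e\<in>bonds N. EE (q e (fst x) (snd x)) p))\<bar>
      \<le> \<bar>tilt_coeff n (snd x)\<bar> * (2 * \<kappa> * (1 + expansion_const (n + snd x)) * (\<beta> + 1 / N))"
      by (simp only: abs_mult[of "tilt_coeff n (snd x)"] abs_ge_zero)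
  qed
  also have "\<dots> = 2 * \<kappa> * (\<Sum>(S, j)\<in>?L. \<bar>tilt_coeff n j\<bar> * (1 + expansion_const (n + j))) * (\<beta> + 1 / N)"
    unfolding case_prod_beta sum_distrib_left sum_distrib_right by (simp add: mult_ac)
  finally have main: "\<bar>\<Sum>e\<in>bonds N. \<Sum>(S, j)\<in>?L. tilt_coeff n j * \<delta> (card S + j) * EE (q e S j) p\<bar>
      \<le> 2 * \<kappa> * (\<Sum>(S, j)\<in>?L. \<bar>tilt_coeff n j\<bar> * (1 + expansion_const (n + j))) * (\<beta> + 1 / N)" .
  have "gain_const \<kappa> n * (\<beta> + 1 / N) = 2 * \<kappa> * (\<Sum>(S, j)\<in>?L. \<bar>tilt_coeff n j\<bar> * (1 + expansion_const (n + j))) * (\<beta> + 1 / N)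
      + 2 * \<kappa> * tilt_const n * (\<beta> + 1 / N)"
    by (simp only: gain_const_def distrib_left distrib_right mult.assoc)
  then show ?thesis using main err by linarith
qed

end

section \<open>Propagation of the fourth overlap moment\<close>

lemma iid_avg_take:
  assumes "finite X" "(\<Sum>x\<in>X. w x) = 1"
  shows "iid_avg X w (n + j) (\<lambda>l. g (take n l)) = iid_avg X w n g"
proof -
  have "iid_avg X w (n + j) (\<lambda>l. g (take n l)) = iid_avg X w n (\<lambda>l. iid_avg X w j (\<lambda>r. g (take n (l @ r))))"
    by (rule iid_avg_append[OF assms(1)])
  also have "\<dots> = iid_avg X w n g"
    by (rule iid_avg_cong) (simp add: iid_avg_const[OF assms])
  finally show ?thesis .
qed

lemma replica_avg_take: "replica_avg N J (n + j) (\<lambda>l. g (take n l)) = replica_avg N J n g"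
  unfolding replica_avg_def by (rule iid_avg_take[OF finite_spin_configs gibbs_weight_sum])

lemma replica_avg_const: "replica_avg N J n (\<lambda>_. c) = c"
  unfolding replica_avg_def by (rule iid_avg_const[OF finite_spin_configs gibbs_weight_sum])

lemma overlap_abs_le:
  assumes "set l \<subseteq> spin_configs N" "2 \<le> length l"
  shows "\<bar>overlap N (l ! 0) (l ! 1)\<bar> \<le> 1"
proof -
  have "{0, 1} \<subseteq> {..<length l}" using assms(2) by auto
  from multi_overlap_abs_le[OF assms(1) this] show ?thesis unfolding multi_overlap_pair .
qed

lemma overlap4_bounds: "0 \<le> overlap4 N J" "\<bar>overlap4 N J\<bar> \<le> 1"
proof -
  have b: "\<bar>overlap N (l ! 0) (l ! 1) ^ 4\<bar> \<le> 1" if "set l \<subseteq> spin_configs N" "length l = 2" for l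
    unfolding power_abs by (rule power_le_one) (use overlap_abs_le[OF that(1)] that(2) in auto)
  show "\<bar>overlap4 N J\<bar> \<le> 1" unfolding overlap4_def by (rule replica_avg_bound[OF b])
  have "replica_avg N J 2 (\<lambda>_. 0) \<le> overlap4 N J" unfolding overlap4_def by (rule replica_avg_mono) simp
  then show "0 \<le> overlap4 N J" by (simp add: replica_avg_const)
qed

lemma gain_const_nonneg: "0 \<le> \<kappa> \<Longrightarrow> 0 \<le> gain_const \<kappa> n"
  unfolding gain_const_def case_prod_beta
  by (intro mult_nonneg_nonneg add_nonneg_nonneg sum_nonneg tilt_const_nonneg) (auto simp: expansion_const_nonneg)

text \<open>
  An upper bound for \<open>E \<langle>R\<^sub>1\<^sub>2\<^sup>4\<rangle>\<close> that is uniform along the interpolation.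
\<close>

definition overlap4_bound :: "real \<Rightarrow> real measure \<Rightarrow> real measure \<Rightarrow> nat \<Rightarrow> real" where
  "overlap4_bound \<kappa> A B N = (mix_expect A B (bonds N) (overlap4 N) 0 + 1 / N) * exp (gain_const \<kappa> 2)"

context
  fixes \<kappa> :: real and A B :: "real measure" and N :: nat
  assumes A: "disorder \<kappa> A" and B: "disorder \<kappa> B" and N: "0 < N"
begin

lemma mix_expect_mono:
  fixes F G :: "(nat \<times> nat \<Rightarrow> real) \<Rightarrow> real"
  assumes "F \<in> borel_measurable (\<Pi>\<^sub>M i\<in>bonds N. borel)" "\<And>x. \<bar>F x\<bar> \<le> c"
    "G \<in> borel_measurable (\<Pi>\<^sub>M i\<in>bonds N. borel)" "\<And>x. \<bar>G x\<bar> \<le> c'" "\<And>x. F x \<le> G x"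
  shows "mix_expect A B (bonds N) F p \<le> mix_expect A B (bonds N) G p"
  unfolding mix_expect_def
  by (rule integral_mono[OF PiM_mix_integrable[OF disorder_pair[OF A B N] assms(1,2)] PiM_mix_integrable[OF disorder_pair[OF A B N] assms(3,4)] assms(5)])

lemma replica_avg_interpolation_deriv:
  assumes f: "\<And>l. set l \<subseteq> spin_configs N \<Longrightarrow> length l = n \<Longrightarrow> \<bar>f l\<bar> \<le> 1" and p: "p \<in> {0..1}"
  shows "(mix_expect A B (bonds N) (\<lambda>J. replica_avg N J n f) has_real_derivative
    (\<Sum>e\<in>bonds N. mix_expect A B (bonds N) (swap_gain A B e (\<lambda>J. replica_avg N J n f)) p)) (at p within {0..1})"
  by (rule mix_expect_deriv[OF disorder_pair[OF A B N] finite_bonds replica_avg_measurable replica_avg_bound[OF f]]) (use p in auto)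

lemma overlap4_measurable: "overlap4 N \<in> borel_measurable (\<Pi>\<^sub>M i\<in>bonds N. borel)"
  unfolding overlap4_def[abs_def] by (rule replica_avg_measurable)

lemma mix_expect_overlap4_nonneg: "0 \<le> mix_expect A B (bonds N) (overlap4 N) p"
  unfolding mix_expect_def by (intro integral_nonneg_AE AE_I2 overlap4_bounds)

text \<open>
  With \<open>f = R\<^sub>1\<^sub>2\<^sup>4\<close> and \<open>R\<^sub>T\<^sup>2 \<le> 1\<close> the derivative is at most a constant times \<open>E \<langle>R\<^sub>1\<^sub>2\<^sup>4\<rangle> + 1 / N\<close>, and Gronwall's
  inequality applies.
\<close>

lemma overlap4_growth:
  assumes p: "p \<in> {0..1}"
  shows "mix_expect A B (bonds N) (overlap4 N) p
    \<le> (mix_expect A B (bonds N) (overlap4 N) 0 + 1 / N) * exp (gain_const \<kappa> 2)"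
proof -
  define \<phi> where "\<phi> = mix_expect A B (bonds N) (overlap4 N)"
  define C where "C = gain_const \<kappa> 2"
  have C: "0 \<le> C" unfolding C_def by (rule gain_const_nonneg[OF disorder_const_nonneg[OF A]])
  let ?f = "\<lambda>l. overlap N (l ! 0) (l ! 1) ^ 4"
  define D where "D p = (\<Sum>e\<in>bonds N. mix_expect A B (bonds N) (swap_gain A B e (overlap4 N)) p)" for p
  have f: "\<bar>?f l\<bar> \<le> 1" if "set l \<subseteq> spin_configs N" "length l = 2" for l
    unfolding power_abs by (rule power_le_one) (use overlap_abs_le[OF that(1)] that(2) in auto)
  have deriv: "(\<phi> has_real_derivative D p) (at p within {0..1})" if "p \<in> {0..1}" for p
    using replica_avg_interpolation_deriv[OF f that] unfolding \<phi>_def D_def overlap4_def[abs_def] .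
  have \<phi>0: "0 \<le> \<phi> p" for p unfolding \<phi>_def by (rule mix_expect_overlap4_nonneg)
  have D: "\<bar>D p\<bar> \<le> C * (\<phi> p + 1 / N)" if p: "p \<in> {0..1}" for p
    unfolding D_def C_def overlap4_def[abs_def]
  proof (rule sum_swap_gain_bound[OF A B N _ _ f])
    fix j :: nat and T assume T: "T \<subseteq> {..<2 + j}" "2 \<le> card T"
    let ?G = "\<lambda>J. replica_avg N J (2 + j) (\<lambda>l. \<bar>overlap N (take 2 l ! 0) (take 2 l ! 1) ^ 4\<bar> * (multi_overlap N T l)\<^sup>2)"
    have le: "\<bar>overlap N (take 2 l ! 0) (take 2 l ! 1) ^ 4\<bar> * (multi_overlap N T l)\<^sup>2 \<le> ?f (take 2 l)"
      if l: "set l \<subseteq> spin_configs N" "length l = 2 + j" for l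
    proof -
      have "(multi_overlap N T l)\<^sup>2 \<le> 1" using multi_overlap_abs_le[OF l(1), of T] T l(2) by (simp add: abs_square_le_1)
      then show ?thesis using mult_left_mono[of "(multi_overlap N T l)\<^sup>2" 1 "?f (take 2 l)"] by (simp add: power_even_abs)
    qed
    have G: "0 \<le> ?G J" "?G J \<le> overlap4 N J" for J
    proof -
      have "replica_avg N J (2 + j) (\<lambda>_. 0) \<le> ?G J" by (rule replica_avg_mono) simp
      then show "0 \<le> ?G J" by (simp only: replica_avg_const)
      have "?G J \<le> replica_avg N J (2 + j) (\<lambda>l. ?f (take 2 l))" by (rule replica_avg_mono) (rule le)
      also have "\<dots> = overlap4 N J" unfolding overlap4_def by (rule replica_avg_take[where g="?f"])
      finally show "?G J \<le> overlap4 N J" .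
    qed
    have "mix_expect A B (bonds N) ?G p \<le> mix_expect A B (bonds N) (overlap4 N) p"
    proof (rule mix_expect_mono[OF replica_avg_measurable _ overlap4_measurable overlap4_bounds(2) G(2)])
      show "\<bar>?G x\<bar> \<le> 1" for x using G[of x] overlap4_bounds(2)[of N x] by linarith
    qed
    then show "mix_expect A B (bonds N) ?G p \<le> \<phi> p" unfolding \<phi>_def .
  qed (use p \<phi>0 in auto)
  let ?g = "\<lambda>p. (\<phi> p + 1 / N) * exp (- C * p)"
  show ?thesis
  proof (cases "p = 0")
    case True
    have "\<phi> 0 * 1 \<le> (\<phi> 0 + 1 / N) * exp C"
      using \<phi>0[of 0] C by (intro mult_mono) auto
    then show ?thesis unfolding True \<phi>_def C_def by simp
  next
    case False
    then have p0: "0 < p" "p \<le> 1" using p by auto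
    have gd: "(?g has_real_derivative (D q * exp (- C * q) + (\<phi> q + 1 / N) * (exp (- C * q) * (- C)))) (at q within {0..1})"
      if "q \<in> {0..1}" for q
      by (rule derivative_eq_intros deriv[OF that] refl | simp)+
    have "?g p \<le> ?g 0"
    proof (rule DERIV_nonpos_imp_decreasing_open[where f="?g", OF less_imp_le[OF p0(1)]])
      fix q assume q: "0 < q" "q < p"
      then have q01: "q \<in> {0..1}" and qi: "q \<in> interior {0..1::real}" using p0 by auto
      from qi have at: "at q within {0..1} = at q" by (rule at_within_interior)
      have "D q * exp (- C * q) \<le> (C * (\<phi> q + 1 / N)) * exp (- C * q)"
        using D[OF q01] by (intro mult_right_mono) auto
      moreover have "(C * (\<phi> q + 1 / N)) * exp (- C * q) + (\<phi> q + 1 / N) * (exp (- C * q) * (- C)) = 0"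
        by (simp only: mult_minus_right mult_ac)
      ultimately have "D q * exp (- C * q) + (\<phi> q + 1 / N) * (exp (- C * q) * (- C)) \<le> 0" by linarith
      then show "\<exists>y. (?g has_real_derivative y) (at q) \<and> y \<le> 0" using gd[OF q01] unfolding at by blast
    next
      have "continuous_on {0..1} ?g"
        by (rule DERIV_continuous_on) (rule gd)
      then show "continuous_on {0..p} ?g" by (rule continuous_on_subset) (use p0 in auto)
    qed
    then have "(\<phi> p + 1 / N) * exp (- C * p) \<le> \<phi> 0 + 1 / N" by simp
    then have "(\<phi> p + 1 / N) * exp (- C * p) * exp (C * p) \<le> (\<phi> 0 + 1 / N) * exp (C * p)"
      by (rule mult_right_mono) simp
    moreover have "exp (- C * p) * exp (C * p) = 1" by (simp add: exp_minus)
    ultimately have "\<phi> p + 1 / N \<le> (\<phi> 0 + 1 / N) * exp (C * p)"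
      by (simp only: mult.assoc mult_1_right)
    also have "\<dots> \<le> (\<phi> 0 + 1 / N) * exp C"
    proof (rule mult_left_mono)
      have "C * p \<le> C" using C p0 by (intro mult_left_le) auto
      then show "exp (C * p) \<le> exp C" by simp
    qed (use \<phi>0[of 0] in simp)
    finally have "\<phi> p + 1 / N \<le> (\<phi> 0 + 1 / N) * exp C" .
    moreover have "0 \<le> 1 / real N" by simp
    ultimately have "\<phi> p \<le> (\<phi> 0 + 1 / N) * exp C" by linarith
    then show ?thesis unfolding \<phi>_def C_def .
  qed
qed

lemma overlap4_bound_nonneg: "0 \<le> overlap4_bound \<kappa> A B N"
  using mix_expect_overlap4_nonneg[of 0] by (auto simp: overlap4_bound_def)

lemma mix_expect_power4_le:
  assumes T: "T \<subseteq> {..<n}" "2 \<le> card T" and p: "p \<in> {0..1}"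
  shows "mix_expect A B (bonds N) (\<lambda>J. replica_avg N J n (\<lambda>l. multi_overlap N T l ^ 4)) p \<le> overlap4_bound \<kappa> A B N"
proof -
  have b: "\<bar>multi_overlap N T l ^ 4\<bar> \<le> 1" if "set l \<subseteq> spin_configs N" "length l = n" for l
    unfolding power_abs by (rule power_le_one) (use multi_overlap_abs_le[OF that(1), of T] T that(2) in auto)
  have "mix_expect A B (bonds N) (\<lambda>J. replica_avg N J n (\<lambda>l. multi_overlap N T l ^ 4)) p \<le> mix_expect A B (bonds N) (overlap4 N) p"
    by (rule mix_expect_mono[OF replica_avg_measurable replica_avg_bound[OF b] overlap4_measurable overlap4_bounds(2) multi_overlap_power4_le[OF T]])
  also have "\<dots> \<le> overlap4_bound \<kappa> A B N" unfolding overlap4_bound_def by (rule overlap4_growth[OF p])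
  finally show ?thesis .
qed

text \<open>
  The mean value theorem along the interpolation.
\<close>

lemma replica_universality_general:
  assumes f: "\<And>l. set l \<subseteq> spin_configs N \<Longrightarrow> length l = n \<Longrightarrow> \<bar>f l\<bar> \<le> 1" and \<beta>0: "0 \<le> \<beta>"
    and \<beta>: "\<And>p j T. p \<in> {0..1} \<Longrightarrow> T \<subseteq> {..<n + j} \<Longrightarrow> 2 \<le> card T \<Longrightarrow>
      mix_expect A B (bonds N) (\<lambda>J. replica_avg N J (n + j) (\<lambda>l. \<bar>f (take n l)\<bar> * (multi_overlap N T l)\<^sup>2)) p \<le> \<beta>"
  shows "\<bar>(\<integral>J. replica_avg N J n f \<partial>(\<Pi>\<^sub>M e\<in>bonds N. B)) - (\<integral>J. replica_avg N J n f \<partial>(\<Pi>\<^sub>M e\<in>bonds N. A))\<bar>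
    \<le> gain_const \<kappa> n * (\<beta> + 1 / N)"
proof -
  let ?\<Phi> = "mix_expect A B (bonds N) (\<lambda>J. replica_avg N J n f)"
  have "norm (?\<Phi> 1 - ?\<Phi> 0) \<le> gain_const \<kappa> n * (\<beta> + 1 / N) * norm (1 - 0 :: real)"
  proof (rule field_differentiable_bound[where S="{0..1}"])
    show "(?\<Phi> has_field_derivative (\<Sum>e\<in>bonds N. mix_expect A B (bonds N) (swap_gain A B e (\<lambda>J. replica_avg N J n f)) p)) (at p within {0..1})"
      if "p \<in> {0..1}" for p by (rule replica_avg_interpolation_deriv[OF f that])
    show "norm (\<Sum>e\<in>bonds N. mix_expect A B (bonds N) (swap_gain A B e (\<lambda>J. replica_avg N J n f)) p) \<le> gain_const \<kappa> n * (\<beta> + 1 / N)"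
      if "p \<in> {0..1}" for p
      unfolding real_norm_def by (rule sum_swap_gain_bound[OF A B N _ _ f \<beta> \<beta>0]) (use that in auto)
  qed auto
  then show ?thesis by (simp add: mix_expect_def mix_ends[OF disorder_pair[OF A B N]])
qed

text \<open>
  Uses \<open>R\<^sub>T\<^sup>2 \<le> h + R\<^sub>T\<^sup>4 / h\<close>; a suitable \<open>h\<close> is chosen only in the limit.
\<close>

lemma replica_universality_bounded:
  assumes f: "\<And>l. set l \<subseteq> spin_configs N \<Longrightarrow> length l = n \<Longrightarrow> \<bar>f l\<bar> \<le> 1" and h: "0 < h"
  shows "\<bar>(\<integral>J. replica_avg N J n f \<partial>(\<Pi>\<^sub>M e\<in>bonds N. B)) - (\<integral>J. replica_avg N J n f \<partial>(\<Pi>\<^sub>M e\<in>bonds N. A))\<bar>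
    \<le> gain_const \<kappa> n * (h + overlap4_bound \<kappa> A B N / h + 1 / N)"
proof (rule replica_universality_general[OF f])
  show "0 \<le> h + overlap4_bound \<kappa> A B N / h" using h overlap4_bound_nonneg by simp
  fix p :: real and j :: nat and T assume p: "p \<in> {0..1}" and T: "T \<subseteq> {..<n + j}" "2 \<le> card T"
  let ?G = "\<lambda>J. replica_avg N J (n + j) (\<lambda>l. \<bar>f (take n l)\<bar> * (multi_overlap N T l)\<^sup>2)"
  let ?H = "\<lambda>J. replica_avg N J (n + j) (\<lambda>l. multi_overlap N T l ^ 4)"
  have ft: "\<bar>f (take n l)\<bar> \<le> 1" if "set l \<subseteq> spin_configs N" "length l = n + j" for l
    using that set_take_subset[of n l] by (intro f) auto
  have R: "\<bar>multi_overlap N T l\<bar> \<le> 1" if "set l \<subseteq> spin_configs N" "length l = n + j" for l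
    using multi_overlap_abs_le[OF that(1), of T] T that(2) by simp
  have Gb: "\<bar>?G J\<bar> \<le> 1" for J
    by (rule replica_avg_bound) (auto simp: abs_mult abs_square_le_1 intro!: mult_le_one ft R)
  have Hb: "\<bar>?H J\<bar> \<le> 1" for J
  proof (rule replica_avg_bound)
    show "\<bar>multi_overlap N T l ^ 4\<bar> \<le> 1" if "set l \<subseteq> spin_configs N" "length l = n + j" for l
      unfolding power_abs by (rule power_le_one) (use R[OF that] in auto)
  qed
  have pt: "\<bar>f (take n l)\<bar> * (multi_overlap N T l)\<^sup>2 \<le> 1 / h * multi_overlap N T l ^ 4 + h" if "set l \<subseteq> spin_configs N" "length l = n + j" for l
  proof -
    have "\<bar>f (take n l)\<bar> * (multi_overlap N T l)\<^sup>2 \<le> 1 * \<bar>(multi_overlap N T l)\<^sup>2\<bar>"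
      using ft[OF that] by (intro mult_mono) auto
    also have "\<dots> \<le> h + 1\<^sup>2 / h * ((multi_overlap N T l)\<^sup>2)\<^sup>2" by (rule abs_le_am_gm[OF h])
    finally show ?thesis by (simp add: power_mult[symmetric])
  qed
  have "?G J \<le> 1 / h * ?H J + h * 1" for J
  proof -
    have "?G J \<le> replica_avg N J (n + j) (\<lambda>l. 1 / h * multi_overlap N T l ^ 4 + h)" by (rule replica_avg_mono) (rule pt)
    also have "\<dots> = 1 / h * ?H J + h"
      unfolding replica_avg_def by (simp only: iid_avg_add iid_avg_cmult iid_avg_const[OF finite_spin_configs gibbs_weight_sum])
    finally show ?thesis by simp
  qed
  then have "mix_expect A B (bonds N) ?G p \<le> mix_expect A B (bonds N) (\<lambda>J. 1 / h * ?H J + h * 1) p"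
  proof (intro mix_expect_mono[OF replica_avg_measurable Gb])
    show "(\<lambda>J. 1 / h * ?H J + h * 1) \<in> borel_measurable (\<Pi>\<^sub>M i\<in>bonds N. borel)"
      by (intro borel_measurable_add borel_measurable_times borel_measurable_const replica_avg_measurable)
    show "\<bar>1 / h * ?H J + h * 1\<bar> \<le> 1 / h + h" for J
    proof -
      have "\<bar>1 / h * ?H J\<bar> \<le> 1 / h" using Hb[of J] h by (simp add: abs_mult divide_right_mono)
      then show ?thesis using h by linarith
    qed
  qed
  also have "\<dots> = 1 / h * mix_expect A B (bonds N) ?H p + h * mix_expect A B (bonds N) (\<lambda>_. 1) p"
    by (rule mix_expect_add[OF disorder_pair[OF A B N] replica_avg_measurable Hb, where c'=1]) auto
  also have "mix_expect A B (bonds N) (\<lambda>_. 1) p = 1"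
    using prob_space.prob_space[OF PiM_mix_prob_space[OF disorder_pair[OF A B N]]] by (simp add: mix_expect_def)
  also have "1 / h * mix_expect A B (bonds N) ?H p + h * 1 \<le> 1 / h * overlap4_bound \<kappa> A B N + h * 1"
    using mix_expect_power4_le[OF T p] h by (intro add_right_mono mult_left_mono) auto
  finally show "mix_expect A B (bonds N) ?G p \<le> h + overlap4_bound \<kappa> A B N / h" by simp
qed

text \<open>
  For \<open>f\<close> of the size of \<open>R\<^sub>1\<^sub>2\<^sup>2\<close> one has \<open>\<langle>\<bar>f\<bar> R\<^sub>T\<^sup>2\<rangle> \<le> \<langle>R\<^sub>1\<^sub>2\<^sup>4\<rangle>\<close>. The resulting bound is linear in the fourth moment
  and stays small after multiplication by \<open>N\<^bsup>2/3\<^esup>\<close>.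
\<close>

lemma replica_universality_quadratic:
  assumes f: "\<And>l. set l \<subseteq> spin_configs N \<Longrightarrow> length l = 2 \<Longrightarrow> \<bar>f l\<bar> \<le> (overlap N (l ! 0) (l ! 1))\<^sup>2"
  shows "\<bar>(\<integral>J. replica_avg N J 2 f \<partial>(\<Pi>\<^sub>M e\<in>bonds N. B)) - (\<integral>J. replica_avg N J 2 f \<partial>(\<Pi>\<^sub>M e\<in>bonds N. A))\<bar>
    \<le> gain_const \<kappa> 2 * (overlap4_bound \<kappa> A B N + 1 / N)"
proof (rule replica_universality_general[OF _ overlap4_bound_nonneg])
  have o: "\<bar>overlap N (l ! 0) (l ! 1)\<bar> \<le> 1" if "set l \<subseteq> spin_configs N" "2 \<le> length l" for l
    using overlap_abs_le that by blast
  show f1: "\<bar>f l\<bar> \<le> 1" if "set l \<subseteq> spin_configs N" "length l = 2" for l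
    using f[OF that] o[of l] that abs_square_le_1[of "overlap N (l ! 0) (l ! 1)"] by linarith
  fix p :: real and j :: nat and T assume p: "p \<in> {0..1}" and T: "T \<subseteq> {..<2 + j}" "2 \<le> card T"
  let ?G = "\<lambda>J. replica_avg N J (2 + j) (\<lambda>l. \<bar>f (take 2 l)\<bar> * (multi_overlap N T l)\<^sup>2)"
  let ?H = "\<lambda>J. replica_avg N J (2 + j) (\<lambda>l. multi_overlap N T l ^ 4)"
  have ft: "\<bar>f (take 2 l)\<bar> \<le> 1" "\<bar>f (take 2 l)\<bar> \<le> (overlap N (take 2 l ! 0) (take 2 l ! 1))\<^sup>2"
    if "set l \<subseteq> spin_configs N" "length l = 2 + j" for l
  proof -
    have t: "set (take 2 l) \<subseteq> spin_configs N" "length (take 2 l) = 2"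
      using that set_take_subset[of 2 l] by auto
    show "\<bar>f (take 2 l)\<bar> \<le> 1" "\<bar>f (take 2 l)\<bar> \<le> (overlap N (take 2 l ! 0) (take 2 l ! 1))\<^sup>2"
      by (rule f1[OF t], rule f[OF t])
  qed
  have R: "\<bar>multi_overlap N T l\<bar> \<le> 1" if "set l \<subseteq> spin_configs N" "length l = 2 + j" for l
    using multi_overlap_abs_le[OF that(1), of T] T that(2) by simp
  have Gb: "\<bar>?G J\<bar> \<le> 1" for J
    by (rule replica_avg_bound) (auto simp: abs_mult abs_square_le_1 intro!: mult_le_one ft R)
  have Hb: "\<bar>?H J\<bar> \<le> 1" for J
  proof (rule replica_avg_bound)
    show "\<bar>multi_overlap N T l ^ 4\<bar> \<le> 1" if "set l \<subseteq> spin_configs N" "length l = 2 + j" for l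
      unfolding power_abs by (rule power_le_one) (use R[OF that] in auto)
  qed
  have amgm: "a\<^sup>2 * b\<^sup>2 \<le> 1 / 2 * a ^ 4 + 1 / 2 * b ^ 4" for a b :: real
    using zero_le_power2[of "a\<^sup>2 - b\<^sup>2"] unfolding power2_diff by (simp add: power_mult[symmetric])
  have pt: "\<bar>f (take 2 l)\<bar> * (multi_overlap N T l)\<^sup>2 \<le> 1 / 2 * overlap N (take 2 l ! 0) (take 2 l ! 1) ^ 4 + 1 / 2 * multi_overlap N T l ^ 4"
    if "set l \<subseteq> spin_configs N" "length l = 2 + j" for l
    by (rule order_trans[OF mult_right_mono[OF ft(2)[OF that]] amgm]) simp
  have "?G J \<le> 1 / 2 * overlap4 N J + 1 / 2 * ?H J" for J
  proof -
    have "?G J \<le> replica_avg N J (2 + j) (\<lambda>l. 1 / 2 * (\<lambda>l. overlap N (l ! 0) (l ! 1) ^ 4) (take 2 l) + 1 / 2 * multi_overlap N T l ^ 4)"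
      by (rule replica_avg_mono) (rule pt)
    also have "\<dots> = 1 / 2 * replica_avg N J (2 + j) (\<lambda>l. (\<lambda>l. overlap N (l ! 0) (l ! 1) ^ 4) (take 2 l)) + 1 / 2 * ?H J"
      unfolding replica_avg_def by (simp only: iid_avg_add iid_avg_cmult)
    also have "replica_avg N J (2 + j) (\<lambda>l. (\<lambda>l. overlap N (l ! 0) (l ! 1) ^ 4) (take 2 l)) = overlap4 N J"
      unfolding overlap4_def by (rule replica_avg_take)
    finally show ?thesis .
  qed
  then have "mix_expect A B (bonds N) ?G p \<le> mix_expect A B (bonds N) (\<lambda>J. 1 / 2 * overlap4 N J + 1 / 2 * ?H J) p"
  proof (intro mix_expect_mono[OF replica_avg_measurable Gb])
    show "(\<lambda>J. 1 / 2 * overlap4 N J + 1 / 2 * ?H J) \<in> borel_measurable (\<Pi>\<^sub>M i\<in>bonds N. borel)"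
      by (intro borel_measurable_add borel_measurable_times borel_measurable_const replica_avg_measurable overlap4_measurable)
    show "\<bar>1 / 2 * overlap4 N J + 1 / 2 * ?H J\<bar> \<le> 1" for J
      using Hb[of J] overlap4_bounds(2)[of N J] by linarith
  qed
  also have "\<dots> = 1 / 2 * mix_expect A B (bonds N) (overlap4 N) p + 1 / 2 * mix_expect A B (bonds N) ?H p"
    by (rule mix_expect_add[OF disorder_pair[OF A B N] overlap4_measurable overlap4_bounds(2) replica_avg_measurable Hb])
  also have "\<dots> \<le> 1 / 2 * overlap4_bound \<kappa> A B N + 1 / 2 * overlap4_bound \<kappa> A B N"
    using mix_expect_power4_le[OF T p] overlap4_growth[OF p, folded overlap4_bound_def] by (intro add_mono mult_left_mono) auto
  finally show "mix_expect A B (bonds N) ?G p \<le> overlap4_bound \<kappa> A B N" by simp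
qed

end

section \<open>The quenched overlap measure as a random law\<close>

lemma gibbs_prob_space: "prob_space (gibbs_measure N J)"
  unfolding gibbs_measure_def
  by (rule prob_space_point_measure[OF finite_spin_configs]) (simp_all add: sum_ennreal gibbs_weight_nonneg gibbs_weight_sum)

lemma gibbs_pair:
  "gibbs_measure N J \<Otimes>\<^sub>M gibbs_measure N J
    = point_measure (spin_configs N \<times> spin_configs N) (\<lambda>z. ennreal (gibbs_weight N J (fst z) * gibbs_weight N J (snd z)))"
proof -
  let ?X = "spin_configs N"
  interpret G: prob_space "gibbs_measure N J"
    by (rule gibbs_prob_space)
  have "gibbs_measure N J \<Otimes>\<^sub>M gibbs_measure N J
      = density (count_space ?X \<Otimes>\<^sub>M count_space ?X) (\<lambda>(x, y). ennreal (gibbs_weight N J x) * ennreal (gibbs_weight N J y))"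
    unfolding gibbs_measure_def point_measure_def
    by (rule pair_measure_density)
      (use G.sigma_finite_measure_axioms in \<open>auto simp: gibbs_measure_def point_measure_def sigma_finite_measure_count_space_finite finite_spin_configs\<close>)
  also have "count_space ?X \<Otimes>\<^sub>M count_space ?X = count_space (?X \<times> ?X)"
    by (rule pair_measure_count_space[OF finite_spin_configs finite_spin_configs])
  finally show ?thesis
    by (simp add: point_measure_def case_prod_beta ennreal_mult' gibbs_weight_nonneg)
qed

lemma overlap_measure_map: "(\<lambda>(\<sigma>, \<tau>). real N powr (1/3) * overlap N \<sigma> \<tau>)
    \<in> borel_measurable (gibbs_measure N J \<Otimes>\<^sub>M gibbs_measure N J)"
  unfolding gibbs_pair measurable_point_measure_eq1 by simp

lemma replica_avg_2:
  "replica_avg N J 2 f = (\<Sum>\<sigma>\<in>spin_configs N. \<Sum>\<tau>\<in>spin_configs N. gibbs_weight N J \<sigma> * (gibbs_weight N J \<tau> * f [\<sigma>, \<tau>]))"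
  by (simp add: replica_avg_def numeral_2_eq_2 iid_avg_Suc[OF finite_spin_configs] sum_distrib_left)

lemma quenched_integral:
  fixes g :: "real \<Rightarrow> real"
  assumes "g \<in> borel_measurable borel"
  shows "(\<integral>x. g x \<partial>quenched_overlap_measure N J)
    = replica_avg N J 2 (\<lambda>l. g (real N powr (1/3) * overlap N (l ! 0) (l ! 1)))"
    and "integrable (quenched_overlap_measure N J) g"
proof -
  let ?X = "spin_configs N" and ?w = "gibbs_weight N J"
  let ?h = "\<lambda>(\<sigma>, \<tau>). real N powr (1/3) * overlap N \<sigma> \<tau>"
  have fin: "finite (?X \<times> ?X)" using finite_spin_configs by auto
  have "(\<integral>x. g x \<partial>quenched_overlap_measure N J) = (\<integral>z. g (?h z) \<partial>(gibbs_measure N J \<Otimes>\<^sub>M gibbs_measure N J))"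
    unfolding quenched_overlap_measure_def by (rule integral_distr[OF overlap_measure_map assms])
  also have "\<dots> = (\<Sum>z\<in>?X \<times> ?X. (?w (fst z) * ?w (snd z)) *\<^sub>R g (?h z))"
    unfolding gibbs_pair by (rule lebesgue_integral_point_measure_finite[OF fin]) (simp add: gibbs_weight_nonneg)
  also have "\<dots> = (\<Sum>\<sigma>\<in>?X. \<Sum>\<tau>\<in>?X. ?w \<sigma> * (?w \<tau> * g (?h (\<sigma>, \<tau>))))"
    by (simp add: sum.cartesian_product case_prod_beta mult.assoc)
  finally show "(\<integral>x. g x \<partial>quenched_overlap_measure N J)
    = replica_avg N J 2 (\<lambda>l. g (real N powr (1/3) * overlap N (l ! 0) (l ! 1)))"
    by (simp add: replica_avg_2)
  have "integrable (gibbs_measure N J \<Otimes>\<^sub>M gibbs_measure N J) (\<lambda>z. g (?h z))"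
    unfolding gibbs_pair by (rule integrable_point_measure_finite[OF fin])
  then show "integrable (quenched_overlap_measure N J) g"
    unfolding quenched_overlap_measure_def by (subst integrable_distr_eq[OF overlap_measure_map assms])
qed

lemma quenched_P2: "quenched_overlap_measure N J \<in> P2_real"
proof -
  interpret GG: pair_prob_space "gibbs_measure N J" "gibbs_measure N J"
    by (simp add: pair_prob_space_def pair_sigma_finite_def prob_space_imp_sigma_finite gibbs_prob_space)
  have "prob_space (quenched_overlap_measure N J)"
    unfolding quenched_overlap_measure_def by (rule GG.prob_space_distr[OF overlap_measure_map])
  moreover have "sets (quenched_overlap_measure N J) = sets borel" "space (quenched_overlap_measure N J) = UNIV"
    by (auto simp: quenched_overlap_measure_def)
  ultimately show ?thesis
    using quenched_integral(2)[of "\<lambda>x. x\<^sup>2" N J]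
    by (simp add: P2_real_def real_distribution_def real_distribution_axioms_def)
qed

lemma gibbs_weight_continuous: "continuous_on UNIV (\<lambda>J. gibbs_weight N J \<sigma>)"
proof -
  have H: "continuous_on UNIV (\<lambda>J. sk_hamiltonian N J \<tau>)" for \<tau>
    unfolding sk_hamiltonian_def case_prod_beta
    by (intro continuous_intros continuous_on_product_coordinates)
  have "(\<Sum>\<tau>\<in>spin_configs N. exp (sk_hamiltonian N J \<tau>)) \<noteq> 0" for J using partition_pos[of N J] by simp
  then show ?thesis unfolding gibbs_weight_def by (intro continuous_intros H) auto
qed

lemma replica_avg_continuous: "continuous_on UNIV (\<lambda>J. replica_avg N J n f)"
proof -
  have "continuous_on UNIV (\<lambda>J. prod_list (map (gibbs_weight N J) l))" for l
    by (induction l) (auto intro!: continuous_intros gibbs_weight_continuous)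
  then show ?thesis unfolding replica_avg_def iid_avg_def by (intro continuous_intros)
qed

lemma overlap_pair_le: "set l \<subseteq> spin_configs N \<Longrightarrow> length l = 2 \<Longrightarrow> \<bar>overlap N (l ! 0) (l ! 1)\<bar> \<le> 1"
  by (rule overlap_abs_le) auto

text \<open>
  The overlap takes values in a bounded set, so for large \<open>K\<close> the excess vanishes, and the cell masses are continuous
  in the finitely many relevant couplings.
\<close>

lemma quenched_W2_near:
  assumes r: "0 < r"
  shows "\<exists>T. open T \<and> J0 \<in> T \<and> (\<forall>J\<in>T. W2 (quenched_overlap_measure N J0) (quenched_overlap_measure N J) < r)"
proof -
  define K where "K = max 1 (real N powr (1/3))"
  have K: "0 < K" by (simp add: K_def)
  obtain n :: nat where n: "32 * K\<^sup>2 / r\<^sup>2 < real n" using reals_Archimedean2 by blast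
  have n0: "0 < real n" by (rule le_less_trans[OF _ n]) simp
  have nk: "16 * K\<^sup>2 / n < r\<^sup>2 / 2" using n n0 r by (simp add: field_simps)
  define a where "a i J = replica_avg N J 2 (\<lambda>l. bump K n i (real N powr (1/3) * overlap N (l ! 0) (l ! 1)))" for i J
  have a: "(\<integral>x. bump K n i x \<partial>quenched_overlap_measure N J) = a i J" for i J
    unfolding a_def by (rule quenched_integral(1)) simp
  have ex: "(\<integral>x. excess K x \<partial>quenched_overlap_measure N J) = 0" for J
  proof -
    have "excess K (real N powr (1/3) * overlap N (l ! 0) (l ! 1)) = 0" if "set l \<subseteq> spin_configs N" "length l = 2" for l
    proof -
      have "\<bar>real N powr (1/3) * overlap N (l ! 0) (l ! 1)\<bar> \<le> real N powr (1/3) * 1"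
        unfolding abs_mult using overlap_pair_le[OF that] by (intro mult_mono) auto
      also have "\<dots> \<le> K" by (simp add: K_def)
      finally show ?thesis by (auto simp: excess_def clip_def)
    qed
    then have "replica_avg N J 2 (\<lambda>l. excess K (real N powr (1/3) * overlap N (l ! 0) (l ! 1))) = replica_avg N J 2 (\<lambda>_. 0)"
      unfolding replica_avg_def by (rule iid_avg_cong)
    then show ?thesis by (simp add: quenched_integral(1) replica_avg_const)
  qed
  let ?T = "{J. 12 * K\<^sup>2 * (\<Sum>i\<le>n. \<bar>a i J0 - a i J\<bar>) < r\<^sup>2 / 2}"
  have "open ?T"
    by (rule open_Collect_less) (auto intro!: continuous_intros simp: a_def replica_avg_continuous)
  moreover have "J0 \<in> ?T" using r by simp
  moreover have "W2 (quenched_overlap_measure N J0) (quenched_overlap_measure N J) < r" if "J \<in> ?T" for J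
  proof -
    have "(W2 (quenched_overlap_measure N J0) (quenched_overlap_measure N J))\<^sup>2
        \<le> 16 * K\<^sup>2 / n + 12 * K\<^sup>2 * (\<Sum>i\<le>n. \<bar>a i J0 - a i J\<bar>)"
      using W2_sq_le_bumps[OF quenched_P2[of N J0] quenched_P2[of N J] K, of n] n0 unfolding a ex by simp
    also have "\<dots> < r\<^sup>2" using nk that by simp
    finally show ?thesis by (rule power2_less_imp_less) (use r in simp)
  qed
  ultimately show ?thesis by blast
qed

text \<open>
  By continuity in the couplings, preimages of open sets are open in the space of all functions on pairs. The
  couplings are given on the bonds alone, with a fixed default value elsewhere, which makes the embedding into
  that space measurable.
\<close>

lemma quenched_measurable:
  "quenched_overlap_measure N \<in> measurable (\<Pi>\<^sub>M e\<in>bonds N. (borel :: real measure)) P2_borel"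
  unfolding P2_borel_def
proof (rule measurable_measure_of)
  show "{U. Metric_space.mopen P2_real W2 U} \<subseteq> Pow P2_real" by (auto simp: P2_mopen_iff)
  show "quenched_overlap_measure N \<in> space (\<Pi>\<^sub>M e\<in>bonds N. (borel :: real measure)) \<rightarrow> P2_real"
    using quenched_P2 by auto
  fix U assume "U \<in> {U. Metric_space.mopen P2_real W2 U}"
  then have U: "\<And>\<mu>. \<mu> \<in> U \<Longrightarrow> \<exists>r>0. \<forall>\<nu>\<in>P2_real. W2 \<mu> \<nu> < r \<longrightarrow> \<nu> \<in> U" by (auto simp: P2_mopen_iff)
  have "open (quenched_overlap_measure N -` U)"
    unfolding open_subopen[of "quenched_overlap_measure N -` U"]
  proof
    fix J0 assume "J0 \<in> quenched_overlap_measure N -` U"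
    then obtain r where r: "r > 0" "\<And>\<nu>. \<nu> \<in> P2_real \<Longrightarrow> W2 (quenched_overlap_measure N J0) \<nu> < r \<Longrightarrow> \<nu> \<in> U"
      using U[of "quenched_overlap_measure N J0"] by auto
    obtain T where "open T" "J0 \<in> T" "\<forall>J\<in>T. W2 (quenched_overlap_measure N J0) (quenched_overlap_measure N J) < r"
      using quenched_W2_near[OF r(1), of J0 N] by blast
    then show "\<exists>T. open T \<and> J0 \<in> T \<and> T \<subseteq> quenched_overlap_measure N -` U"
      using r(2)[OF quenched_P2] by blast
  qed
  then have "quenched_overlap_measure N -` U \<in> sets (borel :: (nat \<times> nat \<Rightarrow> real) measure)" by simp
  moreover have "(\<lambda>J. J) \<in> measurable (\<Pi>\<^sub>M e\<in>bonds N. (borel :: real measure)) (\<Pi>\<^sub>M e\<in>UNIV. (borel :: real measure))"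
  proof (rule measurable_PiM_single')
    fix e :: "nat \<times> nat"
    show "(\<lambda>J. J e) \<in> borel_measurable (\<Pi>\<^sub>M e\<in>bonds N. (borel :: real measure))"
    proof (cases "e \<in> bonds N")
      case True
      then show ?thesis by (rule measurable_component_singleton)
    next
      case False
      have "(\<lambda>J. J e) \<in> borel_measurable (\<Pi>\<^sub>M e\<in>bonds N. (borel :: real measure))
          \<longleftrightarrow> (\<lambda>J. undefined :: real) \<in> borel_measurable (\<Pi>\<^sub>M e\<in>bonds N. (borel :: real measure))"
      proof (rule measurable_cong)
        fix J assume "J \<in> space (\<Pi>\<^sub>M e\<in>bonds N. (borel :: real measure))"
        then have "J \<in> (\<Pi>\<^sub>E e\<in>bonds N. UNIV)" by (simp add: space_PiM)
        from PiE_arb[OF this False] show "J e = undefined" .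
      qed
      then show ?thesis by simp
    qed
  qed auto
  ultimately show "quenched_overlap_measure N -` U \<inter> space (\<Pi>\<^sub>M e\<in>bonds N. (borel :: real measure)) \<in> sets (\<Pi>\<^sub>M e\<in>bonds N. (borel :: real measure))"
    using measurable_sets[of "\<lambda>J. J" _ "\<Pi>\<^sub>M e\<in>UNIV. (borel :: real measure)" "quenched_overlap_measure N -` U"]
    by (simp add: sets_PiM_equal_borel)
qed

context
  fixes \<nu> :: "real measure"
  assumes \<nu>: "prob_space \<nu>" "sets \<nu> = sets borel"
begin

lemma quenched_measurable_law: "quenched_overlap_measure N \<in> measurable (\<Pi>\<^sub>M e\<in>bonds N. \<nu>) P2_borel"
proof -
  have s: "sets (\<Pi>\<^sub>M e\<in>bonds N. \<nu>) = sets (\<Pi>\<^sub>M e\<in>bonds N. (borel :: real measure))"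
    by (rule sets_PiM_cong) (auto simp: \<nu>)
  show ?thesis using quenched_measurable measurable_cong_sets[OF s refl] by blast
qed

lemma replica_avg_law_integrable:
  assumes "\<And>l. set l \<subseteq> spin_configs N \<Longrightarrow> length l = n \<Longrightarrow> \<bar>f l\<bar> \<le> c"
  shows "integrable (\<Pi>\<^sub>M e\<in>bonds N. \<nu>) (\<lambda>J. replica_avg N J n f)"
proof -
  interpret P: prob_space "\<Pi>\<^sub>M e\<in>bonds N. \<nu>" by (rule prob_space_PiM) (rule \<nu>)
  have s: "sets (\<Pi>\<^sub>M e\<in>bonds N. \<nu>) = sets (\<Pi>\<^sub>M e\<in>bonds N. (borel :: real measure))"
    by (rule sets_PiM_cong) (auto simp: \<nu>)
  have "(\<lambda>J. replica_avg N J n f) \<in> borel_measurable (\<Pi>\<^sub>M e\<in>bonds N. \<nu>)"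
    using replica_avg_measurable measurable_cong_sets[OF s refl] by blast
  then show ?thesis by (intro P.integrable_const_bound[where B=c] AE_I2) (simp_all add: replica_avg_bound[OF assms])
qed

lemma quenched_law_integral:
  assumes "F \<in> borel_measurable P2_borel"
  shows "(\<integral>\<mu>. F \<mu> \<partial>quenched_overlap_law \<nu> N) = (\<integral>J. F (quenched_overlap_measure N J) \<partial>(\<Pi>\<^sub>M e\<in>bonds N. \<nu>) :: real)"
    and "integrable (quenched_overlap_law \<nu> N) F \<longleftrightarrow> integrable (\<Pi>\<^sub>M e\<in>bonds N. \<nu>) (\<lambda>J. F (quenched_overlap_measure N J))"
  unfolding quenched_overlap_law_def
  by (rule integral_distr[OF quenched_measurable_law assms], rule integrable_distr_eq[OF quenched_measurable_law assms])

lemma quenched_law_P2: "P2_law (quenched_overlap_law \<nu> N)"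
proof -
  interpret P: prob_space "\<Pi>\<^sub>M e\<in>bonds N. \<nu>" by (rule prob_space_PiM) (rule \<nu>)
  have "prob_space (quenched_overlap_law \<nu> N)"
    unfolding quenched_overlap_law_def by (rule P.prob_space_distr[OF quenched_measurable_law])
  moreover have "integrable (quenched_overlap_law \<nu> N) (\<lambda>\<mu>. \<integral>x. x\<^sup>2 \<partial>\<mu>)"
  proof -
    have "\<bar>(real N powr (1/3) * overlap N (l ! 0) (l ! 1))\<^sup>2\<bar> \<le> (real N powr (1/3))\<^sup>2" if "set l \<subseteq> spin_configs N" "length l = 2" for l
    proof -
      have "(overlap N (l ! 0) (l ! 1))\<^sup>2 \<le> 1" using overlap_pair_le[OF that] by (simp add: abs_square_le_1)
      then show ?thesis by (simp add: power_mult_distrib mult_left_le)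
    qed
    from replica_avg_law_integrable[OF this] show ?thesis
      by (subst quenched_law_integral(2)[OF P2_second_moment_measurable]) (simp add: quenched_integral(1))
  qed
  ultimately show ?thesis by (simp add: P2_law_def quenched_overlap_law_def)
qed

lemma quenched_law_functional:
  assumes m: "(\<lambda>\<mu>. \<integral>x. g x \<partial>\<mu>) \<in> borel_measurable P2_borel" and g: "g \<in> borel_measurable borel"
  shows "(\<integral>\<mu>. (\<integral>x. g x \<partial>\<mu>) \<partial>quenched_overlap_law \<nu> N)
    = (\<integral>J. replica_avg N J 2 (\<lambda>l. g (real N powr (1/3) * overlap N (l ! 0) (l ! 1))) \<partial>(\<Pi>\<^sub>M e\<in>bonds N. \<nu>))"
  by (simp add: quenched_law_integral(1)[OF m] quenched_integral(1)[OF g])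

end

text \<open>
  Products of quenched expectations are expectations over disjoint pairs of replicas.
\<close>

fun pair_product :: "('a \<Rightarrow> 'a \<Rightarrow> real) list \<Rightarrow> 'a list \<Rightarrow> real" where
  "pair_product [] l = 1"
| "pair_product (g # gs) l = g (l ! 0) (l ! 1) * pair_product gs (drop 2 l)"

lemma pair_product_bound:
  assumes "\<And>g \<sigma> \<tau>. g \<in> set gs \<Longrightarrow> \<sigma> \<in> X \<Longrightarrow> \<tau> \<in> X \<Longrightarrow> \<bar>g \<sigma> \<tau>\<bar> \<le> 1" "set l \<subseteq> X" "length l = 2 * length gs"
  shows "\<bar>pair_product gs l\<bar> \<le> 1"
  using assms
proof (induction gs arbitrary: l)
  case (Cons g gs)
  have m: "l ! 0 \<in> set l" "l ! 1 \<in> set l" using Cons.prems(3) by (auto intro!: nth_mem)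
  then have "\<bar>g (l ! 0) (l ! 1)\<bar> \<le> 1" using Cons.prems(1,2) by auto
  moreover have "\<bar>pair_product gs (drop 2 l)\<bar> \<le> 1"
    by (rule Cons.IH) (use Cons.prems set_drop_subset[of 2 l] in auto)
  ultimately show ?case by (simp add: abs_mult mult_le_one)
qed simp

lemma replica_avg_pair_product:
  "replica_avg N J (2 * length gs) (pair_product gs) = prod_list (map (\<lambda>g. replica_avg N J 2 (\<lambda>l. g (l ! 0) (l ! 1))) gs)"
proof (induction gs)
  case Nil
  then show ?case by (simp add: replica_avg_def)
next
  case (Cons g gs)
  let ?I = "iid_avg (spin_configs N) (gibbs_weight N J)"
  have "?I (2 + 2 * length gs) (pair_product (g # gs))
      = ?I 2 (\<lambda>l. ?I (2 * length gs) (\<lambda>r. pair_product (g # gs) (l @ r)))"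
    by (rule iid_avg_append[OF finite_spin_configs])
  also have "\<dots> = ?I 2 (\<lambda>l. ?I (2 * length gs) (pair_product gs) * g (l ! 0) (l ! 1))"
    by (rule iid_avg_cong) (simp add: nth_append iid_avg_cmult)
  also have "\<dots> = ?I (2 * length gs) (pair_product gs) * ?I 2 (\<lambda>l. g (l ! 0) (l ! 1))"
    by (rule iid_avg_cmult)
  finally have "?I (2 + 2 * length gs) (pair_product (g # gs))
      = ?I 2 (\<lambda>l. g (l ! 0) (l ! 1)) * ?I (2 * length gs) (pair_product gs)" by (simp only: mult.commute)
  moreover have "2 * length (g # gs) = 2 + 2 * length gs" by simp
  ultimately show ?case using Cons.IH unfolding replica_avg_def by (simp only: list.map prod_list.Cons)
qed

section \<open>Gaussian and bounded disorder\<close>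

text \<open>
  The fourth and sixth moments of a standard Gaussian are 3 and 15.
\<close>

lemma std_normal_disorder: "15 \<le> \<kappa> \<Longrightarrow> disorder \<kappa> std_normal_distribution"
proof -
  assume \<kappa>: "15 \<le> \<kappa>"
  have m: "integrable std_normal_distribution (\<lambda>x. x ^ (2 * k))"
    "(\<integral>x. x ^ (2 * k) \<partial>std_normal_distribution) = fact (2 * k) / (2 ^ k * fact k)" for k
    using std_normal_moment_even[of k]
    by (auto simp: integrable_density integral_density has_bochner_integral_iff)
  have sym: "distr std_normal_distribution borel uminus = std_normal_distribution"
  proof (rule measure_eqI)
    fix X assume "X \<in> sets (distr std_normal_distribution borel uminus)"
    then have X[measurable]: "X \<in> sets borel" by simp
    have X': "uminus -` X \<in> sets (borel :: real measure)" using measurable_sets[of uminus borel borel X] by simp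
    have "emeasure (distr std_normal_distribution borel uminus) X = emeasure std_normal_distribution (uminus -` X)"
      by (subst emeasure_distr) auto
    also have "\<dots> = (\<integral>\<^sup>+x. ennreal (std_normal_density x) * indicator (uminus -` X) x \<partial>lborel)"
      using X' by (intro emeasure_density) auto
    also have "\<dots> = (\<integral>\<^sup>+x. ennreal (std_normal_density (- x)) * indicator X (- x) \<partial>lborel)"
      by (intro nn_integral_cong) (auto simp: std_normal_density_def indicator_def)
    also have "\<dots> = (\<integral>\<^sup>+x. ennreal (std_normal_density x) * indicator X x \<partial>distr lborel borel uminus)"
      by (subst nn_integral_distr) auto
    also have "\<dots> = emeasure std_normal_distribution X"
      unfolding lborel_distr_uminus by (intro emeasure_density[symmetric]) auto
    finally show "emeasure (distr std_normal_distribution borel uminus) X = emeasure std_normal_distribution X" .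
  qed simp
  have "prob_space std_normal_distribution" by (rule prob_space_normal_density) simp
  then show ?thesis
    unfolding disorder_def using m[of 1] m[of 2] m[of 3] sym \<kappa> by (simp add: fact_numeral)
qed

lemma bounded_symmetric_disorder:
  assumes \<nu>: "symmetric_unit_variance_law b \<nu>" and \<kappa>: "b ^ 4 \<le> \<kappa>" "b ^ 6 \<le> \<kappa>"
  shows "disorder \<kappa> \<nu>"
proof -
  interpret real_distribution \<nu> using \<nu> by (simp add: symmetric_unit_variance_law_def)
  have AE: "AE y in \<nu>. \<bar>y\<bar> \<le> b"
    using AE_prob_1[of "{-b..b}"] \<nu> by (simp add: symmetric_unit_variance_law_def abs_le_iff minus_le_iff conj_commute)
  have bd: "AE y in \<nu>. \<bar>y ^ k\<bar> \<le> b ^ k" for k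
    using AE by eventually_elim (simp add: power_abs power_mono)
  have i: "integrable \<nu> (\<lambda>y. y ^ k)" for k
    by (rule integrable_const_bound[where B="b ^ k"]) (use bd in auto)
  have le: "(\<integral>y. y ^ k \<partial>\<nu>) \<le> b ^ k" for k
  proof -
    have "(\<integral>y. y ^ k \<partial>\<nu>) \<le> (\<integral>y. b ^ k \<partial>\<nu>)"
      using bd[of k] by (intro integral_mono_AE i) (auto elim: eventually_mono)
    then show ?thesis using prob_space by simp
  qed
  show ?thesis unfolding disorder_def
    using \<nu> i le[of 4] le[of 6] \<kappa> prob_space_axioms by (auto simp: symmetric_unit_variance_law_def)
qed

section \<open>Stability of the test functionals\<close>

lemma excess_quadratic: "0 \<le> K \<Longrightarrow> excess K x \<le> 2 * excess K y + 2 * (x - y)\<^sup>2"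
proof -
  assume K: "0 \<le> K"
  let ?p = "x - clip K x" and ?q = "y - clip K y"
  have "\<bar>?p - ?q\<bar> \<le> \<bar>x - y\<bar>" by (auto simp: clip_def max_def min_def)
  then have "(?p - ?q)\<^sup>2 \<le> (x - y)\<^sup>2" by (simp add: abs_le_square_iff)
  moreover have "p\<^sup>2 \<le> 2 * q\<^sup>2 + 2 * (p - q)\<^sup>2" for p q :: real
    using square_diff_le[of "p - q" "- q"] by simp
  from this[of ?p ?q] have "?p\<^sup>2 \<le> 2 * ?q\<^sup>2 + 2 * (?p - ?q)\<^sup>2" .
  ultimately show ?thesis by (simp add: excess_def)
qed

lemma excess_law_compare:
  assumes \<zeta>: "P2_law \<zeta>" "P2_law \<zeta>'" and K: "0 \<le> K"
  shows "(\<integral>\<mu>. (\<integral>x. excess K x \<partial>\<mu>) \<partial>\<zeta>) \<le> 2 * (\<integral>\<mu>. (\<integral>x. excess K x \<partial>\<mu>) \<partial>\<zeta>') + 2 * (iterated_W2 \<zeta> \<zeta>')\<^sup>2"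
proof -
  have "(\<integral>\<mu>. (\<integral>x. excess K x \<partial>\<mu>) \<partial>\<zeta>) \<le> (\<integral>\<mu>. 2 * (\<integral>x. excess K x \<partial>\<mu>) \<partial>\<zeta>') + 2 * (iterated_W2 \<zeta> \<zeta>')\<^sup>2"
  proof (rule iterated_W2_functional_bound[OF \<zeta>])
    show "integrable \<zeta> (\<lambda>\<mu>. \<integral>x. excess K x \<partial>\<mu>)" "integrable \<zeta>' (\<lambda>\<mu>. 2 * (\<integral>x. excess K x \<partial>\<mu>))"
      using P2_law_integrable_excess \<zeta> K by auto
    fix \<mu> \<nu> assume \<mu>: "\<mu> \<in> P2_real" "\<nu> \<in> P2_real"
    have "(\<integral>x. excess K x \<partial>\<mu>) \<le> (\<integral>x. 2 * excess K x \<partial>\<nu>) + 2 * (W2 \<mu> \<nu>)\<^sup>2"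
      by (rule W2_functional_bound[OF \<mu>])
        (use P2_excess_integrable \<mu> K excess_quadratic[OF K] in auto)
    then show "(\<integral>x. excess K x \<partial>\<mu>) \<le> 2 * (\<integral>x. excess K x \<partial>\<nu>) + 2 * (W2 \<mu> \<nu>)\<^sup>2" by simp
  qed simp
  then show ?thesis by simp
qed

text \<open>
  The probability that independent samples of \<open>\<mu>\<close> fall into the cells listed in \<open>is\<close>.
\<close>

definition cell_weight :: "real \<Rightarrow> nat \<Rightarrow> nat list \<Rightarrow> real measure \<Rightarrow> real" where
  "cell_weight K n is \<mu> = prod_list (map (\<lambda>i. \<integral>x. bump K n i x \<partial>\<mu>) is)"

lemma cell_weight_measurable:
  assumes "0 < K" "set is \<subseteq> {..n}"
  shows "cell_weight K n is \<in> borel_measurable P2_borel"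
  using assms(2) unfolding cell_weight_def[abs_def]
  by (induction "is") (auto intro!: borel_measurable_times P2_bump(1)[OF assms(1)])

lemma cell_weight_bound:
  assumes "0 < K" "set is \<subseteq> {..n}" "\<mu> \<in> P2_real"
  shows "\<bar>cell_weight K n is \<mu>\<bar> \<le> 1"
  using assms(2) unfolding cell_weight_def
proof (induction "is")
  case (Cons i "is")
  have "\<bar>\<integral>x. bump K n i x \<partial>\<mu>\<bar> \<le> 1"
    using P2_bump(3,4)[OF assms(1) _ assms(3), of i n] Cons.prems by auto
  then show ?case using Cons by (simp add: abs_mult mult_le_one)
qed simp

lemma cell_weight_integrable:
  assumes \<zeta>: "P2_law \<zeta>" and K: "0 < K" and s: "set is \<subseteq> {..n}"
  shows "integrable \<zeta> (cell_weight K n is)"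
proof -
  interpret prob_space \<zeta> by (rule P2_lawD[OF \<zeta>])
  have "cell_weight K n is \<in> borel_measurable \<zeta>"
    unfolding P2_lawD(5)[OF \<zeta>] by (rule cell_weight_measurable[OF K s])
  then show ?thesis
    by (intro integrable_const_bound[where B=1] AE_I2) (simp_all add: cell_weight_bound[OF K s] P2_lawD(3)[OF \<zeta>])
qed

lemma bump_W2_osc:
  assumes "0 < K" "i \<le> n" "0 < e"
  shows "\<exists>C>0. \<forall>\<mu>\<in>P2_real. \<forall>\<nu>\<in>P2_real. (\<integral>x. bump K n i x \<partial>\<mu>) \<le> (\<integral>x. bump K n i x \<partial>\<nu>) + e + C * (W2 \<mu> \<nu>)\<^sup>2"
proof -
  obtain L where L: "\<And>x y. \<bar>bump K n i x - bump K n i y\<bar> \<le> L * \<bar>x - y\<bar>" using bump_lipschitz[OF assms(1,2)] by auto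
  let ?C = "L\<^sup>2 / e + 1"
  have C: "0 < ?C" using assms(3) by (simp add: add_nonneg_pos)
  have "(\<integral>x. bump K n i x \<partial>\<mu>) \<le> (\<integral>x. bump K n i x \<partial>\<nu>) + e + ?C * (W2 \<mu> \<nu>)\<^sup>2"
    if \<mu>: "\<mu> \<in> P2_real" "\<nu> \<in> P2_real" for \<mu> \<nu>
  proof -
    interpret prob_space \<nu> by (rule P2_realD[OF \<mu>(2)])
    have ib: "integrable \<mu> (bump K n i)" "integrable \<nu> (bump K n i)" using P2_bump(2)[OF assms(1,2)] \<mu> by auto
    have "(\<integral>x. bump K n i x \<partial>\<mu>) \<le> (\<integral>x. bump K n i x + e \<partial>\<nu>) + ?C * (W2 \<mu> \<nu>)\<^sup>2"
    proof (rule W2_functional_bound[OF \<mu> ib(1) _ C])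
      fix x y :: real
      have "bump K n i x - bump K n i y \<le> e + L\<^sup>2 / e * (x - y)\<^sup>2"
        using L[of x y] abs_le_am_gm[OF assms(3), of L "x - y"] by linarith
      moreover have "L\<^sup>2 / e * (x - y)\<^sup>2 \<le> ?C * (x - y)\<^sup>2" by (rule mult_right_mono) auto
      ultimately show "bump K n i x \<le> bump K n i y + e + ?C * (x - y)\<^sup>2" by linarith
    qed (use ib in auto)
    then show ?thesis using ib by (simp add: prob_space)
  qed
  then show ?thesis using C by blast
qed

lemma cell_weight_W2_osc:
  assumes K: "0 < K" and "set is \<subseteq> {..n}" "0 < e"
  shows "\<exists>C>0. \<forall>\<mu>\<in>P2_real. \<forall>\<nu>\<in>P2_real. \<bar>cell_weight K n is \<mu> - cell_weight K n is \<nu>\<bar> \<le> e + C * (W2 \<mu> \<nu>)\<^sup>2"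
  using assms(2,3)
proof (induction "is" arbitrary: e)
  case Nil
  then show ?case by (intro exI[of _ 1]) (auto simp: cell_weight_def add_nonneg_nonneg)
next
  case (Cons i "is")
  have i: "i \<le> n" and is': "set is \<subseteq> {..n}" and e: "0 < e / 2" using Cons.prems by auto
  obtain C1 where C1: "C1 > 0" "\<And>\<mu> \<nu>. \<mu> \<in> P2_real \<Longrightarrow> \<nu> \<in> P2_real \<Longrightarrow>
      (\<integral>x. bump K n i x \<partial>\<mu>) \<le> (\<integral>x. bump K n i x \<partial>\<nu>) + e / 2 + C1 * (W2 \<mu> \<nu>)\<^sup>2"
    using bump_W2_osc[OF K i e] by blast
  obtain C2 where C2: "C2 > 0" "\<And>\<mu> \<nu>. \<mu> \<in> P2_real \<Longrightarrow> \<nu> \<in> P2_real \<Longrightarrow>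
      \<bar>cell_weight K n is \<mu> - cell_weight K n is \<nu>\<bar> \<le> e / 2 + C2 * (W2 \<mu> \<nu>)\<^sup>2"
    using Cons.IH[OF is' e] by blast
  have "\<bar>cell_weight K n (i # is) \<mu> - cell_weight K n (i # is) \<nu>\<bar> \<le> e + (C1 + C2) * (W2 \<mu> \<nu>)\<^sup>2"
    if \<mu>: "\<mu> \<in> P2_real" "\<nu> \<in> P2_real" for \<mu> \<nu>
  proof -
    let ?a = "\<integral>x. bump K n i x \<partial>\<mu>" and ?a' = "\<integral>x. bump K n i x \<partial>\<nu>"
    let ?c = "cell_weight K n is \<mu>" and ?c' = "cell_weight K n is \<nu>"
    have a: "\<bar>?a - ?a'\<bar> \<le> e / 2 + C1 * (W2 \<mu> \<nu>)\<^sup>2"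
      using C1(2)[OF \<mu>] C1(2)[OF \<mu>(2,1)] unfolding W2_commute[of \<nu> \<mu>] by linarith
    have a1: "\<bar>?a\<bar> \<le> 1" using P2_bump(3,4)[OF K i \<mu>(1)] by simp
    have c1: "\<bar>?c'\<bar> \<le> 1" by (rule cell_weight_bound[OF K is' \<mu>(2)])
    have "cell_weight K n (i # is) \<mu> - cell_weight K n (i # is) \<nu> = ?a * (?c - ?c') + (?a - ?a') * ?c'"
      by (simp add: cell_weight_def algebra_simps)
    then have "\<bar>cell_weight K n (i # is) \<mu> - cell_weight K n (i # is) \<nu>\<bar> \<le> \<bar>?a\<bar> * \<bar>?c - ?c'\<bar> + \<bar>?a - ?a'\<bar> * \<bar>?c'\<bar>"
      using abs_triangle_ineq[of "?a * (?c - ?c')" "(?a - ?a') * ?c'"] by (simp only: abs_mult)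
    also have "\<dots> \<le> 1 * \<bar>?c - ?c'\<bar> + \<bar>?a - ?a'\<bar> * 1"
      using a1 c1 by (intro add_mono mult_right_mono mult_left_mono) auto
    also have "\<dots> \<le> (e / 2 + C2 * (W2 \<mu> \<nu>)\<^sup>2) + (e / 2 + C1 * (W2 \<mu> \<nu>)\<^sup>2)"
      using a C2(2)[OF \<mu>] by simp
    also have "\<dots> = e + (C1 + C2) * (W2 \<mu> \<nu>)\<^sup>2" by (simp add: algebra_simps)
    finally show ?thesis .
  qed
  then show ?case using C1(1) C2(1) by (intro exI[of _ "C1 + C2"]) auto
qed

text \<open>
  Cell weights are products of integrals of Lipschitz functions, each in the unit interval, hence
  continuous for the iterated distance.
\<close>

lemma cell_weight_law_compare:
  assumes K: "0 < K" and s: "set is \<subseteq> {..n}" and e: "0 < e"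
  shows "\<exists>C>0. \<forall>\<zeta> \<zeta>'. P2_law \<zeta> \<longrightarrow> P2_law \<zeta>' \<longrightarrow>
    \<bar>(\<integral>\<mu>. cell_weight K n is \<mu> \<partial>\<zeta>) - (\<integral>\<mu>. cell_weight K n is \<mu> \<partial>\<zeta>')\<bar> \<le> e + C * (iterated_W2 \<zeta> \<zeta>')\<^sup>2"
proof -
  obtain C where C: "C > 0" "\<And>\<mu> \<nu>. \<mu> \<in> P2_real \<Longrightarrow> \<nu> \<in> P2_real \<Longrightarrow>
      \<bar>cell_weight K n is \<mu> - cell_weight K n is \<nu>\<bar> \<le> e + C * (W2 \<mu> \<nu>)\<^sup>2"
    using cell_weight_W2_osc[OF K s e] by blast
  have "\<bar>(\<integral>\<mu>. cell_weight K n is \<mu> \<partial>\<zeta>) - (\<integral>\<mu>. cell_weight K n is \<mu> \<partial>\<zeta>')\<bar> \<le> e + C * (iterated_W2 \<zeta> \<zeta>')\<^sup>2"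
    if \<zeta>: "P2_law \<zeta>" "P2_law \<zeta>'" for \<zeta> \<zeta>'
  proof -
    interpret B: prob_space \<zeta>' by (rule P2_lawD[OF \<zeta>(2)])
    note i = cell_weight_integrable[OF \<zeta>(1) K s] cell_weight_integrable[OF \<zeta>(2) K s]
    have "(\<integral>\<mu>. cell_weight K n is \<mu> \<partial>\<zeta>) \<le> (\<integral>\<mu>. cell_weight K n is \<mu> + e \<partial>\<zeta>') + C * (iterated_W2 \<zeta> \<zeta>')\<^sup>2"
    proof (rule iterated_W2_functional_bound[OF \<zeta> i(1) _ C(1)])
      show "cell_weight K n is \<mu> \<le> cell_weight K n is \<nu> + e + C * (W2 \<mu> \<nu>)\<^sup>2" if "\<mu> \<in> P2_real" "\<nu> \<in> P2_real" for \<mu> \<nu>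
        using C(2)[OF that] by linarith
    qed (use i in auto)
    moreover have "(\<integral>\<mu>. - cell_weight K n is \<mu> \<partial>\<zeta>) \<le> (\<integral>\<mu>. - cell_weight K n is \<mu> + e \<partial>\<zeta>') + C * (iterated_W2 \<zeta> \<zeta>')\<^sup>2"
    proof (rule iterated_W2_functional_bound[OF \<zeta> _ _ C(1)])
      show "- cell_weight K n is \<mu> \<le> - cell_weight K n is \<nu> + e + C * (W2 \<mu> \<nu>)\<^sup>2" if "\<mu> \<in> P2_real" "\<nu> \<in> P2_real" for \<mu> \<nu>
        using C(2)[OF that] by linarith
    qed (use i in auto)
    ultimately show ?thesis using i by (simp add: B.prob_space abs_le_iff)
  qed
  then show ?thesis using C(1) by blast
qed

section \<open>Universality of the limit\<close>

lemma third_root_scale: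
  "(\<lambda>N. 1 / (real N powr (1/3))\<^sup>2) \<longlonglongrightarrow> 0" "(\<lambda>N. (real N powr (1/3))\<^sup>2 / real N) \<longlonglongrightarrow> 0"
  "(\<lambda>N. 1 / real N) \<longlonglongrightarrow> 0"
proof -
  have sq: "(real N powr (1/3))\<^sup>2 = real N powr (2/3)" for N
    by (cases "N = 0") (auto simp: powr_powr[symmetric] powr_numeral[symmetric] powr_powr simp flip: powr_realpow)
  show "(\<lambda>N. 1 / (real N powr (1/3))\<^sup>2) \<longlonglongrightarrow> 0" unfolding sq by real_asymp
  show "(\<lambda>N. (real N powr (1/3))\<^sup>2 / real N) \<longlonglongrightarrow> 0" unfolding sq by real_asymp
  show "(\<lambda>N. 1 / real N) \<longlonglongrightarrow> 0" by real_asymp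
qed

context
  fixes \<kappa> :: real and A B :: "real measure" and \<zeta> :: "real measure measure"
  assumes A: "disorder \<kappa> A" and B: "disorder \<kappa> B" and \<zeta>: "P2_law \<zeta>"
    and conv: "(\<lambda>N. iterated_W2 (quenched_overlap_law A N) \<zeta>) \<longlonglongrightarrow> 0"
begin

lemma A_law: "P2_law (quenched_overlap_law A N)" by (rule quenched_law_P2[OF disorderD(1,2)[OF A]])

lemma B_law: "P2_law (quenched_overlap_law B N)" by (rule quenched_law_P2[OF disorderD(1,2)[OF B]])

lemma conv_sq: "(\<lambda>N. (iterated_W2 (quenched_overlap_law A N) \<zeta>)\<^sup>2) \<longlonglongrightarrow> 0"
  using tendsto_power[OF conv, of 2] by simp

lemma small_excess:
  assumes e: "0 < e"
  obtains k :: nat where "0 < k" "(\<integral>\<mu>. (\<integral>x. excess k x \<partial>\<mu>) \<partial>\<zeta>) < e"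
proof -
  have "\<forall>\<^sub>F k in sequentially. (\<integral>\<mu>. (\<integral>x. excess (real k) x \<partial>\<mu>) \<partial>\<zeta>) < e"
    by (rule order_tendstoD(2)[OF P2_law_excess_tendsto[OF \<zeta>] e])
  then have "\<forall>\<^sub>F k in sequentially. (\<integral>\<mu>. (\<integral>x. excess (real k) x \<partial>\<mu>) \<partial>\<zeta>) < e \<and> 0 < k"
    using eventually_gt_at_top[of 0] by eventually_elim simp
  then show thesis using that by (auto simp: eventually_sequentially)
qed

text \<open>
  With \<open>x = s R\<^sub>1\<^sub>2\<close> and \<open>s = N\<^bsup>1/3\<^esup>\<close> this bounds \<open>x\<^sup>2 R\<^sub>1\<^sub>2\<^sup>2\<close>: where \<open>\<bar>x\<bar>\<close> is large the excess controls \<open>x\<^sup>2\<close> and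
  \<open>R\<^sub>1\<^sub>2\<^sup>2 \<le> 1\<close>, elsewhere \<open>R\<^sub>1\<^sub>2\<^sup>2 = x\<^sup>2 / s\<^sup>2\<close> is small.
\<close>

lemma overlap4_A_le:
  assumes K: "0 < K" and N: "0 < N"
  defines "s \<equiv> real N powr (1/3)" and "ex \<equiv> (\<integral>\<mu>. (\<integral>x. excess K x \<partial>\<mu>) \<partial>quenched_overlap_law A N)"
  shows "s\<^sup>2 * (\<integral>J. overlap4 N J \<partial>(\<Pi>\<^sub>M e\<in>bonds N. A)) \<le> (2 + 4 * K\<^sup>2 * (1 / s\<^sup>2)) * ex + 4 * K ^ 4 * (1 / s\<^sup>2)"
proof -
  have s: "0 < s" using N by (simp add: s_def)
  let ?P = "\<Pi>\<^sub>M e\<in>bonds N. A"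
  let ?E = "\<lambda>J. replica_avg N J 2 (\<lambda>l. excess K (s * overlap N (l ! 0) (l ! 1)))"
  interpret P: prob_space ?P by (rule prob_space_PiM) (rule disorderD[OF A])
  have ex: "ex = (\<integral>J. ?E J \<partial>?P)"
    unfolding ex_def s_def
    by (rule quenched_law_functional[OF disorderD(1,2)[OF A] P2_excess_measurable]) (use K in auto)
  have o1: "(overlap N (l ! 0) (l ! 1))\<^sup>2 \<le> 1" if "set l \<subseteq> spin_configs N" "length l = 2" for l
    using overlap_pair_le[OF that] by (simp add: abs_square_le_1)
  have pt: "s\<^sup>2 * r ^ 4 \<le> (2 + 4 * K\<^sup>2 * (1 / s\<^sup>2)) * excess K (s * r) + 4 * K ^ 4 * (1 / s\<^sup>2)" if r: "r\<^sup>2 \<le> 1" for r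
  proof -
    have q: "(s * r)\<^sup>2 \<le> 2 * excess K (s * r) + 2 * K\<^sup>2" by (rule square_le_excess) (use K in simp)
    have "s\<^sup>2 * r ^ 4 = (s * r)\<^sup>2 * r\<^sup>2" by (simp add: power_mult_distrib eval_nat_numeral)
    also have "\<dots> \<le> (2 * excess K (s * r) + 2 * K\<^sup>2) * r\<^sup>2" using q by (rule mult_right_mono) simp
    also have "\<dots> = 2 * excess K (s * r) * r\<^sup>2 + 2 * K\<^sup>2 * ((s * r)\<^sup>2 * (1 / s\<^sup>2))"
      using s by (simp add: power_mult_distrib distrib_right)
    also have "\<dots> \<le> 2 * excess K (s * r) * 1 + 2 * K\<^sup>2 * ((2 * excess K (s * r) + 2 * K\<^sup>2) * (1 / s\<^sup>2))"
      using r q excess_nonneg[of K "s * r"] by (intro add_mono mult_left_mono mult_right_mono) auto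
    also have "\<dots> = (2 + 4 * K\<^sup>2 * (1 / s\<^sup>2)) * excess K (s * r) + 4 * K ^ 4 * (1 / s\<^sup>2)"
      by (simp add: algebra_simps eval_nat_numeral add_divide_distrib)
    finally show ?thesis .
  qed
  have iE: "integrable ?P ?E"
  proof (rule replica_avg_law_integrable[OF disorderD(1,2)[OF A]])
    fix l assume l: "set l \<subseteq> spin_configs N" "length l = 2"
    have "excess K (s * overlap N (l ! 0) (l ! 1)) \<le> (s * overlap N (l ! 0) (l ! 1))\<^sup>2" by (rule excess_le) (use K in simp)
    also have "\<dots> \<le> s\<^sup>2" using o1[OF l] by (simp add: power_mult_distrib mult_left_le)
    finally show "\<bar>excess K (s * overlap N (l ! 0) (l ! 1))\<bar> \<le> s\<^sup>2" using excess_nonneg by simp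
  qed
  have io: "integrable ?P (overlap4 N)"
    unfolding overlap4_def[abs_def]
  proof (rule replica_avg_law_integrable[OF disorderD(1,2)[OF A]])
    show "\<bar>overlap N (l ! 0) (l ! 1) ^ 4\<bar> \<le> 1" if "set l \<subseteq> spin_configs N" "length l = 2" for l
      unfolding power_abs by (rule power_le_one) (use overlap_pair_le[OF that] in auto)
  qed
  have "s\<^sup>2 * overlap4 N J \<le> (2 + 4 * K\<^sup>2 * (1 / s\<^sup>2)) * ?E J + 4 * K ^ 4 * (1 / s\<^sup>2)" for J
  proof -
    have "s\<^sup>2 * overlap4 N J = replica_avg N J 2 (\<lambda>l. s\<^sup>2 * overlap N (l ! 0) (l ! 1) ^ 4)"
      unfolding overlap4_def replica_avg_def by (rule iid_avg_cmult[symmetric])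
    also have "\<dots> \<le> replica_avg N J 2 (\<lambda>l. (2 + 4 * K\<^sup>2 * (1 / s\<^sup>2)) * excess K (s * overlap N (l ! 0) (l ! 1)) + 4 * K ^ 4 * (1 / s\<^sup>2))"
      by (rule replica_avg_mono) (rule pt[OF o1])
    also have "\<dots> = (2 + 4 * K\<^sup>2 * (1 / s\<^sup>2)) * ?E J + 4 * K ^ 4 * (1 / s\<^sup>2)"
      unfolding replica_avg_def by (simp only: iid_avg_add iid_avg_cmult iid_avg_const[OF finite_spin_configs gibbs_weight_sum])
    finally show ?thesis .
  qed
  then have "(\<integral>J. s\<^sup>2 * overlap4 N J \<partial>?P) \<le> (\<integral>J. (2 + 4 * K\<^sup>2 * (1 / s\<^sup>2)) * ?E J + 4 * K ^ 4 * (1 / s\<^sup>2) \<partial>?P)"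
    using iE io by (intro integral_mono Bochner_Integration.integrable_add Bochner_Integration.integrable_mult_right P.integrable_const)
  then show ?thesis using iE unfolding ex by (simp add: P.prob_space)
qed

text \<open>
  Convergence in the iterated distance bounds the mean excess along the sequence by the excess of the limit, which is small for
  large \<open>K\<close>.
\<close>

lemma overlap4_A_tendsto:
  "(\<lambda>N. (real N powr (1/3))\<^sup>2 * (\<integral>J. overlap4 N J \<partial>(\<Pi>\<^sub>M e\<in>bonds N. A))) \<longlonglongrightarrow> 0"
proof (rule LIMSEQ_I)
  fix e :: real assume e: "0 < e"
  \<comment> \<open>the bound below is \<open>3 * (4 * h) + h\<close>\<close>
  define h where "h = e / 20"
  have h: "0 < h" using e by (simp add: h_def)
  obtain k :: nat where k: "0 < k" "(\<integral>\<mu>. (\<integral>x. excess k x \<partial>\<mu>) \<partial>\<zeta>) < h" using small_excess[OF h] .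
  let ?K = "real k"
  let ?t = "\<lambda>N. 1 / (real N powr (1/3))\<^sup>2"
  have t1: "(\<lambda>N. 4 * ?K\<^sup>2 * ?t N) \<longlonglongrightarrow> 0" "(\<lambda>N. 4 * ?K ^ 4 * ?t N) \<longlonglongrightarrow> 0"
    using tendsto_mult_right_zero[OF third_root_scale(1)] by blast+
  have "\<forall>\<^sub>F N in sequentially. 4 * ?K\<^sup>2 * ?t N < 1 \<and> 4 * ?K ^ 4 * ?t N < h \<and> (iterated_W2 (quenched_overlap_law A N) \<zeta>)\<^sup>2 < h \<and> 0 < N"
    by (intro eventually_conj order_tendstoD(2)[OF t1(1)] order_tendstoD(2)[OF t1(2)] order_tendstoD(2)[OF conv_sq] eventually_gt_at_top)
      (use h in auto)
  then have "\<forall>\<^sub>F N in sequentially. norm ((real N powr (1/3))\<^sup>2 * (\<integral>J. overlap4 N J \<partial>(\<Pi>\<^sub>M e\<in>bonds N. A)) - 0) < e"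
  proof eventually_elim
    case (elim N)
    let ?ex = "\<integral>\<mu>. (\<integral>x. excess ?K x \<partial>\<mu>) \<partial>quenched_overlap_law A N"
    have ex: "?ex \<le> 4 * h" using excess_law_compare[OF A_law[of N] \<zeta>, of ?K] k elim by simp
    have ex0: "0 \<le> ?ex" by (intro integral_nonneg_AE AE_I2 excess_integral_nonneg)
    have "(real N powr (1/3))\<^sup>2 * (\<integral>J. overlap4 N J \<partial>(\<Pi>\<^sub>M e\<in>bonds N. A)) \<le> (2 + 4 * ?K\<^sup>2 * ?t N) * ?ex + 4 * ?K ^ 4 * ?t N"
      by (rule overlap4_A_le) (use k elim in auto)
    also have "\<dots> \<le> 3 * (4 * h) + h"
      using elim ex ex0 by (intro add_mono mult_mono) auto
    also have "\<dots> < e" using e by (simp add: h_def)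
    finally have "(real N powr (1/3))\<^sup>2 * (\<integral>J. overlap4 N J \<partial>(\<Pi>\<^sub>M e\<in>bonds N. A)) < e" .
    moreover have "0 \<le> (real N powr (1/3))\<^sup>2 * (\<integral>J. overlap4 N J \<partial>(\<Pi>\<^sub>M e\<in>bonds N. A))"
      by (intro mult_nonneg_nonneg integral_nonneg_AE AE_I2 overlap4_bounds) auto
    ultimately show ?case by simp
  qed
  then show "\<exists>no. \<forall>N\<ge>no. norm ((real N powr (1/3))\<^sup>2 * (\<integral>J. overlap4 N J \<partial>(\<Pi>\<^sub>M e\<in>bonds N. A)) - 0) < e"
    by (simp add: eventually_sequentially)
qed

lemma overlap4_bound_tendsto:
  "(\<lambda>N. (real N powr (1/3))\<^sup>2 * overlap4_bound \<kappa> A B N) \<longlonglongrightarrow> 0" "(\<lambda>N. overlap4_bound \<kappa> A B N) \<longlonglongrightarrow> 0"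
proof -
  have eq: "(real N powr (1/3))\<^sup>2 * overlap4_bound \<kappa> A B N
      = ((real N powr (1/3))\<^sup>2 * (\<integral>J. overlap4 N J \<partial>(\<Pi>\<^sub>M e\<in>bonds N. A)) + (real N powr (1/3))\<^sup>2 / real N) * exp (gain_const \<kappa> 2)" for N
    using mix_ends(1)[OF disorderD(1,2)[OF A] disorderD(1,2)[OF B]]
    by (simp add: overlap4_bound_def mix_expect_def distrib_left mult.assoc)
  show 1: "(\<lambda>N. (real N powr (1/3))\<^sup>2 * overlap4_bound \<kappa> A B N) \<longlonglongrightarrow> 0"
    unfolding eq using tendsto_mult_left_zero[OF tendsto_add_zero[OF overlap4_A_tendsto third_root_scale(2)]] .
  have "(\<lambda>N. 1 / (real N powr (1/3))\<^sup>2 * ((real N powr (1/3))\<^sup>2 * overlap4_bound \<kappa> A B N)) \<longlonglongrightarrow> 0 * 0"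
    by (rule tendsto_mult[OF third_root_scale(1) 1])
  moreover have "\<forall>\<^sub>F N in sequentially. 1 / (real N powr (1/3))\<^sup>2 * ((real N powr (1/3))\<^sup>2 * overlap4_bound \<kappa> A B N) = overlap4_bound \<kappa> A B N"
    using eventually_gt_at_top[of 0] by eventually_elim simp
  ultimately show "(\<lambda>N. overlap4_bound \<kappa> A B N) \<longlonglongrightarrow> 0"
    using Lim_transform_eventually by fastforce
qed

lemma replica_universality_tendsto:
  assumes f: "\<And>N l. set l \<subseteq> spin_configs N \<Longrightarrow> length l = n \<Longrightarrow> \<bar>f N l\<bar> \<le> 1"
  shows "(\<lambda>N. (\<integral>J. replica_avg N J n (f N) \<partial>(\<Pi>\<^sub>M e\<in>bonds N. B)) - (\<integral>J. replica_avg N J n (f N) \<partial>(\<Pi>\<^sub>M e\<in>bonds N. A))) \<longlonglongrightarrow> 0"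
proof (rule LIMSEQ_I)
  fix e :: real assume e: "0 < e"
  let ?C = "gain_const \<kappa> n"
  have C: "0 \<le> ?C" by (rule gain_const_nonneg[OF disorder_const_nonneg[OF A]])
  define h where "h = e / (2 * (?C + 1))"
  have h: "0 < h" "?C * h < e / 2 + 0" using e C by (auto simp: h_def field_simps add_strict_increasing)
  have "(\<lambda>N. ?C * (overlap4_bound \<kappa> A B N / h + 1 / N)) \<longlonglongrightarrow> ?C * (0 / h + 0)"
    by (intro tendsto_intros overlap4_bound_tendsto(2) third_root_scale(3)) (use h in auto)
  then have lim: "(\<lambda>N. ?C * (overlap4_bound \<kappa> A B N / h + 1 / N)) \<longlonglongrightarrow> 0" by simp
  have "\<forall>\<^sub>F N in sequentially. ?C * (overlap4_bound \<kappa> A B N / h + 1 / N) < e / 2 \<and> 0 < N"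
    by (intro eventually_conj order_tendstoD(2)[OF lim] eventually_gt_at_top) (use e in auto)
  then have "\<forall>\<^sub>F N in sequentially. norm ((\<integral>J. replica_avg N J n (f N) \<partial>(\<Pi>\<^sub>M e\<in>bonds N. B)) - (\<integral>J. replica_avg N J n (f N) \<partial>(\<Pi>\<^sub>M e\<in>bonds N. A)) - 0) < e"
  proof eventually_elim
    case (elim N)
    have "\<bar>(\<integral>J. replica_avg N J n (f N) \<partial>(\<Pi>\<^sub>M e\<in>bonds N. B)) - (\<integral>J. replica_avg N J n (f N) \<partial>(\<Pi>\<^sub>M e\<in>bonds N. A))\<bar>
        \<le> ?C * (h + overlap4_bound \<kappa> A B N / h + 1 / N)"
      by (rule replica_universality_bounded[OF A B _ f h(1)]) (use elim in auto)
    also have "\<dots> = ?C * h + ?C * (overlap4_bound \<kappa> A B N / h + 1 / N)" by (simp add: distrib_left)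
    also have "\<dots> < e" using h(2) elim by linarith
    finally show ?case by simp
  qed
  then show "\<exists>no. \<forall>N\<ge>no. norm ((\<integral>J. replica_avg N J n (f N) \<partial>(\<Pi>\<^sub>M e\<in>bonds N. B)) - (\<integral>J. replica_avg N J n (f N) \<partial>(\<Pi>\<^sub>M e\<in>bonds N. A)) - 0) < e"
    by (simp add: eventually_sequentially)
qed

lemma cell_weight_tendsto:
  assumes K: "0 < K" and s: "set is \<subseteq> {..n}"
  shows "(\<lambda>N. \<integral>\<mu>. cell_weight K n is \<mu> \<partial>quenched_overlap_law B N) \<longlonglongrightarrow> (\<integral>\<mu>. cell_weight K n is \<mu> \<partial>\<zeta>)"
proof -
  define gs where "gs N = map (\<lambda>i \<sigma> \<tau>. bump K n i (real N powr (1/3) * overlap N \<sigma> \<tau>)) is" for N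
  have q: "cell_weight K n is (quenched_overlap_measure N J) = replica_avg N J (2 * length is) (pair_product (gs N))" for N J
    using replica_avg_pair_product[of N J "gs N"]
    by (simp add: cell_weight_def gs_def quenched_integral(1) comp_def)
  have law: "(\<integral>\<mu>. cell_weight K n is \<mu> \<partial>quenched_overlap_law M N) = (\<integral>J. replica_avg N J (2 * length is) (pair_product (gs N)) \<partial>(\<Pi>\<^sub>M e\<in>bonds N. M))"
    if "disorder \<kappa> M" for M N
    using quenched_law_integral(1)[OF disorderD(1,2)[OF that] cell_weight_measurable[OF K s]] by (simp add: q)
  have "(\<lambda>N. (\<integral>\<mu>. cell_weight K n is \<mu> \<partial>quenched_overlap_law B N) - (\<integral>\<mu>. cell_weight K n is \<mu> \<partial>quenched_overlap_law A N)) \<longlonglongrightarrow> 0"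
    unfolding law[OF A] law[OF B]
  proof (rule replica_universality_tendsto)
    fix N l assume l: "set l \<subseteq> spin_configs N" "length l = 2 * length is"
    show "\<bar>pair_product (gs N) l\<bar> \<le> 1"
    proof (rule pair_product_bound[OF _ l(1)])
      fix g \<sigma> \<tau> assume "g \<in> set (gs N)"
      then obtain i where i: "i \<le> n" "g = (\<lambda>\<sigma> \<tau>. bump K n i (real N powr (1/3) * overlap N \<sigma> \<tau>))"
        using s by (auto simp: gs_def)
      then show "\<bar>g \<sigma> \<tau>\<bar> \<le> 1" using bump_nonneg[OF K] bump_le1[OF K i(1)] by simp
    qed (use l in \<open>simp add: gs_def\<close>)
  qed
  moreover have "(\<lambda>N. \<integral>\<mu>. cell_weight K n is \<mu> \<partial>quenched_overlap_law A N) \<longlonglongrightarrow> (\<integral>\<mu>. cell_weight K n is \<mu> \<partial>\<zeta>)"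
  proof (rule LIMSEQ_I)
    fix e :: real assume e: "0 < e"
    obtain C where C: "C > 0" "\<And>\<zeta> \<zeta>'. P2_law \<zeta> \<Longrightarrow> P2_law \<zeta>' \<Longrightarrow>
      \<bar>(\<integral>\<mu>. cell_weight K n is \<mu> \<partial>\<zeta>) - (\<integral>\<mu>. cell_weight K n is \<mu> \<partial>\<zeta>')\<bar> \<le> e / 2 + C * (iterated_W2 \<zeta> \<zeta>')\<^sup>2"
      using cell_weight_law_compare[OF K s, of "e / 2"] e by auto
    have "\<forall>\<^sub>F N in sequentially. C * (iterated_W2 (quenched_overlap_law A N) \<zeta>)\<^sup>2 < e / 2"
      by (rule order_tendstoD(2)[OF tendsto_mult_right_zero[OF conv_sq]]) (use e in simp)
    then have "\<forall>\<^sub>F N in sequentially. norm ((\<integral>\<mu>. cell_weight K n is \<mu> \<partial>quenched_overlap_law A N) - (\<integral>\<mu>. cell_weight K n is \<mu> \<partial>\<zeta>)) < e"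
    proof eventually_elim
      case (elim N)
      show ?case using C(2)[OF A_law[of N] \<zeta>] elim by simp
    qed
    then show "\<exists>no. \<forall>N\<ge>no. norm ((\<integral>\<mu>. cell_weight K n is \<mu> \<partial>quenched_overlap_law A N) - (\<integral>\<mu>. cell_weight K n is \<mu> \<partial>\<zeta>)) < e"
      by (simp add: eventually_sequentially)
  qed
  ultimately have "(\<lambda>N. ((\<integral>\<mu>. cell_weight K n is \<mu> \<partial>quenched_overlap_law B N) - (\<integral>\<mu>. cell_weight K n is \<mu> \<partial>quenched_overlap_law A N))
      + (\<integral>\<mu>. cell_weight K n is \<mu> \<partial>quenched_overlap_law A N)) \<longlonglongrightarrow> 0 + (\<integral>\<mu>. cell_weight K n is \<mu> \<partial>\<zeta>)"
    by (rule tendsto_add)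
  then show ?thesis by simp
qed

text \<open>
  Divided by \<open>N\<^bsup>2/3\<^esup>\<close>, the excess is a function of two replicas of the size of \<open>R\<^sub>1\<^sub>2\<^sup>2\<close>.
\<close>

lemma excess_universality:
  assumes K: "0 < K"
  shows "(\<lambda>N. (\<integral>\<mu>. (\<integral>x. excess K x \<partial>\<mu>) \<partial>quenched_overlap_law B N) - (\<integral>\<mu>. (\<integral>x. excess K x \<partial>\<mu>) \<partial>quenched_overlap_law A N)) \<longlonglongrightarrow> 0"
proof (rule Lim_null_comparison)
  let ?s = "\<lambda>N. real N powr (1/3)"
  have "(\<lambda>N. gain_const \<kappa> 2 * (?s N ^ 2 * overlap4_bound \<kappa> A B N + ?s N ^ 2 / N)) \<longlonglongrightarrow> gain_const \<kappa> 2 * (0 + 0)"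
    by (intro tendsto_intros overlap4_bound_tendsto(1) third_root_scale(2))
  then show "(\<lambda>N. gain_const \<kappa> 2 * (?s N ^ 2 * overlap4_bound \<kappa> A B N + ?s N ^ 2 / N)) \<longlonglongrightarrow> 0" by simp
  show "\<forall>\<^sub>F N in sequentially. norm ((\<integral>\<mu>. (\<integral>x. excess K x \<partial>\<mu>) \<partial>quenched_overlap_law B N) - (\<integral>\<mu>. (\<integral>x. excess K x \<partial>\<mu>) \<partial>quenched_overlap_law A N))
      \<le> gain_const \<kappa> 2 * (?s N ^ 2 * overlap4_bound \<kappa> A B N + ?s N ^ 2 / N)"
    using eventually_gt_at_top[of 0]
  proof eventually_elim
    case (elim N)
    have s: "0 < ?s N" using elim by simp
    let ?f = "\<lambda>l. 1 / (?s N)\<^sup>2 * excess K (?s N * overlap N (l ! 0) (l ! 1))"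
    have law: "(\<integral>\<mu>. (\<integral>x. excess K x \<partial>\<mu>) \<partial>quenched_overlap_law M N) = (?s N)\<^sup>2 * (\<integral>J. replica_avg N J 2 ?f \<partial>(\<Pi>\<^sub>M e\<in>bonds N. M))"
      if M: "disorder \<kappa> M" for M
    proof -
      have "(\<integral>J. replica_avg N J 2 ?f \<partial>(\<Pi>\<^sub>M e\<in>bonds N. M))
          = 1 / (?s N)\<^sup>2 * (\<integral>J. replica_avg N J 2 (\<lambda>l. excess K (?s N * overlap N (l ! 0) (l ! 1))) \<partial>(\<Pi>\<^sub>M e\<in>bonds N. M))"
        unfolding replica_avg_def iid_avg_cmult by (rule Bochner_Integration.integral_mult_right_zero)
      moreover have "(\<integral>\<mu>. (\<integral>x. excess K x \<partial>\<mu>) \<partial>quenched_overlap_law M N)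
          = (\<integral>J. replica_avg N J 2 (\<lambda>l. excess K (?s N * overlap N (l ! 0) (l ! 1))) \<partial>(\<Pi>\<^sub>M e\<in>bonds N. M))"
        by (rule quenched_law_functional[OF disorderD(1,2)[OF M] P2_excess_measurable]) (use K in auto)
      ultimately show ?thesis using s by simp
    qed
    have "\<bar>(\<integral>J. replica_avg N J 2 ?f \<partial>(\<Pi>\<^sub>M e\<in>bonds N. B)) - (\<integral>J. replica_avg N J 2 ?f \<partial>(\<Pi>\<^sub>M e\<in>bonds N. A))\<bar>
        \<le> gain_const \<kappa> 2 * (overlap4_bound \<kappa> A B N + 1 / N)"
    proof (rule replica_universality_quadratic[OF A B elim])
      fix l
      have "1 / (?s N)\<^sup>2 * excess K (?s N * overlap N (l ! 0) (l ! 1)) \<le> 1 / (?s N)\<^sup>2 * (?s N * overlap N (l ! 0) (l ! 1))\<^sup>2"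
        by (intro mult_left_mono excess_le) (use K in auto)
      also have "\<dots> = (overlap N (l ! 0) (l ! 1))\<^sup>2" using s by (simp add: power_mult_distrib)
      finally show "\<bar>?f l\<bar> \<le> (overlap N (l ! 0) (l ! 1))\<^sup>2" using excess_nonneg by (simp add: abs_mult)
    qed
    then have "(?s N)\<^sup>2 * \<bar>(\<integral>J. replica_avg N J 2 ?f \<partial>(\<Pi>\<^sub>M e\<in>bonds N. B)) - (\<integral>J. replica_avg N J 2 ?f \<partial>(\<Pi>\<^sub>M e\<in>bonds N. A))\<bar>
        \<le> (?s N)\<^sup>2 * (gain_const \<kappa> 2 * (overlap4_bound \<kappa> A B N + 1 / N))"
      by (rule mult_left_mono) simp
    moreover have "norm ((?s N)\<^sup>2 * x - (?s N)\<^sup>2 * y) = (?s N)\<^sup>2 * \<bar>x - y\<bar>" for x y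
      unfolding right_diff_distrib[symmetric] by (simp add: abs_mult)
    moreover have "(?s N)\<^sup>2 * (gain_const \<kappa> 2 * (overlap4_bound \<kappa> A B N + 1 / N)) = gain_const \<kappa> 2 * (?s N ^ 2 * overlap4_bound \<kappa> A B N + ?s N ^ 2 / N)"
      by (simp add: distrib_left)
    ultimately show ?case unfolding law[OF A] law[OF B] by simp
  qed
qed

text \<open>
  The parameters are chosen in the order \<open>K\<close>, \<open>n\<close>, \<open>m\<close>: first the limit has small excess outside \<open>[-K, K]\<close>, then the
  discretisation errors at both levels become small. For fixed parameters only finitely many cell weights and the
  excess are involved, and these converge.
\<close>

lemma universality: "(\<lambda>N. iterated_W2 (quenched_overlap_law B N) \<zeta>) \<longlonglongrightarrow> 0"
proof (rule LIMSEQ_I)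
  fix r :: real assume r: "0 < r"
  \<comment> \<open>the five error terms below add up to at most \<open>99 h\<close>\<close>
  define h where "h = r\<^sup>2 / 200"
  have h: "0 < h" using r by (simp add: h_def)
  obtain k :: nat where k: "0 < k" "(\<integral>\<mu>. (\<integral>x. excess k x \<partial>\<mu>) \<partial>\<zeta>) < h" using small_excess[OF h] .
  define K where "K = real k"
  have K: "0 < K" using k by (simp add: K_def)
  obtain n :: nat where n: "32 * K\<^sup>2 / h < real n" using reals_Archimedean2 by blast
  have n0: "0 < real n" by (rule le_less_trans[OF _ n]) (use h in simp)
  have nk: "32 * K\<^sup>2 / n < h" using n n0 h by (simp add: field_simps)
  obtain m :: nat where m: "(48 * K\<^sup>2 * (real n + 1) / h)\<^sup>2 < real m" using reals_Archimedean2 by blast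
  have m0: "0 < real m" by (rule le_less_trans[OF _ m]) simp
  have mk: "48 * K\<^sup>2 * (real n + 1) / sqrt m < h"
  proof -
    have "48 * K\<^sup>2 * (real n + 1) / h < sqrt m"
      using real_less_rsqrt[OF m] .
    then show ?thesis using m0 h by (simp add: field_simps)
  qed
  let ?L = "{is. set is \<subseteq> {..n} \<and> length is = m}"
  let ?D = "\<lambda>N. \<Sum>is\<in>?L. \<bar>(\<integral>\<mu>. cell_weight K n is \<mu> \<partial>quenched_overlap_law B N) - (\<integral>\<mu>. cell_weight K n is \<mu> \<partial>\<zeta>)\<bar>"
  have "?D \<longlonglongrightarrow> (\<Sum>is\<in>?L. \<bar>(\<integral>\<mu>. cell_weight K n is \<mu> \<partial>\<zeta>) - (\<integral>\<mu>. cell_weight K n is \<mu> \<partial>\<zeta>)\<bar>)"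
    by (intro tendsto_sum tendsto_rabs tendsto_diff tendsto_const cell_weight_tendsto K) auto
  then have D0: "(\<lambda>N. 24 * K\<^sup>2 * ?D N) \<longlonglongrightarrow> 0"
    using tendsto_mult_right_zero by fastforce
  let ?ex = "\<lambda>M N. \<integral>\<mu>. (\<integral>x. excess K x \<partial>\<mu>) \<partial>quenched_overlap_law M N"
  have "\<forall>\<^sub>F N in sequentially. 24 * K\<^sup>2 * ?D N < h \<and> ?ex B N - ?ex A N < h \<and> (iterated_W2 (quenched_overlap_law A N) \<zeta>)\<^sup>2 < h"
    by (intro eventually_conj order_tendstoD(2)[OF D0] order_tendstoD(2)[OF excess_universality[OF K]] order_tendstoD(2)[OF conv_sq] h)
  then have "\<forall>\<^sub>F N in sequentially. norm (iterated_W2 (quenched_overlap_law B N) \<zeta> - 0) < r"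
  proof eventually_elim
    case (elim N)
    have e: "?ex A N \<le> 2 * (\<integral>\<mu>. (\<integral>x. excess K x \<partial>\<mu>) \<partial>\<zeta>) + 2 * (iterated_W2 (quenched_overlap_law A N) \<zeta>)\<^sup>2"
      by (rule excess_law_compare[OF A_law \<zeta>]) (use K in simp)
    have k': "(\<integral>\<mu>. (\<integral>x. excess K x \<partial>\<mu>) \<partial>\<zeta>) < h" using k by (simp add: K_def)
    have "(iterated_W2 (quenched_overlap_law B N) \<zeta>)\<^sup>2 \<le> 32 * K\<^sup>2 / n + 48 * K\<^sup>2 * (real n + 1) / sqrt m
        + 16 * ?ex B N + 16 * (\<integral>\<mu>. (\<integral>x. excess K x \<partial>\<mu>) \<partial>\<zeta>) + 24 * K\<^sup>2 * ?D N"
      using iterated_W2_sq_le[OF B_law[of N] \<zeta> K, of n m] n0 m0 unfolding cell_weight_def by simp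
    also have "\<dots> < 200 * h" using nk mk elim e k' h by linarith
    also have "\<dots> = r\<^sup>2" by (simp add: h_def)
    finally have "iterated_W2 (quenched_overlap_law B N) \<zeta> < r"
      by (rule power2_less_imp_less) (use r in simp)
    then show ?case using wasserstein2_nonneg[of W2 "quenched_overlap_law B N" \<zeta>] by simp
  qed
  then show "\<exists>no. \<forall>N\<ge>no. norm (iterated_W2 (quenched_overlap_law B N) \<zeta> - 0) < r"
    by (simp add: eventually_sequentially)
qed

end

lemma bounded_disorder_universality:
  assumes \<zeta>: "\<zeta> \<in> P2_P2_real"
    and conv: "(\<lambda>N. iterated_W2 (quenched_overlap_law std_normal_distribution N) \<zeta>) \<longlonglongrightarrow> 0"
    and \<nu>: "symmetric_unit_variance_law b \<nu>"
  shows "(\<lambda>N. iterated_W2 (quenched_overlap_law \<nu> N) \<zeta>) \<longlonglongrightarrow> 0"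
proof -
  define \<kappa> where "\<kappa> = 15 + b ^ 4 + b ^ 6"
  have p: "0 \<le> b ^ 4" "0 \<le> b ^ 6" by (simp_all add: zero_le_even_power)
  have "disorder \<kappa> std_normal_distribution" by (rule std_normal_disorder) (use p in \<open>simp add: \<kappa>_def\<close>)
  moreover have "disorder \<kappa> \<nu>" by (rule bounded_symmetric_disorder[OF \<nu>]) (use p in \<open>simp_all add: \<kappa>_def\<close>)
  ultimately show ?thesis using P2_P2_law[OF \<zeta>] conv by (rule universality)
qed

theorem corollary1p2:
  shows
    "(\<forall>\<zeta>\<in>P2_P2_real.
        (\<lambda>N. iterated_W2 (quenched_overlap_law std_normal_distribution N) \<zeta>) \<longlonglongrightarrow> 0 \<longrightarrow>
        (\<forall>b::real. \<forall>\<nu>::real measure. b \<ge> 1 \<and> symmetric_unit_variance_law b \<nu> \<longrightarrow>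
           (\<lambda>N. iterated_W2 (quenched_overlap_law \<nu> N) \<zeta>) \<longlonglongrightarrow> 0))
     \<and>
     (\<forall>(\<Omega> :: 'w measure) (P :: 'w \<Rightarrow> real measure).
        prob_space \<Omega> \<and> P \<in> measurable \<Omega> P2_borel \<and> distr \<Omega> P2_borel P \<in> P2_P2_real \<and>
        (\<lambda>N. iterated_W2 (quenched_overlap_law std_normal_distribution N)
               (distr \<Omega> P2_borel P)) \<longlonglongrightarrow> 0 \<longrightarrow>
        (\<forall>b::real. \<forall>\<nu>::real measure. b \<ge> 1 \<and> symmetric_unit_variance_law b \<nu> \<longrightarrow>
           (\<lambda>N. iterated_W2 (quenched_overlap_law \<nu> N) (distr \<Omega> P2_borel P)) \<longlonglongrightarrow> 0))"
  by (auto intro: bounded_disorder_universality)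

end
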